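(* Let $S$ be a scheme, let $a,b,c,d\in\mathbb{P}^1(S)$ be pairwise strongly distinct, and let $\sigma\in\mathrm{PGL}_2(S)$ be the unique automorphism such that $\sigma(a)=\boldsymbol{\infty}$, $\sigma(b)=\mathbf{0}$, and $\sigma(c)=\mathbf{1}$. Then $\sigma(d)=(\mathcal{O}_S;z,1)$, where $z=(a,b;c,d)$ is the cross-ratio.
   Context: $\mathbb{P}^1=\mathbb{P}^1_{\mathbb{Z}}$ with standard homogeneous coordinates $x_0,x_1\in\Gamma(\mathbb{P}^1,\mathcal{O}(1))$, and $\mathbb{P}^1(S)=\mathrm{Hom}(S,\mathbb{P}^1)$ (equivalently, sections of $\mathbb{P}^1_S\to S$). A point $a\in\mathbb{P}^1(S)$ is the same as an equivalence class of data $(A;a_0,a_1)$, where $A$ is a line bundle on $S$ (isomorphic to $a^*\mathcal{O}(1)$) and $a_0,a_1$ are global sections of $A$ (corresponding to $a^*(x_0),a^*(x_1)$) that generate $A$; $(A;a_0,a_1)$ and $(A';a_0',a_1')$ are equivalent iff there is an isomorphism $A\to A'$ taking $a_i$ to $a_i'$ for $i=0,1$. Standard points: $\boldsymbol{\infty}=(\mathcal{O}_S;1,0)$, $\mathbf{0}=(\mathcal{O}_S;0,1)$, $\mathbf{1}=(\mathcal{O}_S;1,1)$. Two morphisms of schemes $f,g\colon X\to Y$ are strongly distinct if their equalizer in the category of schemes is the empty scheme $\varnothing\to X$. $\mathrm{PGL}_2(S)$ (the $S$-points of the group scheme $\mathrm{PGL}_2$ over $\mathbb{Z}$) is identified with the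 group of equivalence classes of pairs $(L;M)$, where $L$ is a line bundle on $S$ with $L^{\otimes 2}\cong\mathcal{O}_S$ and $M$ is a $2\times 2$ matrix of global sections of $L$ whose determinant, computed with tensor products, is a nowhere-vanishing section of $L^{\otimes 2}$; $(L;M)\sim(L';M')$ iff some isomorphism $\varphi\colon L\to L'$ satisfies $\varphi(M)=M'$ entrywise. The product is $(L;M)\cdot(L';M')=(L\otimes L';M\star M')$ with $(M\star M')_{i,j}=\sum_k m_{i,k}\otimes m'_{k,j}$. This group is also naturally identified with $\mathrm{Aut}_S(\mathbb{P}^1_S)$. The element $\sigma=(L;M)$ acts on $\mathbb{P}^1(S)$ by $\sigma(A;a_0,a_1)=\left(L\otimes A;\,M\star\begin{pmatrix} a_0 \\ a_1 \end{pmatrix}\right)$. Any pairwise strongly distinct triple $(a,b,c)$ in $\mathbb{P}^1(S)$ is carried to $(\boldsymbol{\infty},\mathbf{0},\mathbf{1})$ by exactly one element of $\mathrm{PGL}_2(S)$, so $\sigma$ is well defined. Cross-ratio: if $a,b,c,d\in\mathbb{P}^1(S)$ are pairwise strongly distinct, they can be represented by data $(L;a_0,a_1)$, $(L;b_0,b_1)$, $(L;c_0,c_1)$, $(L;d_0,d_1)$ with a common line bundle $L$ satisfying $L^{\otimes 2}\cong\mathcal{O}_S$. Put $\Delta(a,b)=a_0\otimes b_1-a_1\otimes b_0\in\Gamma(S,L^{\otimes 2})$ (similarly for other pairs); it is nowhere vanishing for strongly distinct points. Choose an isomorphism $\varphi\colon L^{\otimes 2}\to\mathcal{O}_S$. Then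 $$(a,b;c,d)=\frac{\varphi(\Delta(a,c))\,\varphi(\Delta(b,d))}{\varphi(\Delta(a,d))\,\varphi(\Delta(b,c))}\in\Gamma(S,\mathcal{O}_S),$$ which does not depend on the choices. *)

theory Defs
  imports "HOL-Library.Multiset" "HOL-Analysis.Abstract_Topology"
    "HOL-Algebra.QuotRing" "HOL-Algebra.Module"
begin

section \<open>Sheaves, stalks and locally ringed spaces\<close>

text \<open>
  Presheaves are given by their sections \<open>F U\<close> and restriction maps \<open>r U V\<close> (from \<open>U\<close> to
  \<open>V \<subseteq> U\<close>). Only the values at open sets and at elements of \<open>F U\<close> are meaningful. The empty
  family is allowed in the gluing condition, so \<open>F {}\<close> is a singleton.
\<close>

definition sheaf_of_sets ::
    "'p topology \<Rightarrow> ('p set \<Rightarrow> 'x set) \<Rightarrow> ('p set \<Rightarrow> 'p set \<Rightarrow> 'x \<Rightarrow> 'x) \<Rightarrow> bool" where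
  "sheaf_of_sets T F r \<longleftrightarrow>
     (\<forall>U V. openin T U \<and> openin T V \<and> V \<subseteq> U \<longrightarrow> r U V \<in> F U \<rightarrow> F V) \<and>
     (\<forall>U. openin T U \<longrightarrow> (\<forall>s \<in> F U. r U U s = s)) \<and>
     (\<forall>U V W. openin T U \<and> openin T V \<and> openin T W \<and> W \<subseteq> V \<and> V \<subseteq> U \<longrightarrow>
        (\<forall>s \<in> F U. r V W (r U V s) = r U W s)) \<and>
     (\<forall>\<U> s. (\<forall>V \<in> \<U>. openin T V \<and> s V \<in> F V) \<and>
        (\<forall>V \<in> \<U>. \<forall>W \<in> \<U>. r V (V \<inter> W) (s V) = r W (V \<inter> W) (s W)) \<longrightarrow>
        (\<exists>!t. t \<in> F (\<Union>\<U>) \<and> (\<forall>V \<in> \<U>. r (\<Union>\<U>) V t = s V)))"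

record ('p, 'r) ringed_space =
  spc :: "'p topology"
  sec :: "'p set \<Rightarrow> 'r ring"
  res :: "'p set \<Rightarrow> 'p set \<Rightarrow> 'r \<Rightarrow> 'r"

abbreviation points :: "('p, 'r) ringed_space \<Rightarrow> 'p set" where
  "points X \<equiv> topspace (spc X)"

abbreviation global_sections :: "('p, 'r) ringed_space \<Rightarrow> 'r ring" where
  "global_sections X \<equiv> sec X (points X)"

definition is_ringed_space :: "('p, 'r) ringed_space \<Rightarrow> bool" where
  "is_ringed_space X \<longleftrightarrow>
     sheaf_of_sets (spc X) (\<lambda>U. carrier (sec X U)) (res X) \<and>
     (\<forall>U. openin (spc X) U \<longrightarrow> cring (sec X U)) \<and>
     (\<forall>U V. openin (spc X) U \<and> openin (spc X) V \<and> V \<subseteq> U \<longrightarrow>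
        res X U V \<in> ring_hom (sec X U) (sec X V))"

type_synonym ('p, 'x) germ = "('p set \<times> 'x) set"

definition germ ::
    "'p topology \<Rightarrow> ('p set \<Rightarrow> 'x set) \<Rightarrow> ('p set \<Rightarrow> 'p set \<Rightarrow> 'x \<Rightarrow> 'x) \<Rightarrow>
     'p \<Rightarrow> 'p set \<Rightarrow> 'x \<Rightarrow> ('p, 'x) germ" where
  "germ T F r p U s =
     {(V, t). openin T V \<and> p \<in> V \<and> t \<in> F V \<and>
        (\<exists>W. openin T W \<and> p \<in> W \<and> W \<subseteq> U \<inter> V \<and> r U W s = r V W t)}"

abbreviation ogerm ::
    "('p, 'r) ringed_space \<Rightarrow> 'p \<Rightarrow> 'p set \<Rightarrow> 'r \<Rightarrow> ('p, 'r) germ" where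
  "ogerm X \<equiv> germ (spc X) (\<lambda>U. carrier (sec X U)) (res X)"

text \<open>
  Operations on equivalence classes (here and below) are defined as the union of the results over
  all representatives, which is the common value of these results.
\<close>

definition stalk :: "('p, 'r) ringed_space \<Rightarrow> 'p \<Rightarrow> ('p, 'r) germ ring" where
  "stalk X p =
     \<lparr> carrier = {ogerm X p U s | U s. openin (spc X) U \<and> p \<in> U \<and> s \<in> carrier (sec X U)},
       mult = (\<lambda>x y. \<Union>(U, s) \<in> x. \<Union>(V, t) \<in> y.
         ogerm X p (U \<inter> V)
           (res X U (U \<inter> V) s \<otimes>\<^bsub>sec X (U \<inter> V)\<^esub> res X V (U \<inter> V) t)),
       one = ogerm X p (points X) \<one>\<^bsub>global_sections X\<^esub>,
       zero = ogerm X p (points X) \<zero>\<^bsub>global_sections X\<^esub>,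
       add = (\<lambda>x y. \<Union>(U, s) \<in> x. \<Union>(V, t) \<in> y.
         ogerm X p (U \<inter> V)
           (res X U (U \<inter> V) s \<oplus>\<^bsub>sec X (U \<inter> V)\<^esub> res X V (U \<inter> V) t)) \<rparr>"

definition nonunits :: "('a, 'b) ring_scheme \<Rightarrow> 'a set" where
  "nonunits R = carrier R - Units R"

definition local_ring :: "('a, 'b) ring_scheme \<Rightarrow> bool" where
  "local_ring R \<longleftrightarrow> cring R \<and> ideal (nonunits R) R"

definition locally_ringed_space :: "('p, 'r) ringed_space \<Rightarrow> bool" where
  "locally_ringed_space X \<longleftrightarrow>
     is_ringed_space X \<and> (\<forall>p \<in> points X. local_ring (stalk X p))"


section \<open>Morphisms\<close>

text \<open>
  A morphism \<open>T \<rightarrow> S\<close> is a map \<open>pt\<close> on points together with maps \<open>sh U\<close> from the sections of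
  \<open>S\<close> over \<open>U\<close> to the sections of \<open>T\<close> over the preimage of \<open>U\<close>.
\<close>

record ('q, 't, 'p, 'r) morph =
  pt :: "'q \<Rightarrow> 'p"
  sh :: "'p set \<Rightarrow> 'r \<Rightarrow> 't"

definition preim ::
    "('q, 't) ringed_space \<Rightarrow> ('q, 't, 'p, 'r) morph \<Rightarrow> 'p set \<Rightarrow> 'q set" where
  "preim T h U = {t \<in> points T. pt h t \<in> U}"

definition stalk_map ::
    "('q, 't) ringed_space \<Rightarrow> ('q, 't, 'p, 'r) morph \<Rightarrow> 'q \<Rightarrow> ('p, 'r) germ \<Rightarrow> ('q, 't) germ" where
  "stalk_map T h t x = (\<Union>(U, s) \<in> x. ogerm T t (preim T h U) (sh h U s))"

definition morphism ::
    "('q, 't) ringed_space \<Rightarrow> ('p, 'r) ringed_space \<Rightarrow> ('q, 't, 'p, 'r) morph \<Rightarrow> bool" where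
  "morphism T S h \<longleftrightarrow>
     continuous_map (spc T) (spc S) (pt h) \<and>
     (\<forall>U. openin (spc S) U \<longrightarrow> sh h U \<in> ring_hom (sec S U) (sec T (preim T h U))) \<and>
     (\<forall>U V. openin (spc S) U \<and> openin (spc S) V \<and> V \<subseteq> U \<longrightarrow>
        (\<forall>s \<in> carrier (sec S U).
           sh h V (res S U V s) = res T (preim T h U) (preim T h V) (sh h U s))) \<and>
     (\<forall>t \<in> points T. \<forall>x \<in> carrier (stalk S (pt h t)).
        stalk_map T h t x \<in> Units (stalk T t) \<longrightarrow> x \<in> Units (stalk S (pt h t)))"

definition morph_eq ::
    "('q, 't) ringed_space \<Rightarrow> ('p, 'r) ringed_space \<Rightarrow>
     ('q, 't, 'p, 'r) morph \<Rightarrow> ('q, 't, 'p, 'r) morph \<Rightarrow> bool" where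
  "morph_eq T S h k \<longleftrightarrow>
     (\<forall>t \<in> points T. pt h t = pt k t) \<and>
     (\<forall>U. openin (spc S) U \<longrightarrow> (\<forall>s \<in> carrier (sec S U). sh h U s = sh k U s))"

definition id_morph :: "('p, 'r, 'p, 'r) morph" where
  "id_morph = \<lparr> pt = id, sh = (\<lambda>U. id) \<rparr>"

text \<open>The composite of \<open>k : T \<rightarrow> E\<close> followed by \<open>i : E \<rightarrow> S\<close>.\<close>

definition comp_morph ::
    "('e, 'v) ringed_space \<Rightarrow> ('e, 'v, 'p, 'r) morph \<Rightarrow> ('q, 't, 'e, 'v) morph \<Rightarrow>
     ('q, 't, 'p, 'r) morph" where
  "comp_morph E i k = \<lparr> pt = pt i \<circ> pt k, sh = (\<lambda>U. sh k (preim E i U) \<circ> sh i U) \<rparr>"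


section \<open>Affine schemes and schemes\<close>

definition zariski :: "'r ring \<Rightarrow> 'r set topology" where
  "zariski A =
     topology (\<lambda>U. \<exists>E \<subseteq> carrier A. U = {P. primeideal P A \<and> \<not> E \<subseteq> P})"

lemma istopology_zariski:
  "istopology (\<lambda>U. \<exists>E \<subseteq> carrier A. U = {P. primeideal P A \<and> \<not> E \<subseteq> P})"
  unfolding istopology_def
proof (intro conjI allI impI)
  fix U V
  assume "\<exists>E \<subseteq> carrier A. U = {P. primeideal P A \<and> \<not> E \<subseteq> P}"
    and "\<exists>E \<subseteq> carrier A. V = {P. primeideal P A \<and> \<not> E \<subseteq> P}"
  then obtain E F where E: "E \<subseteq> carrier A" "U = {P. primeideal P A \<and> \<not> E \<subseteq> P}"
    and F: "F \<subseteq> carrier A" "V = {P. primeideal P A \<and> \<not> F \<subseteq> P}" by blast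
  let ?G = "{e \<otimes>\<^bsub>A\<^esub> f | e f. e \<in> E \<and> f \<in> F} \<inter> carrier A"
  have "?G \<subseteq> P \<longleftrightarrow> E \<subseteq> P \<or> F \<subseteq> P" if P: "primeideal P A" for P
  proof -
    interpret primeideal P A by fact
    show ?thesis
    proof
      assume G: "?G \<subseteq> P"
      have "f \<in> P" if e: "e \<in> E" "e \<notin> P" and f: "f \<in> F" for e f
        using I_prime[of e f] e f E(1) F(1) G by blast
      then show "E \<subseteq> P \<or> F \<subseteq> P"
        by blast
    next
      assume *: "E \<subseteq> P \<or> F \<subseteq> P"
      have "e \<otimes>\<^bsub>A\<^esub> f \<in> P" if "e \<in> E" "f \<in> F" for e f
        using * that E(1) F(1) I_l_closed[of f e] I_r_closed[of e f] by blast
      then show "?G \<subseteq> P"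
        by blast
    qed
  qed
  then have "U \<inter> V = {P. primeideal P A \<and> \<not> ?G \<subseteq> P}"
    unfolding E(2) F(2) by blast
  then show "\<exists>E \<subseteq> carrier A. U \<inter> V = {P. primeideal P A \<and> \<not> E \<subseteq> P}"
    by (intro exI[of _ ?G]) blast
next
  fix \<K>
  assume "\<forall>K\<in>\<K>. \<exists>E\<subseteq>carrier A. K = {P. primeideal P A \<and> \<not> E \<subseteq> P}"
  then obtain E where E: "\<And>K. K \<in> \<K> \<Longrightarrow> E K \<subseteq> carrier A \<and> K = {P. primeideal P A \<and> \<not> E K \<subseteq> P}"
    by metis
  have "\<Union>\<K> = {P. primeideal P A \<and> \<not> (\<Union>K\<in>\<K>. E K) \<subseteq> P}"
    using E by blast
  then show "\<exists>E\<subseteq>carrier A. \<Union>\<K> = {P. primeideal P A \<and> \<not> E \<subseteq> P}"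
    using E by (intro exI[of _ "\<Union>K\<in>\<K>. E K"]) blast
qed

text \<open>The fraction \<open>a / s\<close> in the localization of \<open>A\<close> at the prime ideal \<open>P\<close>.\<close>

definition frac :: "'r ring \<Rightarrow> 'r set \<Rightarrow> 'r \<Rightarrow> 'r \<Rightarrow> ('r \<times> 'r) set" where
  "frac A P a s =
     {(b, t). b \<in> carrier A \<and> t \<in> carrier A - P \<and>
        (\<exists>u \<in> carrier A - P. u \<otimes>\<^bsub>A\<^esub> (a \<otimes>\<^bsub>A\<^esub> t) = u \<otimes>\<^bsub>A\<^esub> (b \<otimes>\<^bsub>A\<^esub> s))}"

definition localization :: "'r ring \<Rightarrow> 'r set \<Rightarrow> ('r \<times> 'r) set ring" where
  "localization A P =
     \<lparr> carrier = {frac A P a s | a s. a \<in> carrier A \<and> s \<in> carrier A - P},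
       mult = (\<lambda>x y. \<Union>(a, s) \<in> x. \<Union>(b, t) \<in> y. frac A P (a \<otimes>\<^bsub>A\<^esub> b) (s \<otimes>\<^bsub>A\<^esub> t)),
       one = frac A P \<one>\<^bsub>A\<^esub> \<one>\<^bsub>A\<^esub>,
       zero = frac A P \<zero>\<^bsub>A\<^esub> \<one>\<^bsub>A\<^esub>,
       add = (\<lambda>x y. \<Union>(a, s) \<in> x. \<Union>(b, t) \<in> y.
         frac A P (a \<otimes>\<^bsub>A\<^esub> t \<oplus>\<^bsub>A\<^esub> b \<otimes>\<^bsub>A\<^esub> s) (s \<otimes>\<^bsub>A\<^esub> t)) \<rparr>"

definition Spec :: "'r ring \<Rightarrow> ('r set, 'r set \<Rightarrow> ('r \<times> 'r) set) ringed_space" where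
  "Spec A =
     \<lparr> spc = zariski A,
       sec = (\<lambda>U.
         \<lparr> carrier = {f \<in> (\<Pi>\<^sub>E P \<in> U. carrier (localization A P)).
             \<forall>P \<in> U. \<exists>V a s. openin (zariski A) V \<and> P \<in> V \<and> V \<subseteq> U \<and>
               a \<in> carrier A \<and> s \<in> carrier A \<and> (\<forall>Q \<in> V. s \<notin> Q \<and> f Q = frac A Q a s)},
           mult = (\<lambda>f g. \<lambda>P \<in> U. f P \<otimes>\<^bsub>localization A P\<^esub> g P),
           one = (\<lambda>P \<in> U. \<one>\<^bsub>localization A P\<^esub>),
           zero = (\<lambda>P \<in> U. \<zero>\<^bsub>localization A P\<^esub>),
           add = (\<lambda>f g. \<lambda>P \<in> U. f P \<oplus>\<^bsub>localization A P\<^esub> g P) \<rparr>),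
       res = (\<lambda>U V f. restrict f V) \<rparr>"

definition open_subspace :: "('p, 'r) ringed_space \<Rightarrow> 'p set \<Rightarrow> ('p, 'r) ringed_space" where
  "open_subspace X U = X\<lparr>spc := subtopology (spc X) U\<rparr>"

definition ringed_space_iso ::
    "('q, 't) ringed_space \<Rightarrow> ('p, 'r) ringed_space \<Rightarrow> ('q, 't, 'p, 'r) morph \<Rightarrow> bool" where
  "ringed_space_iso X Y h \<longleftrightarrow>
     homeomorphic_map (spc X) (spc Y) (pt h) \<and>
     (\<forall>U. openin (spc Y) U \<longrightarrow> sh h U \<in> ring_iso (sec Y U) (sec X (preim X h U))) \<and>
     (\<forall>U V. openin (spc Y) U \<and> openin (spc Y) V \<and> V \<subseteq> U \<longrightarrow>
        (\<forall>s \<in> carrier (sec Y U).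
           sh h V (res Y U V s) = res X (preim X h U) (preim X h V) (sh h U s)))"

text \<open>
  The ring \<open>A\<close> may be taken in the type \<open>'r\<close> of sections of \<open>X\<close> because \<open>A\<close> is isomorphic to
  the ring of sections of \<open>X\<close> over \<open>U\<close> whenever \<open>U\<close> is isomorphic to \<open>Spec A\<close>.
\<close>

definition scheme :: "('p, 'r) ringed_space \<Rightarrow> bool" where
  "scheme X \<longleftrightarrow>
     locally_ringed_space X \<and>
     (\<forall>p \<in> points X. \<exists>U (A :: 'r ring) h. openin (spc X) U \<and> p \<in> U \<and> cring A \<and>
        ringed_space_iso (open_subspace X U) (Spec A) h)"

definition empty_scheme :: "('p, 'r) ringed_space" where
  "empty_scheme =
     \<lparr> spc = discrete_topology {},
       sec = (\<lambda>U. \<lparr> carrier = {undefined}, mult = (\<lambda>x y. undefined), one = undefined,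
                    zero = undefined, add = (\<lambda>x y. undefined) \<rparr>),
       res = (\<lambda>U V s. s) \<rparr>"

definition empty_morph :: "('q, 't, 'p, 'r) morph" where
  "empty_morph = \<lparr> pt = (\<lambda>t. undefined), sh = (\<lambda>U s. undefined) \<rparr>"


section \<open>Sheaves of modules and line bundles\<close>

text \<open>
  HOL-Algebra's module records extend ring records; their fields \<open>mult\<close> and \<open>one\<close> carry no
  meaning for modules.
\<close>

record ('p, 'r, 'm) mod_sheaf =
  msec :: "'p set \<Rightarrow> ('r, 'm) module"
  mres :: "'p set \<Rightarrow> 'p set \<Rightarrow> 'm \<Rightarrow> 'm"

definition structure_sheaf :: "('p, 'r) ringed_space \<Rightarrow> ('p, 'r, 'r) mod_sheaf" where
  "structure_sheaf X =
     \<lparr> msec = (\<lambda>U.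
         \<lparr> carrier = carrier (sec X U), mult = mult (sec X U), one = one (sec X U),
           zero = zero (sec X U), add = add (sec X U), smult = mult (sec X U) \<rparr>),
       mres = res X \<rparr>"

definition module_sheaf :: "('p, 'r) ringed_space \<Rightarrow> ('p, 'r, 'm) mod_sheaf \<Rightarrow> bool" where
  "module_sheaf X F \<longleftrightarrow>
     sheaf_of_sets (spc X) (\<lambda>U. carrier (msec F U)) (mres F) \<and>
     (\<forall>U. openin (spc X) U \<longrightarrow> module (sec X U) (msec F U)) \<and>
     (\<forall>U V. openin (spc X) U \<and> openin (spc X) V \<and> V \<subseteq> U \<longrightarrow>
        (\<forall>x \<in> carrier (msec F U). \<forall>y \<in> carrier (msec F U).
           mres F U V (x \<oplus>\<^bsub>msec F U\<^esub> y) = mres F U V x \<oplus>\<^bsub>msec F V\<^esub> mres F U V y) \<and>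
        (\<forall>r \<in> carrier (sec X U). \<forall>x \<in> carrier (msec F U).
           mres F U V (r \<odot>\<^bsub>msec F U\<^esub> x) = res X U V r \<odot>\<^bsub>msec F V\<^esub> mres F U V x))"

definition module_sheaf_iso ::
    "('p, 'r) ringed_space \<Rightarrow> ('p, 'r, 'm) mod_sheaf \<Rightarrow> ('p, 'r, 'n) mod_sheaf \<Rightarrow>
     ('p set \<Rightarrow> 'm \<Rightarrow> 'n) \<Rightarrow> bool" where
  "module_sheaf_iso X F G \<theta> \<longleftrightarrow>
     (\<forall>U. openin (spc X) U \<longrightarrow>
        bij_betw (\<theta> U) (carrier (msec F U)) (carrier (msec G U)) \<and>
        (\<forall>x \<in> carrier (msec F U). \<forall>y \<in> carrier (msec F U).
           \<theta> U (x \<oplus>\<^bsub>msec F U\<^esub> y) = \<theta> U x \<oplus>\<^bsub>msec G U\<^esub> \<theta> U y) \<and>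
        (\<forall>r \<in> carrier (sec X U). \<forall>x \<in> carrier (msec F U).
           \<theta> U (r \<odot>\<^bsub>msec F U\<^esub> x) = r \<odot>\<^bsub>msec G U\<^esub> \<theta> U x)) \<and>
     (\<forall>U V. openin (spc X) U \<and> openin (spc X) V \<and> V \<subseteq> U \<longrightarrow>
        (\<forall>x \<in> carrier (msec F U). \<theta> V (mres F U V x) = mres G U V (\<theta> U x)))"

definition line_bundle :: "('p, 'r) ringed_space \<Rightarrow> ('p, 'r, 'm) mod_sheaf \<Rightarrow> bool" where
  "line_bundle X L \<longleftrightarrow>
     module_sheaf X L \<and>
     (\<forall>p \<in> points X. \<exists>U \<theta>. openin (spc X) U \<and> p \<in> U \<and>
        module_sheaf_iso (open_subspace X U) L (structure_sheaf X) \<theta>)"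

abbreviation mgerm ::
    "('p, 'r) ringed_space \<Rightarrow> ('p, 'r, 'm) mod_sheaf \<Rightarrow> 'p \<Rightarrow> 'p set \<Rightarrow> 'm \<Rightarrow> ('p, 'm) germ" where
  "mgerm X F \<equiv> germ (spc X) (\<lambda>U. carrier (msec F U)) (mres F)"

definition mstalk ::
    "('p, 'r) ringed_space \<Rightarrow> ('p, 'r, 'm) mod_sheaf \<Rightarrow> 'p \<Rightarrow>
     (('p, 'r) germ, ('p, 'm) germ) module" where
  "mstalk X F p =
     \<lparr> carrier = {mgerm X F p U s | U s. openin (spc X) U \<and> p \<in> U \<and> s \<in> carrier (msec F U)},
       mult = undefined, one = undefined,
       zero = mgerm X F p (points X) \<zero>\<^bsub>msec F (points X)\<^esub>,
       add = (\<lambda>x y. \<Union>(U, s) \<in> x. \<Union>(V, t) \<in> y.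
         mgerm X F p (U \<inter> V)
           (mres F U (U \<inter> V) s \<oplus>\<^bsub>msec F (U \<inter> V)\<^esub> mres F V (U \<inter> V) t)),
       smult = (\<lambda>r x. \<Union>(U, f) \<in> r. \<Union>(V, s) \<in> x.
         mgerm X F p (U \<inter> V)
           (res X U (U \<inter> V) f \<odot>\<^bsub>msec F (U \<inter> V)\<^esub> mres F V (U \<inter> V) s)) \<rparr>"

text \<open>
  The global section \<open>s\<close> vanishes at \<open>p\<close> iff its image in the fibre \<open>F\<^sub>p / \<mm>\<^sub>p F\<^sub>p\<close> is zero;
  \<open>\<mm>\<^sub>p F\<^sub>p\<close> is the submodule generated by the products \<open>r \<odot> x\<close> with \<open>r\<close> in the maximal ideal.
\<close>

definition nowhere_vanishing ::
    "('p, 'r) ringed_space \<Rightarrow> ('p, 'r, 'm) mod_sheaf \<Rightarrow> 'm \<Rightarrow> bool" where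
  "nowhere_vanishing X F s \<longleftrightarrow>
     (\<forall>p \<in> points X. mgerm X F p (points X) s \<notin>
        \<Inter>{H. submodule H (stalk X p) (mstalk X F p) \<and>
            (\<forall>r \<in> nonunits (stalk X p). \<forall>x \<in> carrier (mstalk X F p).
               r \<odot>\<^bsub>mstalk X F p\<^esub> x \<in> H)})"


section \<open>Tensor products and pullbacks\<close>

text \<open>
  For a ring homomorphism \<open>\<phi> : R \<rightarrow> B\<close>, a \<open>B\<close>-module \<open>M\<close> and an \<open>R\<close>-module \<open>N\<close>, the
  \<open>B\<close>-module \<open>M \<otimes>\<^sub>R N\<close>: an element is a class of formal finite sums of symbols \<open>m \<otimes> n\<close>, i.e.
  of finite multisets of pairs. The relation (m, n) + (- m, n) = (0, n) = 0 provides negatives.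
\<close>

inductive tensor_rel ::
    "('a \<Rightarrow> 'b) \<Rightarrow> 'a ring \<Rightarrow> ('b, 'm) module \<Rightarrow> ('a, 'n) module \<Rightarrow>
     ('m \<times> 'n) multiset \<Rightarrow> ('m \<times> 'n) multiset \<Rightarrow> bool"
  for \<phi> :: "'a \<Rightarrow> 'b" and R :: "'a ring" and M :: "('b, 'm) module" and N :: "('a, 'n) module"
where
  refl: "tensor_rel \<phi> R M N X X"
| sym: "tensor_rel \<phi> R M N X Y \<Longrightarrow> tensor_rel \<phi> R M N Y X"
| trans: "tensor_rel \<phi> R M N X Y \<Longrightarrow> tensor_rel \<phi> R M N Y Z \<Longrightarrow> tensor_rel \<phi> R M N X Z"
| cong: "tensor_rel \<phi> R M N X Y \<Longrightarrow> tensor_rel \<phi> R M N (X + Z) (Y + Z)"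
| zero: "n \<in> carrier N \<Longrightarrow> tensor_rel \<phi> R M N {#(\<zero>\<^bsub>M\<^esub>, n)#} {#}"
| add_left: "m \<in> carrier M \<Longrightarrow> m' \<in> carrier M \<Longrightarrow> n \<in> carrier N \<Longrightarrow>
    tensor_rel \<phi> R M N {#(m \<oplus>\<^bsub>M\<^esub> m', n)#} {#(m, n), (m', n)#}"
| add_right: "m \<in> carrier M \<Longrightarrow> n \<in> carrier N \<Longrightarrow> n' \<in> carrier N \<Longrightarrow>
    tensor_rel \<phi> R M N {#(m, n \<oplus>\<^bsub>N\<^esub> n')#} {#(m, n), (m, n')#}"
| balanced: "r \<in> carrier R \<Longrightarrow> m \<in> carrier M \<Longrightarrow> n \<in> carrier N \<Longrightarrow>
    tensor_rel \<phi> R M N {#(\<phi> r \<odot>\<^bsub>M\<^esub> m, n)#} {#(m, r \<odot>\<^bsub>N\<^esub> n)#}"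

definition tensor_class ::
    "('a \<Rightarrow> 'b) \<Rightarrow> 'a ring \<Rightarrow> ('b, 'm) module \<Rightarrow> ('a, 'n) module \<Rightarrow>
     ('m \<times> 'n) multiset \<Rightarrow> ('m \<times> 'n) multiset set" where
  "tensor_class \<phi> R M N X = {Y. tensor_rel \<phi> R M N X Y}"

definition tensor_module ::
    "('a \<Rightarrow> 'b) \<Rightarrow> 'a ring \<Rightarrow> ('b, 'm) module \<Rightarrow> ('a, 'n) module \<Rightarrow>
     ('b, ('m \<times> 'n) multiset set) module" where
  "tensor_module \<phi> R M N =
     \<lparr> carrier = {tensor_class \<phi> R M N X | X. set_mset X \<subseteq> carrier M \<times> carrier N},
       mult = undefined, one = undefined,
       zero = tensor_class \<phi> R M N {#},
       add = (\<lambda>x y. \<Union>X \<in> x. \<Union>Y \<in> y. tensor_class \<phi> R M N (X + Y)),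
       smult = (\<lambda>b x. \<Union>X \<in> x.
         tensor_class \<phi> R M N (image_mset (\<lambda>(m, n). (b \<odot>\<^bsub>M\<^esub> m, n)) X)) \<rparr>"

text \<open>
  For a morphism \<open>h : T \<rightarrow> S\<close>, a module sheaf \<open>L\<close> on \<open>T\<close> and a module sheaf \<open>A\<close> on \<open>S\<close>,
  \<open>tensor_along T S h L A\<close> is the sheaf of modules \<open>L \<otimes> h\<^sup>-\<^sup>1 A\<close> on \<open>T\<close>, the tensor product being
  over \<open>h\<^sup>-\<^sup>1 O\<^sub>S\<close>. Its stalk at \<open>t\<close> is the tensor product of the stalks of \<open>L\<close> at \<open>t\<close> and of
  \<open>A\<close> at \<open>h t\<close>; as in the usual construction of a sheafification, a section is a family of elements
  of the stalks that is locally given by a finite sum of tensors \<open>l \<otimes> a\<close> of sections.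
  For the identity morphism it is the tensor product of two module sheaves, and for \<open>L = O\<^sub>T\<close> it
  is the pullback of \<open>A\<close> along \<open>h\<close>.
\<close>

type_synonym ('q, 'l, 'p, 'm) tensor_section =
  "'q \<Rightarrow> (('q, 'l) germ \<times> ('p, 'm) germ) multiset set"

definition tensor_stalk ::
    "('q, 't) ringed_space \<Rightarrow> ('p, 'r) ringed_space \<Rightarrow> ('q, 't, 'p, 'r) morph \<Rightarrow>
     ('q, 't, 'l) mod_sheaf \<Rightarrow> ('p, 'r, 'm) mod_sheaf \<Rightarrow> 'q \<Rightarrow>
     (('q, 't) germ, (('q, 'l) germ \<times> ('p, 'm) germ) multiset set) module" where
  "tensor_stalk T S h L A t =
     tensor_module (stalk_map T h t) (stalk S (pt h t)) (mstalk T L t) (mstalk S A (pt h t))"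

definition tensor_sum ::
    "('q, 't) ringed_space \<Rightarrow> ('p, 'r) ringed_space \<Rightarrow> ('q, 't, 'p, 'r) morph \<Rightarrow>
     ('q, 't, 'l) mod_sheaf \<Rightarrow> ('p, 'r, 'm) mod_sheaf \<Rightarrow> 'q set \<Rightarrow> 'p set \<Rightarrow>
     ('l \<times> 'm) multiset \<Rightarrow> ('q, 'l, 'p, 'm) tensor_section" where
  "tensor_sum T S h L A W U Z =
     (\<lambda>t \<in> W. tensor_class (stalk_map T h t) (stalk S (pt h t))
        (mstalk T L t) (mstalk S A (pt h t))
        (image_mset (\<lambda>(l, a). (mgerm T L t W l, mgerm S A (pt h t) U a)) Z))"

definition tensor_along ::
    "('q, 't) ringed_space \<Rightarrow> ('p, 'r) ringed_space \<Rightarrow> ('q, 't, 'p, 'r) morph \<Rightarrow>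
     ('q, 't, 'l) mod_sheaf \<Rightarrow> ('p, 'r, 'm) mod_sheaf \<Rightarrow>
     ('q, 't, ('q, 'l, 'p, 'm) tensor_section) mod_sheaf" where
  "tensor_along T S h L A =
     \<lparr> msec = (\<lambda>V.
         \<lparr> carrier = {f \<in> extensional V.
             \<forall>t \<in> V. \<exists>W U Z. openin (spc T) W \<and> t \<in> W \<and> W \<subseteq> V \<and>
               openin (spc S) U \<and> W \<subseteq> preim T h U \<and>
               set_mset Z \<subseteq> carrier (msec L W) \<times> carrier (msec A U) \<and>
               (\<forall>w \<in> W. f w = tensor_sum T S h L A W U Z w)},
           mult = undefined, one = undefined,
           zero = (\<lambda>t \<in> V. \<zero>\<^bsub>tensor_stalk T S h L A t\<^esub>),
           add = (\<lambda>f g. \<lambda>t \<in> V. f t \<oplus>\<^bsub>tensor_stalk T S h L A t\<^esub> g t),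
           smult = (\<lambda>r f. \<lambda>t \<in> V. ogerm T t V r \<odot>\<^bsub>tensor_stalk T S h L A t\<^esub> f t) \<rparr>),
       mres = (\<lambda>V W f. restrict f W) \<rparr>"

abbreviation tensor_sheaf ::
    "('p, 'r) ringed_space \<Rightarrow> ('p, 'r, 'l) mod_sheaf \<Rightarrow> ('p, 'r, 'm) mod_sheaf \<Rightarrow>
     ('p, 'r, ('p, 'l, 'p, 'm) tensor_section) mod_sheaf" where
  "tensor_sheaf S L A \<equiv> tensor_along S S id_morph L A"

text \<open>The global section \<open>l \<otimes> a\<close> of the tensor product of \<open>L\<close> and \<open>A\<close>.\<close>

definition tensor ::
    "('p, 'r) ringed_space \<Rightarrow> ('p, 'r, 'l) mod_sheaf \<Rightarrow> ('p, 'r, 'm) mod_sheaf \<Rightarrow>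
     'l \<Rightarrow> 'm \<Rightarrow> ('p, 'l, 'p, 'm) tensor_section" where
  "tensor S L A l a = tensor_sum S S id_morph L A (points S) (points S) {#(l, a)#}"


section \<open>Points of the projective line\<close>

text \<open>
  A point of \<open>\<P>\<^sup>1(S)\<close> is represented by a triple \<open>(A, a\<^sub>0, a\<^sub>1)\<close>, and equality of points is the
  relation \<open>P1_eq\<close>; the two line bundles compared by \<open>P1_eq\<close> may have sections in different types.
\<close>

type_synonym ('p, 'r, 'm) p1_data = "('p, 'r, 'm) mod_sheaf \<times> 'm \<times> 'm"

fun P1_point :: "('p, 'r) ringed_space \<Rightarrow> ('p, 'r, 'm) p1_data \<Rightarrow> bool" where
  "P1_point S (A, a\<^sub>0, a\<^sub>1) \<longleftrightarrow>
     line_bundle S A \<and>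
     a\<^sub>0 \<in> carrier (msec A (points S)) \<and> a\<^sub>1 \<in> carrier (msec A (points S)) \<and>
     (\<forall>p \<in> points S. \<forall>x \<in> carrier (mstalk S A p).
        \<exists>r\<^sub>0 \<in> carrier (stalk S p). \<exists>r\<^sub>1 \<in> carrier (stalk S p).
          x = r\<^sub>0 \<odot>\<^bsub>mstalk S A p\<^esub> mgerm S A p (points S) a\<^sub>0
              \<oplus>\<^bsub>mstalk S A p\<^esub> r\<^sub>1 \<odot>\<^bsub>mstalk S A p\<^esub> mgerm S A p (points S) a\<^sub>1)"

fun P1_eq :: "('p, 'r) ringed_space \<Rightarrow> ('p, 'r, 'm) p1_data \<Rightarrow> ('p, 'r, 'n) p1_data \<Rightarrow> bool" where
  "P1_eq S (A, a\<^sub>0, a\<^sub>1) (B, b\<^sub>0, b\<^sub>1) \<longleftrightarrow>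
     (\<exists>\<theta>. module_sheaf_iso S A B \<theta> \<and> \<theta> (points S) a\<^sub>0 = b\<^sub>0 \<and> \<theta> (points S) a\<^sub>1 = b\<^sub>1)"

definition P1_infinity :: "('p, 'r) ringed_space \<Rightarrow> ('p, 'r, 'r) p1_data" where
  "P1_infinity S = (structure_sheaf S, \<one>\<^bsub>global_sections S\<^esub>, \<zero>\<^bsub>global_sections S\<^esub>)"

definition P1_zero :: "('p, 'r) ringed_space \<Rightarrow> ('p, 'r, 'r) p1_data" where
  "P1_zero S = (structure_sheaf S, \<zero>\<^bsub>global_sections S\<^esub>, \<one>\<^bsub>global_sections S\<^esub>)"

definition P1_one :: "('p, 'r) ringed_space \<Rightarrow> ('p, 'r, 'r) p1_data" where
  "P1_one S = (structure_sheaf S, \<one>\<^bsub>global_sections S\<^esub>, \<one>\<^bsub>global_sections S\<^esub>)"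

text \<open>The composite of \<open>h : T \<rightarrow> S\<close> with a point \<open>S \<rightarrow> \<P>\<^sup>1\<close>.\<close>

fun P1_pullback ::
    "('q, 't) ringed_space \<Rightarrow> ('p, 'r) ringed_space \<Rightarrow> ('q, 't, 'p, 'r) morph \<Rightarrow>
     ('p, 'r, 'm) p1_data \<Rightarrow> ('q, 't, ('q, 't, 'p, 'm) tensor_section) p1_data" where
  "P1_pullback T S h (A, a\<^sub>0, a\<^sub>1) =
     (tensor_along T S h (structure_sheaf T) A,
      tensor_sum T S h (structure_sheaf T) A (points T) (points S)
        {#(\<one>\<^bsub>global_sections T\<^esub>, a\<^sub>0)#},
      tensor_sum T S h (structure_sheaf T) A (points T) (points S)
        {#(\<one>\<^bsub>global_sections T\<^esub>, a\<^sub>1)#})"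

text \<open>
  \<open>i : E \<rightarrow> S\<close> is an equalizer of the two morphisms \<open>a, b : S \<rightarrow> \<P>\<^sup>1\<close>, where the test schemes
  have points and sections in the same types as \<open>E\<close>.
\<close>

definition P1_equalizes ::
    "('p, 'r) ringed_space \<Rightarrow> ('p, 'r, 'm) p1_data \<Rightarrow> ('p, 'r, 'n) p1_data \<Rightarrow>
     ('q, 't) ringed_space \<Rightarrow> ('q, 't, 'p, 'r) morph \<Rightarrow> bool" where
  "P1_equalizes S a b T h \<longleftrightarrow>
     scheme T \<and> morphism T S h \<and> P1_eq T (P1_pullback T S h a) (P1_pullback T S h b)"

definition P1_equalizer ::
    "('p, 'r) ringed_space \<Rightarrow> ('p, 'r, 'm) p1_data \<Rightarrow> ('p, 'r, 'n) p1_data \<Rightarrow>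
     ('q, 't) ringed_space \<Rightarrow> ('q, 't, 'p, 'r) morph \<Rightarrow> bool" where
  "P1_equalizer S a b E i \<longleftrightarrow>
     P1_equalizes S a b E i \<and>
     (\<forall>(T :: ('q, 't) ringed_space) h. P1_equalizes S a b T h \<longrightarrow>
        (\<exists>k. morphism T E k \<and> morph_eq T S (comp_morph E i k) h \<and>
           (\<forall>k'. morphism T E k' \<and> morph_eq T S (comp_morph E i k') h \<longrightarrow> morph_eq T E k k')))"

text \<open>
  The type of schemes used for the equalizer is large enough to contain a copy of every locally
  closed subscheme of \<open>S\<close> (hence of the equalizer itself) and of the spectrum of every residue field
  of \<open>S\<close>: a section of a locally closed subscheme \<open>Z\<close> is determined by the set of all local
  sections of \<open>S\<close> that restrict to it on \<open>Z\<close>, and an element of the residue field at \<open>p\<close> by the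
  set of all sections of \<open>S\<close> around \<open>p\<close> with this value at \<open>p\<close>.
\<close>

definition strongly_distinct ::
    "('p, 'r) ringed_space \<Rightarrow> ('p, 'r, 'm) p1_data \<Rightarrow> ('p, 'r, 'n) p1_data \<Rightarrow> bool" where
  "strongly_distinct S a b \<longleftrightarrow>
     P1_equalizer S a b (empty_scheme :: ('p, ('p, 'r) germ) ringed_space) empty_morph"


section \<open>The group \<open>PGL\<^sub>2(S)\<close> and its action\<close>

text \<open>
  Elements of \<open>PGL\<^sub>2(S)\<close> are represented by pairs \<open>(L, M)\<close>, where the matrix \<open>M\<close> is indexed by
  \<open>{0, 1} \<times> {0, 1}\<close>.
\<close>

type_synonym ('p, 'r, 'l) pgl2_data = "('p, 'r, 'l) mod_sheaf \<times> (nat \<Rightarrow> nat \<Rightarrow> 'l)"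

fun PGL2_element :: "('p, 'r) ringed_space \<Rightarrow> ('p, 'r, 'l) pgl2_data \<Rightarrow> bool" where
  "PGL2_element S (L, M) \<longleftrightarrow>
     line_bundle S L \<and>
     (\<exists>\<phi>. module_sheaf_iso S (tensor_sheaf S L L) (structure_sheaf S) \<phi>) \<and>
     (\<forall>i \<in> {0, 1}. \<forall>j \<in> {0, 1}. M i j \<in> carrier (msec L (points S))) \<and>
     nowhere_vanishing S (tensor_sheaf S L L)
       (tensor S L L (M 0 0) (M 1 1)
        \<ominus>\<^bsub>msec (tensor_sheaf S L L) (points S)\<^esub> tensor S L L (M 0 1) (M 1 0))"

fun PGL2_act ::
    "('p, 'r) ringed_space \<Rightarrow> ('p, 'r, 'l) pgl2_data \<Rightarrow> ('p, 'r, 'm) p1_data \<Rightarrow>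
     ('p, 'r, ('p, 'l, 'p, 'm) tensor_section) p1_data" where
  "PGL2_act S (L, M) (A, a\<^sub>0, a\<^sub>1) =
     (tensor_sheaf S L A,
      tensor S L A (M 0 0) a\<^sub>0 \<oplus>\<^bsub>msec (tensor_sheaf S L A) (points S)\<^esub> tensor S L A (M 0 1) a\<^sub>1,
      tensor S L A (M 1 0) a\<^sub>0 \<oplus>\<^bsub>msec (tensor_sheaf S L A) (points S)\<^esub> tensor S L A (M 1 1) a\<^sub>1)"


section \<open>The cross-ratio\<close>

fun Delta ::
    "('p, 'r) ringed_space \<Rightarrow> ('p, 'r, 'm) mod_sheaf \<Rightarrow> 'm \<times> 'm \<Rightarrow> 'm \<times> 'm \<Rightarrow>
     ('p, 'm, 'p, 'm) tensor_section" where
  "Delta S L (a\<^sub>0, a\<^sub>1) (b\<^sub>0, b\<^sub>1) =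
     tensor S L L a\<^sub>0 b\<^sub>1 \<ominus>\<^bsub>msec (tensor_sheaf S L L) (points S)\<^esub> tensor S L L a\<^sub>1 b\<^sub>0"

definition is_cross_ratio ::
    "('p, 'r) ringed_space \<Rightarrow> ('p, 'r, 'm) p1_data \<Rightarrow> ('p, 'r, 'm) p1_data \<Rightarrow>
     ('p, 'r, 'm) p1_data \<Rightarrow> ('p, 'r, 'm) p1_data \<Rightarrow> 'r \<Rightarrow> bool" where
  "is_cross_ratio S a b c d z \<longleftrightarrow>
     (\<exists>(L :: ('p, 'r, 'm) mod_sheaf) a' b' c' d' \<phi>.
        P1_point S (L, a') \<and> P1_point S (L, b') \<and> P1_point S (L, c') \<and> P1_point S (L, d') \<and>
        P1_eq S a (L, a') \<and> P1_eq S b (L, b') \<and> P1_eq S c (L, c') \<and> P1_eq S d (L, d') \<and>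
        module_sheaf_iso S (tensor_sheaf S L L) (structure_sheaf S) \<phi> \<and>
        (let \<delta> = (\<lambda>x y. \<phi> (points S) (Delta S L x y)); R = global_sections S in
           z = (\<delta> a' c' \<otimes>\<^bsub>R\<^esub> \<delta> b' d') \<otimes>\<^bsub>R\<^esub> inv\<^bsub>R\<^esub> (\<delta> a' d' \<otimes>\<^bsub>R\<^esub> \<delta> b' c')))"

text \<open>
  The common line bundle may be taken in the type of the given ones: if the points are pairwise
  strongly distinct, then any of the four given line bundles can be used for \<open>L\<close>.
\<close>

definition cross_ratio ::
    "('p, 'r) ringed_space \<Rightarrow> ('p, 'r, 'm) p1_data \<Rightarrow> ('p, 'r, 'm) p1_data \<Rightarrow>
     ('p, 'r, 'm) p1_data \<Rightarrow> ('p, 'r, 'm) p1_data \<Rightarrow> 'r" where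
  "cross_ratio S a b c d = (THE z. is_cross_ratio S a b c d z)"

end

theory Submission
  imports Defs "HOL-Algebra.Weak_Morphisms"
begin

text \<open>
  Everything is computed in the stalks. After choosing an isomorphism of each stalk of each line
  bundle with the stalk of the structure sheaf, sections become families of elements of the local
  rings \<open>R\<close>, tensor products become products, and isomorphisms of line bundles become families of
  units that are regular relative to local generators. A point \<open>(A; a\<^sub>0, a\<^sub>1)\<close> becomes a unimodular
  vector, determined up to a unit, at each point of \<open>S\<close>. Strong distinctness says that the
  determinant of two such vectors is a unit: at a point where it is not, the two points would agree
  on the spectrum of the residue field. The theorem then is the identity that \<open>\<sigma>\<close> multiplies all
  determinants by \<open>det \<sigma>\<close>, so that \<open>(x, y) = \<sigma>(d)\<close> satisfies \<open>x = z y\<close> with \<open>y\<close> a unit.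
\<close>

section \<open>Germs of sections\<close>

text \<open>\<open>cross_ratio\<close> is a definite description, so exactly one value must be shown
  to qualify. Uniqueness is checked in stalks. Existence asks for one bundle carrying all four
  points and for a trivialization of its square. Both come from determinants: for strongly distinct
  points, \<Delta>(a, b) is a nowhere vanishing section of A \<otimes> B, so A and B are inverse to
  each other; with three such points all bundles are isomorphic and each is its own inverse.

  Strong distinctness can be tested only with schemes whose points have the type of the points of S
  and whose sections have the type of germs. Residue fields are therefore built on representatives
  inside the stalk, and their spectra are put on the point of S itself.

  Independent choices at all points avoid transition functions, but a single coordinate then says
  nothing about neighbouring points. Every global isomorphism is therefore obtained by exhibiting,
  near each point, a frame and its image whose coordinates differ by the intended unit.\<close>

lemma sheaf_resD:
  assumes "sheaf_of_sets T F r" "openin T U" "openin T V" "V \<subseteq> U" "s \<in> F U"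
  shows "r U V s \<in> F V"
proof -
  have "r U V \<in> F U \<rightarrow> F V"
    using assms(1)[unfolded sheaf_of_sets_def, THEN conjunct1] assms(2-4) by blast
  then show ?thesis using assms(5) by (rule funcset_mem)
qed

lemma sheaf_res_id:
  assumes "sheaf_of_sets T F r" "openin T U" "s \<in> F U"
  shows "r U U s = s"
  using assms(1)[unfolded sheaf_of_sets_def, THEN conjunct2, THEN conjunct1] assms(2,3) by blast

lemma sheaf_res_res:
  assumes "sheaf_of_sets T F r" "openin T U" "openin T V" "openin T W" "W \<subseteq> V" "V \<subseteq> U" "s \<in> F U"
  shows "r V W (r U V s) = r U W s"
  using assms(1)[unfolded sheaf_of_sets_def, THEN conjunct2, THEN conjunct2, THEN conjunct1] assms(2-) by blast

lemma sheaf_glue: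
  assumes "sheaf_of_sets T F r"
    and "\<And>V. V \<in> \<U> \<Longrightarrow> openin T V" "\<And>V. V \<in> \<U> \<Longrightarrow> s V \<in> F V"
    and "\<And>V W. V \<in> \<U> \<Longrightarrow> W \<in> \<U> \<Longrightarrow> r V (V \<inter> W) (s V) = r W (V \<inter> W) (s W)"
  shows "\<exists>!t. t \<in> F (\<Union>\<U>) \<and> (\<forall>V \<in> \<U>. r (\<Union>\<U>) V t = s V)"
proof -
  note h = assms(1)[unfolded sheaf_of_sets_def, THEN conjunct2, THEN conjunct2, THEN conjunct2]
  show ?thesis
    by (rule h[THEN spec[of _ \<U>], THEN spec[of _ s], THEN mp]) (intro conjI ballI assms(2-))
qed

text \<open>Gluing contains separation: over the cover by all V on which s and t agree, both of them
  glue the family of restrictions of s.\<close>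

lemma sheaf_separated:
  assumes sh: "sheaf_of_sets T F r" and U: "openin T U" and s: "s \<in> F U" and t: "t \<in> F U"
    and loc: "\<And>p. p \<in> U \<Longrightarrow> \<exists>V. openin T V \<and> p \<in> V \<and> V \<subseteq> U \<and> r U V s = r U V t"
  shows "s = t"
proof -
  let ?\<U> = "{V. openin T V \<and> V \<subseteq> U \<and> r U V s = r U V t}"
  have un: "\<Union>?\<U> = U" using loc by blast
  have "\<exists>!x. x \<in> F (\<Union>?\<U>) \<and> (\<forall>V \<in> ?\<U>. r (\<Union>?\<U>) V x = r U V s)"
  proof (rule sheaf_glue[OF sh])
    fix V W assume V: "V \<in> ?\<U>" and W: "W \<in> ?\<U>"
    then have o: "openin T (V \<inter> W)" by auto
    have "r V (V \<inter> W) (r U V s) = r U (V \<inter> W) s"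
      by (rule sheaf_res_res[OF sh U]) (use V o s in auto)
    also have "\<dots> = r W (V \<inter> W) (r U W s)"
      by (rule sheaf_res_res[symmetric, OF sh U]) (use W o s in auto)
    finally show "r V (V \<inter> W) (r U V s) = r W (V \<inter> W) (r U W s)" .
  qed (auto intro!: sheaf_resD[OF sh U] s t)
  then have ex: "\<exists>!x. x \<in> F U \<and> (\<forall>V \<in> ?\<U>. r U V x = r U V s)" unfolding un .
  have ps: "s \<in> F U \<and> (\<forall>V \<in> ?\<U>. r U V s = r U V s)" using s by blast
  have pt: "t \<in> F U \<and> (\<forall>V \<in> ?\<U>. r U V t = r U V s)" using t by simp
  show ?thesis by (rule HOL.trans[OF the1_equality[OF ex ps, symmetric] the1_equality[OF ex pt]])
qed

text \<open>\<open>germ\<close> is a set of pairs, and equality of two such sets has to be reduced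
  to agreement near p. A germ contains its own representative, which gives one direction; the other
  is transitivity of agreement near p, on the intersection of two witnesses.\<close>

lemma germ_eq_iff:
  assumes sh: "sheaf_of_sets T F r" and U: "openin T U" "p \<in> U" "s \<in> F U"
    and V: "openin T V" "p \<in> V" "t \<in> F V"
  shows "germ T F r p U s = germ T F r p V t \<longleftrightarrow>
    (\<exists>W. openin T W \<and> p \<in> W \<and> W \<subseteq> U \<inter> V \<and> r U W s = r V W t)" (is "?L \<longleftrightarrow> ?R")
proof
  assume ?L
  moreover have "(V, t) \<in> germ T F r p V t" using V unfolding germ_def by auto
  ultimately have "(V, t) \<in> germ T F r p U s" by simp
  then show ?R unfolding germ_def by auto
next
  \<comment> \<open>One inclusion for arbitrary data; the other is the same fact with the two
    sections exchanged.\<close>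
  have *: "germ T F r p U s \<subseteq> germ T F r p V t" if U: "openin T U" "p \<in> U" "s \<in> F U"
    and V: "openin T V" "p \<in> V" "t \<in> F V" and R: "openin T W" "p \<in> W" "W \<subseteq> U \<inter> V" "r U W s = r V W t"
    for U V W s t
  proof
    fix x assume "x \<in> germ T F r p U s"
    then obtain X y W' where x: "x = (X, y)" "openin T X" "p \<in> X" "y \<in> F X" and
      W': "openin T W'" "p \<in> W'" "W' \<subseteq> U \<inter> X" "r U W' s = r X W' y"
      unfolding germ_def by blast
    let ?W = "W \<inter> W'"
    have o: "openin T ?W" using R W' by auto
    have "r V ?W t = r W ?W (r V W t)" by (rule sheaf_res_res[symmetric, OF sh]) (use V R o in auto)
    also have "\<dots> = r U ?W s" unfolding R(4)[symmetric] by (rule sheaf_res_res[OF sh]) (use U R o in auto)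
    also have "\<dots> = r W' ?W (r U W' s)" by (rule sheaf_res_res[symmetric, OF sh]) (use U W' o in auto)
    also have "\<dots> = r X ?W y" unfolding W'(4) by (rule sheaf_res_res[OF sh]) (use x W' o in auto)
    finally show "x \<in> germ T F r p V t" using o R W' V x unfolding germ_def by blast
  qed
  assume ?R
  then obtain W where "openin T W" "p \<in> W" "W \<subseteq> U \<inter> V" "r U W s = r V W t" by blast
  then show ?L using *[OF U V, of W] *[OF V U, of W] by (simp add: Int_commute)
qed

lemma germ_res:
  assumes sh: "sheaf_of_sets T F r" and U: "openin T U" and V: "openin T V" "p \<in> V" "V \<subseteq> U"
    and s: "s \<in> F U"
  shows "germ T F r p V (r U V s) = germ T F r p U s"
proof -
  have c: "r U V s \<in> F V" by (rule sheaf_resD[OF sh U V(1,3) s])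
  have p: "p \<in> U" using V by blast
  have e: "r V V (r U V s) = r U V s" by (rule sheaf_res_id[OF sh V(1) c])
  have "V \<subseteq> V \<inter> U" using V by blast
  then have "\<exists>W. openin T W \<and> p \<in> W \<and> W \<subseteq> V \<inter> U \<and> r V W (r U V s) = r U W s" using V(1,2) e by metis
  then show ?thesis unfolding germ_eq_iff[OF sh V(1,2) c U p s] .
qed

lemma germ_self:
  assumes "openin T U" "p \<in> U" "s \<in> F U"
  shows "(U, s) \<in> germ T F r p U s"
  using assms unfolding germ_def by blast

lemma germ_memD:
  assumes sh: "sheaf_of_sets T F r" and U: "openin T U" "p \<in> U" "s \<in> F U"
    and m: "(V, t) \<in> germ T F r p U s"
  shows "openin T V" "p \<in> V" "t \<in> F V" "germ T F r p V t = germ T F r p U s"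
proof -
  from m obtain W where V: "openin T V" "p \<in> V" "t \<in> F V"
    and W: "openin T W \<and> p \<in> W \<and> W \<subseteq> U \<inter> V \<and> r U W s = r V W t"
    unfolding germ_def by blast
  from V show "openin T V" "p \<in> V" "t \<in> F V" .
  show "germ T F r p V t = germ T F r p U s"
    by (rule iffD2[OF germ_eq_iff[OF sh U V], symmetric]) (use W in blast)
qed

text \<open>The operations on stalks are unions over representatives. If every representative gives
  the same set \<open>c\<close>, the union is \<open>c\<close>, because a germ has at least one
  representative.\<close>

lemma UN_germ:
  assumes sh: "sheaf_of_sets T F r" and U: "openin T U" "p \<in> U" "s \<in> F U"
    and c: "\<And>V t. openin T V \<Longrightarrow> p \<in> V \<Longrightarrow> t \<in> F V \<Longrightarrow> germ T F r p V t = germ T F r p U s \<Longrightarrow> f V t = c"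
  shows "(\<Union>(V, t) \<in> germ T F r p U s. f V t) = c"
proof -
  have "case x of (V, t) \<Rightarrow> f V t = c" if "x \<in> germ T F r p U s" for x
    using c germ_memD[OF sh U] that by (cases x) auto
  then show ?thesis using germ_self[of T U p s F r] U by fastforce
qed

lemma germ_inj:
  assumes sh: "sheaf_of_sets T F r" and U: "openin T U" and s: "s \<in> F U" and t: "t \<in> F U"
    and eq: "\<And>p. p \<in> U \<Longrightarrow> germ T F r p U s = germ T F r p U t"
  shows "s = t"
proof (rule sheaf_separated[OF sh U s t])
  fix p assume p: "p \<in> U"
  from eq[OF this] show "\<exists>V. openin T V \<and> p \<in> V \<and> V \<subseteq> U \<and> r U V s = r U V t"
    unfolding germ_eq_iff[OF sh U p s U p t] by auto
qed

text \<open>Sections that realize \<xi> over two open sets have equal germs on the overlap, hence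
  agree there by \<open>germ_inj\<close> and can be glued. Inverses of functions and sections with
  prescribed coordinates are obtained in this way.\<close>

lemma germ_glue:
  assumes sh: "sheaf_of_sets T F r" and U: "openin T U"
    and loc: "\<And>p. p \<in> U \<Longrightarrow> \<exists>V s. openin T V \<and> p \<in> V \<and> V \<subseteq> U \<and> s \<in> F V \<and>
       (\<forall>q \<in> V. germ T F r q V s = \<xi> q)"
  shows "\<exists>s \<in> F U. \<forall>q \<in> U. germ T F r q U s = \<xi> q"
proof -
  let ?P = "\<lambda>V s. openin T V \<and> V \<subseteq> U \<and> s \<in> F V \<and> (\<forall>q \<in> V. germ T F r q V s = \<xi> q)"
  let ?\<U> = "{V. \<exists>s. ?P V s}"
  define f where "f V = (SOME s. ?P V s)" for V
  have f: "?P V (f V)" if "V \<in> ?\<U>" for V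
    unfolding f_def by (rule someI_ex[of "?P V"]) (use that in blast)
  have un: "\<Union>?\<U> = U"
  proof (intro equalityI subsetI)
    fix p assume "p \<in> U"
    from loc[OF this] obtain V s where "p \<in> V" "?P V s" by auto
    then show "p \<in> \<Union>?\<U>" by blast
  qed blast
  have "\<exists>!t. t \<in> F (\<Union>?\<U>) \<and> (\<forall>V \<in> ?\<U>. r (\<Union>?\<U>) V t = f V)"
  proof (rule sheaf_glue[OF sh])
    fix V W assume V: "V \<in> ?\<U>" and W: "W \<in> ?\<U>"
    note fV = f[OF V] and fW = f[OF W]
    have o: "openin T (V \<inter> W)" using fV fW by auto
    have c: "r V (V \<inter> W) (f V) \<in> F (V \<inter> W)" "r W (V \<inter> W) (f W) \<in> F (V \<inter> W)"
      by (rule sheaf_resD[OF sh _ o]; use fV fW in blast)+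
    show "r V (V \<inter> W) (f V) = r W (V \<inter> W) (f W)"
    proof (rule germ_inj[OF sh o c])
      fix p assume p: "p \<in> V \<inter> W"
      have "germ T F r p (V \<inter> W) (r V (V \<inter> W) (f V)) = germ T F r p V (f V)"
        by (rule germ_res[OF sh]) (use fV o p in auto)
      moreover have "germ T F r p (V \<inter> W) (r W (V \<inter> W) (f W)) = germ T F r p W (f W)"
        by (rule germ_res[OF sh]) (use fW o p in auto)
      ultimately show "germ T F r p (V \<inter> W) (r V (V \<inter> W) (f V)) = germ T F r p (V \<inter> W) (r W (V \<inter> W) (f W))"
        using fV fW p by auto
    qed
  next
    show "openin T V" if "V \<in> ?\<U>" for V using f[OF that] by (elim conjE)
    show "f V \<in> F V" if "V \<in> ?\<U>" for V using f[OF that] by (elim conjE)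
  qed
  then have "\<exists>!t. t \<in> F U \<and> (\<forall>V \<in> ?\<U>. r U V t = f V)" unfolding un .
  from ex1_implies_ex[OF this] obtain t where tt: "t \<in> F U \<and> (\<forall>V \<in> ?\<U>. r U V t = f V)" ..
  note t = conjunct1[OF tt] conjunct2[OF tt]
  have "germ T F r q U t = \<xi> q" if q: "q \<in> U" for q
  proof -
    have "q \<in> \<Union>?\<U>" unfolding un by (rule q)
    then obtain V where V: "V \<in> ?\<U>" "q \<in> V" by (rule UnionE)
    have "germ T F r q U t = germ T F r q V (r U V t)"
      by (rule germ_res[symmetric, OF sh U conjunct1[OF f[OF V(1)]] V(2)
            conjunct1[OF conjunct2[OF f[OF V(1)]]] t(1)])
    also have "r U V t = f V" using bspec[OF t(2) V(1)] .
    also have "germ T F r q V (f V) = \<xi> q" using f[OF V(1)] V(2) by (elim conjE) (rule bspec)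
    finally show ?thesis .
  qed
  with t(1) show ?thesis by (intro bexI ballI)
qed

text \<open>Three sheaves occur because the same computation serves addition and multiplication of
  germs as well as the action of functions on a module. Compatibility of \<open>m\<close> with
  restriction makes the result independent of the representatives: both pairs agree on an
  intersection of neighbourhoods.\<close>

lemma germ_binop:
  assumes s1: "sheaf_of_sets T F r" and s2: "sheaf_of_sets T F' r'" and s3: "sheaf_of_sets T F'' r''"
    and cl: "\<And>U s t. openin T U \<Longrightarrow> s \<in> F U \<Longrightarrow> t \<in> F' U \<Longrightarrow> m U s t \<in> F'' U"
    and nat: "\<And>U V s t. openin T U \<Longrightarrow> openin T V \<Longrightarrow> V \<subseteq> U \<Longrightarrow> s \<in> F U \<Longrightarrow> t \<in> F' U \<Longrightarrow>
       r'' U V (m U s t) = m V (r U V s) (r' U V t)"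
    and U: "openin T U" "p \<in> U" "s \<in> F U" "t \<in> F' U"
  shows "(\<Union>(A, x) \<in> germ T F r p U s. \<Union>(B, y) \<in> germ T F' r' p U t.
     germ T F'' r'' p (A \<inter> B) (m (A \<inter> B) (r A (A \<inter> B) x) (r' B (A \<inter> B) y))) =
     germ T F'' r'' p U (m U s t)"
proof (rule UN_germ[OF s1 U(1-3)], rule UN_germ[OF s2 U(1,2,4)])
  fix A x B y
  assume A: "openin T A" "p \<in> A" "x \<in> F A" and gA: "germ T F r p A x = germ T F r p U s"
    and B: "openin T B" "p \<in> B" "y \<in> F' B" and gB: "germ T F' r' p B y = germ T F' r' p U t"
  obtain W where W: "openin T W" "p \<in> W" "W \<subseteq> A \<inter> U" "r A W x = r U W s"
    using germ_eq_iff[OF s1 A U(1-3)] gA by blast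
  obtain W' where W': "openin T W'" "p \<in> W'" "W' \<subseteq> B \<inter> U" "r' B W' y = r' U W' t"
    using germ_eq_iff[OF s2 B U(1,2,4)] gB by blast
  let ?W = "W \<inter> W'"
  have o: "openin T ?W" "openin T (A \<inter> B)" using W W' A B by auto
  have xm: "r A (A \<inter> B) x \<in> F (A \<inter> B)" "r' B (A \<inter> B) y \<in> F' (A \<inter> B)"
    using sheaf_resD[OF s1 A(1) o(2) _ A(3)] sheaf_resD[OF s2 B(1) o(2) _ B(3)] by auto
  have "r A ?W x = r W ?W (r A W x)" by (rule sheaf_res_res[symmetric, OF s1]) (use W W' A o in auto)
  also have "\<dots> = r U ?W s" unfolding W(4) by (rule sheaf_res_res[OF s1]) (use W W' U o in auto)
  finally have e1: "r A ?W x = r U ?W s" .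
  have "r' B ?W y = r' W' ?W (r' B W' y)" by (rule sheaf_res_res[symmetric, OF s2]) (use W W' B o in auto)
  also have "\<dots> = r' U ?W t" unfolding W'(4) by (rule sheaf_res_res[OF s2]) (use W W' U o in auto)
  finally have e2: "r' B ?W y = r' U ?W t" .
  have "r'' (A \<inter> B) ?W (m (A \<inter> B) (r A (A \<inter> B) x) (r' B (A \<inter> B) y)) =
      m ?W (r (A \<inter> B) ?W (r A (A \<inter> B) x)) (r' (A \<inter> B) ?W (r' B (A \<inter> B) y))"
    by (rule nat) (use W W' xm o in auto)
  also have "r (A \<inter> B) ?W (r A (A \<inter> B) x) = r A ?W x"
    by (rule sheaf_res_res[OF s1]) (use W W' A o in auto)
  also have "r' (A \<inter> B) ?W (r' B (A \<inter> B) y) = r' B ?W y"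
    by (rule sheaf_res_res[OF s2]) (use W W' B o in auto)
  also have "m ?W (r A ?W x) (r' B ?W y) = r'' U ?W (m U s t)"
    unfolding e1 e2 by (rule nat[symmetric]) (use W W' U o in auto)
  finally have e: "r'' (A \<inter> B) ?W (m (A \<inter> B) (r A (A \<inter> B) x) (r' B (A \<inter> B) y)) = r'' U ?W (m U s t)" .
  have p: "p \<in> A \<inter> B" "p \<in> ?W" "?W \<subseteq> A \<inter> B \<inter> U" using A B W W' by auto
  show "germ T F'' r'' p (A \<inter> B) (m (A \<inter> B) (r A (A \<inter> B) x) (r' B (A \<inter> B) y)) =
     germ T F'' r'' p U (m U s t)"
    unfolding germ_eq_iff[OF s3 o(2) p(1) cl[OF o(2) xm] U(1,2) cl[OF U(1,3,4)]]
    by (rule exI[of _ ?W]) (intro conjI o p e)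
qed

subsection \<open>Stalks of the structure sheaf\<close>

locale ringed =
  fixes S :: "('p, 'r) ringed_space"
  assumes is_ringed: "is_ringed_space S"
begin

abbreviation Op where "Op \<equiv> openin (spc S)"
abbreviation R where "R \<equiv> stalk S"

lemma Op_sub: "Op U \<Longrightarrow> p \<in> U \<Longrightarrow> p \<in> points S"
  using openin_subset by blast

lemma sheafO: "sheaf_of_sets (spc S) (\<lambda>U. carrier (sec S U)) (res S)"
  using is_ringed unfolding is_ringed_space_def by blast

lemma cringO: "Op U \<Longrightarrow> cring (sec S U)"
  using is_ringed unfolding is_ringed_space_def by blast

lemma resO: "Op U \<Longrightarrow> Op V \<Longrightarrow> V \<subseteq> U \<Longrightarrow> res S U V \<in> ring_hom (sec S U) (sec S V)"
  using is_ringed unfolding is_ringed_space_def by blast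

lemma stalk_carrierE:
  assumes "x \<in> carrier (R p)"
  obtains U s where "x = ogerm S p U s" "Op U" "p \<in> U" "s \<in> carrier (sec S U)"
  using assms unfolding stalk_def by auto

lemma ogerm_closed [intro, simp]: "Op U \<Longrightarrow> p \<in> U \<Longrightarrow> s \<in> carrier (sec S U) \<Longrightarrow> ogerm S p U s \<in> carrier (R p)"
  unfolding stalk_def by auto

lemma ogerm_mult:
  assumes "Op U" "p \<in> U" "s \<in> carrier (sec S U)" "t \<in> carrier (sec S U)"
  shows "ogerm S p U (s \<otimes>\<^bsub>sec S U\<^esub> t) = ogerm S p U s \<otimes>\<^bsub>R p\<^esub> ogerm S p U t"
  unfolding stalk_def monoid.simps
  by (rule germ_binop[OF sheafO sheafO sheafO, symmetric])
     (use assms cringO resO in \<open>auto simp: cring.cring_simprules ring_hom_mult\<close>)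

lemma ogerm_add:
  assumes "Op U" "p \<in> U" "s \<in> carrier (sec S U)" "t \<in> carrier (sec S U)"
  shows "ogerm S p U (s \<oplus>\<^bsub>sec S U\<^esub> t) = ogerm S p U s \<oplus>\<^bsub>R p\<^esub> ogerm S p U t"
  unfolding stalk_def ring_record_simps
  by (rule germ_binop[OF sheafO sheafO sheafO, symmetric])
     (use assms cringO resO in \<open>auto simp: cring.cring_simprules ring_hom_add\<close>)

lemma ogerm_res:
  assumes "Op U" "Op V" "p \<in> V" "V \<subseteq> U" "s \<in> carrier (sec S U)"
  shows "ogerm S p V (res S U V s) = ogerm S p U s"
  by (rule germ_res[OF sheafO assms])

lemma ogerm_one:
  assumes "Op U" "p \<in> U" shows "ogerm S p U \<one>\<^bsub>sec S U\<^esub> = \<one>\<^bsub>R p\<^esub>"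
proof -
  have "ogerm S p U (res S (points S) U \<one>\<^bsub>global_sections S\<^esub>) = ogerm S p (points S) \<one>\<^bsub>global_sections S\<^esub>"
    by (rule ogerm_res) (use assms openin_subset cringO[of "points S"] in \<open>auto simp: cring.cring_simprules\<close>)
  moreover have "res S (points S) U \<one>\<^bsub>global_sections S\<^esub> = \<one>\<^bsub>sec S U\<^esub>"
    using resO[of "points S" U] assms openin_subset ring_hom_one by blast
  ultimately show ?thesis by (simp add: stalk_def)
qed

lemma ogerm_hom: "Op U \<Longrightarrow> p \<in> U \<Longrightarrow> ogerm S p U \<in> ring_hom (sec S U) (R p)"
  by (rule ring_hom_memI) (auto simp: ogerm_mult ogerm_add ogerm_one)

lemma ogerm_zero:
  assumes "Op U" "p \<in> U" shows "ogerm S p U \<zero>\<^bsub>sec S U\<^esub> = \<zero>\<^bsub>R p\<^esub>"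
proof -
  have g: "Op (points S)" "U \<subseteq> points S" using assms openin_subset by auto
  interpret g: cring "global_sections S" by (rule cringO[OF g(1)])
  have "res S (points S) U \<zero>\<^bsub>global_sections S\<^esub> = \<zero>\<^bsub>sec S U\<^esub>"
    by (rule ring_hom_zero[OF resO[OF g(1) assms(1) g(2)] g.ring_axioms cring.axioms(1)[OF cringO[OF assms(1)]]])
  then show ?thesis using ogerm_res[OF g(1) assms g(2) g.zero_closed] by (simp add: stalk_def)
qed

lemma stalk_carrierE2:
  assumes x: "x \<in> carrier (R p)" and y: "y \<in> carrier (R p)"
  obtains U s t where "x = ogerm S p U s" "y = ogerm S p U t" "Op U" "p \<in> U"
    "s \<in> carrier (sec S U)" "t \<in> carrier (sec S U)"
proof -
  obtain U s where U: "x = ogerm S p U s" "Op U" "p \<in> U" "s \<in> carrier (sec S U)" by (rule stalk_carrierE[OF x])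
  obtain V t where V: "y = ogerm S p V t" "Op V" "p \<in> V" "t \<in> carrier (sec S V)" by (rule stalk_carrierE[OF y])
  have o: "Op (U \<inter> V)" "p \<in> U \<inter> V" using U V by auto
  show ?thesis
    by (rule that[of "U \<inter> V" "res S U (U \<inter> V) s" "res S V (U \<inter> V) t"])
       (use o U V ogerm_res[OF U(2) o _ U(4)] ogerm_res[OF V(2) o _ V(4)]
          sheaf_resD[OF sheafO U(2) o(1) _ U(4)] sheaf_resD[OF sheafO V(2) o(1) _ V(4)] in auto)
qed

lemma stalk_carrierE3:
  assumes x: "x \<in> carrier (R p)" and y: "y \<in> carrier (R p)" and z: "z \<in> carrier (R p)"
  obtains U s t w where "x = ogerm S p U s" "y = ogerm S p U t" "z = ogerm S p U w" "Op U" "p \<in> U"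
    "s \<in> carrier (sec S U)" "t \<in> carrier (sec S U)" "w \<in> carrier (sec S U)"
proof -
  obtain U s t where U: "x = ogerm S p U s" "y = ogerm S p U t" "Op U" "p \<in> U"
    "s \<in> carrier (sec S U)" "t \<in> carrier (sec S U)" by (rule stalk_carrierE2[OF x y])
  obtain V w where V: "z = ogerm S p V w" "Op V" "p \<in> V" "w \<in> carrier (sec S V)" by (rule stalk_carrierE[OF z])
  have o: "Op (U \<inter> V)" "p \<in> U \<inter> V" using U V by auto
  show ?thesis
    by (rule that[of "U \<inter> V" "res S U (U \<inter> V) s" "res S U (U \<inter> V) t" "res S V (U \<inter> V) w"])
       (use o U V ogerm_res[OF U(3) o _ U(5)] ogerm_res[OF U(3) o _ U(6)] ogerm_res[OF V(2) o _ V(4)]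
          sheaf_resD[OF sheafO U(3) o(1) _ U(5)] sheaf_resD[OF sheafO U(3) o(1) _ U(6)]
          sheaf_resD[OF sheafO V(2) o(1) _ V(4)] in auto)
qed

text \<open>Each axiom involves at most three germs; these are represented over one neighbourhood,
  where the axiom holds in the ring of sections.\<close>

lemma cring_stalk:
  assumes p: "p \<in> points S"
  shows "cring (R p)"
proof (rule cringI)
  note op = ogerm_add[symmetric] ogerm_mult[symmetric]
  have g: "Op (points S)" by simp
  interpret g: cring "global_sections S" by (rule cringO[OF g])
  note z = ogerm_zero[OF g p, symmetric] and u = ogerm_one[OF g p, symmetric]
  show "abelian_group (R p)"
  proof (rule abelian_groupI)
    fix x y assume "x \<in> carrier (R p)" "y \<in> carrier (R p)"
    then obtain U s t where e: "x = ogerm S p U s" "y = ogerm S p U t" and U: "Op U" "p \<in> U"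
      "s \<in> carrier (sec S U)" "t \<in> carrier (sec S U)" by (rule stalk_carrierE2)
    interpret u: cring "sec S U" by (rule cringO[OF U(1)])
    show "x \<oplus>\<^bsub>R p\<^esub> y \<in> carrier (R p)" "x \<oplus>\<^bsub>R p\<^esub> y = y \<oplus>\<^bsub>R p\<^esub> x"
      unfolding e using U by (simp_all add: op u.a_comm)
  next
    show "\<zero>\<^bsub>R p\<^esub> \<in> carrier (R p)" unfolding z using p by auto
  next
    fix x y w assume "x \<in> carrier (R p)" "y \<in> carrier (R p)" "w \<in> carrier (R p)"
    then obtain U s t r where e: "x = ogerm S p U s" "y = ogerm S p U t" "w = ogerm S p U r" and U: "Op U" "p \<in> U"
      "s \<in> carrier (sec S U)" "t \<in> carrier (sec S U)" "r \<in> carrier (sec S U)" by (rule stalk_carrierE3)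
    interpret u: cring "sec S U" by (rule cringO[OF U(1)])
    show "x \<oplus>\<^bsub>R p\<^esub> y \<oplus>\<^bsub>R p\<^esub> w = x \<oplus>\<^bsub>R p\<^esub> (y \<oplus>\<^bsub>R p\<^esub> w)"
      unfolding e using U by (simp add: op u.a_assoc)
  next
    fix x assume "x \<in> carrier (R p)"
    then obtain U s where e: "x = ogerm S p U s" and U: "Op U" "p \<in> U" "s \<in> carrier (sec S U)"
      by (rule stalk_carrierE)
    interpret u: cring "sec S U" by (rule cringO[OF U(1)])
    note zU = ogerm_zero[OF U(1,2), symmetric]
    show "\<zero>\<^bsub>R p\<^esub> \<oplus>\<^bsub>R p\<^esub> x = x" unfolding e zU using U by (simp add: op)
    have "ogerm S p U (\<ominus>\<^bsub>sec S U\<^esub> s) \<oplus>\<^bsub>R p\<^esub> x = \<zero>\<^bsub>R p\<^esub>" unfolding e zU using U by (simp add: op u.l_neg)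
    moreover have "ogerm S p U (\<ominus>\<^bsub>sec S U\<^esub> s) \<in> carrier (R p)" using U by auto
    ultimately show "\<exists>y \<in> carrier (R p). y \<oplus>\<^bsub>R p\<^esub> x = \<zero>\<^bsub>R p\<^esub>" by blast
  qed
  show "comm_monoid (R p)"
  proof (rule comm_monoidI)
    fix x y assume "x \<in> carrier (R p)" "y \<in> carrier (R p)"
    then obtain U s t where e: "x = ogerm S p U s" "y = ogerm S p U t" and U: "Op U" "p \<in> U"
      "s \<in> carrier (sec S U)" "t \<in> carrier (sec S U)" by (rule stalk_carrierE2)
    interpret u: cring "sec S U" by (rule cringO[OF U(1)])
    show "x \<otimes>\<^bsub>R p\<^esub> y \<in> carrier (R p)" "x \<otimes>\<^bsub>R p\<^esub> y = y \<otimes>\<^bsub>R p\<^esub> x"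
      unfolding e using U by (simp_all add: op u.m_comm)
  next
    show "\<one>\<^bsub>R p\<^esub> \<in> carrier (R p)" unfolding u using p by auto
  next
    fix x y w assume "x \<in> carrier (R p)" "y \<in> carrier (R p)" "w \<in> carrier (R p)"
    then obtain U s t r where e: "x = ogerm S p U s" "y = ogerm S p U t" "w = ogerm S p U r" and U: "Op U" "p \<in> U"
      "s \<in> carrier (sec S U)" "t \<in> carrier (sec S U)" "r \<in> carrier (sec S U)" by (rule stalk_carrierE3)
    interpret u: cring "sec S U" by (rule cringO[OF U(1)])
    show "x \<otimes>\<^bsub>R p\<^esub> y \<otimes>\<^bsub>R p\<^esub> w = x \<otimes>\<^bsub>R p\<^esub> (y \<otimes>\<^bsub>R p\<^esub> w)"
      unfolding e using U by (simp add: op u.m_assoc)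
  next
    fix x assume "x \<in> carrier (R p)"
    then obtain U s where e: "x = ogerm S p U s" and U: "Op U" "p \<in> U" "s \<in> carrier (sec S U)"
      by (rule stalk_carrierE)
    interpret u: cring "sec S U" by (rule cringO[OF U(1)])
    show "\<one>\<^bsub>R p\<^esub> \<otimes>\<^bsub>R p\<^esub> x = x" unfolding e ogerm_one[OF U(1,2), symmetric] using U by (simp add: op)
  qed
  fix x y w assume "x \<in> carrier (R p)" "y \<in> carrier (R p)" "w \<in> carrier (R p)"
  then obtain U s t r where e: "x = ogerm S p U s" "y = ogerm S p U t" "w = ogerm S p U r" and U: "Op U" "p \<in> U"
    "s \<in> carrier (sec S U)" "t \<in> carrier (sec S U)" "r \<in> carrier (sec S U)" by (rule stalk_carrierE3)
  interpret u: cring "sec S U" by (rule cringO[OF U(1)])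
  show "(x \<oplus>\<^bsub>R p\<^esub> y) \<otimes>\<^bsub>R p\<^esub> w = x \<otimes>\<^bsub>R p\<^esub> w \<oplus>\<^bsub>R p\<^esub> y \<otimes>\<^bsub>R p\<^esub> w"
    unfolding e using U by (simp add: op u.l_distr)
qed

lemma ogerm_minus:
  assumes "Op U" "p \<in> U" "s \<in> carrier (sec S U)" "t \<in> carrier (sec S U)"
  shows "ogerm S p U (s \<ominus>\<^bsub>sec S U\<^esub> t) = ogerm S p U s \<ominus>\<^bsub>R p\<^esub> ogerm S p U t"
proof -
  interpret a: cring "sec S U" using cringO assms by blast
  interpret b: cring "R p" using cring_stalk Op_sub assms by blast
  interpret h: ring_hom_ring "sec S U" "R p" "ogerm S p U"
    by (rule ring_hom_ringI2) (use ogerm_hom assms in \<open>auto intro: a.ring_axioms b.ring_axioms\<close>)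
  show ?thesis using assms by (simp add: a_minus_def)
qed

lemma ogerm_eqD:
  assumes "Op U" "p \<in> U" "s \<in> carrier (sec S U)" "Op V" "p \<in> V" "t \<in> carrier (sec S V)"
    and "ogerm S p U s = ogerm S p V t"
  obtains W where "Op W" "p \<in> W" "W \<subseteq> U \<inter> V" "res S U W s = res S V W t"
    "\<And>q. q \<in> W \<Longrightarrow> ogerm S q U s = ogerm S q V t"
proof -
  obtain W where W: "Op W" "p \<in> W" "W \<subseteq> U \<inter> V" "res S U W s = res S V W t"
    using assms germ_eq_iff[OF sheafO assms(1-6)] by blast
  moreover have "ogerm S q U s = ogerm S q V t" if "q \<in> W" for q
    using W that ogerm_res[of U W q s] ogerm_res[of V W q t] assms by auto
  ultimately show ?thesis using that by blast
qed

lemma ogerm_inj: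
  assumes "Op U" "s \<in> carrier (sec S U)" "t \<in> carrier (sec S U)"
    and "\<And>p. p \<in> U \<Longrightarrow> ogerm S p U s = ogerm S p U t"
  shows "s = t"
  by (rule germ_inj[OF sheafO assms(1)]) (use assms in auto)

lemma UN_ogerm:
  assumes U: "Op U" "p \<in> U" "s \<in> carrier (sec S U)"
    and c: "\<And>V t. Op V \<Longrightarrow> p \<in> V \<Longrightarrow> t \<in> carrier (sec S V) \<Longrightarrow> ogerm S p V t = ogerm S p U s \<Longrightarrow> f V t = c"
  shows "(\<Union>(V, t) \<in> ogerm S p U s. f V t) = c"
  by (rule UN_germ[OF sheafO]) (use assms in auto)

text \<open>An inverse in the stalk is the germ of some section, and a product with the germ of 1
  equals 1 on a smaller neighbourhood.\<close>

lemma ogerm_unit_near: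
  assumes "Op U" "p \<in> U" "s \<in> carrier (sec S U)" "ogerm S p U s \<in> Units (R p)"
  obtains V t where "Op V" "p \<in> V" "V \<subseteq> U" "t \<in> carrier (sec S V)"
    "res S U V s \<otimes>\<^bsub>sec S V\<^esub> t = \<one>\<^bsub>sec S V\<^esub>"
proof -
  interpret b: cring "R p" using cring_stalk Op_sub assms by blast
  obtain y where y: "y \<in> carrier (R p)" "ogerm S p U s \<otimes>\<^bsub>R p\<^esub> y = \<one>\<^bsub>R p\<^esub>"
    using assms(4) by (auto simp: Units_def)
  obtain V t where V: "y = ogerm S p V t" "Op V" "p \<in> V" "t \<in> carrier (sec S V)"
    by (rule stalk_carrierE[OF y(1)])
  let ?W = "U \<inter> V"
  let ?s = "res S U ?W s" and ?t = "res S V ?W t"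
  have o: "Op ?W" "p \<in> ?W" using assms V by auto
  interpret w: cring "sec S ?W" using o cringO by blast
  have c: "?s \<in> carrier (sec S ?W)" "?t \<in> carrier (sec S ?W)"
    using assms V o sheaf_resD[OF sheafO, of U ?W s] sheaf_resD[OF sheafO, of V ?W t] by auto
  have "ogerm S p ?W (?s \<otimes>\<^bsub>sec S ?W\<^esub> ?t) = ogerm S p ?W \<one>\<^bsub>sec S ?W\<^esub>"
    using y V assms o c by (simp add: ogerm_mult ogerm_res ogerm_one)
  then obtain X where X: "Op X" "p \<in> X" "X \<subseteq> ?W \<inter> ?W"
    "res S ?W X (?s \<otimes>\<^bsub>sec S ?W\<^esub> ?t) = res S ?W X \<one>\<^bsub>sec S ?W\<^esub>"
    by (rule ogerm_eqD[OF o w.m_closed[OF c] o w.one_closed])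
  have h: "res S ?W X \<in> ring_hom (sec S ?W) (sec S X)" using X o resO by auto
  show ?thesis
  proof (rule that[of X "res S ?W X ?t"])
    show "res S ?W X ?t \<in> carrier (sec S X)" using ring_hom_closed[OF h c(2)] .
    have "res S ?W X ?s = res S U X s"
      by (rule sheaf_res_res[OF sheafO]) (use X o assms in auto)
    then show "res S U X s \<otimes>\<^bsub>sec S X\<^esub> res S ?W X ?t = \<one>\<^bsub>sec S X\<^esub>"
      using X(4) ring_hom_mult[OF h c] ring_hom_one[OF h] by simp
  qed (use X in auto)
qed

text \<open>Inverses are unique, so the local inverses have the germs \<open>inv\<close> at all
  points and glue to an inverse over U.\<close>

lemma ogerm_Units:
  assumes "Op U" "s \<in> carrier (sec S U)" "\<And>p. p \<in> U \<Longrightarrow> ogerm S p U s \<in> Units (R p)"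
  shows "s \<in> Units (sec S U)"
proof -
  interpret u: cring "sec S U" using assms cringO by blast
  have "\<exists>t \<in> carrier (sec S U). \<forall>q \<in> U. ogerm S q U t = inv\<^bsub>R q\<^esub> ogerm S q U s"
  proof (rule germ_glue[OF sheafO assms(1)])
    fix p assume p: "p \<in> U"
    obtain V t where V: "Op V" "p \<in> V" "V \<subseteq> U" "t \<in> carrier (sec S V)"
      and e: "res S U V s \<otimes>\<^bsub>sec S V\<^esub> t = \<one>\<^bsub>sec S V\<^esub>"
      by (rule ogerm_unit_near[OF assms(1) p assms(2,3)]) (use p in auto)
    have "ogerm S q V t = inv\<^bsub>R q\<^esub> ogerm S q U s" if q: "q \<in> V" for q
    proof -
      interpret b: cring "R q" using cring_stalk Op_sub V q by blast
      have c: "res S U V s \<in> carrier (sec S V)" using V assms sheaf_resD[OF sheafO, of U V s] by auto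
      have "ogerm S q V (res S U V s) \<otimes>\<^bsub>R q\<^esub> ogerm S q V t = \<one>\<^bsub>R q\<^esub>"
        unfolding ogerm_mult[OF V(1) q c V(4), symmetric] e by (rule ogerm_one[OF V(1) q])
      moreover have "ogerm S q V (res S U V s) = ogerm S q U s"
        by (rule ogerm_res[OF assms(1) V(1) q V(3) assms(2)])
      ultimately have "ogerm S q U s \<otimes>\<^bsub>R q\<^esub> ogerm S q V t = \<one>\<^bsub>R q\<^esub>" by simp
      then show ?thesis
        using b.comm_inv_char[of "ogerm S q U s" "ogerm S q V t"] V q assms(1,2) by auto
    qed
    then show "\<exists>V t. Op V \<and> p \<in> V \<and> V \<subseteq> U \<and> t \<in> carrier (sec S V) \<and>
         (\<forall>q \<in> V. ogerm S q V t = inv\<^bsub>R q\<^esub> ogerm S q U s)" using V by blast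
  qed
  then obtain t where t: "t \<in> carrier (sec S U)" "\<And>q. q \<in> U \<Longrightarrow> ogerm S q U t = inv\<^bsub>R q\<^esub> ogerm S q U s" by auto
  have "s \<otimes>\<^bsub>sec S U\<^esub> t = \<one>\<^bsub>sec S U\<^esub>"
  proof (rule ogerm_inj[OF assms(1)])
    fix p assume p: "p \<in> U"
    interpret b: cring "R p" using cring_stalk Op_sub assms p by blast
    show "ogerm S p U (s \<otimes>\<^bsub>sec S U\<^esub> t) = ogerm S p U \<one>\<^bsub>sec S U\<^esub>"
      using t assms p by (simp add: ogerm_mult ogerm_one)
  qed (use t assms in auto)
  then show ?thesis using t(1) assms(2) u.m_comm[of s t] unfolding Units_def by auto
qed

end

lemma (in comm_monoid) factor_Units:
  assumes ab: "a \<otimes> b \<in> Units G" and a: "a \<in> carrier G" and b: "b \<in> carrier G"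
  shows "a \<in> Units G"
proof -
  have c: "b \<otimes> inv (a \<otimes> b) \<in> carrier G" using ab b by simp
  have "a \<otimes> (b \<otimes> inv (a \<otimes> b)) = \<one>" using ab a b by (simp add: m_assoc[symmetric])
  then show ?thesis using a c m_comm[OF a c] unfolding Units_def by auto
qed

section \<open>Coordinates\<close>

text \<open>
  \<open>v p U x\<close> is the coordinate at \<open>p\<close> of the section \<open>x\<close> over \<open>U\<close>. The coordinates at different
  points are chosen independently, so that those of a nonvanishing section need not vary regularly
  with the point; but quotients of the coordinates of two sections do.
\<close>

locale coordinates = ringed S for S :: "('p, 'r) ringed_space" +
  fixes F :: "('p, 'r, 'm) mod_sheaf"
    and v :: "'p \<Rightarrow> 'p set \<Rightarrow> 'm \<Rightarrow> ('p, 'r) germ"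
  assumes zero_closed: "Op U \<Longrightarrow> \<zero>\<^bsub>msec F U\<^esub> \<in> carrier (msec F U)"
    and add_closed: "Op U \<Longrightarrow> x \<in> carrier (msec F U) \<Longrightarrow> y \<in> carrier (msec F U) \<Longrightarrow>
      x \<oplus>\<^bsub>msec F U\<^esub> y \<in> carrier (msec F U)"
    and smult_closed: "Op U \<Longrightarrow> r \<in> carrier (sec S U) \<Longrightarrow> x \<in> carrier (msec F U) \<Longrightarrow>
      r \<odot>\<^bsub>msec F U\<^esub> x \<in> carrier (msec F U)"
    and mres_closed: "Op U \<Longrightarrow> Op V \<Longrightarrow> V \<subseteq> U \<Longrightarrow> x \<in> carrier (msec F U) \<Longrightarrow>
      mres F U V x \<in> carrier (msec F V)"
    and val_closed: "Op U \<Longrightarrow> p \<in> U \<Longrightarrow> x \<in> carrier (msec F U) \<Longrightarrow> v p U x \<in> carrier (R p)"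
    and val_zero: "Op U \<Longrightarrow> p \<in> U \<Longrightarrow> v p U \<zero>\<^bsub>msec F U\<^esub> = \<zero>\<^bsub>R p\<^esub>"
    and val_add: "Op U \<Longrightarrow> p \<in> U \<Longrightarrow> x \<in> carrier (msec F U) \<Longrightarrow> y \<in> carrier (msec F U) \<Longrightarrow>
      v p U (x \<oplus>\<^bsub>msec F U\<^esub> y) = v p U x \<oplus>\<^bsub>R p\<^esub> v p U y"
    and val_smult: "Op U \<Longrightarrow> p \<in> U \<Longrightarrow> r \<in> carrier (sec S U) \<Longrightarrow> x \<in> carrier (msec F U) \<Longrightarrow>
      v p U (r \<odot>\<^bsub>msec F U\<^esub> x) = ogerm S p U r \<otimes>\<^bsub>R p\<^esub> v p U x"
    and val_res: "Op U \<Longrightarrow> Op V \<Longrightarrow> V \<subseteq> U \<Longrightarrow> p \<in> V \<Longrightarrow> x \<in> carrier (msec F U) \<Longrightarrow>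
      v p V (mres F U V x) = v p U x"
    and val_inj: "Op U \<Longrightarrow> x \<in> carrier (msec F U) \<Longrightarrow> y \<in> carrier (msec F U) \<Longrightarrow>
      (\<And>p. p \<in> U \<Longrightarrow> v p U x = v p U y) \<Longrightarrow> x = y"
    and val_glue: "Op U \<Longrightarrow> (\<And>p. p \<in> U \<Longrightarrow> \<exists>V x. Op V \<and> p \<in> V \<and> V \<subseteq> U \<and> x \<in> carrier (msec F V) \<and>
        (\<forall>q \<in> V. v q V x = \<xi> q)) \<Longrightarrow> \<exists>x \<in> carrier (msec F U). \<forall>q \<in> U. v q U x = \<xi> q"
    and val_near: "Op U \<Longrightarrow> p \<in> U \<Longrightarrow> x \<in> carrier (msec F U) \<Longrightarrow> Op V \<Longrightarrow> p \<in> V \<Longrightarrow>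
      y \<in> carrier (msec F V) \<Longrightarrow> v p U x = v p V y \<Longrightarrow>
      \<exists>W. Op W \<and> p \<in> W \<and> W \<subseteq> U \<inter> V \<and> (\<forall>q \<in> W. v q U x = v q V y)"
    and frame: "p \<in> points S \<Longrightarrow> \<exists>U e. Op U \<and> p \<in> U \<and> e \<in> carrier (msec F U) \<and>
      (\<forall>q \<in> U. v q U e \<in> Units (R q))"
begin

text \<open>\<open>coordinates\<close> speaks of zero, sums and scalar multiples, while the
  difference in a module record is defined through the inverse in its additive monoid. This inverse
  is found as (-1) y, and its uniqueness is checked in coordinates.\<close>

lemma minus:
  assumes U: "Op U" and x: "x \<in> carrier (msec F U)" and y: "y \<in> carrier (msec F U)"
  shows minus_closed: "x \<ominus>\<^bsub>msec F U\<^esub> y \<in> carrier (msec F U)"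
    and val_minus: "p \<in> U \<Longrightarrow> v p U (x \<ominus>\<^bsub>msec F U\<^esub> y) = v p U x \<ominus>\<^bsub>R p\<^esub> v p U y"
proof -
  interpret u: cring "sec S U" using cringO U by blast
  define y' where "y' = (\<ominus>\<^bsub>sec S U\<^esub> \<one>\<^bsub>sec S U\<^esub>) \<odot>\<^bsub>msec F U\<^esub> y"
  have y': "y' \<in> carrier (msec F U)" unfolding y'_def by (rule smult_closed) (use U y in auto)
  have vy': "v q U y' = \<ominus>\<^bsub>R q\<^esub> v q U y" if q: "q \<in> U" for q
  proof -
    interpret b: cring "R q" using cring_stalk Op_sub U q by blast
    have "ogerm S q U (\<zero>\<^bsub>sec S U\<^esub> \<ominus>\<^bsub>sec S U\<^esub> \<one>\<^bsub>sec S U\<^esub>) = \<zero>\<^bsub>R q\<^esub> \<ominus>\<^bsub>R q\<^esub> \<one>\<^bsub>R q\<^esub>"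
      using ogerm_minus[OF U q, of "\<zero>\<^bsub>sec S U\<^esub>" "\<one>\<^bsub>sec S U\<^esub>"] ogerm_zero[OF U q] ogerm_one[OF U q] by simp
    then have "ogerm S q U (\<ominus>\<^bsub>sec S U\<^esub> \<one>\<^bsub>sec S U\<^esub>) = \<ominus>\<^bsub>R q\<^esub> \<one>\<^bsub>R q\<^esub>" by (simp add: a_minus_def)
    then show ?thesis unfolding y'_def
      using val_smult[OF U q _ y] val_closed[OF U q y] by (simp add: b.l_minus)
  qed
  have inv: "a_inv (msec F U) y = y'"
    unfolding a_inv_def m_inv_def
  proof (rule the_equality)
    have "y \<oplus>\<^bsub>msec F U\<^esub> y' = \<zero>\<^bsub>msec F U\<^esub> \<and> y' \<oplus>\<^bsub>msec F U\<^esub> y = \<zero>\<^bsub>msec F U\<^esub>"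
    proof (intro conjI; rule val_inj[OF U])
      fix q assume q: "q \<in> U"
      interpret b: cring "R q" using cring_stalk Op_sub U q by blast
      show "v q U (y \<oplus>\<^bsub>msec F U\<^esub> y') = v q U \<zero>\<^bsub>msec F U\<^esub>" "v q U (y' \<oplus>\<^bsub>msec F U\<^esub> y) = v q U \<zero>\<^bsub>msec F U\<^esub>"
        using val_add[OF U q] val_zero[OF U q] y y' vy'[OF q] val_closed[OF U q y]
        by (simp_all add: b.r_neg b.l_neg)
    qed (use U y y' add_closed zero_closed in auto)
    then show "y' \<in> carrier (add_monoid (msec F U)) \<and> y \<otimes>\<^bsub>add_monoid (msec F U)\<^esub> y' = \<one>\<^bsub>add_monoid (msec F U)\<^esub> \<and>
        y' \<otimes>\<^bsub>add_monoid (msec F U)\<^esub> y = \<one>\<^bsub>add_monoid (msec F U)\<^esub>" using y' by simp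
  next
    fix z assume "z \<in> carrier (add_monoid (msec F U)) \<and> y \<otimes>\<^bsub>add_monoid (msec F U)\<^esub> z = \<one>\<^bsub>add_monoid (msec F U)\<^esub> \<and>
        z \<otimes>\<^bsub>add_monoid (msec F U)\<^esub> y = \<one>\<^bsub>add_monoid (msec F U)\<^esub>"
    then have z: "z \<in> carrier (msec F U)" "z \<oplus>\<^bsub>msec F U\<^esub> y = \<zero>\<^bsub>msec F U\<^esub>" by auto
    show "z = y'"
    proof (rule val_inj[OF U z(1) y'])
      fix q assume q: "q \<in> U"
      interpret b: cring "R q" using cring_stalk Op_sub U q by blast
      have "v q U z \<oplus>\<^bsub>R q\<^esub> v q U y = \<zero>\<^bsub>R q\<^esub>"
        using val_add[OF U q z(1) y] z(2) val_zero[OF U q] by simp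
      then show "v q U z = v q U y'"
        unfolding vy'[OF q] using val_closed[OF U q] z(1) y b.minus_equality by auto
    qed
  qed
  show "x \<ominus>\<^bsub>msec F U\<^esub> y \<in> carrier (msec F U)"
    unfolding a_minus_def inv using add_closed U x y' by blast
  show "v p U (x \<ominus>\<^bsub>msec F U\<^esub> y) = v p U x \<ominus>\<^bsub>R p\<^esub> v p U y" if "p \<in> U"
    unfolding a_minus_def inv using val_add[OF U that x y'] vy'[OF that] by simp
qed

text \<open>The quotient of the two coordinates at p is an element of the local ring, thus the germ
  of a function f. The sections x and f e have the same coordinate at p and hence, by
  \<open>val_near\<close>, at all points near p.\<close>

lemma expand:
  assumes U: "Op U" "p \<in> U" "e \<in> carrier (msec F U)" "v p U e \<in> Units (R p)"
    and V: "Op V" "p \<in> V" "x \<in> carrier (msec F V)"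
  shows "\<exists>W r. Op W \<and> p \<in> W \<and> W \<subseteq> U \<inter> V \<and> r \<in> carrier (sec S W) \<and>
    (\<forall>q \<in> W. v q V x = ogerm S q W r \<otimes>\<^bsub>R q\<^esub> v q U e)"
proof -
  interpret b: cring "R p" using cring_stalk Op_sub U by blast
  have c: "v p V x \<in> carrier (R p)" "v p U e \<in> carrier (R p)" using val_closed U V by auto
  have "v p V x \<otimes>\<^bsub>R p\<^esub> inv\<^bsub>R p\<^esub> v p U e \<in> carrier (R p)" using c U(4) by auto
  then obtain X f where X: "v p V x \<otimes>\<^bsub>R p\<^esub> inv\<^bsub>R p\<^esub> v p U e = ogerm S p X f" "Op X" "p \<in> X" "f \<in> carrier (sec S X)"
    by (rule stalk_carrierE)
  let ?Y = "U \<inter> X"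
  have Y: "Op ?Y" "p \<in> ?Y" using U X by auto
  let ?f = "res S X ?Y f" and ?e = "mres F U ?Y e"
  have fc: "?f \<in> carrier (sec S ?Y)" using sheaf_resD[OF sheafO X(2) Y(1) _ X(4)] by auto
  have ec: "?e \<in> carrier (msec F ?Y)" using mres_closed U Y by auto
  have val: "v q ?Y (?f \<odot>\<^bsub>msec F ?Y\<^esub> ?e) = ogerm S q X f \<otimes>\<^bsub>R q\<^esub> v q U e" if "q \<in> ?Y" for q
    using val_smult[OF Y(1) that fc ec] val_res[OF U(1) Y(1) _ that U(3)] ogerm_res[OF X(2) Y(1) that _ X(4)]
    by simp
  have "v p ?Y (?f \<odot>\<^bsub>msec F ?Y\<^esub> ?e) = v p V x"
    unfolding val[OF Y(2)] X(1)[symmetric] using c U(4) by (simp add: b.m_assoc)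
  from val_near[OF Y smult_closed[OF Y(1) fc ec] V this] obtain W where
    W: "Op W" "p \<in> W" "W \<subseteq> ?Y \<inter> V" "\<And>q. q \<in> W \<Longrightarrow> v q ?Y (?f \<odot>\<^bsub>msec F ?Y\<^esub> ?e) = v q V x" by auto
  have "v q V x = ogerm S q W (res S X W f) \<otimes>\<^bsub>R q\<^esub> v q U e" if q: "q \<in> W" for q
    using val[of q] W(4)[OF q] W(1,3) q ogerm_res[OF X(2) W(1) q _ X(4)] by auto
  moreover have "res S X W f \<in> carrier (sec S W)" using sheaf_resD[OF sheafO X(2) W(1) _ X(4)] W(3) by auto
  ultimately show ?thesis using W by (intro exI[of _ W] exI[of _ "res S X W f"]) auto
qed

end

text \<open>Near p every section is r e for a fixed frame e, and \<theta> is linear over functions,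
  so the ratio of the coordinates of \<theta>(x) and x at p is the one of \<theta>(e) and e.\<close>

lemma iso_imp_scaling:
  assumes F: "coordinates S F v" and G: "coordinates S G w" and iso: "module_sheaf_iso S F G \<theta>"
    and p: "p \<in> points S"
  shows "\<exists>u \<in> Units (stalk S p). \<forall>U x. openin (spc S) U \<longrightarrow> p \<in> U \<longrightarrow> x \<in> carrier (msec F U) \<longrightarrow>
    w p U (\<theta> U x) = u \<otimes>\<^bsub>stalk S p\<^esub> v p U x"
proof -
  interpret F: coordinates S F v by (rule F)
  interpret G: coordinates S G w by (rule G)
  interpret b: cring "stalk S p" using F.cring_stalk p by blast
  note iso1 = iso[unfolded module_sheaf_iso_def, THEN conjunct1, rule_format]
  have bij: "F.Op U \<Longrightarrow> bij_betw (\<theta> U) (carrier (msec F U)) (carrier (msec G U))" for U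
    using iso1[of U] by blast
  have cl: "F.Op U \<Longrightarrow> x \<in> carrier (msec F U) \<Longrightarrow> \<theta> U x \<in> carrier (msec G U)" for U x
    using bij[of U] by (auto simp: bij_betw_def)
  have sm: "F.Op U \<Longrightarrow> r \<in> carrier (sec S U) \<Longrightarrow> x \<in> carrier (msec F U) \<Longrightarrow>
      \<theta> U (r \<odot>\<^bsub>msec F U\<^esub> x) = r \<odot>\<^bsub>msec G U\<^esub> \<theta> U x" for U r x
    using iso1[of U] by blast
  have rs: "F.Op U \<Longrightarrow> F.Op V \<Longrightarrow> V \<subseteq> U \<Longrightarrow> x \<in> carrier (msec F U) \<Longrightarrow>
      \<theta> V (mres F U V x) = mres G U V (\<theta> U x)" for U V x
    using iso[unfolded module_sheaf_iso_def, THEN conjunct2] by blast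
  obtain U e where e: "F.Op U" "p \<in> U" "e \<in> carrier (msec F U)" "v p U e \<in> Units (stalk S p)"
    using F.frame[OF p] by blast
  let ?i = "inv\<^bsub>stalk S p\<^esub> v p U e"
  define u where "u = w p U (\<theta> U e) \<otimes>\<^bsub>stalk S p\<^esub> ?i"
  have ic: "?i \<in> carrier (stalk S p)" using e by auto
  have wc: "w p U (\<theta> U e) \<in> carrier (stalk S p)" using G.val_closed e cl by blast
  have uc: "u \<in> carrier (stalk S p)" unfolding u_def using ic wc by auto
  have main: "w p V (\<theta> V x) = u \<otimes>\<^bsub>stalk S p\<^esub> v p V x" if V: "F.Op V" "p \<in> V" "x \<in> carrier (msec F V)" for V x
  proof -
    obtain W r where W: "F.Op W" "p \<in> W" "W \<subseteq> U \<inter> V" "r \<in> carrier (sec S W)"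
      "\<And>q. q \<in> W \<Longrightarrow> v q V x = ogerm S q W r \<otimes>\<^bsub>stalk S q\<^esub> v q U e"
      using F.expand[OF e V] by blast
    have ew: "mres F U W e \<in> carrier (msec F W)" using F.mres_closed e W by auto
    have "mres F V W x = r \<odot>\<^bsub>msec F W\<^esub> mres F U W e"
    proof (rule F.val_inj[OF W(1)])
      fix q assume q: "q \<in> W"
      show "v q W (mres F V W x) = v q W (r \<odot>\<^bsub>msec F W\<^esub> mres F U W e)"
        using F.val_smult[OF W(1) q W(4) ew] F.val_res[OF V(1) W(1) _ q V(3)] F.val_res[OF e(1) W(1) _ q e(3)]
          W(5)[OF q] W(3) by simp
    qed (use F.mres_closed F.smult_closed V W ew in auto)
    then have "mres G V W (\<theta> V x) = r \<odot>\<^bsub>msec G W\<^esub> mres G U W (\<theta> U e)"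
      using rs[OF V(1) W(1) _ V(3)] rs[OF e(1) W(1) _ e(3)] sm[OF W(1,4) ew] W(3) by simp
    then have "w p V (\<theta> V x) = ogerm S p W r \<otimes>\<^bsub>stalk S p\<^esub> w p U (\<theta> U e)"
      using G.val_smult[OF W(1,2,4) G.mres_closed[OF e(1) W(1) _ cl[OF e(1,3)]]] W(3)
        G.val_res[OF V(1) W(1) _ W(2) cl[OF V(1,3)]] G.val_res[OF e(1) W(1) _ W(2) cl[OF e(1,3)]] by simp
    moreover have "u \<otimes>\<^bsub>stalk S p\<^esub> v p V x = ogerm S p W r \<otimes>\<^bsub>stalk S p\<^esub> w p U (\<theta> U e) \<otimes>\<^bsub>stalk S p\<^esub> (?i \<otimes>\<^bsub>stalk S p\<^esub> v p U e)"
      unfolding u_def W(5)[OF W(2)] using ic wc e W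
      by (simp add: b.m_ac b.Units_closed del: b.Units_l_inv b.Units_r_inv)
    moreover have "?i \<otimes>\<^bsub>stalk S p\<^esub> v p U e = \<one>\<^bsub>stalk S p\<^esub>" using e(4) by (rule b.Units_l_inv)
    ultimately show ?thesis using wc F.ogerm_closed[OF W(1,2,4)] by (metis b.m_closed b.r_one)
  qed
  \<comment> \<open>A section whose image has a unit coordinate at p shows that \<open>u\<close>
    divides a unit.\<close>
  obtain U' e' where e': "F.Op U'" "p \<in> U'" "e' \<in> carrier (msec G U')" "w p U' e' \<in> Units (stalk S p)"
    using G.frame[OF p] by blast
  obtain y where y: "y \<in> carrier (msec F U')" "\<theta> U' y = e'"
    using bij_betw_imp_surj_on[OF bij[OF e'(1)]] e'(3) by (metis imageE)
  have "u \<otimes>\<^bsub>stalk S p\<^esub> v p U' y \<in> Units (stalk S p)" using main[OF e'(1,2) y(1)] e' y by simp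
  then have "u \<in> Units (stalk S p)"
    using b.factor_Units uc F.val_closed[OF e'(1,2) y(1)] by blast
  with main show ?thesis by blast
qed

text \<open>Regularity of \<open>u\<close> is asked for only on one frame e near each point. If x =
  r e there, then r e' has the coordinates u x, and these local sections glue.\<close>

lemma scaling_transfer:
  assumes F: "coordinates S F v" and G: "coordinates S G w"
    and loc: "\<And>p. p \<in> points S \<Longrightarrow> \<exists>U e e'. openin (spc S) U \<and> p \<in> U \<and>
      e \<in> carrier (msec F U) \<and> e' \<in> carrier (msec G U) \<and>
      (\<forall>q \<in> U. v q U e \<in> Units (stalk S q) \<and> w q U e' = u q \<otimes>\<^bsub>stalk S q\<^esub> v q U e)"
    and u: "\<And>p. p \<in> points S \<Longrightarrow> u p \<in> Units (stalk S p)"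
    and U: "openin (spc S) U" and x: "x \<in> carrier (msec F U)"
  shows "\<exists>y \<in> carrier (msec G U). \<forall>q \<in> U. w q U y = u q \<otimes>\<^bsub>stalk S q\<^esub> v q U x"
proof -
  interpret F: coordinates S F v by (rule F)
  interpret G: coordinates S G w by (rule G)
  show ?thesis
  proof (rule G.val_glue[OF U])
    fix p assume p: "p \<in> U"
    obtain V e e' where V: "F.Op V" "p \<in> V" "e \<in> carrier (msec F V)" "e' \<in> carrier (msec G V)"
      and e: "\<And>q. q \<in> V \<Longrightarrow> v q V e \<in> Units (stalk S q)"
      and e': "\<And>q. q \<in> V \<Longrightarrow> w q V e' = u q \<otimes>\<^bsub>stalk S q\<^esub> v q V e"
      using loc[OF F.Op_sub[OF U p]] by blast
    obtain W r where W: "F.Op W" "p \<in> W" "W \<subseteq> V \<inter> U" "r \<in> carrier (sec S W)"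
      "\<And>q. q \<in> W \<Longrightarrow> v q U x = ogerm S q W r \<otimes>\<^bsub>stalk S q\<^esub> v q V e"
      using F.expand[OF V(1-3) e[OF V(2)] U p x] by blast
    have c: "mres G V W e' \<in> carrier (msec G W)" using G.mres_closed V W by auto
    have "w q W (r \<odot>\<^bsub>msec G W\<^esub> mres G V W e') = u q \<otimes>\<^bsub>stalk S q\<^esub> v q U x" if q: "q \<in> W" for q
    proof -
      interpret b: cring "stalk S q" using F.cring_stalk F.Op_sub W q by blast
      have qV: "q \<in> V" using q W by auto
      show ?thesis
        using G.val_smult[OF W(1) q W(4) c] G.val_res[OF V(1) W(1) _ q V(4)] W(3) e'[OF qV] W(5)[OF q]
          e[OF qV] u[OF F.Op_sub[OF W(1) q]] F.ogerm_closed[OF W(1) q W(4)]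
        by (simp add: b.m_lcomm b.Units_closed)
    qed
    then show "\<exists>V y. F.Op V \<and> p \<in> V \<and> V \<subseteq> U \<and> y \<in> carrier (msec G V) \<and>
        (\<forall>q\<in>V. w q V y = u q \<otimes>\<^bsub>stalk S q\<^esub> v q U x)"
      using W G.smult_closed[OF W(1,4) c] by (intro exI[of _ W]) auto
  qed
qed

text \<open>Converse of \<open>iso_imp_scaling\<close>. Sections are determined by their
  coordinates, so any choice of sections with the coordinates u x is automatically additive, linear
  and compatible with restriction. The content is the existence of such sections, supplied by
  \<open>scaling_transfer\<close>.\<close>

lemma scaling_imp_iso:
  assumes F: "coordinates S F v" and G: "coordinates S G w"
    and loc: "\<And>p. p \<in> points S \<Longrightarrow> \<exists>U e e'. openin (spc S) U \<and> p \<in> U \<and>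
      e \<in> carrier (msec F U) \<and> e' \<in> carrier (msec G U) \<and>
      (\<forall>q \<in> U. v q U e \<in> Units (stalk S q) \<and> w q U e' = u q \<otimes>\<^bsub>stalk S q\<^esub> v q U e)"
    and u: "\<And>p. p \<in> points S \<Longrightarrow> u p \<in> Units (stalk S p)"
  shows "\<exists>\<theta>. module_sheaf_iso S F G \<theta> \<and> (\<forall>U x. openin (spc S) U \<longrightarrow> x \<in> carrier (msec F U) \<longrightarrow>
    (\<forall>p \<in> U. w p U (\<theta> U x) = u p \<otimes>\<^bsub>stalk S p\<^esub> v p U x))"
proof -
  interpret F: coordinates S F v by (rule F)
  interpret G: coordinates S G w by (rule G)
  define \<theta> where "\<theta> U x = (SOME y. y \<in> carrier (msec G U) \<and> (\<forall>q \<in> U. w q U y = u q \<otimes>\<^bsub>stalk S q\<^esub> v q U x))" for U x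
  have th: "\<theta> U x \<in> carrier (msec G U) \<and> (\<forall>q \<in> U. w q U (\<theta> U x) = u q \<otimes>\<^bsub>stalk S q\<^esub> v q U x)"
    if "F.Op U" "x \<in> carrier (msec F U)" for U x
    unfolding \<theta>_def by (rule someI_ex) (use scaling_transfer[OF F G loc u that] in blast)
  note thc = th[THEN conjunct1] and thv = th[THEN conjunct2, THEN bspec]
  \<comment> \<open>For surjectivity: \<open>e'\<close> has unit coordinates as well, so
    \<open>scaling_transfer\<close> applies with F and G exchanged and with the inverse of
    u.\<close>
  have bwd: "\<exists>x \<in> carrier (msec F U). \<forall>q \<in> U. v q U x = inv\<^bsub>stalk S q\<^esub> u q \<otimes>\<^bsub>stalk S q\<^esub> w q U y"
    if U: "F.Op U" and y: "y \<in> carrier (msec G U)" for U y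
  proof (rule scaling_transfer[OF G F _ _ U y])
    fix p assume p: "p \<in> points S"
    interpret b: cring "stalk S p" by (rule F.cring_stalk[OF p])
    show "inv\<^bsub>stalk S p\<^esub> u p \<in> Units (stalk S p)" using u[OF p] by simp
    obtain V e e' where V: "F.Op V" "p \<in> V" "e \<in> carrier (msec F V)" "e' \<in> carrier (msec G V)"
      and e: "\<And>q. q \<in> V \<Longrightarrow> v q V e \<in> Units (stalk S q)"
      and e': "\<And>q. q \<in> V \<Longrightarrow> w q V e' = u q \<otimes>\<^bsub>stalk S q\<^esub> v q V e"
      using loc[OF p] by blast
    have "w q V e' \<in> Units (stalk S q) \<and> v q V e = inv\<^bsub>stalk S q\<^esub> u q \<otimes>\<^bsub>stalk S q\<^esub> w q V e'" if q: "q \<in> V" for q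
    proof -
      interpret b: cring "stalk S q" using F.cring_stalk F.Op_sub V q by blast
      show ?thesis using e[OF q] u[OF F.Op_sub[OF V(1) q]] unfolding e'[OF q]
        by (simp add: b.m_assoc[symmetric] b.Units_closed)
    qed
    then show "\<exists>U e e'. F.Op U \<and> p \<in> U \<and> e \<in> carrier (msec G U) \<and> e' \<in> carrier (msec F U) \<and>
      (\<forall>q \<in> U. w q U e \<in> Units (stalk S q) \<and> v q U e' = inv\<^bsub>stalk S q\<^esub> u q \<otimes>\<^bsub>stalk S q\<^esub> w q U e)"
      using V by (intro exI[of _ V] exI[of _ e'] exI[of _ e]) auto
  qed
  have "module_sheaf_iso S F G \<theta>"
    unfolding module_sheaf_iso_def
  proof (intro conjI allI impI ballI)
    fix U assume U: "F.Op U"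
    show "bij_betw (\<theta> U) (carrier (msec F U)) (carrier (msec G U))"
      unfolding bij_betw_def
    proof (intro conjI inj_onI equalityI subsetI)
      fix x y assume x: "x \<in> carrier (msec F U)" and y: "y \<in> carrier (msec F U)" and e: "\<theta> U x = \<theta> U y"
      show "x = y"
      proof (rule F.val_inj[OF U x y])
        fix q assume q: "q \<in> U"
        interpret b: cring "stalk S q" using F.cring_stalk F.Op_sub U q by blast
        have "u q \<otimes>\<^bsub>stalk S q\<^esub> v q U x = u q \<otimes>\<^bsub>stalk S q\<^esub> v q U y"
          using thv[OF U x q] thv[OF U y q] e by simp
        then show "v q U x = v q U y"
          using b.Units_l_cancel u[OF F.Op_sub[OF U q]] F.val_closed[OF U q] x y by blast
      qed
    next
      fix y assume "y \<in> \<theta> U ` carrier (msec F U)"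
      then show "y \<in> carrier (msec G U)" using thc[OF U] by blast
    next
      fix y assume y: "y \<in> carrier (msec G U)"
      obtain x where x: "x \<in> carrier (msec F U)"
        and xv: "\<And>q. q \<in> U \<Longrightarrow> v q U x = inv\<^bsub>stalk S q\<^esub> u q \<otimes>\<^bsub>stalk S q\<^esub> w q U y"
        using bwd[OF U y] by blast
      have "\<theta> U x = y"
      proof (rule G.val_inj[OF U thc[OF U x] y])
        fix q assume q: "q \<in> U"
        interpret b: cring "stalk S q" using F.cring_stalk F.Op_sub U q by blast
        show "w q U (\<theta> U x) = w q U y"
          unfolding thv[OF U x q] xv[OF q] using u[OF F.Op_sub[OF U q]] G.val_closed[OF U q y]
          by (simp add: b.m_assoc[symmetric] b.Units_closed)
      qed
      then show "y \<in> \<theta> U ` carrier (msec F U)" using x by blast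
    qed
  next
    fix U x y assume U: "F.Op U" and x: "x \<in> carrier (msec F U)" and y: "y \<in> carrier (msec F U)"
    show "\<theta> U (x \<oplus>\<^bsub>msec F U\<^esub> y) = \<theta> U x \<oplus>\<^bsub>msec G U\<^esub> \<theta> U y"
    proof (rule G.val_inj[OF U thc[OF U F.add_closed[OF U x y]] G.add_closed[OF U thc[OF U x] thc[OF U y]]])
      fix q assume q: "q \<in> U"
      interpret b: cring "stalk S q" using F.cring_stalk F.Op_sub U q by blast
      show "w q U (\<theta> U (x \<oplus>\<^bsub>msec F U\<^esub> y)) = w q U (\<theta> U x \<oplus>\<^bsub>msec G U\<^esub> \<theta> U y)"
        unfolding thv[OF U F.add_closed[OF U x y] q] G.val_add[OF U q thc[OF U x] thc[OF U y]]
          thv[OF U x q] thv[OF U y q] F.val_add[OF U q x y]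
        by (rule b.r_distr) (use F.val_closed[OF U q] x y u[OF F.Op_sub[OF U q]] b.Units_closed in auto)
    qed
  next
    fix U r x assume U: "F.Op U" and r: "r \<in> carrier (sec S U)" and x: "x \<in> carrier (msec F U)"
    show "\<theta> U (r \<odot>\<^bsub>msec F U\<^esub> x) = r \<odot>\<^bsub>msec G U\<^esub> \<theta> U x"
    proof (rule G.val_inj[OF U thc[OF U F.smult_closed[OF U r x]] G.smult_closed[OF U r thc[OF U x]]])
      fix q assume q: "q \<in> U"
      interpret b: cring "stalk S q" using F.cring_stalk F.Op_sub U q by blast
      show "w q U (\<theta> U (r \<odot>\<^bsub>msec F U\<^esub> x)) = w q U (r \<odot>\<^bsub>msec G U\<^esub> \<theta> U x)"
        unfolding thv[OF U F.smult_closed[OF U r x] q] G.val_smult[OF U q r thc[OF U x]]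
          thv[OF U x q] F.val_smult[OF U q r x]
        by (rule b.m_lcomm) (use F.val_closed[OF U q x] u[OF F.Op_sub[OF U q]] b.Units_closed F.ogerm_closed[OF U q r] in auto)
    qed
  next
    fix U V x assume "F.Op U \<and> F.Op V \<and> V \<subseteq> U" and x: "x \<in> carrier (msec F U)"
    then have U: "F.Op U" and V: "F.Op V" "V \<subseteq> U" by auto
    note xV = F.mres_closed[OF U V x]
    show "\<theta> V (mres F U V x) = mres G U V (\<theta> U x)"
    proof (rule G.val_inj[OF V(1) thc[OF V(1) xV] G.mres_closed[OF U V thc[OF U x]]])
      fix q assume q: "q \<in> V"
      then have qU: "q \<in> U" using V by auto
      show "w q V (\<theta> V (mres F U V x)) = w q V (mres G U V (\<theta> U x))"
        unfolding thv[OF V(1) xV q] G.val_res[OF U V q thc[OF U x]] F.val_res[OF U V q x] thv[OF U x qU] ..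
    qed
  qed
  then show ?thesis using thv by blast
qed

section \<open>Line bundles\<close>

text \<open>A free module of rank one with a chosen coordinate. Only the operations and their images
  under \<open>c\<close> are constrained; the module laws follow from those of R because
  \<open>c\<close> is injective.\<close>

locale rank_one = cring R for R (structure) +
  fixes M :: "('a, 'm) module" and c :: "'m \<Rightarrow> 'a"
  assumes bij: "bij_betw c (carrier M) (carrier R)"
    and zero_mem: "\<zero>\<^bsub>M\<^esub> \<in> carrier M" "c \<zero>\<^bsub>M\<^esub> = \<zero>"
    and add_mem: "x \<in> carrier M \<Longrightarrow> y \<in> carrier M \<Longrightarrow> x \<oplus>\<^bsub>M\<^esub> y \<in> carrier M"
    and c_add: "x \<in> carrier M \<Longrightarrow> y \<in> carrier M \<Longrightarrow> c (x \<oplus>\<^bsub>M\<^esub> y) = c x \<oplus> c y"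
    and smult_mem: "r \<in> carrier R \<Longrightarrow> x \<in> carrier M \<Longrightarrow> r \<odot>\<^bsub>M\<^esub> x \<in> carrier M"
    and c_smult: "r \<in> carrier R \<Longrightarrow> x \<in> carrier M \<Longrightarrow> c (r \<odot>\<^bsub>M\<^esub> x) = r \<otimes> c x"
begin

lemma c_closed [simp, intro]: "x \<in> carrier M \<Longrightarrow> c x \<in> carrier R"
  using bij by (rule bij_betw_apply)

lemma c_inj: "x \<in> carrier M \<Longrightarrow> y \<in> carrier M \<Longrightarrow> c x = c y \<Longrightarrow> x = y"
  using bij_betw_imp_inj_on[OF bij] by (rule inj_onD)

lemma generator: obtains e where "e \<in> carrier M" "c e = \<one>"
  using bij_betw_imp_surj_on[OF bij] one_closed by (metis imageE)

end

section \<open>The structure sheaf\<close>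

context ringed
begin

lemma structure_sheaf_simps [simp]:
  "carrier (msec (structure_sheaf S) U) = carrier (sec S U)"
  "zero (msec (structure_sheaf S) U) = zero (sec S U)"
  "add (msec (structure_sheaf S) U) = add (sec S U)"
  "smult (msec (structure_sheaf S) U) = mult (sec S U)"
  "mres (structure_sheaf S) = res S"
  by (simp_all add: structure_sheaf_def)

lemma mstalk_structure_sheaf_simps:
  "carrier (mstalk S (structure_sheaf S) p) = carrier (R p)"
  "zero (mstalk S (structure_sheaf S) p) = zero (R p)"
  "add (mstalk S (structure_sheaf S) p) = add (R p)"
  "smult (mstalk S (structure_sheaf S) p) = mult (R p)"
  by (simp_all add: mstalk_def stalk_def)

lemma rank_one_structure_sheaf:
  assumes "p \<in> points S"
  shows "rank_one (R p) (mstalk S (structure_sheaf S) p) (\<lambda>x. x)"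
proof -
  interpret cring "R p" by (rule cring_stalk[OF assms])
  show ?thesis by unfold_locales (auto simp: mstalk_structure_sheaf_simps bij_betw_def)
qed

lemma coordinates_structure_sheaf: "coordinates S (structure_sheaf S) (ogerm S)"
proof unfold_locales
  fix U assume U: "Op U"
  interpret u: cring "sec S U" by (rule cringO[OF U])
  show "\<zero>\<^bsub>msec (structure_sheaf S) U\<^esub> \<in> carrier (msec (structure_sheaf S) U)" by simp
  { fix x y assume "x \<in> carrier (msec (structure_sheaf S) U)" "y \<in> carrier (msec (structure_sheaf S) U)"
    then show "x \<oplus>\<^bsub>msec (structure_sheaf S) U\<^esub> y \<in> carrier (msec (structure_sheaf S) U)" by simp }
  { fix r x assume "r \<in> carrier (sec S U)" "x \<in> carrier (msec (structure_sheaf S) U)"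
    then show "r \<odot>\<^bsub>msec (structure_sheaf S) U\<^esub> x \<in> carrier (msec (structure_sheaf S) U)" by simp }
  fix \<xi> assume "\<And>p. p \<in> U \<Longrightarrow> \<exists>V x. Op V \<and> p \<in> V \<and> V \<subseteq> U \<and> x \<in> carrier (msec (structure_sheaf S) V) \<and>
      (\<forall>q\<in>V. ogerm S q V x = \<xi> q)"
  then show "\<exists>x\<in>carrier (msec (structure_sheaf S) U). \<forall>q\<in>U. ogerm S q U x = \<xi> q"
    unfolding structure_sheaf_simps by (rule germ_glue[OF sheafO U])
next
  fix U p x V y
  assume a: "Op U" "p \<in> U" "x \<in> carrier (msec (structure_sheaf S) U)" "Op V" "p \<in> V"
    "y \<in> carrier (msec (structure_sheaf S) V)" "ogerm S p U x = ogerm S p V y"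
  show "\<exists>W. Op W \<and> p \<in> W \<and> W \<subseteq> U \<inter> V \<and> (\<forall>q\<in>W. ogerm S q U x = ogerm S q V y)"
    using ogerm_eqD[OF a(1,2) a(3)[unfolded structure_sheaf_simps] a(4,5) a(6)[unfolded structure_sheaf_simps] a(7)]
    by metis
next
  fix p assume p: "p \<in> points S"
  interpret u: cring "global_sections S" by (rule cringO) simp
  have "ogerm S q (points S) \<one>\<^bsub>global_sections S\<^esub> \<in> Units (R q)" if q: "q \<in> points S" for q
  proof -
    interpret b: cring "R q" by (rule cring_stalk[OF q])
    show ?thesis using q by (simp add: ogerm_one)
  qed
  then show "\<exists>U e. Op U \<and> p \<in> U \<and> e \<in> carrier (msec (structure_sheaf S) U) \<and> (\<forall>q\<in>U. ogerm S q U e \<in> Units (R q))"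
    using p by (intro exI[of _ "points S"] exI[of _ "\<one>\<^bsub>global_sections S\<^esub>"]) auto
qed (auto simp: ogerm_add ogerm_mult ogerm_zero ogerm_res intro: sheaf_resD[OF sheafO] ogerm_inj)

end

section \<open>Stalks of sheaves of modules\<close>

locale module_sheaf_on = ringed S for S :: "('p, 'r) ringed_space" +
  fixes F :: "('p, 'r, 'm) mod_sheaf"
  assumes module_sheaf: "module_sheaf S F"
begin

lemma sheafM: "sheaf_of_sets (spc S) (\<lambda>U. carrier (msec F U)) (mres F)"
  using module_sheaf unfolding module_sheaf_def by (rule conjunct1)

lemma moduleM: "Op U \<Longrightarrow> module (sec S U) (msec F U)"
  using module_sheaf[unfolded module_sheaf_def, THEN conjunct2, THEN conjunct1] by simp

lemma mres_add: "Op U \<Longrightarrow> Op V \<Longrightarrow> V \<subseteq> U \<Longrightarrow> x \<in> carrier (msec F U) \<Longrightarrow> y \<in> carrier (msec F U) \<Longrightarrow>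
    mres F U V (x \<oplus>\<^bsub>msec F U\<^esub> y) = mres F U V x \<oplus>\<^bsub>msec F V\<^esub> mres F U V y"
  using module_sheaf[unfolded module_sheaf_def, THEN conjunct2, THEN conjunct2] by simp

lemma mres_smult: "Op U \<Longrightarrow> Op V \<Longrightarrow> V \<subseteq> U \<Longrightarrow> r \<in> carrier (sec S U) \<Longrightarrow> x \<in> carrier (msec F U) \<Longrightarrow>
    mres F U V (r \<odot>\<^bsub>msec F U\<^esub> x) = res S U V r \<odot>\<^bsub>msec F V\<^esub> mres F U V x"
  using module_sheaf[unfolded module_sheaf_def, THEN conjunct2, THEN conjunct2] by simp

lemma mem_zero: "Op U \<Longrightarrow> \<zero>\<^bsub>msec F U\<^esub> \<in> carrier (msec F U)"
  by (rule abelian_monoid.zero_closed[OF abelian_group.axioms(1)[OF module.axioms(2)[OF moduleM]]])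

lemma mem_add: "Op U \<Longrightarrow> x \<in> carrier (msec F U) \<Longrightarrow> y \<in> carrier (msec F U) \<Longrightarrow> x \<oplus>\<^bsub>msec F U\<^esub> y \<in> carrier (msec F U)"
  by (rule abelian_monoid.a_closed[OF abelian_group.axioms(1)[OF module.axioms(2)[OF moduleM]]])

lemma mem_smult: "Op U \<Longrightarrow> r \<in> carrier (sec S U) \<Longrightarrow> x \<in> carrier (msec F U) \<Longrightarrow> r \<odot>\<^bsub>msec F U\<^esub> x \<in> carrier (msec F U)"
  by (rule module.smult_closed[OF moduleM])

lemma mem_res: "Op U \<Longrightarrow> Op V \<Longrightarrow> V \<subseteq> U \<Longrightarrow> x \<in> carrier (msec F U) \<Longrightarrow> mres F U V x \<in> carrier (msec F V)"
  by (rule sheaf_resD[OF sheafM])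

lemma mgerm_closed [intro, simp]: "Op U \<Longrightarrow> p \<in> U \<Longrightarrow> x \<in> carrier (msec F U) \<Longrightarrow> mgerm S F p U x \<in> carrier (mstalk S F p)"
  unfolding mstalk_def by auto

lemma mstalkE:
  assumes "x \<in> carrier (mstalk S F p)"
  obtains U s where "x = mgerm S F p U s" "Op U" "p \<in> U" "s \<in> carrier (msec F U)"
  using assms unfolding mstalk_def by auto

lemma mgerm_res:
  assumes "Op U" "Op V" "p \<in> V" "V \<subseteq> U" "s \<in> carrier (msec F U)"
  shows "mgerm S F p V (mres F U V s) = mgerm S F p U s"
  by (rule germ_res[OF sheafM assms])

lemma mstalk_inE:
  assumes x: "x \<in> carrier (mstalk S F p)" and N: "Op N" "p \<in> N"
  obtains U s where "x = mgerm S F p U s" "Op U" "p \<in> U" "U \<subseteq> N" "s \<in> carrier (msec F U)"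
proof -
  obtain U s where U: "x = mgerm S F p U s" "Op U" "p \<in> U" "s \<in> carrier (msec F U)" by (rule mstalkE[OF x])
  have o: "Op (U \<inter> N)" "p \<in> U \<inter> N" using U N by auto
  show ?thesis
    by (rule that[of "U \<inter> N" "mres F U (U \<inter> N) s"])
       (use o U mem_res[OF U(2) o(1) _ U(4)] mgerm_res[OF U(2) o _ U(4)] in auto)
qed

lemma mgerm_add:
  assumes "Op U" "p \<in> U" "s \<in> carrier (msec F U)" "t \<in> carrier (msec F U)"
  shows "mgerm S F p U (s \<oplus>\<^bsub>msec F U\<^esub> t) = mgerm S F p U s \<oplus>\<^bsub>mstalk S F p\<^esub> mgerm S F p U t"
  unfolding mstalk_def ring_record_simps
  by (rule germ_binop[where m = "\<lambda>U. add (msec F U)", OF sheafM sheafM sheafM mem_add mres_add assms, symmetric])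

lemma mgerm_smult:
  assumes "Op U" "p \<in> U" "r \<in> carrier (sec S U)" "t \<in> carrier (msec F U)"
  shows "mgerm S F p U (r \<odot>\<^bsub>msec F U\<^esub> t) = ogerm S p U r \<odot>\<^bsub>mstalk S F p\<^esub> mgerm S F p U t"
  unfolding mstalk_def module.simps
  by (rule germ_binop[where m = "\<lambda>U. smult (msec F U)", OF sheafO sheafM sheafM mem_smult mres_smult assms, symmetric])

lemma mgerm_zero:
  assumes "Op U" "p \<in> U" shows "mgerm S F p U \<zero>\<^bsub>msec F U\<^esub> = \<zero>\<^bsub>mstalk S F p\<^esub>"
proof -
  have g: "Op (points S)" "U \<subseteq> points S" using assms(1) openin_subset by auto
  interpret m: module "global_sections S" "msec F (points S)" by (rule moduleM[OF g(1)])
  interpret n: module "sec S U" "msec F U" by (rule moduleM[OF assms(1)])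
  let ?z = "\<zero>\<^bsub>msec F (points S)\<^esub>" and ?y = "mres F (points S) U \<zero>\<^bsub>msec F (points S)\<^esub>"
  have y: "?y \<in> carrier (msec F U)" by (rule mem_res[OF g(1) assms(1) g(2) m.M.zero_closed])
  have "?y = ?y \<oplus>\<^bsub>msec F U\<^esub> ?y"
    using mres_add[OF g(1) assms(1) g(2) m.M.zero_closed m.M.zero_closed] by simp
  then have "?y = \<zero>\<^bsub>msec F U\<^esub>" using y n.M.add.r_cancel_one' by metis
  then have "mgerm S F p U \<zero>\<^bsub>msec F U\<^esub> = mgerm S F p (points S) ?z"
    using mgerm_res[OF g(1) assms g(2) m.M.zero_closed] by simp
  then show ?thesis by (simp add: mstalk_def)
qed

text \<open>The charts identify coordinates with germs, so separation and gluing come from those for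
  germs. The existence of frames is a separate hypothesis because the charts at different points are
  unrelated.\<close>

lemma coordinates_of_charts:
  assumes c: "\<And>p. p \<in> points S \<Longrightarrow> rank_one (R p) (mstalk S F p) (c p)"
    and fr: "\<And>p. p \<in> points S \<Longrightarrow> \<exists>U e. Op U \<and> p \<in> U \<and> e \<in> carrier (msec F U) \<and>
      (\<forall>q \<in> U. c q (mgerm S F q U e) \<in> Units (R q))"
  shows "coordinates S F (\<lambda>p U x. c p (mgerm S F p U x))"
proof unfold_locales
  have r1: "rank_one (R p) (mstalk S F p) (c p)" if "Op U" "p \<in> U" for U p using c Op_sub that by blast
  note cl = rank_one.c_closed[OF r1] and inj = rank_one.c_inj[OF r1]
  {
    fix U p x assume U: "Op U" "p \<in> U" and x: "x \<in> carrier (msec F U)"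
    show "c p (mgerm S F p U x) \<in> carrier (R p)" by (rule cl[OF U]) (use U x in auto)
    fix r assume r: "r \<in> carrier (sec S U)"
    show "c p (mgerm S F p U (r \<odot>\<^bsub>msec F U\<^esub> x)) = ogerm S p U r \<otimes>\<^bsub>R p\<^esub> c p (mgerm S F p U x)"
      unfolding mgerm_smult[OF U r x] by (rule rank_one.c_smult[OF r1[OF U]]) (use U x r in auto)
  }
  {
    fix U p assume U: "Op U" "p \<in> U"
    show "c p (mgerm S F p U \<zero>\<^bsub>msec F U\<^esub>) = \<zero>\<^bsub>R p\<^esub>"
      unfolding mgerm_zero[OF U] by (rule rank_one.zero_mem(2)[OF r1[OF U]])
  }
  {
    fix U p x y assume U: "Op U" "p \<in> U" and x: "x \<in> carrier (msec F U)" and y: "y \<in> carrier (msec F U)"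
    show "c p (mgerm S F p U (x \<oplus>\<^bsub>msec F U\<^esub> y)) = c p (mgerm S F p U x) \<oplus>\<^bsub>R p\<^esub> c p (mgerm S F p U y)"
      unfolding mgerm_add[OF U x y] by (rule rank_one.c_add[OF r1[OF U]]) (use U x y in auto)
  }
  {
    fix U V p x assume U: "Op U" "Op V" "V \<subseteq> U" "p \<in> V" and x: "x \<in> carrier (msec F U)"
    show "c p (mgerm S F p V (mres F U V x)) = c p (mgerm S F p U x)"
      unfolding mgerm_res[OF U(1,2,4,3) x] ..
  }
  {
    fix U x y assume U: "Op U" and x: "x \<in> carrier (msec F U)" and y: "y \<in> carrier (msec F U)"
      and e: "\<And>p. p \<in> U \<Longrightarrow> c p (mgerm S F p U x) = c p (mgerm S F p U y)"
    show "x = y"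
      by (rule germ_inj[OF sheafM U x y], rule inj[OF U]) (use U x y e in auto)
  }
  {
    fix U \<xi> assume U: "Op U" and loc: "\<And>p. p \<in> U \<Longrightarrow> \<exists>V x. Op V \<and> p \<in> V \<and> V \<subseteq> U \<and> x \<in> carrier (msec F V) \<and>
        (\<forall>q \<in> V. c q (mgerm S F q V x) = \<xi> q)"
    \<comment> \<open>The inverses of the charts turn the prescribed coordinates into prescribed
      germs.\<close>
    have "\<exists>x \<in> carrier (msec F U). \<forall>q \<in> U. mgerm S F q U x = inv_into (carrier (mstalk S F q)) (c q) (\<xi> q)"
    proof (rule germ_glue[OF sheafM U])
      fix p assume "p \<in> U"
      from loc[OF this] obtain V x where V: "Op V" "p \<in> V" "V \<subseteq> U" "x \<in> carrier (msec F V)"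
        and e: "\<And>q. q \<in> V \<Longrightarrow> c q (mgerm S F q V x) = \<xi> q" by blast
      have "mgerm S F q V x = inv_into (carrier (mstalk S F q)) (c q) (\<xi> q)" if q: "q \<in> V" for q
        unfolding e[OF q, symmetric]
        by (rule inv_into_f_f[symmetric, OF bij_betw_imp_inj_on[OF rank_one.bij[OF r1[OF V(1) q]]]])
           (use V q in auto)
      with V show "\<exists>V x. Op V \<and> p \<in> V \<and> V \<subseteq> U \<and> x \<in> carrier (msec F V) \<and>
        (\<forall>q \<in> V. mgerm S F q V x = inv_into (carrier (mstalk S F q)) (c q) (\<xi> q))" by blast
    qed
    then obtain x where x: "x \<in> carrier (msec F U)"
      and ex: "\<And>q. q \<in> U \<Longrightarrow> mgerm S F q U x = inv_into (carrier (mstalk S F q)) (c q) (\<xi> q)" by blast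
    have "c q (mgerm S F q U x) = \<xi> q" if q: "q \<in> U" for q
      unfolding ex[OF q]
    proof (rule bij_betw_inv_into_right[OF rank_one.bij[OF r1[OF U q]]])
      obtain V y where "Op V" "q \<in> V" "y \<in> carrier (msec F V)" "c q (mgerm S F q V y) = \<xi> q"
        using loc[OF q] q by blast
      then show "\<xi> q \<in> carrier (R q)" using cl[of V q "mgerm S F q V y"] by auto
    qed
    with x show "\<exists>x \<in> carrier (msec F U). \<forall>q \<in> U. c q (mgerm S F q U x) = \<xi> q" by blast
  }
  {
    fix U p x V y
    assume U: "Op U" "p \<in> U" "x \<in> carrier (msec F U)" and V: "Op V" "p \<in> V" "y \<in> carrier (msec F V)"
      and e: "c p (mgerm S F p U x) = c p (mgerm S F p V y)"
    have "mgerm S F p U x = mgerm S F p V y" by (rule inj[OF U(1,2) _ _ e]) (use U V in auto)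
    then obtain W where W: "Op W" "p \<in> W" "W \<subseteq> U \<inter> V" "mres F U W x = mres F V W y"
      unfolding germ_eq_iff[OF sheafM U V] by blast
    have "mgerm S F q U x = mgerm S F q V y" if q: "q \<in> W" for q
      using mgerm_res[OF U(1) W(1) q _ U(3)] mgerm_res[OF V(1) W(1) q _ V(3)] W(3,4) by simp
    with W show "\<exists>W. Op W \<and> p \<in> W \<and> W \<subseteq> U \<inter> V \<and> (\<forall>q \<in> W. c q (mgerm S F q U x) = c q (mgerm S F q V y))"
      by (intro exI[of _ W]) auto
  }
qed (use mem_zero mem_add mem_smult mem_res fr in auto)

end

section \<open>Charts of line bundles\<close>

context ringed
begin

text \<open>Coordinates on whole stalks are kept beside those on sections: tensor products and the
  generation condition for points of the projective line speak about arbitrary elements of the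
  stalks.\<close>

definition charts :: "('p, 'r, 'm) mod_sheaf \<Rightarrow> ('p \<Rightarrow> ('p, 'm) germ \<Rightarrow> ('p, 'r) germ) \<Rightarrow> bool" where
  "charts F c \<longleftrightarrow> (\<forall>p \<in> points S. rank_one (R p) (mstalk S F p) (c p)) \<and>
     coordinates S F (\<lambda>p U x. c p (mgerm S F p U x))"

lemma charts_structure_sheaf: "charts (structure_sheaf S) (\<lambda>p x. x)"
  unfolding charts_def using rank_one_structure_sheaf coordinates_structure_sheaf by (simp add: structure_sheaf_def)

text \<open>A local trivialization acts on germs, which gives the chart at p, and the section
  \<open>e\<close> that it maps to 1 generates L over every smaller open set. The latter will show
  that \<open>e\<close> has unit coordinates in any family of charts.\<close>

lemma line_bundle_chart:
  assumes L: "line_bundle S L" and p: "p \<in> points S"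
  obtains U e c where "Op U" "p \<in> U" "e \<in> carrier (msec L U)"
    "rank_one (R p) (mstalk S L p) c"
    "\<And>V x. Op V \<Longrightarrow> V \<subseteq> U \<Longrightarrow> x \<in> carrier (msec L V) \<Longrightarrow>
      \<exists>r \<in> carrier (sec S V). x = r \<odot>\<^bsub>msec L V\<^esub> mres L U V e"
proof -
  interpret M: module_sheaf_on S L by unfold_locales (use L in \<open>simp add: line_bundle_def\<close>)
  interpret b: cring "R p" by (rule cring_stalk[OF p])
  obtain U \<theta> where U: "Op U" "p \<in> U" and th: "module_sheaf_iso (open_subspace S U) L (structure_sheaf S) \<theta>"
    using L p unfolding line_bundle_def by blast
  have opU: "openin (spc (open_subspace S U)) V \<longleftrightarrow> Op V \<and> V \<subseteq> U" for V
    using openin_open_subtopology[OF U(1)] by (simp add: open_subspace_def)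
  have sec: "sec (open_subspace S U) = sec S" by (simp add: open_subspace_def)
  note th' = th[unfolded module_sheaf_iso_def opU sec structure_sheaf_simps]
  note th1 = th'[THEN conjunct1, rule_format, OF conjI]
  have bij: "bij_betw (\<theta> V) (carrier (msec L V)) (carrier (sec S V))" if "Op V" "V \<subseteq> U" for V
    using th1[OF that] by (rule conjunct1)
  have cl: "\<theta> V x \<in> carrier (sec S V)" if "Op V" "V \<subseteq> U" "x \<in> carrier (msec L V)" for V x
    by (rule bij_betw_apply[OF bij[OF that(1,2)] that(3)])
  have add: "\<theta> V (x \<oplus>\<^bsub>msec L V\<^esub> y) = \<theta> V x \<oplus>\<^bsub>sec S V\<^esub> \<theta> V y"
    if "Op V" "V \<subseteq> U" "x \<in> carrier (msec L V)" "y \<in> carrier (msec L V)" for V x y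
    using th1[OF that(1,2)] that(3,4) by simp
  have sm: "\<theta> V (r \<odot>\<^bsub>msec L V\<^esub> x) = r \<otimes>\<^bsub>sec S V\<^esub> \<theta> V x"
    if "Op V" "V \<subseteq> U" "r \<in> carrier (sec S V)" "x \<in> carrier (msec L V)" for V r x
    using th1[OF that(1,2)] that(3,4) by simp
  have rs: "\<theta> W (mres L V W x) = res S V W (\<theta> V x)"
    if "Op V" "V \<subseteq> U" "Op W" "W \<subseteq> V" "x \<in> carrier (msec L V)" for V W x
    using th'[THEN conjunct2, rule_format, of V W x] that by auto
  \<comment> \<open>A representative is first restricted into U, because the trivialization is
    meaningful only over open subsets of U.\<close>
  define c where "c x = (\<Union>(V, s) \<in> x. ogerm S p (V \<inter> U) (\<theta> (V \<inter> U) (mres L V (V \<inter> U) s)))" for x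
  have c: "c (mgerm S L p V s) = ogerm S p V (\<theta> V s)"
    if V: "Op V" "p \<in> V" "V \<subseteq> U" "s \<in> carrier (msec L V)" for V s
    unfolding c_def
  proof (rule UN_germ[OF M.sheafM V(1,2,4)])
    fix X t assume X: "Op X" "p \<in> X" "t \<in> carrier (msec L X)" "mgerm S L p X t = mgerm S L p V s"
    obtain W where W: "Op W" "p \<in> W" "W \<subseteq> X \<inter> V" "mres L X W t = mres L V W s"
      using X(4) unfolding germ_eq_iff[OF M.sheafM X(1-3) V(1,2,4)] by blast
    let ?Y = "X \<inter> U"
    have Y: "Op ?Y" "p \<in> ?Y" "W \<subseteq> ?Y" using X U W V by auto
    have tY: "mres L X ?Y t \<in> carrier (msec L ?Y)" by (rule M.mem_res) (use X Y in auto)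
    have "mres L ?Y W (mres L X ?Y t) = mres L X W t"
      by (rule sheaf_res_res[OF M.sheafM X(1) Y(1) W(1) Y(3) _ X(3)]) auto
    then have "\<theta> W (mres L V W s) = res S ?Y W (\<theta> ?Y (mres L X ?Y t))"
      using rs[OF Y(1) _ W(1) Y(3) tY] W(4) by simp
    moreover have "\<theta> W (mres L V W s) = res S V W (\<theta> V s)"
      by (rule rs[OF V(1,3) W(1) _ V(4)]) (use W in auto)
    ultimately have "res S ?Y W (\<theta> ?Y (mres L X ?Y t)) = res S V W (\<theta> V s)" by simp
    then show "ogerm S p ?Y (\<theta> ?Y (mres L X ?Y t)) = ogerm S p V (\<theta> V s)"
      using ogerm_res[OF Y(1) W(1,2) Y(3) cl[OF Y(1) _ tY]] ogerm_res[OF V(1) W(1,2) _ cl[OF V(1,3,4)]] W(3) by auto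
  qed
  have stalkE: "\<exists>V s. x = mgerm S L p V s \<and> Op V \<and> p \<in> V \<and> V \<subseteq> U \<and> s \<in> carrier (msec L V)"
    if "x \<in> carrier (mstalk S L p)" for x by (rule M.mstalk_inE[OF that U]) blast
  have stalkE2: "\<exists>V s t. x = mgerm S L p V s \<and> y = mgerm S L p V t \<and> Op V \<and> p \<in> V \<and> V \<subseteq> U \<and>
      s \<in> carrier (msec L V) \<and> t \<in> carrier (msec L V)"
    if x: "x \<in> carrier (mstalk S L p)" and y: "y \<in> carrier (mstalk S L p)" for x y
  proof -
    obtain V s where V: "x = mgerm S L p V s" "Op V" "p \<in> V" "V \<subseteq> U" "s \<in> carrier (msec L V)"
      using stalkE[OF x] by blast
    obtain W t where W: "y = mgerm S L p W t" "Op W" "p \<in> W" "W \<subseteq> V" "t \<in> carrier (msec L W)"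
      by (rule M.mstalk_inE[OF y V(2,3)])
    show ?thesis
      by (rule exI[of _ W], rule exI[of _ "mres L V W s"], rule exI[of _ t])
         (use V W M.mgerm_res[OF V(2) W(2,3,4) V(5)] M.mem_res[OF V(2) W(2,4) V(5)] in auto)
  qed
  have r1: "rank_one (R p) (mstalk S L p) c"
  proof unfold_locales
    show "bij_betw c (carrier (mstalk S L p)) (carrier (R p))"
      unfolding bij_betw_def
    proof
      show "inj_on c (carrier (mstalk S L p))"
      proof (rule inj_onI)
      fix x y assume "x \<in> carrier (mstalk S L p)" "y \<in> carrier (mstalk S L p)" and e: "c x = c y"
      then obtain V s t where x: "x = mgerm S L p V s" "y = mgerm S L p V t" and V: "Op V" "p \<in> V" "V \<subseteq> U"
        and s: "s \<in> carrier (msec L V)" and t: "t \<in> carrier (msec L V)" using stalkE2 by blast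
      have "ogerm S p V (\<theta> V s) = ogerm S p V (\<theta> V t)" using e unfolding x c[OF V s] c[OF V t] .
      then obtain W where W: "Op W" "p \<in> W" "W \<subseteq> V \<inter> V" "res S V W (\<theta> V s) = res S V W (\<theta> V t)"
        by (rule ogerm_eqD[OF V(1,2) cl[OF V(1,3) s] V(1,2) cl[OF V(1,3) t]])
      then have W': "W \<subseteq> V" by auto
      have "\<theta> W (mres L V W s) = \<theta> W (mres L V W t)"
        unfolding rs[OF V(1,3) W(1) W' s] rs[OF V(1,3) W(1) W' t] by (rule W(4))
      then have "mres L V W s = mres L V W t"
        by (rule inj_onD[OF bij_betw_imp_inj_on[OF bij[OF W(1) subset_trans[OF W' V(3)]]] _
              M.mem_res[OF V(1) W(1) W' s] M.mem_res[OF V(1) W(1) W' t]])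
      then show "x = y" using M.mgerm_res[OF V(1) W(1,2) W' s] M.mgerm_res[OF V(1) W(1,2) W' t] unfolding x by simp
      qed
      show "c ` carrier (mstalk S L p) = carrier (R p)"
      proof (intro equalityI subsetI)
      fix y assume "y \<in> c ` carrier (mstalk S L p)"
      then obtain x where x: "y = c x" "x \<in> carrier (mstalk S L p)" by blast
      obtain V s where V: "x = mgerm S L p V s" "Op V" "p \<in> V" "V \<subseteq> U" "s \<in> carrier (msec L V)"
        using stalkE[OF x(2)] by blast
      show "y \<in> carrier (R p)" unfolding x(1) V(1) c[OF V(2-)] using V cl[OF V(2,4,5)] by auto
    next
      fix y assume "y \<in> carrier (R p)"
      then obtain X f where X: "y = ogerm S p X f" "Op X" "p \<in> X" "f \<in> carrier (sec S X)" by (rule stalk_carrierE)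
      let ?V = "X \<inter> U"
      have V: "Op ?V" "p \<in> ?V" "?V \<subseteq> U" using X U by auto
      have "res S X ?V f \<in> carrier (sec S ?V)" by (rule sheaf_resD[OF sheafO X(2) V(1) _ X(4)]) auto
      then obtain s where s: "s \<in> carrier (msec L ?V)" "res S X ?V f = \<theta> ?V s"
        using bij_betw_imp_surj_on[OF bij[OF V(1,3)]] by (metis imageE)
      have "y = c (mgerm S L p ?V s)"
        unfolding c[OF V s(1)] s(2)[symmetric] X(1) by (rule ogerm_res[symmetric, OF X(2) V(1,2) _ X(4)]) auto
      then show "y \<in> c ` carrier (mstalk S L p)" using V s by auto
      qed
    qed
    have m0: "\<zero>\<^bsub>mstalk S L p\<^esub> = mgerm S L p U \<zero>\<^bsub>msec L U\<^esub>" by (rule M.mgerm_zero[OF U, symmetric])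
    note z = M.mem_zero[OF U(1)]
    show "\<zero>\<^bsub>mstalk S L p\<^esub> \<in> carrier (mstalk S L p)" unfolding m0 using U z by auto
    interpret u: cring "sec S U" by (rule cringO[OF U(1)])
    interpret m: module "sec S U" "msec L U" by (rule M.moduleM[OF U(1)])
    \<comment> \<open>An isomorphism is defined by compatibility with sums and scalar multiples, so
      the image of 0 is found by cancelling.\<close>
    have "\<theta> U \<zero>\<^bsub>msec L U\<^esub> = \<theta> U \<zero>\<^bsub>msec L U\<^esub> \<oplus>\<^bsub>sec S U\<^esub> \<theta> U \<zero>\<^bsub>msec L U\<^esub>"
      using add[OF U(1) subset_refl z z] by simp
    then have "\<theta> U \<zero>\<^bsub>msec L U\<^esub> = \<zero>\<^bsub>sec S U\<^esub>" using u.add.r_cancel_one' cl[OF U(1) subset_refl z] by metis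
    then show "c \<zero>\<^bsub>mstalk S L p\<^esub> = \<zero>\<^bsub>R p\<^esub>"
      unfolding m0 c[OF U subset_refl z] by (simp add: ogerm_zero[OF U])
    { fix x y assume "x \<in> carrier (mstalk S L p)" "y \<in> carrier (mstalk S L p)"
      then obtain V s t where x: "x = mgerm S L p V s" "y = mgerm S L p V t" and V: "Op V" "p \<in> V" "V \<subseteq> U"
        and s: "s \<in> carrier (msec L V)" and t: "t \<in> carrier (msec L V)" using stalkE2 by blast
      have st: "s \<oplus>\<^bsub>msec L V\<^esub> t \<in> carrier (msec L V)" by (rule M.mem_add[OF V(1) s t])
      have e: "x \<oplus>\<^bsub>mstalk S L p\<^esub> y = mgerm S L p V (s \<oplus>\<^bsub>msec L V\<^esub> t)" unfolding x by (rule M.mgerm_add[OF V(1,2) s t, symmetric])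
      show "x \<oplus>\<^bsub>mstalk S L p\<^esub> y \<in> carrier (mstalk S L p)" unfolding e using V st by auto
      show "c (x \<oplus>\<^bsub>mstalk S L p\<^esub> y) = c x \<oplus>\<^bsub>R p\<^esub> c y"
        unfolding e c[OF V st] unfolding x c[OF V s] c[OF V t] add[OF V(1,3) s t]
        by (rule ogerm_add[OF V(1,2) cl[OF V(1,3) s] cl[OF V(1,3) t]]) }
    { fix r x assume r: "r \<in> carrier (R p)" and "x \<in> carrier (mstalk S L p)"
      then obtain V s where x: "x = mgerm S L p V s" and V: "Op V" "p \<in> V" "V \<subseteq> U"
        and s: "s \<in> carrier (msec L V)" using stalkE by blast
      from r obtain X f where X: "r = ogerm S p X f" "Op X" "p \<in> X" "f \<in> carrier (sec S X)" by (rule stalk_carrierE)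
      let ?W = "X \<inter> V"
      have W: "Op ?W" "p \<in> ?W" "?W \<subseteq> U" "?W \<subseteq> V" using X V by auto
      let ?f = "res S X ?W f" and ?s = "mres L V ?W s"
      have f: "?f \<in> carrier (sec S ?W)" by (rule sheaf_resD[OF sheafO X(2) W(1) _ X(4)]) auto
      have s': "?s \<in> carrier (msec L ?W)" by (rule M.mem_res[OF V(1) W(1) W(4) s])
      have rr: "r = ogerm S p ?W ?f" unfolding X(1) by (rule ogerm_res[symmetric, OF X(2) W(1,2) _ X(4)]) auto
      have xx: "x = mgerm S L p ?W ?s" unfolding x by (rule M.mgerm_res[symmetric, OF V(1) W(1,2,4) s])
      have fs: "?f \<odot>\<^bsub>msec L ?W\<^esub> ?s \<in> carrier (msec L ?W)" by (rule M.mem_smult[OF W(1) f s'])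
      have e: "r \<odot>\<^bsub>mstalk S L p\<^esub> x = mgerm S L p ?W (?f \<odot>\<^bsub>msec L ?W\<^esub> ?s)"
        unfolding rr xx by (rule M.mgerm_smult[OF W(1,2) f s', symmetric])
      show "r \<odot>\<^bsub>mstalk S L p\<^esub> x \<in> carrier (mstalk S L p)" unfolding e using W fs by auto
      show "c (r \<odot>\<^bsub>mstalk S L p\<^esub> x) = r \<otimes>\<^bsub>R p\<^esub> c x"
        unfolding e c[OF W(1-3) fs] unfolding rr xx c[OF W(1-3) s'] sm[OF W(1,3) f s']
        by (rule ogerm_mult[OF W(1,2) f cl[OF W(1,3) s']]) }
  qed
  interpret u: cring "sec S U" by (rule cringO[OF U(1)])
  obtain e where e: "e \<in> carrier (msec L U)" "\<theta> U e = \<one>\<^bsub>sec S U\<^esub>"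
    using bij_betw_imp_surj_on[OF bij[OF U(1) subset_refl]] u.one_closed by (metis imageE)
  have gen: "\<exists>r \<in> carrier (sec S V). x = r \<odot>\<^bsub>msec L V\<^esub> mres L U V e"
    if V: "Op V" "V \<subseteq> U" and x: "x \<in> carrier (msec L V)" for V x
  proof (rule bexI)
    interpret vr: cring "sec S V" by (rule cringO[OF V(1)])
    show r: "\<theta> V x \<in> carrier (sec S V)" by (rule cl[OF V x])
    have eV: "mres L U V e \<in> carrier (msec L V)" by (rule M.mem_res[OF U(1) V e(1)])
    have "\<theta> V (mres L U V e) = \<one>\<^bsub>sec S V\<^esub>"
      unfolding rs[OF U(1) subset_refl V e(1)] e(2) by (rule ring_hom_one[OF resO[OF U(1) V]])
    then have "\<theta> V (\<theta> V x \<odot>\<^bsub>msec L V\<^esub> mres L U V e) = \<theta> V x"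
      unfolding sm[OF V r eV] using r by simp
    then show "x = \<theta> V x \<odot>\<^bsub>msec L V\<^esub> mres L U V e"
      by (intro inj_onD[OF bij_betw_imp_inj_on[OF bij[OF V]]]) (use x M.mem_smult[OF V(1) r eV] in auto)
  qed
  show ?thesis by (rule that[OF U e(1) r1 gen])
qed

text \<open>The charts are chosen separately at each point. A local generator \<open>e\<close> is
  still a frame for them: the element with coordinate 1 at q is a multiple of the germ of
  \<open>e\<close>, so the coordinate of \<open>e\<close> divides 1.\<close>

lemma line_bundle_charts:
  assumes L: "line_bundle S L"
  shows "\<exists>c. charts L c"
proof -
  interpret M: module_sheaf_on S L by unfold_locales (use L in \<open>simp add: line_bundle_def\<close>)
  have "\<exists>c. rank_one (R p) (mstalk S L p) c" if p: "p \<in> points S" for p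
    by (rule line_bundle_chart[OF L p]) blast
  then obtain c where c: "\<And>p. p \<in> points S \<Longrightarrow> rank_one (R p) (mstalk S L p) (c p)" by metis
  have "coordinates S L (\<lambda>p U x. c p (mgerm S L p U x))"
  proof (rule M.coordinates_of_charts[OF c])
    fix p assume p: "p \<in> points S"
    obtain U e where U: "Op U" "p \<in> U" "e \<in> carrier (msec L U)"
      and gen: "\<And>V x. Op V \<Longrightarrow> V \<subseteq> U \<Longrightarrow> x \<in> carrier (msec L V) \<Longrightarrow>
        \<exists>r \<in> carrier (sec S V). x = r \<odot>\<^bsub>msec L V\<^esub> mres L U V e"
      using line_bundle_chart[OF L p] by metis
    have "c q (mgerm S L q U e) \<in> Units (R q)" if q: "q \<in> U" for q
    proof -
      interpret r: rank_one "R q" "mstalk S L q" "c q" by (rule c[OF Op_sub[OF U(1) q]])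
      obtain x where x: "x \<in> carrier (mstalk S L q)" "c q x = \<one>\<^bsub>R q\<^esub>" by (rule r.generator)
      obtain V s where V: "x = mgerm S L q V s" "Op V" "q \<in> V" "V \<subseteq> U" "s \<in> carrier (msec L V)"
        by (rule M.mstalk_inE[OF x(1) U(1) q])
      obtain f where f: "f \<in> carrier (sec S V)" "s = f \<odot>\<^bsub>msec L V\<^esub> mres L U V e" using gen[OF V(2,4,5)] by blast
      have eV: "mres L U V e \<in> carrier (msec L V)" by (rule M.mem_res[OF U(1) V(2,4) U(3)])
      have "x = ogerm S q V f \<odot>\<^bsub>mstalk S L q\<^esub> mgerm S L q U e"
        unfolding V(1) f(2) M.mgerm_smult[OF V(2,3) f(1) eV] M.mgerm_res[OF U(1) V(2,3,4) U(3)] ..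
      then have "ogerm S q V f \<otimes>\<^bsub>R q\<^esub> c q (mgerm S L q U e) = \<one>\<^bsub>R q\<^esub>"
        using r.c_smult[of "ogerm S q V f" "mgerm S L q U e"] x(2) V f U q by auto
      then have "c q (mgerm S L q U e) \<otimes>\<^bsub>R q\<^esub> ogerm S q V f \<in> Units (R q)"
        using r.m_comm[of "ogerm S q V f" "c q (mgerm S L q U e)"] V f U q by auto
      then show ?thesis using r.factor_Units[of "c q (mgerm S L q U e)" "ogerm S q V f"] V f U q by auto
    qed
    then show "\<exists>U e. Op U \<and> p \<in> U \<and> e \<in> carrier (msec L U) \<and> (\<forall>q \<in> U. c q (mgerm S L q U e) \<in> Units (R q))"
      using U by blast
  qed
  with c show ?thesis unfolding charts_def by blast
qed

end

section \<open>Tensor products of free modules of rank one\<close>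

text \<open>The guard makes the folded function commute on the whole type and not just on the carrier.\<close>

definition msum :: "('a, 'b) ring_scheme \<Rightarrow> ('k \<Rightarrow> 'a) \<Rightarrow> 'k multiset \<Rightarrow> 'a" where
  "msum B f X = fold_mset (\<lambda>k acc. if acc \<in> carrier B then f k \<oplus>\<^bsub>B\<^esub> acc else acc) \<zero>\<^bsub>B\<^esub> X"

context cring
begin

lemma msum_empty [simp]: "msum R f {#} = \<zero>"
  by (simp add: msum_def)

text \<open>Closedness comes along because the guard of the fold adds a summand only if the sum so
  far lies in the carrier.\<close>

lemma msum_step:
  assumes f: "\<And>k. f k \<in> carrier R"
  shows "msum R f X \<in> carrier R \<and> msum R f (add_mset k X) = f k \<oplus> msum R f X"
proof -
  interpret comp_fun_commute "\<lambda>k acc. if acc \<in> carrier R then f k \<oplus> acc else acc"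
    by unfold_locales (auto simp: fun_eq_iff f a_lcomm)
  have c: "msum R f X \<in> carrier R" by (induction X) (auto simp: msum_def f)
  then show ?thesis by (simp add: msum_def)
qed

lemma msum_closed: "(\<And>k. f k \<in> carrier R) \<Longrightarrow> msum R f X \<in> carrier R"
  by (rule conjunct1[OF msum_step])

lemma msum_add_mset: "(\<And>k. f k \<in> carrier R) \<Longrightarrow> msum R f (add_mset k X) = f k \<oplus> msum R f X"
  by (rule conjunct2[OF msum_step])

lemma msum_union:
  assumes f: "\<And>k. f k \<in> carrier R"
  shows "msum R f (X + Y) = msum R f X \<oplus> msum R f Y"
  by (induction X) (use f in \<open>simp_all add: msum_add_mset msum_closed a_assoc\<close>)

end

text \<open>The shape of the stalks of a tensor product along a morphism: M belongs to the source, N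
  to the target, and m \<otimes> n is to have the coordinate c(m) \<phi>(c(n)).\<close>

locale rank_one_tensor = M: rank_one B M cM + N: rank_one R N cN
  for B :: "'b ring" and M :: "('b, 'm) module" and cM :: "'m \<Rightarrow> 'b"
    and R :: "'a ring" and N :: "('a, 'n) module" and cN :: "'n \<Rightarrow> 'a" +
  fixes \<phi> :: "'a \<Rightarrow> 'b"
  assumes hom: "\<phi> \<in> ring_hom R B"
begin

abbreviation rel where "rel \<equiv> tensor_rel \<phi> R M N"
abbreviation cls where "cls \<equiv> tensor_class \<phi> R M N"
abbreviation prod where "prod \<equiv> tensor_module \<phi> R M N"

text \<open>The default 0 gives a value to every multiset. This matters because
  \<open>tensor_rel\<close> also relates multisets with entries outside the carriers, by its rules
  \<open>refl\<close> and \<open>cong\<close>.\<close>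

definition tval :: "'m \<times> 'n \<Rightarrow> 'b" where
  "tval k = (if fst k \<in> carrier M \<and> snd k \<in> carrier N then cM (fst k) \<otimes>\<^bsub>B\<^esub> \<phi> (cN (snd k)) else \<zero>\<^bsub>B\<^esub>)"

definition tsum :: "('m \<times> 'n) multiset \<Rightarrow> 'b" where "tsum = msum B tval"

definition tcoord :: "('m \<times> 'n) multiset set \<Rightarrow> 'b" where
  "tcoord \<zeta> = tsum (SOME X. X \<in> \<zeta>)"

lemma phi_closed [simp]: "r \<in> carrier R \<Longrightarrow> \<phi> r \<in> carrier B"
  by (rule ring_hom_closed[OF hom])

lemma tval_closed [simp]: "tval k \<in> carrier B"
  by (simp add: tval_def)

lemma tval_eq: "m \<in> carrier M \<Longrightarrow> n \<in> carrier N \<Longrightarrow> tval (m, n) = cM m \<otimes>\<^bsub>B\<^esub> \<phi> (cN n)"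
  by (simp add: tval_def)

lemma tsum_simps [simp]:
  "tsum {#} = \<zero>\<^bsub>B\<^esub>" "tsum X \<in> carrier B" "tsum (add_mset k X) = tval k \<oplus>\<^bsub>B\<^esub> tsum X"
  "tsum (X + Y) = tsum X \<oplus>\<^bsub>B\<^esub> tsum Y"
  by (simp_all add: tsum_def M.msum_closed M.msum_add_mset M.msum_union)

text \<open>Makes \<open>tcoord\<close> independent of the representative that it picks: each
  generating relation of the tensor product is respected by (m, n) going to c(m)
  \<phi>(c(n)).\<close>

lemma tsum_rel: "rel X Y \<Longrightarrow> tsum X = tsum Y"
proof (induction rule: tensor_rel.induct)
  case (zero n)
  then show ?case by (simp add: tval_eq M.zero_mem)
next
  case (add_left m m' n)
  then show ?case by (simp add: tval_eq M.add_mem M.c_add M.l_distr)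
next
  case (add_right m n n')
  then show ?case by (simp add: tval_eq N.add_mem N.c_add ring_hom_add[OF hom] M.r_distr)
next
  case (balanced r m n)
  then show ?case
    by (simp add: tval_eq M.smult_mem M.c_smult N.smult_mem N.c_smult ring_hom_mult[OF hom] M.m_ac)
qed simp_all

lemma cls_eq_iff: "cls X = cls Y \<longleftrightarrow> rel X Y"
proof
  assume "cls X = cls Y"
  moreover have "Y \<in> cls Y" by (simp add: tensor_class_def tensor_rel.refl)
  ultimately have "Y \<in> cls X" by simp
  then show "rel X Y" by (simp add: tensor_class_def)
next
  assume "rel X Y"
  then show "cls X = cls Y"
    unfolding tensor_class_def using tensor_rel.trans tensor_rel.sym by blast
qed

lemma cls_mem: "Y \<in> cls X \<longleftrightarrow> rel X Y"
  by (simp add: tensor_class_def)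

lemma cls_self: "X \<in> cls X"
  by (simp add: cls_mem tensor_rel.refl)

lemma tcoord_cls: "tcoord (cls X) = tsum X"
proof -
  have "(SOME Y. Y \<in> cls X) \<in> cls X" by (rule someI) (rule cls_self)
  then show ?thesis unfolding tcoord_def cls_mem by (rule tsum_rel[symmetric])
qed

lemma cls_UN:
  assumes "\<And>Y. rel X Y \<Longrightarrow> f Y = c"
  shows "(\<Union>Y \<in> cls X. f Y) = c"
  using assms cls_self[of X] by (auto simp: cls_mem)

lemma rel_add:
  assumes "rel X X'" "rel Y Y'" shows "rel (X + Y) (X' + Y')"
proof -
  have "rel (X + Y) (X' + Y)" by (rule tensor_rel.cong[OF assms(1)])
  moreover have "rel (X' + Y) (X' + Y')"
    using tensor_rel.cong[OF assms(2), of X'] by (simp only: add.commute)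
  ultimately show ?thesis by (rule tensor_rel.trans)
qed

lemma prod_add: "cls X \<oplus>\<^bsub>prod\<^esub> cls Y = cls (X + Y)"
  unfolding tensor_module_def ring_record_simps
  by (rule cls_UN, rule cls_UN) (simp add: cls_eq_iff rel_add tensor_rel.sym)

abbreviation scale where "scale b \<equiv> image_mset (\<lambda>(m, n). (b \<odot>\<^bsub>M\<^esub> m, n))"

text \<open>Makes scalar multiplication of classes well defined. The laws of M that are needed are
  read off in B through the injective coordinate.\<close>

lemma rel_scale:
  assumes b: "b \<in> carrier B"
  shows "rel X Y \<Longrightarrow> rel (scale b X) (scale b Y)"
proof (induction rule: tensor_rel.induct)
  case (trans X Y Z)
  show ?case by (rule tensor_rel.trans[OF trans.IH])
next
  case (zero n)
  have "b \<odot>\<^bsub>M\<^esub> \<zero>\<^bsub>M\<^esub> = \<zero>\<^bsub>M\<^esub>"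
    by (rule M.c_inj) (use b in \<open>auto simp: M.zero_mem M.smult_mem M.c_smult\<close>)
  then show ?case using zero by (simp add: tensor_rel.zero)
next
  case (add_left m m' n)
  have "b \<odot>\<^bsub>M\<^esub> (m \<oplus>\<^bsub>M\<^esub> m') = b \<odot>\<^bsub>M\<^esub> m \<oplus>\<^bsub>M\<^esub> b \<odot>\<^bsub>M\<^esub> m'"
    by (rule M.c_inj) (use b add_left in \<open>auto simp: M.add_mem M.smult_mem M.c_smult M.c_add M.r_distr\<close>)
  then show ?case using add_left b by (simp add: tensor_rel.add_left M.smult_mem)
next
  case (add_right m n n')
  then show ?case using b by (simp add: tensor_rel.add_right M.smult_mem)
next
  case (balanced r m n)
  have "b \<odot>\<^bsub>M\<^esub> (\<phi> r \<odot>\<^bsub>M\<^esub> m) = \<phi> r \<odot>\<^bsub>M\<^esub> (b \<odot>\<^bsub>M\<^esub> m)"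
    by (rule M.c_inj) (use b balanced in \<open>auto simp: M.smult_mem M.c_smult M.m_lcomm\<close>)
  then show ?case using balanced b by (simp add: tensor_rel.balanced M.smult_mem)
qed (auto intro: tensor_rel.refl tensor_rel.sym tensor_rel.cong)

lemma prod_smult: "b \<in> carrier B \<Longrightarrow> b \<odot>\<^bsub>prod\<^esub> cls X = cls (scale b X)"
  unfolding tensor_module_def module.simps
  by (rule cls_UN) (simp add: cls_eq_iff rel_scale tensor_rel.sym)

lemma tsum_scale:
  assumes b: "b \<in> carrier B" and X: "set_mset X \<subseteq> carrier M \<times> carrier N"
  shows "tsum (scale b X) = b \<otimes>\<^bsub>B\<^esub> tsum X"
  using X by (induction X) (use b in \<open>auto simp: tval_eq M.smult_mem M.c_smult M.r_distr M.m_assoc\<close>)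

lemma scale_mem:
  "b \<in> carrier B \<Longrightarrow> set_mset X \<subseteq> carrier M \<times> carrier N \<Longrightarrow> set_mset (scale b X) \<subseteq> carrier M \<times> carrier N"
  by (auto simp: M.smult_mem)

lemma prodE:
  assumes "x \<in> carrier prod"
  obtains X where "x = cls X" "set_mset X \<subseteq> carrier M \<times> carrier N"
  using assms by (auto simp: tensor_module_def)

lemma prod_mem: "set_mset X \<subseteq> carrier M \<times> carrier N \<Longrightarrow> cls X \<in> carrier prod"
  by (auto simp: tensor_module_def)

lemma prod_zero: "\<zero>\<^bsub>prod\<^esub> = cls {#}"
  by (simp add: tensor_module_def)

text \<open>Writing n = c(n) e and moving the scalar across the tensor sign turns each summand into
  one with second factor e, and such summands add up in the first factor.\<close>

lemma rel_pure:
  assumes e: "e \<in> carrier N" "cN e = \<one>\<^bsub>R\<^esub>" and X: "set_mset X \<subseteq> carrier M \<times> carrier N"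
  shows "\<exists>m \<in> carrier M. rel X {#(m, e)#}"
  using X
proof (induction X)
  case empty
  show ?case using tensor_rel.sym[OF tensor_rel.zero[OF e(1)]] M.zero_mem(1) by blast
next
  case (add k X)
  obtain m n where k: "k = (m, n)" "m \<in> carrier M" "n \<in> carrier N" using add.prems by (cases k) auto
  obtain m' where m': "m' \<in> carrier M" "rel X {#(m', e)#}" using add by auto
  let ?m = "\<phi> (cN n) \<odot>\<^bsub>M\<^esub> m"
  have mc: "?m \<in> carrier M" using k by (simp add: M.smult_mem)
  have "cN n \<odot>\<^bsub>N\<^esub> e = n" by (rule N.c_inj) (use k e in \<open>auto simp: N.smult_mem N.c_smult\<close>)
  then have "rel {#(m, n)#} {#(?m, e)#}"
    using tensor_rel.sym[OF tensor_rel.balanced[of "cN n" R m M e N \<phi>]] k e by simp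
  from rel_add[OF this m'(2)] have "rel (add_mset k X) {#(?m, e), (m', e)#}" using k by (simp add: add_mset_commute)
  moreover have "rel {#(?m, e), (m', e)#} {#(?m \<oplus>\<^bsub>M\<^esub> m', e)#}"
    by (rule tensor_rel.sym[OF tensor_rel.add_left[OF mc m'(1) e(1)]])
  ultimately have "rel (add_mset k X) {#(?m \<oplus>\<^bsub>M\<^esub> m', e)#}" by (rule tensor_rel.trans)
  then show ?case using M.add_mem[OF mc m'(1)] by blast
qed

text \<open>Every class is that of some m \<otimes> e with one fixed \<open>e\<close>, and its
  coordinate is that of m because \<phi>(1) = 1. Hence classes with equal coordinates are
  equal.\<close>

lemma rank_one_prod: "rank_one B prod tcoord"
proof unfold_locales
  obtain e where e: "e \<in> carrier N" "cN e = \<one>\<^bsub>R\<^esub>" by (rule N.generator)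
  have pure: "tsum {#(m, e)#} = cM m" if "m \<in> carrier M" for m
    using that e ring_hom_one[OF hom] by (simp add: tval_eq)
  have inj: "inj_on tcoord (carrier prod)"
  proof (rule inj_onI)
    fix x y assume x: "x \<in> carrier prod" and y: "y \<in> carrier prod" and eq: "tcoord x = tcoord y"
    obtain X where X: "x = cls X" "set_mset X \<subseteq> carrier M \<times> carrier N" by (rule prodE[OF x])
    obtain Y where Y: "y = cls Y" "set_mset Y \<subseteq> carrier M \<times> carrier N" by (rule prodE[OF y])
    obtain m where m: "m \<in> carrier M" "rel X {#(m, e)#}" using rel_pure[OF e X(2)] by blast
    obtain n where n: "n \<in> carrier M" "rel Y {#(n, e)#}" using rel_pure[OF e Y(2)] by blast
    have "cM m = cM n"
      using eq tsum_rel[OF m(2)] tsum_rel[OF n(2)] unfolding X(1) Y(1) tcoord_cls pure[OF m(1)] pure[OF n(1)] by simp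
    then have "m = n" using m n M.c_inj by blast
    then show "x = y" unfolding X(1) Y(1) cls_eq_iff using m(2) n(2) tensor_rel.sym tensor_rel.trans by blast
  qed
  have "tcoord ` carrier prod = carrier B"
  proof (intro equalityI subsetI)
    fix b assume "b \<in> tcoord ` carrier prod"
    then show "b \<in> carrier B" by (auto simp: tcoord_cls elim!: prodE)
  next
    fix b assume "b \<in> carrier B"
    then obtain m where m: "m \<in> carrier M" "b = cM m" using bij_betw_imp_surj_on[OF M.bij] by blast
    then have "b = tcoord (cls {#(m, e)#})" unfolding tcoord_cls pure[OF m(1)] by simp
    moreover have "cls {#(m, e)#} \<in> carrier prod" by (rule prod_mem) (use m e in auto)
    ultimately show "b \<in> tcoord ` carrier prod" by blast
  qed
  with inj show "bij_betw tcoord (carrier prod) (carrier B)" by (simp add: bij_betw_def)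
  show "\<zero>\<^bsub>prod\<^esub> \<in> carrier prod" unfolding prod_zero by (rule prod_mem) simp
  show "tcoord \<zero>\<^bsub>prod\<^esub> = \<zero>\<^bsub>B\<^esub>" unfolding prod_zero tcoord_cls by simp
  {
    fix x y assume "x \<in> carrier prod" "y \<in> carrier prod"
    then obtain X Y where X: "x = cls X" "set_mset X \<subseteq> carrier M \<times> carrier N"
      and Y: "y = cls Y" "set_mset Y \<subseteq> carrier M \<times> carrier N" by (metis prodE)
    show "x \<oplus>\<^bsub>prod\<^esub> y \<in> carrier prod" unfolding X(1) Y(1) prod_add by (rule prod_mem) (use X Y in auto)
    show "tcoord (x \<oplus>\<^bsub>prod\<^esub> y) = tcoord x \<oplus>\<^bsub>B\<^esub> tcoord y" unfolding X(1) Y(1) prod_add tcoord_cls by simp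
  }
  {
    fix b x assume b: "b \<in> carrier B" and "x \<in> carrier prod"
    then obtain X where X: "x = cls X" "set_mset X \<subseteq> carrier M \<times> carrier N" by (metis prodE)
    show "b \<odot>\<^bsub>prod\<^esub> x \<in> carrier prod" unfolding X(1) prod_smult[OF b] by (rule prod_mem[OF scale_mem[OF b X(2)]])
    show "tcoord (b \<odot>\<^bsub>prod\<^esub> x) = b \<otimes>\<^bsub>B\<^esub> tcoord x"
      unfolding X(1) prod_smult[OF b] tcoord_cls by (rule tsum_scale[OF b X(2)])
  }
qed

end

section \<open>Tensor products along a morphism\<close>

lemma ring_hom_Units:
  assumes h: "h \<in> ring_hom R S" and R: "ring R" and x: "x \<in> Units R"
  shows "h x \<in> Units S"
proof -
  interpret ring R by (rule R)
  obtain y where y: "y \<in> carrier R" "y \<otimes>\<^bsub>R\<^esub> x = \<one>\<^bsub>R\<^esub>" "x \<otimes>\<^bsub>R\<^esub> y = \<one>\<^bsub>R\<^esub>" using x by (auto simp: Units_def)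
  then have "h y \<otimes>\<^bsub>S\<^esub> h x = \<one>\<^bsub>S\<^esub>" "h x \<otimes>\<^bsub>S\<^esub> h y = \<one>\<^bsub>S\<^esub>"
    using ring_hom_mult[OF h] ring_hom_one[OF h] Units_closed[OF x] by metis+
  then show ?thesis using ring_hom_closed[OF h] y(1) Units_closed[OF x] by (auto simp: Units_def)
qed

lemma (in ringed) module_sheaf_on_structure_sheaf: "module_sheaf_on S (structure_sheaf S)"
proof unfold_locales
  have "module (sec S U) (msec (structure_sheaf S) U)" if U: "Op U" for U
  proof -
    interpret u: cring "sec S U" by (rule cringO[OF U])
    interpret abelian_group "msec (structure_sheaf S) U"
      by (rule abelian_groupI) (auto simp: u.a_ac intro: u.add.r_inv_ex u.add.l_inv_ex)
    show ?thesis by unfold_locales (auto simp: u.l_distr u.r_distr u.m_assoc)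
  qed
  then show "module_sheaf S (structure_sheaf S)"
    unfolding module_sheaf_def using sheafO resO by (auto simp: ring_hom_add ring_hom_mult)
qed

text \<open>A morphism without the locality condition on stalk maps: for the residue point in
  \<open>strongly_distinct_unit\<close>, the stalk maps are computed before locality is
  established.\<close>

locale ringed_map = T: ringed T + S: ringed S
  for T :: "('q, 't) ringed_space" and S :: "('p, 'r) ringed_space" +
  fixes h :: "('q, 't, 'p, 'r) morph"
  assumes cont: "continuous_map (spc T) (spc S) (pt h)"
    and sh_hom: "S.Op U \<Longrightarrow> sh h U \<in> ring_hom (sec S U) (sec T (preim T h U))"
    and sh_res: "S.Op U \<Longrightarrow> S.Op V \<Longrightarrow> V \<subseteq> U \<Longrightarrow> s \<in> carrier (sec S U) \<Longrightarrow>
      sh h V (res S U V s) = res T (preim T h U) (preim T h V) (sh h U s)"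
begin

lemma preim_open: "S.Op U \<Longrightarrow> T.Op (preim T h U)"
  unfolding preim_def by (rule openin_continuous_map_preimage[OF cont])

lemma pt_mem: "t \<in> points T \<Longrightarrow> pt h t \<in> points S"
  using cont by (auto simp: continuous_map_def)

lemma preim_mono: "U \<subseteq> V \<Longrightarrow> preim T h U \<subseteq> preim T h V"
  by (auto simp: preim_def)

lemma preim_Int: "preim T h (U \<inter> V) = preim T h U \<inter> preim T h V"
  by (auto simp: preim_def)

lemma stalk_map_ogerm:
  assumes U: "S.Op U" "t \<in> preim T h U" and s: "s \<in> carrier (sec S U)"
  shows "stalk_map T h t (ogerm S (pt h t) U s) = ogerm T t (preim T h U) (sh h U s)"
  unfolding stalk_map_def
proof (rule S.UN_ogerm[OF U(1) _ s])
  have t: "t \<in> points T" "pt h t \<in> U" using U by (auto simp: preim_def)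
  then show "pt h t \<in> U" by simp
  fix V x assume V: "S.Op V" "pt h t \<in> V" "x \<in> carrier (sec S V)"
    and e: "ogerm S (pt h t) V x = ogerm S (pt h t) U s"
  obtain W where W: "S.Op W" "pt h t \<in> W" "W \<subseteq> V \<inter> U" "res S V W x = res S U W s"
    by (rule S.ogerm_eqD[OF V U(1) t(2) s e])
  have tW: "t \<in> preim T h W" using W t by (auto simp: preim_def)
  have "ogerm T t (preim T h V) (sh h V x) = ogerm T t (preim T h W) (sh h W (res S V W x))"
    using sh_res[OF V(1) W(1) _ V(3)] W(3) preim_mono[of W V]
      T.ogerm_res[OF preim_open[OF V(1)] preim_open[OF W(1)] tW _ ring_hom_closed[OF sh_hom[OF V(1)] V(3)]] by auto
  moreover have "ogerm T t (preim T h U) (sh h U s) = ogerm T t (preim T h W) (sh h W (res S U W s))"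
    using sh_res[OF U(1) W(1) _ s] W(3) preim_mono[of W U]
      T.ogerm_res[OF preim_open[OF U(1)] preim_open[OF W(1)] tW _ ring_hom_closed[OF sh_hom[OF U(1)] s]] by auto
  ultimately show "ogerm T t (preim T h V) (sh h V x) = ogerm T t (preim T h U) (sh h U s)"
    unfolding W(4) by simp
qed

lemma stalk_map_hom:
  assumes t: "t \<in> points T"
  shows "stalk_map T h t \<in> ring_hom (stalk S (pt h t)) (stalk T t)"
proof (rule ring_hom_memI)
  interpret s: cring "stalk S (pt h t)" by (rule S.cring_stalk[OF pt_mem[OF t]])
  have tm: "t \<in> preim T h U" if "pt h t \<in> U" for U using t that by (simp add: preim_def)
  note sc = ring_hom_closed[OF sh_hom]
  {
    fix x assume "x \<in> carrier (stalk S (pt h t))"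
    then obtain U s where U: "x = ogerm S (pt h t) U s" "S.Op U" "pt h t \<in> U" "s \<in> carrier (sec S U)"
      by (rule S.stalk_carrierE)
    show "stalk_map T h t x \<in> carrier (stalk T t)"
      unfolding U(1) stalk_map_ogerm[OF U(2) tm[OF U(3)] U(4)]
      by (rule T.ogerm_closed[OF preim_open[OF U(2)] tm[OF U(3)] sc[OF U(2,4)]])
  }
  {
    fix x y assume "x \<in> carrier (stalk S (pt h t))" "y \<in> carrier (stalk S (pt h t))"
    then obtain U a b where x: "x = ogerm S (pt h t) U a" and y: "y = ogerm S (pt h t) U b"
      and U: "S.Op U" "pt h t \<in> U" and a: "a \<in> carrier (sec S U)" and b: "b \<in> carrier (sec S U)"
      by (rule S.stalk_carrierE2)
    interpret u: cring "sec S U" by (rule S.cringO[OF U(1)])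
    note o = preim_open[OF U(1)] tm[OF U(2)]
    show "stalk_map T h t (x \<otimes>\<^bsub>stalk S (pt h t)\<^esub> y) = stalk_map T h t x \<otimes>\<^bsub>stalk T t\<^esub> stalk_map T h t y"
      unfolding x y S.ogerm_mult[OF U a b, symmetric] stalk_map_ogerm[OF U(1) o(2) u.m_closed[OF a b]]
        stalk_map_ogerm[OF U(1) o(2) a] stalk_map_ogerm[OF U(1) o(2) b] ring_hom_mult[OF sh_hom[OF U(1)] a b]
      by (rule T.ogerm_mult[OF o sc[OF U(1) a] sc[OF U(1) b]])
    show "stalk_map T h t (x \<oplus>\<^bsub>stalk S (pt h t)\<^esub> y) = stalk_map T h t x \<oplus>\<^bsub>stalk T t\<^esub> stalk_map T h t y"
      unfolding x y S.ogerm_add[OF U a b, symmetric] stalk_map_ogerm[OF U(1) o(2) u.a_closed[OF a b]]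
        stalk_map_ogerm[OF U(1) o(2) a] stalk_map_ogerm[OF U(1) o(2) b] ring_hom_add[OF sh_hom[OF U(1)] a b]
      by (rule T.ogerm_add[OF o sc[OF U(1) a] sc[OF U(1) b]])
  }
  have g: "S.Op (points S)" "pt h t \<in> points S" using pt_mem[OF t] by auto
  interpret u: cring "global_sections S" by (rule S.cringO[OF g(1)])
  show "stalk_map T h t \<one>\<^bsub>stalk S (pt h t)\<^esub> = \<one>\<^bsub>stalk T t\<^esub>"
    unfolding S.ogerm_one[OF g, symmetric] stalk_map_ogerm[OF g(1) tm[OF g(2)] u.one_closed]
      ring_hom_one[OF sh_hom[OF g(1)]]
    by (rule T.ogerm_one[OF preim_open[OF g(1)] tm[OF g(2)]])
qed

end

section \<open>Sections of a tensor product along a morphism\<close>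

locale tensor_product = ringed_map T S h + L: module_sheaf_on T L + A: module_sheaf_on S A
  for T :: "('q, 't) ringed_space" and S :: "('p, 'r) ringed_space" and h
    and L :: "('q, 't, 'l) mod_sheaf" and A :: "('p, 'r, 'm) mod_sheaf" +
  fixes cL :: "'q \<Rightarrow> ('q, 'l) germ \<Rightarrow> ('q, 't) germ" and cA :: "'p \<Rightarrow> ('p, 'm) germ \<Rightarrow> ('p, 'r) germ"
  assumes chL: "T.charts L cL" and chA: "S.charts A cA"
begin

abbreviation vL where "vL t W l \<equiv> cL t (mgerm T L t W l)"
abbreviation vA where "vA p U a \<equiv> cA p (mgerm S A p U a)"
abbreviation G where "G \<equiv> tensor_along T S h L A"
abbreviation P where "P \<equiv> tensor_stalk T S h L A"
abbreviation tcls where "tcls t \<equiv> tensor_class (stalk_map T h t) (stalk S (pt h t)) (mstalk T L t) (mstalk S A (pt h t))"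
abbreviation germs where "germs t W U \<equiv> image_mset (\<lambda>(l, a). (mgerm T L t W l, mgerm S A (pt h t) U a))"
abbreviation tc where "tc t \<equiv> rank_one_tensor.tcoord (stalk T t) (mstalk T L t) (cL t)
  (mstalk S A (pt h t)) (cA (pt h t)) (stalk_map T h t)"
abbreviation tsm where "tsm t \<equiv> rank_one_tensor.tsum (stalk T t) (mstalk T L t) (cL t)
  (mstalk S A (pt h t)) (cA (pt h t)) (stalk_map T h t)"

definition repr :: "'q set \<Rightarrow> 'p set \<Rightarrow> ('l \<times> 'm) multiset \<Rightarrow> bool" where
  "repr W U Z \<longleftrightarrow> T.Op W \<and> S.Op U \<and> W \<subseteq> preim T h U \<and> set_mset Z \<subseteq> carrier (msec L W) \<times> carrier (msec A U)"

lemma coordL: "coordinates T L vL" and coordA: "coordinates S A vA"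
  using chL chA by (auto simp: T.charts_def S.charts_def)

sublocale cL: coordinates T L vL by (rule coordL)
sublocale cA: coordinates S A vA by (rule coordA)

lemma rt:
  assumes t: "t \<in> points T"
  shows "rank_one_tensor (stalk T t) (mstalk T L t) (cL t) (stalk S (pt h t)) (mstalk S A (pt h t)) (cA (pt h t)) (stalk_map T h t)"
proof -
  interpret a: rank_one "stalk T t" "mstalk T L t" "cL t" using chL t by (auto simp: T.charts_def)
  interpret b: rank_one "stalk S (pt h t)" "mstalk S A (pt h t)" "cA (pt h t)"
    using chA pt_mem[OF t] by (auto simp: S.charts_def)
  show ?thesis by unfold_locales (rule stalk_map_hom[OF t])
qed

lemma rP: "t \<in> points T \<Longrightarrow> rank_one (stalk T t) (P t) (tc t)"
  unfolding tensor_stalk_def by (rule rank_one_tensor.rank_one_prod[OF rt])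

lemma reprD:
  assumes "repr W U Z"
  shows "T.Op W" "S.Op U" "W \<subseteq> preim T h U" "set_mset Z \<subseteq> carrier (msec L W) \<times> carrier (msec A U)"
    "w \<in> W \<Longrightarrow> w \<in> points T" "w \<in> W \<Longrightarrow> pt h w \<in> U"
  using assms T.Op_sub by (auto simp: repr_def preim_def)

lemma germs_mem:
  assumes r: "repr W U Z" and w: "w \<in> W"
  shows "set_mset (germs w W U Z) \<subseteq> carrier (mstalk T L w) \<times> carrier (mstalk S A (pt h w))"
  using reprD[OF r] w by auto

lemma sec_iff: "f \<in> carrier (msec G V) \<longleftrightarrow> f \<in> extensional V \<and>
  (\<forall>t \<in> V. \<exists>W U Z. repr W U Z \<and> t \<in> W \<and> W \<subseteq> V \<and> (\<forall>w \<in> W. f w = tcls w (germs w W U Z)))"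
proof -
  have "(T.Op W \<and> t \<in> W \<and> W \<subseteq> V \<and> S.Op U \<and> W \<subseteq> preim T h U \<and>
      set_mset Z \<subseteq> carrier (msec L W) \<times> carrier (msec A U) \<and> (\<forall>w \<in> W. f w = tensor_sum T S h L A W U Z w)) \<longleftrightarrow>
    repr W U Z \<and> t \<in> W \<and> W \<subseteq> V \<and> (\<forall>w \<in> W. f w = tcls w (germs w W U Z))" for t W U Z
    by (auto simp: repr_def tensor_sum_def)
  then show ?thesis by (simp add: tensor_along_def del: ex_simps)
qed

lemma secE:
  assumes "f \<in> carrier (msec G V)" "t \<in> V"
  obtains W U Z where "repr W U Z" "t \<in> W" "W \<subseteq> V" "\<And>w. w \<in> W \<Longrightarrow> f w = tcls w (germs w W U Z)"
  using assms unfolding sec_iff by blast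

lemma secI:
  assumes "f \<in> extensional V"
    and "\<And>t. t \<in> V \<Longrightarrow> \<exists>W U Z. repr W U Z \<and> t \<in> W \<and> W \<subseteq> V \<and> (\<forall>w \<in> W. f w = tcls w (germs w W U Z))"
  shows "f \<in> carrier (msec G V)"
  using assms unfolding sec_iff by blast

text \<open>Sections are added near a point by adding multisets of tensors, which requires
  presentations over the same open sets. Restriction changes the sections in the multiset but not
  their germs.\<close>

lemma repr_restrict:
  assumes r: "repr W U Z" and W': "T.Op W'" "W' \<subseteq> W" and U': "S.Op U'" "U' \<subseteq> U" "W' \<subseteq> preim T h U'"
  obtains Z' where "repr W' U' Z'" "\<And>w. w \<in> W' \<Longrightarrow> germs w W' U' Z' = germs w W U Z"
proof
  note rD = reprD[OF r]
  let ?Z = "image_mset (\<lambda>(l, a). (mres L W W' l, mres A U U' a)) Z"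
  show "repr W' U' ?Z"
    unfolding repr_def using rD W' U' L.mem_res[OF rD(1) W'] A.mem_res[OF rD(2) U'(1,2)] by auto
  fix w assume w: "w \<in> W'"
  have w': "pt h w \<in> U'" using w U' by (auto simp: preim_def)
  show "germs w W' U' ?Z = germs w W U Z"
    unfolding image_mset.compositionality
  proof (rule image_mset_cong)
    fix k assume k: "k \<in># Z"
    obtain l a where "k = (l, a)" "l \<in> carrier (msec L W)" "a \<in> carrier (msec A U)"
      using rD(4) k by (cases k) auto
    then show "((\<lambda>(l, a). (mgerm T L w W' l, mgerm S A (pt h w) U' a)) \<circ> (\<lambda>(l, a). (mres L W W' l, mres A U U' a))) k
      = (case k of (l, a) \<Rightarrow> (mgerm T L w W l, mgerm S A (pt h w) U a))"
      using L.mgerm_res[OF rD(1) W'(1) w W'(2)] A.mgerm_res[OF rD(2) U'(1) w' U'(2)] by simp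
  qed
qed

lemma sec_at:
  assumes V: "T.Op V" and f: "f \<in> carrier (msec G V)" and t: "t \<in> V"
  shows "f t \<in> carrier (P t)"
proof -
  obtain W U Z where r: "repr W U Z" "t \<in> W" "f t = tcls t (germs t W U Z)"
    using secE[OF f t] by metis
  interpret rank_one_tensor "stalk T t" "mstalk T L t" "cL t" "stalk S (pt h t)" "mstalk S A (pt h t)" "cA (pt h t)" "stalk_map T h t"
    by (rule rt[OF T.Op_sub[OF V t]])
  show ?thesis unfolding r(3) tensor_stalk_def by (rule prod_mem[OF germs_mem[OF r(1,2)]])
qed

lemma tc_repr:
  assumes r: "repr W U Z" and w: "w \<in> W"
  shows "tc w (tcls w (germs w W U Z)) = tsm w (germs w W U Z)"
  by (rule rank_one_tensor.tcoord_cls[OF rt[OF reprD(5)[OF r w]]])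

text \<open>The regularity of tensor sections: near t a finite sum of tensors is a regular function
  times the tensor e \<otimes> d of two frames. A summand with l = r e and a = s d contributes the
  product of r with the image of s under the morphism.\<close>

lemma sum_expand:
  assumes "repr W U Z" and t: "t \<in> W"
    and eL: "T.Op X" "t \<in> X" "e \<in> carrier (msec L X)" "vL t X e \<in> Units (stalk T t)"
    and eA: "S.Op Y" "pt h t \<in> Y" "d \<in> carrier (msec A Y)" "vA (pt h t) Y d \<in> Units (stalk S (pt h t))"
  shows "\<exists>W' \<rho>. T.Op W' \<and> t \<in> W' \<and> W' \<subseteq> W \<inter> X \<inter> preim T h Y \<and> \<rho> \<in> carrier (sec T W') \<and>
    (\<forall>w \<in> W'. tsm w (germs w W U Z) =
       ogerm T w W' \<rho> \<otimes>\<^bsub>stalk T w\<^esub> (vL w X e \<otimes>\<^bsub>stalk T w\<^esub> stalk_map T h w (vA (pt h w) Y d)))"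
  using assms(1)
proof (induction Z)
  case empty
  note rD = reprD[OF empty]
  let ?W = "W \<inter> X \<inter> preim T h Y"
  have W: "T.Op ?W" "t \<in> ?W" using rD t eL eA preim_open[OF eA(1)] by (auto simp: preim_def)
  interpret c: cring "sec T ?W" by (rule T.cringO[OF W(1)])
  have "tsm w {#} = ogerm T w ?W \<zero>\<^bsub>sec T ?W\<^esub> \<otimes>\<^bsub>stalk T w\<^esub> (vL w X e \<otimes>\<^bsub>stalk T w\<^esub> stalk_map T h w (vA (pt h w) Y d))"
    if w: "w \<in> ?W" for w
  proof -
    have wT: "w \<in> points T" "w \<in> X" "pt h w \<in> Y" using w by (auto simp: preim_def)
    interpret r: rank_one_tensor "stalk T w" "mstalk T L w" "cL w" "stalk S (pt h w)" "mstalk S A (pt h w)" "cA (pt h w)" "stalk_map T h w"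
      by (rule rt[OF wT(1)])
    show ?thesis
      using cL.val_closed[OF eL(1) wT(2) eL(3)] cA.val_closed[OF eA(1) wT(3) eA(3)]
      by (simp add: T.ogerm_zero[OF W(1) w])
  qed
  then show ?case using W c.zero_closed by auto
next
  case (add k Z)
  have r0: "repr W U Z" using add.prems by (auto simp: repr_def)
  note rD = reprD[OF add.prems]
  obtain l a where k: "k = (l, a)" "l \<in> carrier (msec L W)" "a \<in> carrier (msec A U)"
    using rD(4) by (cases k) auto
  obtain W1 \<rho> where W1: "T.Op W1" "t \<in> W1" "W1 \<subseteq> W \<inter> X \<inter> preim T h Y" "\<rho> \<in> carrier (sec T W1)"
    and e1: "\<And>w. w \<in> W1 \<Longrightarrow> tsm w (germs w W U Z) =
       ogerm T w W1 \<rho> \<otimes>\<^bsub>stalk T w\<^esub> (vL w X e \<otimes>\<^bsub>stalk T w\<^esub> stalk_map T h w (vA (pt h w) Y d))"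
    using add.IH[OF r0] by blast
  obtain W2 r where W2: "T.Op W2" "t \<in> W2" "W2 \<subseteq> X \<inter> W" "r \<in> carrier (sec T W2)"
    and e2: "\<And>w. w \<in> W2 \<Longrightarrow> vL w W l = ogerm T w W2 r \<otimes>\<^bsub>stalk T w\<^esub> vL w X e"
    using cL.expand[OF eL rD(1) t k(2)] by blast
  obtain U3 s where U3: "S.Op U3" "pt h t \<in> U3" "U3 \<subseteq> Y \<inter> U" "s \<in> carrier (sec S U3)"
    and e3: "\<And>p. p \<in> U3 \<Longrightarrow> vA p U a = ogerm S p U3 s \<otimes>\<^bsub>stalk S p\<^esub> vA p Y d"
    using cA.expand[OF eA rD(2) rD(6)[OF t] k(3)] by blast
  let ?P = "preim T h U3"
  have P: "T.Op ?P" by (rule preim_open[OF U3(1)])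
  let ?W = "W1 \<inter> W2 \<inter> ?P"
  have W: "T.Op ?W" "t \<in> ?W" "?W \<subseteq> W \<inter> X \<inter> preim T h Y"
    using W1 W2 P U3 rD(5)[OF t] by (auto simp: preim_def)
  interpret c: cring "sec T ?W" by (rule T.cringO[OF W(1)])
  have shc: "sh h U3 s \<in> carrier (sec T ?P)" by (rule ring_hom_closed[OF sh_hom[OF U3(1)] U3(4)])
  let ?\<rho> = "res T W1 ?W \<rho>" and ?r = "res T W2 ?W r" and ?s = "res T ?P ?W (sh h U3 s)"
  have cl: "?\<rho> \<in> carrier (sec T ?W)" "?r \<in> carrier (sec T ?W)" "?s \<in> carrier (sec T ?W)"
    using sheaf_resD[OF T.sheafO W1(1) W(1) _ W1(4)] sheaf_resD[OF T.sheafO W2(1) W(1) _ W2(4)]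
      sheaf_resD[OF T.sheafO P W(1) _ shc] by auto
  \<comment> \<open>The product is the contribution of the new summand, \<open>?\<rho>\<close> that
    of the remaining ones.\<close>
  let ?f = "?r \<otimes>\<^bsub>sec T ?W\<^esub> ?s \<oplus>\<^bsub>sec T ?W\<^esub> ?\<rho>"
  have "tsm w (germs w W U (add_mset k Z)) =
       ogerm T w ?W ?f \<otimes>\<^bsub>stalk T w\<^esub> (vL w X e \<otimes>\<^bsub>stalk T w\<^esub> stalk_map T h w (vA (pt h w) Y d))"
    if w: "w \<in> ?W" for w
  proof -
    have w1: "w \<in> W1" "w \<in> W2" "w \<in> ?P" and wT: "w \<in> points T" "w \<in> X" "w \<in> W" "pt h w \<in> Y" "pt h w \<in> U3" "pt h w \<in> U"
      using w W(3) rD(6)[of w] by (auto simp: preim_def)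
    interpret r: rank_one_tensor "stalk T w" "mstalk T L w" "cL w" "stalk S (pt h w)" "mstalk S A (pt h w)" "cA (pt h w)" "stalk_map T h w"
      by (rule rt[OF wT(1)])
    have c1: "vL w X e \<in> carrier (stalk T w)" by (rule cL.val_closed[OF eL(1) wT(2) eL(3)])
    have c2: "vA (pt h w) Y d \<in> carrier (stalk S (pt h w))" by (rule cA.val_closed[OF eA(1) wT(4) eA(3)])
    have c3: "ogerm S (pt h w) U3 s \<in> carrier (stalk S (pt h w))" by (rule S.ogerm_closed[OF U3(1) wT(5) U3(4)])
    have c4: "ogerm T w W1 \<rho> \<in> carrier (stalk T w)" "ogerm T w W2 r \<in> carrier (stalk T w)" "ogerm T w ?P (sh h U3 s) \<in> carrier (stalk T w)"
      using T.ogerm_closed[OF W1(1) w1(1) W1(4)] T.ogerm_closed[OF W2(1) w1(2) W2(4)] T.ogerm_closed[OF P w1(3) shc] by auto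
    have f: "ogerm T w ?W ?f = ogerm T w W2 r \<otimes>\<^bsub>stalk T w\<^esub> ogerm T w ?P (sh h U3 s) \<oplus>\<^bsub>stalk T w\<^esub> ogerm T w W1 \<rho>"
    proof -
      have "?W \<subseteq> W1" "?W \<subseteq> W2" "?W \<subseteq> ?P" by auto
      then show ?thesis
        unfolding T.ogerm_add[OF W(1) w c.m_closed[OF cl(2,3)] cl(1)] T.ogerm_mult[OF W(1) w cl(2,3)]
        using T.ogerm_res[OF W1(1) W(1) w _ W1(4)] T.ogerm_res[OF W2(1) W(1) w _ W2(4)] T.ogerm_res[OF P W(1) w _ shc]
        by simp
    qed
    have v: "r.tval (mgerm T L w W l, mgerm S A (pt h w) U a) =
        (ogerm T w W2 r \<otimes>\<^bsub>stalk T w\<^esub> vL w X e) \<otimes>\<^bsub>stalk T w\<^esub>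
        (ogerm T w ?P (sh h U3 s) \<otimes>\<^bsub>stalk T w\<^esub> stalk_map T h w (vA (pt h w) Y d))"
      unfolding e2[OF w1(2), symmetric] stalk_map_ogerm[OF U3(1) w1(3) U3(4), symmetric]
        ring_hom_mult[OF r.hom c3 c2, symmetric] e3[OF wT(5), symmetric]
      by (rule r.tval_eq) (use rD(1,2) k wT in auto)
    have "tsm w (germs w W U (add_mset k Z)) = r.tval (mgerm T L w W l, mgerm S A (pt h w) U a)
        \<oplus>\<^bsub>stalk T w\<^esub> tsm w (germs w W U Z)" unfolding k(1) by simp
    also have "\<dots> = ogerm T w ?W ?f \<otimes>\<^bsub>stalk T w\<^esub> (vL w X e \<otimes>\<^bsub>stalk T w\<^esub> stalk_map T h w (vA (pt h w) Y d))"
      unfolding v f e1[OF w1(1)] by (subst r.M.l_distr) (use c1 c2 c4 in \<open>simp_all add: r.M.m_ac\<close>)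
    finally show ?thesis .
  qed
  then show ?case using W cl c.a_closed c.m_closed by (intro exI[of _ ?W] exI[of _ ?f]) auto
qed

lemma pure_sum:
  assumes W: "T.Op W" and U: "S.Op U" "W \<subseteq> preim T h U"
    and l: "l \<in> carrier (msec L W)" and a: "a \<in> carrier (msec A U)"
  shows "tensor_sum T S h L A W U {#(l, a)#} \<in> carrier (msec G W)"
    and "w \<in> W \<Longrightarrow> tc w (tensor_sum T S h L A W U {#(l, a)#} w) =
      vL w W l \<otimes>\<^bsub>stalk T w\<^esub> stalk_map T h w (vA (pt h w) U a)"
proof -
  have r: "repr W U {#(l, a)#}" using assms by (auto simp: repr_def)
  show "tensor_sum T S h L A W U {#(l, a)#} \<in> carrier (msec G W)"
  proof (rule secI)
    show "tensor_sum T S h L A W U {#(l, a)#} \<in> extensional W" by (simp add: tensor_sum_def)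
    have "\<forall>w \<in> W. tensor_sum T S h L A W U {#(l, a)#} w = tcls w (germs w W U {#(l, a)#})"
      by (simp add: tensor_sum_def)
    then show "\<exists>W' U' Z. repr W' U' Z \<and> t \<in> W' \<and> W' \<subseteq> W \<and>
        (\<forall>w \<in> W'. tensor_sum T S h L A W U {#(l, a)#} w = tcls w (germs w W' U' Z))" if "t \<in> W" for t
      using r that by blast
  qed
  assume w: "w \<in> W"
  interpret r: rank_one_tensor "stalk T w" "mstalk T L w" "cL w" "stalk S (pt h w)" "mstalk S A (pt h w)" "cA (pt h w)" "stalk_map T h w"
    by (rule rt[OF reprD(5)[OF r w]])
  have "tensor_sum T S h L A W U {#(l, a)#} w = tcls w (germs w W U {#(l, a)#})"
    using w by (simp add: tensor_sum_def)
  then have "tc w (tensor_sum T S h L A W U {#(l, a)#} w) = r.tval (mgerm T L w W l, mgerm S A (pt h w) U a)"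
    using tc_repr[OF r w] by simp
  moreover have "r.tval (mgerm T L w W l, mgerm S A (pt h w) U a) = vL w W l \<otimes>\<^bsub>stalk T w\<^esub> stalk_map T h w (vA (pt h w) U a)"
    by (rule r.tval_eq) (use W U l a w reprD(6)[OF r w] in auto)
  ultimately show "tc w (tensor_sum T S h L A W U {#(l, a)#} w) =
      vL w W l \<otimes>\<^bsub>stalk T w\<^esub> stalk_map T h w (vA (pt h w) U a)" by simp
qed

text \<open>A section is by definition a family of elements of the stalks, so separation and gluing
  are pointwise. The substantial points are \<open>val_near\<close>, where two sections are compared
  through one frame by \<open>sum_expand\<close>, and the frame itself, the tensor of a frame of L
  and one of A.\<close>

lemma coordinates_tensor: "coordinates T G (\<lambda>t V f. tc t (f t))"
proof unfold_locales
  {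
    fix V assume V: "T.Op V"
    show "\<zero>\<^bsub>msec G V\<^esub> \<in> carrier (msec G V)"
    proof (rule secI)
      show "\<zero>\<^bsub>msec G V\<^esub> \<in> extensional V" by (simp add: tensor_along_def)
      fix t assume t: "t \<in> V"
      have "repr V (points S) {#}" unfolding repr_def
        using V openin_subset[OF V] pt_mem by (auto simp: preim_def)
      moreover have "\<zero>\<^bsub>msec G V\<^esub> w = tcls w (germs w V (points S) {#})" if "w \<in> V" for w
        using that by (simp add: tensor_along_def tensor_stalk_def tensor_module_def)
      ultimately show "\<exists>W U Z. repr W U Z \<and> t \<in> W \<and> W \<subseteq> V \<and> (\<forall>w \<in> W. \<zero>\<^bsub>msec G V\<^esub> w = tcls w (germs w W U Z))"
        using t by blast
    qed
    fix p assume p: "p \<in> V"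
    have "\<zero>\<^bsub>msec G V\<^esub> p = \<zero>\<^bsub>P p\<^esub>" using p by (simp add: tensor_along_def)
    then show "tc p (\<zero>\<^bsub>msec G V\<^esub> p) = \<zero>\<^bsub>stalk T p\<^esub>" using rank_one.zero_mem(2)[OF rP[OF T.Op_sub[OF V p]]] by simp
  }
  {
    fix V f g assume V: "T.Op V" and f: "f \<in> carrier (msec G V)" and g: "g \<in> carrier (msec G V)"
    have e: "(f \<oplus>\<^bsub>msec G V\<^esub> g) w = f w \<oplus>\<^bsub>P w\<^esub> g w" if "w \<in> V" for w
      using that by (simp add: tensor_along_def)
    show "f \<oplus>\<^bsub>msec G V\<^esub> g \<in> carrier (msec G V)"
    proof (rule secI)
      show "f \<oplus>\<^bsub>msec G V\<^esub> g \<in> extensional V" by (simp add: tensor_along_def)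
      fix t assume t: "t \<in> V"
      obtain W U Z where r: "repr W U Z" "t \<in> W" "W \<subseteq> V" "\<And>w. w \<in> W \<Longrightarrow> f w = tcls w (germs w W U Z)"
        by (rule secE[OF f t]) blast
      obtain W' U' Z' where r': "repr W' U' Z'" "t \<in> W'" "W' \<subseteq> V" "\<And>w. w \<in> W' \<Longrightarrow> g w = tcls w (germs w W' U' Z')"
        by (rule secE[OF g t]) blast
      let ?W = "W \<inter> W'" and ?U = "U \<inter> U'"
      have o: "T.Op ?W" "S.Op ?U" "?W \<subseteq> preim T h ?U" using reprD[OF r(1)] reprD[OF r'(1)] preim_Int by auto
      obtain Y where Y: "repr ?W ?U Y" "\<And>w. w \<in> ?W \<Longrightarrow> germs w ?W ?U Y = germs w W U Z"
        by (rule repr_restrict[OF r(1) o(1) _ o(2) _ o(3)]) auto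
      obtain Y' where Y': "repr ?W ?U Y'" "\<And>w. w \<in> ?W \<Longrightarrow> germs w ?W ?U Y' = germs w W' U' Z'"
        by (rule repr_restrict[OF r'(1) o(1) _ o(2) _ o(3)]) auto
      have "(f \<oplus>\<^bsub>msec G V\<^esub> g) w = tcls w (germs w ?W ?U (Y + Y'))" if w: "w \<in> ?W" for w
      proof -
        interpret r: rank_one_tensor "stalk T w" "mstalk T L w" "cL w" "stalk S (pt h w)" "mstalk S A (pt h w)" "cA (pt h w)" "stalk_map T h w"
          by (rule rt[OF reprD(5)[OF Y(1) w]])
        have wV: "w \<in> V" "w \<in> W" "w \<in> W'" using w r(3) by auto
        show ?thesis unfolding e[OF wV(1)] r(4)[OF wV(2)] r'(4)[OF wV(3)] image_mset_union Y(2)[OF w] Y'(2)[OF w] tensor_stalk_def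
          by (rule r.prod_add)
      qed
      moreover have "repr ?W ?U (Y + Y')" using Y(1) Y'(1) by (auto simp: repr_def)
      ultimately show "\<exists>W U Z. repr W U Z \<and> t \<in> W \<and> W \<subseteq> V \<and> (\<forall>w \<in> W. (f \<oplus>\<^bsub>msec G V\<^esub> g) w = tcls w (germs w W U Z))"
        using r r' by (intro exI[of _ ?W] exI[of _ ?U] exI[of _ "Y + Y'"]) auto
    qed
    fix p assume p: "p \<in> V"
    show "tc p ((f \<oplus>\<^bsub>msec G V\<^esub> g) p) = tc p (f p) \<oplus>\<^bsub>stalk T p\<^esub> tc p (g p)"
      unfolding e[OF p] by (rule rank_one.c_add[OF rP[OF T.Op_sub[OF V p]] sec_at[OF V f p] sec_at[OF V g p]])
  }
  {
    fix V r f assume V: "T.Op V" and r: "r \<in> carrier (sec T V)" and f: "f \<in> carrier (msec G V)"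
    have e: "(r \<odot>\<^bsub>msec G V\<^esub> f) w = ogerm T w V r \<odot>\<^bsub>P w\<^esub> f w" if "w \<in> V" for w
      using that by (simp add: tensor_along_def)
    show "r \<odot>\<^bsub>msec G V\<^esub> f \<in> carrier (msec G V)"
    proof (rule secI)
      show "r \<odot>\<^bsub>msec G V\<^esub> f \<in> extensional V" by (simp add: tensor_along_def)
      fix t assume t: "t \<in> V"
      obtain W U Z where rp: "repr W U Z" "t \<in> W" "W \<subseteq> V" "\<And>w. w \<in> W \<Longrightarrow> f w = tcls w (germs w W U Z)"
        by (rule secE[OF f t]) blast
      note rD = reprD[OF rp(1)]
      let ?r = "res T V W r"
      let ?Z = "image_mset (\<lambda>(l, a). (?r \<odot>\<^bsub>msec L W\<^esub> l, a)) Z"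
      have rc: "?r \<in> carrier (sec T W)" by (rule sheaf_resD[OF T.sheafO V rD(1) rp(3) r])
      have r2: "repr W U ?Z" unfolding repr_def using rD L.mem_smult[OF rD(1) rc] by auto
      have "(r \<odot>\<^bsub>msec G V\<^esub> f) w = tcls w (germs w W U ?Z)" if w: "w \<in> W" for w
      proof -
        interpret r: rank_one_tensor "stalk T w" "mstalk T L w" "cL w" "stalk S (pt h w)" "mstalk S A (pt h w)" "cA (pt h w)" "stalk_map T h w"
          by (rule rt[OF rD(5)[OF w]])
        have wV: "w \<in> V" using w rp(3) by auto
        have "germs w W U ?Z = r.scale (ogerm T w V r) (germs w W U Z)"
          unfolding image_mset.compositionality
        proof (rule image_mset_cong)
          fix k assume k: "k \<in># Z"
          obtain l a where "k = (l, a)" "l \<in> carrier (msec L W)" using rD(4) k by (cases k) auto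
          then show "((\<lambda>(l, a). (mgerm T L w W l, mgerm S A (pt h w) U a)) \<circ> (\<lambda>(l, a). (?r \<odot>\<^bsub>msec L W\<^esub> l, a))) k =
            ((\<lambda>(m, n). (ogerm T w V r \<odot>\<^bsub>mstalk T L w\<^esub> m, n)) \<circ> (\<lambda>(l, a). (mgerm T L w W l, mgerm S A (pt h w) U a))) k"
            using L.mgerm_smult[OF rD(1) w rc] T.ogerm_res[OF V rD(1) w rp(3) r] by simp
        qed
        then show ?thesis
          unfolding e[OF wV] rp(4)[OF w] tensor_stalk_def
          using r.prod_smult[OF T.ogerm_closed[OF V wV r]] by simp
      qed
      then show "\<exists>W U Z. repr W U Z \<and> t \<in> W \<and> W \<subseteq> V \<and> (\<forall>w \<in> W. (r \<odot>\<^bsub>msec G V\<^esub> f) w = tcls w (germs w W U Z))"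
        using r2 rp by blast
    qed
    fix p assume p: "p \<in> V"
    show "tc p ((r \<odot>\<^bsub>msec G V\<^esub> f) p) = ogerm T p V r \<otimes>\<^bsub>stalk T p\<^esub> tc p (f p)"
      unfolding e[OF p] by (rule rank_one.c_smult[OF rP[OF T.Op_sub[OF V p]] T.ogerm_closed[OF V p r] sec_at[OF V f p]])
  }
  {
    fix V V' f assume V: "T.Op V" "T.Op V'" "V' \<subseteq> V" and f: "f \<in> carrier (msec G V)"
    have e: "mres G V V' f w = f w" if "w \<in> V'" for w using that by (simp add: tensor_along_def)
    show "mres G V V' f \<in> carrier (msec G V')"
    proof (rule secI)
      show "mres G V V' f \<in> extensional V'" by (simp add: tensor_along_def)
      fix t assume t: "t \<in> V'"
      then have tV: "t \<in> V" using V by auto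
      obtain W U Z where rp: "repr W U Z" "t \<in> W" "W \<subseteq> V" "\<And>w. w \<in> W \<Longrightarrow> f w = tcls w (germs w W U Z)"
        by (rule secE[OF f tV]) blast
      let ?W = "W \<inter> V'"
      have o: "T.Op ?W" "?W \<subseteq> W" using reprD(1)[OF rp(1)] V by auto
      obtain Z' where Z': "repr ?W U Z'" "\<And>w. w \<in> ?W \<Longrightarrow> germs w ?W U Z' = germs w W U Z"
        by (rule repr_restrict[OF rp(1) o reprD(2)[OF rp(1)] subset_refl]) (use o reprD(3)[OF rp(1)] in auto)
      then show "\<exists>W U Z. repr W U Z \<and> t \<in> W \<and> W \<subseteq> V' \<and> (\<forall>w \<in> W. mres G V V' f w = tcls w (germs w W U Z))"
        using t rp e by (intro exI[of _ ?W] exI[of _ U] exI[of _ Z']) auto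
    qed
    fix p assume "p \<in> V'"
    then show "tc p (mres G V V' f p) = tc p (f p)" using e by simp
  }
  {
    fix V p f assume V: "T.Op V" "p \<in> V" and f: "f \<in> carrier (msec G V)"
    show "tc p (f p) \<in> carrier (stalk T p)"
      by (rule rank_one.c_closed[OF rP[OF T.Op_sub[OF V]] sec_at[OF V(1) f V(2)]])
  }
  {
    fix V f g assume V: "T.Op V" and f: "f \<in> carrier (msec G V)" and g: "g \<in> carrier (msec G V)"
      and e: "\<And>p. p \<in> V \<Longrightarrow> tc p (f p) = tc p (g p)"
    show "f = g"
    proof (rule extensionalityI)
      show "f \<in> extensional V" "g \<in> extensional V" using f g by (auto simp: sec_iff)
      fix p assume p: "p \<in> V"
      show "f p = g p"
        by (rule rank_one.c_inj[OF rP[OF T.Op_sub[OF V p]] sec_at[OF V f p] sec_at[OF V g p] e[OF p]])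
    qed
  }
  {
    fix V \<xi> assume V: "T.Op V" and loc: "\<And>p. p \<in> V \<Longrightarrow> \<exists>V' f. T.Op V' \<and> p \<in> V' \<and> V' \<subseteq> V \<and> f \<in> carrier (msec G V') \<and>
       (\<forall>q \<in> V'. tc q (f q) = \<xi> q)"
    \<comment> \<open>The coordinates force the value at each point; that the family is locally a
      sum of tensors is inherited from the given local sections.\<close>
    define f where "f = (\<lambda>t \<in> V. inv_into (carrier (P t)) (tc t) (\<xi> t))"
    have fx: "f q = x q" if V': "T.Op V'" "V' \<subseteq> V" "q \<in> V'" "x \<in> carrier (msec G V')" "tc q (x q) = \<xi> q" for V' x q
    proof -
      have "q \<in> V" using V' by auto
      then have "f q = inv_into (carrier (P q)) (tc q) (tc q (x q))" unfolding V'(5) by (simp add: f_def)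
      also have "\<dots> = x q"
        by (rule inv_into_f_f[OF bij_betw_imp_inj_on[OF rank_one.bij[OF rP[OF T.Op_sub[OF V'(1,3)]]]] sec_at[OF V'(1,4,3)]])
      finally show ?thesis .
    qed
    show "\<exists>f \<in> carrier (msec G V). \<forall>q \<in> V. tc q (f q) = \<xi> q"
    proof (rule bexI[of _ f])
      show "\<forall>q \<in> V. tc q (f q) = \<xi> q"
      proof
        fix q assume q: "q \<in> V"
        obtain V' x where V': "T.Op V'" "q \<in> V'" "V' \<subseteq> V" "x \<in> carrier (msec G V')" "tc q (x q) = \<xi> q"
          using loc[OF q] by blast
        show "tc q (f q) = \<xi> q" using fx[OF V'(1,3,2,4,5)] V'(5) by simp
      qed
      show "f \<in> carrier (msec G V)"
      proof (rule secI)
        show "f \<in> extensional V" by (simp add: f_def)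
        fix t assume t: "t \<in> V"
        obtain V' x where V': "T.Op V'" "t \<in> V'" "V' \<subseteq> V" "x \<in> carrier (msec G V')" "\<And>q. q \<in> V' \<Longrightarrow> tc q (x q) = \<xi> q"
          using loc[OF t] by blast
        obtain W U Z where rp: "repr W U Z" "t \<in> W" "W \<subseteq> V'" "\<And>w. w \<in> W \<Longrightarrow> x w = tcls w (germs w W U Z)"
          by (rule secE[OF V'(4,2)]) blast
        have "f w = tcls w (germs w W U Z)" if w: "w \<in> W" for w
          using fx[OF V'(1,3) _ V'(4) V'(5)] rp(3,4) w by auto
        then show "\<exists>W U Z. repr W U Z \<and> t \<in> W \<and> W \<subseteq> V \<and> (\<forall>w \<in> W. f w = tcls w (germs w W U Z))"
          using rp V'(3) by (intro exI[of _ W] exI[of _ U] exI[of _ Z]) auto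
      qed
    qed
  }
  {
    fix V p f V' g
    assume V: "T.Op V" "p \<in> V" "f \<in> carrier (msec G V)" and V': "T.Op V'" "p \<in> V'" "g \<in> carrier (msec G V')"
      and e: "tc p (f p) = tc p (g p)"
    have p: "p \<in> points T" by (rule T.Op_sub[OF V(1,2)])
    obtain X l where X: "T.Op X" "p \<in> X" "l \<in> carrier (msec L X)" and lu: "\<And>q. q \<in> X \<Longrightarrow> vL q X l \<in> Units (stalk T q)"
      using cL.frame[OF p] by blast
    obtain Y a where Y: "S.Op Y" "pt h p \<in> Y" "a \<in> carrier (msec A Y)" and au: "\<And>q. q \<in> Y \<Longrightarrow> vA q Y a \<in> Units (stalk S q)"
      using cA.frame[OF pt_mem[OF p]] by blast
    obtain W U Z where r: "repr W U Z" "p \<in> W" "W \<subseteq> V" "\<And>w. w \<in> W \<Longrightarrow> f w = tcls w (germs w W U Z)"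
      by (rule secE[OF V(3,2)]) blast
    obtain W' U' Z' where r': "repr W' U' Z'" "p \<in> W'" "W' \<subseteq> V'" "\<And>w. w \<in> W' \<Longrightarrow> g w = tcls w (germs w W' U' Z')"
      by (rule secE[OF V'(3,2)]) blast
    let ?g = "\<lambda>w. vL w X l \<otimes>\<^bsub>stalk T w\<^esub> stalk_map T h w (vA (pt h w) Y a)"
    obtain W1 \<rho> where W1: "T.Op W1" "p \<in> W1" "W1 \<subseteq> W \<inter> X \<inter> preim T h Y" "\<rho> \<in> carrier (sec T W1)"
      and e1: "\<And>w. w \<in> W1 \<Longrightarrow> tsm w (germs w W U Z) = ogerm T w W1 \<rho> \<otimes>\<^bsub>stalk T w\<^esub> ?g w"
      using sum_expand[OF r(1,2) X lu[OF X(2)] Y au[OF Y(2)]] by blast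
    obtain W2 \<rho>' where W2: "T.Op W2" "p \<in> W2" "W2 \<subseteq> W' \<inter> X \<inter> preim T h Y" "\<rho>' \<in> carrier (sec T W2)"
      and e2: "\<And>w. w \<in> W2 \<Longrightarrow> tsm w (germs w W' U' Z') = ogerm T w W2 \<rho>' \<otimes>\<^bsub>stalk T w\<^esub> ?g w"
      using sum_expand[OF r'(1,2) X lu[OF X(2)] Y au[OF Y(2)]] by blast
    have f1: "tc w (f w) = ogerm T w W1 \<rho> \<otimes>\<^bsub>stalk T w\<^esub> ?g w" if w: "w \<in> W1" for w
    proof -
      have wW: "w \<in> W" using w W1(3) by auto
      show ?thesis unfolding r(4)[OF wW] tc_repr[OF r(1) wW] by (rule e1[OF w])
    qed
    have g1: "tc w (g w) = ogerm T w W2 \<rho>' \<otimes>\<^bsub>stalk T w\<^esub> ?g w" if w: "w \<in> W2" for w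
    proof -
      have wW: "w \<in> W'" using w W2(3) by auto
      show ?thesis unfolding r'(4)[OF wW] tc_repr[OF r'(1) wW] by (rule e2[OF w])
    qed
    interpret r: rank_one_tensor "stalk T p" "mstalk T L p" "cL p" "stalk S (pt h p)" "mstalk S A (pt h p)" "cA (pt h p)" "stalk_map T h p"
      by (rule rt[OF p])
    have "stalk_map T h p (vA (pt h p) Y a) \<in> Units (stalk T p)"
      by (rule ring_hom_Units[OF r.hom r.N.ring_axioms au[OF Y(2)]])
    then have gu: "?g p \<in> Units (stalk T p)" using lu[OF X(2)] by simp
    \<comment> \<open>The common frame has a unit coordinate at p, so the two coefficient functions
      have the same germ at p and agree near p.\<close>
    have "ogerm T p W1 \<rho> = ogerm T p W2 \<rho>'"
      using e[unfolded f1[OF W1(2)] g1[OF W2(2)]] gu T.ogerm_closed[OF W1(1,2,4)] T.ogerm_closed[OF W2(1,2,4)]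
      by (metis r.M.Units_closed r.M.Units_l_cancel r.M.m_comm)
    then obtain W3 where W3: "T.Op W3" "p \<in> W3" "W3 \<subseteq> W1 \<inter> W2"
      "\<And>q. q \<in> W3 \<Longrightarrow> ogerm T q W1 \<rho> = ogerm T q W2 \<rho>'"
      by (rule T.ogerm_eqD[OF W1(1,2,4) W2(1,2,4)]) blast
    have "tc q (f q) = tc q (g q)" if q: "q \<in> W3" for q
      using f1[of q] g1[of q] W3(3) W3(4)[OF q] q by auto
    then show "\<exists>W. T.Op W \<and> p \<in> W \<and> W \<subseteq> V \<inter> V' \<and> (\<forall>q \<in> W. tc q (f q) = tc q (g q))"
      using W3 W1(3) W2(3) r(3) r'(3) by (intro exI[of _ W3]) blast
  }
  {
    fix p assume p: "p \<in> points T"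
    obtain X l where X: "T.Op X" "p \<in> X" "l \<in> carrier (msec L X)" and lu: "\<And>q. q \<in> X \<Longrightarrow> vL q X l \<in> Units (stalk T q)"
      using cL.frame[OF p] by blast
    obtain Y a where Y: "S.Op Y" "pt h p \<in> Y" "a \<in> carrier (msec A Y)" and au: "\<And>q. q \<in> Y \<Longrightarrow> vA q Y a \<in> Units (stalk S q)"
      using cA.frame[OF pt_mem[OF p]] by blast
    let ?W = "X \<inter> preim T h Y"
    have W: "T.Op ?W" "p \<in> ?W" "?W \<subseteq> preim T h Y" using X Y p preim_open[OF Y(1)] by (auto simp: preim_def)
    let ?l = "mres L X ?W l"
    have l: "?l \<in> carrier (msec L ?W)" by (rule L.mem_res[OF X(1) W(1) _ X(3)]) auto
    note ps = pure_sum[OF W(1) Y(1) W(3) l Y(3)]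
    have "tc q (tensor_sum T S h L A ?W Y {#(?l, a)#} q) \<in> Units (stalk T q)" if q: "q \<in> ?W" for q
    proof -
      have q': "q \<in> X" "pt h q \<in> Y" "q \<in> points T" using q by (auto simp: preim_def)
      interpret r: rank_one_tensor "stalk T q" "mstalk T L q" "cL q" "stalk S (pt h q)" "mstalk S A (pt h q)" "cA (pt h q)" "stalk_map T h q"
        by (rule rt[OF q'(3)])
      have "stalk_map T h q (vA (pt h q) Y a) \<in> Units (stalk T q)"
        by (rule ring_hom_Units[OF r.hom r.N.ring_axioms au[OF q'(2)]])
      then show ?thesis
        unfolding ps(2)[OF q] using lu[OF q'(1)] cL.val_res[OF X(1) W(1) _ q X(3)] by simp
    qed
    then show "\<exists>U e. T.Op U \<and> p \<in> U \<and> e \<in> carrier (msec G U) \<and> (\<forall>q \<in> U. tc q (e q) \<in> Units (stalk T q))"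
      using W ps(1) by blast
  }
qed

end

section \<open>The spectrum of a residue field\<close>

text \<open>The quotient by the maximal ideal is realized on chosen representatives of the cosets,
  so that its elements have the same type as those of R; the cosets themselves would be sets.
  \<open>image_ring\<close> transports the operations along the choice \<open>\<pi>\<close>.\<close>

lemma residue_field_exists:
  fixes R :: "'a ring"
  assumes R: "local_ring R"
  obtains K :: "'a ring" and \<pi> where "field K" "\<pi> \<in> ring_hom R K"
    "\<And>x. x \<in> carrier R \<Longrightarrow> \<pi> x = \<zero>\<^bsub>K\<^esub> \<longleftrightarrow> x \<in> nonunits R"
proof -
  interpret cring R using R by (simp add: local_ring_def)
  interpret I: ideal "nonunits R" R using R by (simp add: local_ring_def)
  let ?I = "nonunits R"
  define \<pi> where "\<pi> a = (SOME b. b \<in> carrier R \<and> a \<ominus>\<^bsub>R\<^esub> b \<in> ?I)" for a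
  have Iadd: "x \<oplus>\<^bsub>R\<^esub> y \<in> ?I" if "x \<in> ?I" "y \<in> ?I" for x y using that by (rule I.a_closed)
  have Ineg: "\<ominus>\<^bsub>R\<^esub> x \<in> ?I" if "x \<in> ?I" for x using that by (rule I.a_inv_closed)
  have sub: "a \<ominus>\<^bsub>R\<^esub> c \<in> ?I" if "a \<ominus>\<^bsub>R\<^esub> b \<in> ?I" "b \<ominus>\<^bsub>R\<^esub> c \<in> ?I" "a \<in> carrier R" "b \<in> carrier R" "c \<in> carrier R" for a b c
  proof -
    have "a \<ominus>\<^bsub>R\<^esub> c = (a \<ominus>\<^bsub>R\<^esub> b) \<oplus>\<^bsub>R\<^esub> (b \<ominus>\<^bsub>R\<^esub> c)" using that(3-5) by algebra
    then show ?thesis using Iadd[OF that(1,2)] by simp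
  qed
  have sym: "b \<ominus>\<^bsub>R\<^esub> a \<in> ?I" if "a \<ominus>\<^bsub>R\<^esub> b \<in> ?I" "a \<in> carrier R" "b \<in> carrier R" for a b
  proof -
    have "b \<ominus>\<^bsub>R\<^esub> a = \<ominus>\<^bsub>R\<^esub> (a \<ominus>\<^bsub>R\<^esub> b)" using that(2,3) by algebra
    then show ?thesis using Ineg[OF that(1)] by simp
  qed
  have pi: "\<pi> a \<in> carrier R \<and> a \<ominus>\<^bsub>R\<^esub> \<pi> a \<in> ?I" if a: "a \<in> carrier R" for a
    unfolding \<pi>_def
  proof (rule someI)
    have "a \<ominus>\<^bsub>R\<^esub> a = \<zero>\<^bsub>R\<^esub>" using a by algebra
    then show "a \<in> carrier R \<and> a \<ominus>\<^bsub>R\<^esub> a \<in> ?I" using a I.zero_closed by simp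
  qed
  have weak: "weak_ring_morphism \<pi> ?I R"
  proof (rule weak_ring_morphismI[OF I.ideal_axioms], rule iffI)
    fix a b assume a: "a \<in> carrier R" and b: "b \<in> carrier R"
    { assume e: "\<pi> a = \<pi> b"
      show "a \<ominus>\<^bsub>R\<^esub> b \<in> ?I"
        using sub[of a "\<pi> a" b] sym[of b "\<pi> b"] pi[OF a] pi[OF b] a b unfolding e by blast }
    { assume e: "a \<ominus>\<^bsub>R\<^esub> b \<in> ?I"
      \<comment> \<open>For elements of one coset the predicates from which \<open>\<pi>\<close>
        chooses are the same, hence so are the choices.\<close>
      have "(a \<ominus>\<^bsub>R\<^esub> c \<in> ?I) = (b \<ominus>\<^bsub>R\<^esub> c \<in> ?I)" if c: "c \<in> carrier R" for c
        using sub[OF e _ a b c] sub[OF sym[OF e a b] _ b a c] by blast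
      then show "\<pi> a = \<pi> b" unfolding \<pi>_def by (metis (lifting)) }
  qed
  let ?K = "image_ring \<pi> R"
  have hom: "\<pi> \<in> ring_hom R ?K" by (rule weak_ring_morphism_is_hom[OF weak])
  interpret K: ring ?K by (rule image_ring_is_ring[OF weak])
  have zero: "\<pi> x = \<zero>\<^bsub>?K\<^esub> \<longleftrightarrow> x \<in> ?I" if x: "x \<in> carrier R" for x
  proof -
    have "\<pi> x = \<zero>\<^bsub>?K\<^esub> \<longleftrightarrow> x \<ominus>\<^bsub>R\<^esub> \<zero>\<^bsub>R\<^esub> \<in> ?I"
      unfolding image_ring_zero by (rule weak_ring_morphism.inj_mod_ideal[OF weak x zero_closed])
    also have "x \<ominus>\<^bsub>R\<^esub> \<zero>\<^bsub>R\<^esub> = x" using x by algebra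
    finally show ?thesis .
  qed
  have surj: "\<exists>a \<in> carrier R. x = \<pi> a" if "x \<in> carrier ?K" for x
    using that unfolding image_ring_carrier by blast
  interpret K: cring ?K
  proof (unfold_locales)
    fix x y assume "x \<in> carrier ?K" "y \<in> carrier ?K"
    then obtain a b where "a \<in> carrier R" "x = \<pi> a" "b \<in> carrier R" "y = \<pi> b" using surj by metis
    then show "x \<otimes>\<^bsub>?K\<^esub> y = y \<otimes>\<^bsub>?K\<^esub> x" using ring_hom_mult[OF hom] m_comm by metis
  qed
  have one: "\<one>\<^bsub>?K\<^esub> \<noteq> \<zero>\<^bsub>?K\<^esub>"
    using zero[OF one_closed] ring_hom_one[OF hom] by (auto simp: nonunits_def)
  have fieldK: "field ?K"
  proof (rule K.cring_fieldI, intro equalityI subsetI)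
    fix x assume x: "x \<in> Units ?K"
    then have "x \<noteq> \<zero>\<^bsub>?K\<^esub>" using one K.l_null by (metis K.Units_inv_closed K.Units_r_inv)
    then show "x \<in> carrier ?K - {\<zero>\<^bsub>?K\<^esub>}" using x by auto
  next
    fix x assume "x \<in> carrier ?K - {\<zero>\<^bsub>?K\<^esub>}"
    then obtain a where a: "a \<in> carrier R" "x = \<pi> a" "\<pi> a \<noteq> \<zero>\<^bsub>?K\<^esub>" using surj by blast
    then have "a \<in> Units R" using zero[OF a(1)] by (auto simp: nonunits_def)
    then show "x \<in> Units ?K" unfolding a(2) by (rule ring_hom_Units[OF hom ring_axioms])
  qed
  show ?thesis by (rule that[OF fieldK hom zero])
qed

text \<open>The fraction \<open>x / 1\<close> in the localization of a field at its zero ideal.\<close>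

definition field_frac :: "'k ring \<Rightarrow> 'k \<Rightarrow> ('k \<times> 'k) set" where
  "field_frac K x = {(b, t). b \<in> carrier K \<and> t \<in> carrier K - {\<zero>\<^bsub>K\<^esub>} \<and> x \<otimes>\<^bsub>K\<^esub> t = b}"

section \<open>The spectrum of a field\<close>

locale field_spec = field K for K :: "'k ring"
begin

abbreviation fr where "fr \<equiv> field_frac K"
abbreviation loc where "loc \<equiv> localization K {\<zero>\<^bsub>K\<^esub>}"

text \<open>In a field the auxiliary factor u in the equality of fractions cancels, and so does the
  denominator s, which leaves x t = b.\<close>

lemma frac_eq:
  assumes a: "a \<in> carrier K" and s: "s \<in> carrier K - {\<zero>\<^bsub>K\<^esub>}" and x: "x \<in> carrier K" and e: "a = x \<otimes>\<^bsub>K\<^esub> s"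
  shows "frac K {\<zero>\<^bsub>K\<^esub>} a s = fr x"
proof -
  have "(\<exists>u \<in> carrier K - {\<zero>\<^bsub>K\<^esub>}. u \<otimes>\<^bsub>K\<^esub> (a \<otimes>\<^bsub>K\<^esub> t) = u \<otimes>\<^bsub>K\<^esub> (b \<otimes>\<^bsub>K\<^esub> s)) \<longleftrightarrow> x \<otimes>\<^bsub>K\<^esub> t = b"
    if b: "b \<in> carrier K" and t: "t \<in> carrier K" for b t
  proof
    assume "\<exists>u \<in> carrier K - {\<zero>\<^bsub>K\<^esub>}. u \<otimes>\<^bsub>K\<^esub> (a \<otimes>\<^bsub>K\<^esub> t) = u \<otimes>\<^bsub>K\<^esub> (b \<otimes>\<^bsub>K\<^esub> s)"
    then have "a \<otimes>\<^bsub>K\<^esub> t = b \<otimes>\<^bsub>K\<^esub> s" using m_lcancel a b t s by auto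
    then have "s \<otimes>\<^bsub>K\<^esub> (x \<otimes>\<^bsub>K\<^esub> t) = s \<otimes>\<^bsub>K\<^esub> b" unfolding e using x b s t by (simp add: m_ac)
    then show "x \<otimes>\<^bsub>K\<^esub> t = b" using m_lcancel[of s "x \<otimes>\<^bsub>K\<^esub> t" b] x b s t by auto
  next
    assume "x \<otimes>\<^bsub>K\<^esub> t = b"
    then have "\<one>\<^bsub>K\<^esub> \<otimes>\<^bsub>K\<^esub> (a \<otimes>\<^bsub>K\<^esub> t) = \<one>\<^bsub>K\<^esub> \<otimes>\<^bsub>K\<^esub> (b \<otimes>\<^bsub>K\<^esub> s)" unfolding e using x b s t by (auto simp: m_ac)
    then show "\<exists>u \<in> carrier K - {\<zero>\<^bsub>K\<^esub>}. u \<otimes>\<^bsub>K\<^esub> (a \<otimes>\<^bsub>K\<^esub> t) = u \<otimes>\<^bsub>K\<^esub> (b \<otimes>\<^bsub>K\<^esub> s)"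
      using one_not_zero one_closed by blast
  qed
  then show ?thesis unfolding frac_def field_frac_def by auto
qed

lemma frac_eq_inv:
  assumes a: "a \<in> carrier K" and s: "s \<in> carrier K - {\<zero>\<^bsub>K\<^esub>}"
  obtains x where "x \<in> carrier K" "frac K {\<zero>\<^bsub>K\<^esub>} a s = fr x"
proof
  have u: "s \<in> Units K" using s by (simp add: field_Units)
  show x: "a \<otimes>\<^bsub>K\<^esub> inv\<^bsub>K\<^esub> s \<in> carrier K" using a u by auto
  show "frac K {\<zero>\<^bsub>K\<^esub>} a s = fr (a \<otimes>\<^bsub>K\<^esub> inv\<^bsub>K\<^esub> s)"
    by (rule frac_eq[OF a s x]) (use a u s in \<open>simp add: m_assoc\<close>)
qed

lemma fr_self: "x \<in> carrier K \<Longrightarrow> (x, \<one>\<^bsub>K\<^esub>) \<in> fr x"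
  by (simp add: field_frac_def)

lemma fr_inj: "x \<in> carrier K \<Longrightarrow> y \<in> carrier K \<Longrightarrow> fr x = fr y \<Longrightarrow> x = y"
  using fr_self[of x] by (simp add: field_frac_def)

lemma fr_one: "x \<in> carrier K \<Longrightarrow> fr x = frac K {\<zero>\<^bsub>K\<^esub>} x \<one>\<^bsub>K\<^esub>"
  by (rule frac_eq[symmetric]) auto

text \<open>As for germs, operations on fractions are unions over representatives; those of x / 1
  are the pairs (x t, t) with t nonzero.\<close>

lemma fr_UN:
  assumes x: "x \<in> carrier K"
    and c: "\<And>t. t \<in> carrier K - {\<zero>\<^bsub>K\<^esub>} \<Longrightarrow> f (x \<otimes>\<^bsub>K\<^esub> t) t = c"
  shows "(\<Union>(a, t) \<in> fr x. f a t) = c"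
proof -
  have "case k of (a, t) \<Rightarrow> f a t = c" if "k \<in> fr x" for k
    using that c by (auto simp: field_frac_def)
  then show ?thesis using fr_self[OF x] by fastforce
qed

lemma loc_carrier: "carrier loc = fr ` carrier K"
proof (intro equalityI subsetI)
  fix f assume "f \<in> carrier loc"
  then obtain a s where "f = frac K {\<zero>\<^bsub>K\<^esub>} a s" "a \<in> carrier K" "s \<in> carrier K - {\<zero>\<^bsub>K\<^esub>}"
    by (auto simp: localization_def)
  then show "f \<in> fr ` carrier K" by (metis frac_eq_inv imageI)
next
  fix f assume "f \<in> fr ` carrier K"
  then obtain x where x: "x \<in> carrier K" "f = fr x" by blast
  have "\<exists>a s. f = frac K {\<zero>\<^bsub>K\<^esub>} a s \<and> a \<in> carrier K \<and> s \<in> carrier K - {\<zero>\<^bsub>K\<^esub>}"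
    unfolding x(2) fr_one[OF x(1)]
    by (rule exI[of _ x], rule exI[of _ "\<one>\<^bsub>K\<^esub>"]) (use x(1) in simp)
  then show "f \<in> carrier loc" by (simp add: localization_def)
qed

lemma loc_simps:
  assumes x: "x \<in> carrier K" and y: "y \<in> carrier K"
  shows "fr x \<otimes>\<^bsub>loc\<^esub> fr y = fr (x \<otimes>\<^bsub>K\<^esub> y)" "fr x \<oplus>\<^bsub>loc\<^esub> fr y = fr (x \<oplus>\<^bsub>K\<^esub> y)"
    "\<one>\<^bsub>loc\<^esub> = fr \<one>\<^bsub>K\<^esub>" "\<zero>\<^bsub>loc\<^esub> = fr \<zero>\<^bsub>K\<^esub>"
proof -
  have st: "s \<otimes>\<^bsub>K\<^esub> t \<in> carrier K - {\<zero>\<^bsub>K\<^esub>}" if "s \<in> carrier K - {\<zero>\<^bsub>K\<^esub>}" "t \<in> carrier K - {\<zero>\<^bsub>K\<^esub>}" for s t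
    using that integral_iff by auto
  show "fr x \<otimes>\<^bsub>loc\<^esub> fr y = fr (x \<otimes>\<^bsub>K\<^esub> y)"
    unfolding localization_def monoid.simps
  proof (rule fr_UN[OF x], rule fr_UN[OF y])
    fix s t assume s: "s \<in> carrier K - {\<zero>\<^bsub>K\<^esub>}" and t: "t \<in> carrier K - {\<zero>\<^bsub>K\<^esub>}"
    show "frac K {\<zero>\<^bsub>K\<^esub>} (x \<otimes>\<^bsub>K\<^esub> s \<otimes>\<^bsub>K\<^esub> (y \<otimes>\<^bsub>K\<^esub> t)) (s \<otimes>\<^bsub>K\<^esub> t) = fr (x \<otimes>\<^bsub>K\<^esub> y)"
      by (rule frac_eq[OF _ st[OF s t]]) (use x y s t in \<open>auto simp: m_ac\<close>)
  qed
  show "fr x \<oplus>\<^bsub>loc\<^esub> fr y = fr (x \<oplus>\<^bsub>K\<^esub> y)"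
    unfolding localization_def ring_record_simps
  proof (rule fr_UN[OF x], rule fr_UN[OF y])
    fix s t assume s: "s \<in> carrier K - {\<zero>\<^bsub>K\<^esub>}" and t: "t \<in> carrier K - {\<zero>\<^bsub>K\<^esub>}"
    show "frac K {\<zero>\<^bsub>K\<^esub>} (x \<otimes>\<^bsub>K\<^esub> s \<otimes>\<^bsub>K\<^esub> t \<oplus>\<^bsub>K\<^esub> y \<otimes>\<^bsub>K\<^esub> t \<otimes>\<^bsub>K\<^esub> s) (s \<otimes>\<^bsub>K\<^esub> t) = fr (x \<oplus>\<^bsub>K\<^esub> y)"
      by (rule frac_eq[OF _ st[OF s t]]) (use x y s t in \<open>auto simp: l_distr r_distr m_ac\<close>)
  qed
  show "\<one>\<^bsub>loc\<^esub> = fr \<one>\<^bsub>K\<^esub>" "\<zero>\<^bsub>loc\<^esub> = fr \<zero>\<^bsub>K\<^esub>"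
    by (simp_all add: fr_one) (simp_all add: localization_def)
qed

lemma primeideal_iff: "primeideal P K \<longleftrightarrow> P = {\<zero>\<^bsub>K\<^esub>}"
proof
  assume P: "primeideal P K"
  interpret P: primeideal P K by (rule P)
  have "P \<in> {{\<zero>\<^bsub>K\<^esub>}, carrier K}" using all_ideals P.ideal_axioms by blast
  then show "P = {\<zero>\<^bsub>K\<^esub>}" using P.I_notcarr by auto
next
  assume "P = {\<zero>\<^bsub>K\<^esub>}"
  then show "primeideal P K" using zeroprimeideal by simp
qed

text \<open>The only prime ideal is 0; the two open sets are cut out by the empty set and by
  1.\<close>

lemma openin_zariski: "openin (zariski K) U \<longleftrightarrow> U \<subseteq> {{\<zero>\<^bsub>K\<^esub>}}"
proof -
  have "openin (zariski K) U \<longleftrightarrow> (\<exists>E \<subseteq> carrier K. U = {P. primeideal P K \<and> \<not> E \<subseteq> P})"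
    unfolding zariski_def topology_inverse'[OF istopology_zariski] ..
  also have "\<dots> \<longleftrightarrow> (\<exists>E \<subseteq> carrier K. U = {P. P = {\<zero>\<^bsub>K\<^esub>} \<and> \<not> E \<subseteq> P})"
    by (simp only: primeideal_iff)
  also have "\<dots> \<longleftrightarrow> U \<subseteq> {{\<zero>\<^bsub>K\<^esub>}}"
  proof
    assume "U \<subseteq> {{\<zero>\<^bsub>K\<^esub>}}"
    then consider "U = {}" | "U = {{\<zero>\<^bsub>K\<^esub>}}" by blast
    then show "\<exists>E \<subseteq> carrier K. U = {P. P = {\<zero>\<^bsub>K\<^esub>} \<and> \<not> E \<subseteq> P}"
    proof cases
      case 1
      then show ?thesis by (intro exI[of _ "{}"]) auto
    next
      case 2
      then show ?thesis by (intro exI[of _ "{\<one>\<^bsub>K\<^esub>}"]) auto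
    qed
  qed blast
  finally show ?thesis .
qed

lemma zariski_eq: "zariski K = discrete_topology {{\<zero>\<^bsub>K\<^esub>}}"
  unfolding topology_eq openin_zariski by simp

abbreviation sp where "sp x \<equiv> (\<lambda>P \<in> {{\<zero>\<^bsub>K\<^esub>}}. fr x)"

lemma Spec_sec_carrier: "carrier (sec (Spec K) {{\<zero>\<^bsub>K\<^esub>}}) = sp ` carrier K"
proof (intro equalityI subsetI)
  fix f assume "f \<in> carrier (sec (Spec K) {{\<zero>\<^bsub>K\<^esub>}})"
  then have f: "f \<in> (\<Pi>\<^sub>E P \<in> {{\<zero>\<^bsub>K\<^esub>}}. carrier (localization K P))" by (simp add: Spec_def)
  then have "f {\<zero>\<^bsub>K\<^esub>} \<in> fr ` carrier K" using loc_carrier by auto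
  then obtain x where x: "x \<in> carrier K" "f {\<zero>\<^bsub>K\<^esub>} = fr x" by blast
  have "f = sp x" by (rule extensionalityI[of _ "{{\<zero>\<^bsub>K\<^esub>}}"]) (use f x in \<open>auto simp: PiE_def\<close>)
  then show "f \<in> sp ` carrier K" using x(1) by blast
next
  fix f assume "f \<in> sp ` carrier K"
  then obtain x where x: "x \<in> carrier K" "f = sp x" by blast
  have "\<exists>V a s. openin (zariski K) V \<and> {\<zero>\<^bsub>K\<^esub>} \<in> V \<and> V \<subseteq> {{\<zero>\<^bsub>K\<^esub>}} \<and>
      a \<in> carrier K \<and> s \<in> carrier K \<and> (\<forall>Q \<in> V. s \<notin> Q \<and> f Q = frac K Q a s)"
    unfolding openin_zariski using x fr_one
    by (intro exI[of _ "{{\<zero>\<^bsub>K\<^esub>}}"] exI[of _ x] exI[of _ "\<one>\<^bsub>K\<^esub>"]) auto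
  then show "f \<in> carrier (sec (Spec K) {{\<zero>\<^bsub>K\<^esub>}})" using x loc_carrier by (simp add: Spec_def)
qed

lemma sp_iso: "sp \<in> ring_iso K (sec (Spec K) {{\<zero>\<^bsub>K\<^esub>}})"
proof (rule ring_iso_memI)
  fix x assume x: "x \<in> carrier K"
  then show "sp x \<in> carrier (sec (Spec K) {{\<zero>\<^bsub>K\<^esub>}})" unfolding Spec_sec_carrier by blast
  fix y assume y: "y \<in> carrier K"
  show "sp (x \<otimes>\<^bsub>K\<^esub> y) = sp x \<otimes>\<^bsub>sec (Spec K) {{\<zero>\<^bsub>K\<^esub>}}\<^esub> sp y"
    "sp (x \<oplus>\<^bsub>K\<^esub> y) = sp x \<oplus>\<^bsub>sec (Spec K) {{\<zero>\<^bsub>K\<^esub>}}\<^esub> sp y"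
    using loc_simps[OF x y] by (auto simp: Spec_def restrict_def fun_eq_iff)
next
  show "sp \<one>\<^bsub>K\<^esub> = \<one>\<^bsub>sec (Spec K) {{\<zero>\<^bsub>K\<^esub>}}\<^esub>"
    using loc_simps[OF one_closed one_closed] by (auto simp: Spec_def restrict_def fun_eq_iff)
  have "inj_on sp (carrier K)"
  proof (rule inj_onI)
    fix x y assume x: "x \<in> carrier K" and y: "y \<in> carrier K" and "sp x = sp y"
    then have "fr x = fr y" by (metis insertI1 restrict_apply')
    then show "x = y" by (rule fr_inj[OF x y])
  qed
  then show "bij_betw sp (carrier K) (carrier (sec (Spec K) {{\<zero>\<^bsub>K\<^esub>}}))"
    unfolding Spec_sec_carrier by (simp add: bij_betw_def)
qed

end

text \<open>Spec K moved to a prescribed point. Spec K itself has sets of ring elements as points,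
  while \<open>strongly_distinct\<close> tests only with spaces whose points have the type of those
  of S. Away from q the ring is the zero ring on the carrier {0}, as gluing of the empty family
  requires.\<close>

definition point_space :: "'q \<Rightarrow> 'k ring \<Rightarrow> ('q, 'k) ringed_space" where
  "point_space q K =
     \<lparr> spc = discrete_topology {q},
       sec = (\<lambda>U. if q \<in> U then K else K\<lparr>carrier := {\<zero>\<^bsub>K\<^esub>}, one := \<zero>\<^bsub>K\<^esub>\<rparr>),
       res = (\<lambda>U V s. if q \<in> V then s else \<zero>\<^bsub>K\<^esub>) \<rparr>"

section \<open>The one-point scheme of a field\<close>

locale residue_point = field_spec K for q :: 'q and K :: "'k ring"
begin

abbreviation T where "T \<equiv> point_space q K"

lemma T_simps:
  "openin (spc T) U \<longleftrightarrow> U \<subseteq> {q}" "points T = {q}"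
  "q \<in> U \<Longrightarrow> sec T U = K" "q \<notin> U \<Longrightarrow> carrier (sec T U) = {\<zero>\<^bsub>K\<^esub>}"
  "q \<notin> U \<Longrightarrow> \<one>\<^bsub>sec T U\<^esub> = \<zero>\<^bsub>K\<^esub>" "mult (sec T U) = mult K" "add (sec T U) = add K" "zero (sec T U) = zero K"
  "q \<in> V \<Longrightarrow> res T U V s = s" "q \<notin> V \<Longrightarrow> res T U V s = \<zero>\<^bsub>K\<^esub>"
  by (simp_all add: point_space_def)

lemma cring_T: "cring (sec T U)"
proof (cases "q \<in> U")
  case True
  then show ?thesis using T_simps(3) is_cring by simp
next
  case False
  show ?thesis
  proof (rule cringI)
    show "abelian_group (sec T U)"
      by (rule abelian_groupI) (auto simp: T_simps(4)[OF False] T_simps(7,8))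
    show "comm_monoid (sec T U)"
      by (rule comm_monoidI) (auto simp: T_simps(4,5)[OF False] T_simps(6))
  qed (auto simp: T_simps(4)[OF False] T_simps(6,7))
qed

text \<open>If a member of the cover contains q, its section is the glued one, since restriction
  keeps values at q; otherwise all sections are 0.\<close>

lemma is_ringed_T: "is_ringed_space T"
proof -
  have glue: "\<exists>!t. t \<in> carrier (sec T (\<Union>\<U>)) \<and> (\<forall>V \<in> \<U>. res T (\<Union>\<U>) V t = s V)"
    if s: "\<forall>V \<in> \<U>. openin (spc T) V \<and> s V \<in> carrier (sec T V)"
      and c: "\<forall>V \<in> \<U>. \<forall>W \<in> \<U>. res T V (V \<inter> W) (s V) = res T W (V \<inter> W) (s W)" for \<U> s
  proof (cases "q \<in> \<Union>\<U>")
    case True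
    then obtain V0 where V0: "V0 \<in> \<U>" "q \<in> V0" by blast
    have e: "res T (\<Union>\<U>) V (s V0) = s V" if V: "V \<in> \<U>" for V
    proof (cases "q \<in> V")
      case True
      have "res T V (V \<inter> V0) (s V) = res T V0 (V \<inter> V0) (s V0)" using c V V0(1) by blast
      then have "s V = s V0" using True V0(2) by (simp add: T_simps(9))
      then show ?thesis using True by (simp add: T_simps)
    next
      case False
      then show ?thesis using s V T_simps(4)[OF False] by (auto simp: T_simps(10))
    qed
    show ?thesis
    proof (rule ex1I[of _ "s V0"])
      show "s V0 \<in> carrier (sec T (\<Union>\<U>)) \<and> (\<forall>V\<in>\<U>. res T (\<Union>\<U>) V (s V0) = s V)"
        using e s V0 True T_simps(3)[of V0] T_simps(3)[of "\<Union>\<U>"] by auto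
      fix t assume "t \<in> carrier (sec T (\<Union>\<U>)) \<and> (\<forall>V\<in>\<U>. res T (\<Union>\<U>) V t = s V)"
      then show "t = s V0" using V0 T_simps(9)[OF V0(2)] by auto
    qed
  next
    case False
    have "s V = \<zero>\<^bsub>K\<^esub>" if "V \<in> \<U>" for V using s that False T_simps(4)[of V] by auto
    then show ?thesis using False by (intro ex1I[of _ "\<zero>\<^bsub>K\<^esub>"]) (auto simp: T_simps(4,10))
  qed
  have rc: "res T U V s \<in> carrier (sec T V)" if "V \<subseteq> U" "s \<in> carrier (sec T U)" for U V s
    using that by (cases "q \<in> V") (auto simp: T_simps)
  have id: "res T U U s = s" if "s \<in> carrier (sec T U)" for U s
    using that by (cases "q \<in> U") (auto simp: T_simps)
  have tr: "res T V W (res T U V s) = res T U W s" if "W \<subseteq> V" for U V W s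
    using that by (cases "q \<in> W") (auto simp: T_simps)
  have sh: "sheaf_of_sets (spc T) (\<lambda>U. carrier (sec T U)) (res T)"
    unfolding sheaf_of_sets_def
  proof (intro conjI allI impI ballI)
    show "res T U V \<in> carrier (sec T U) \<rightarrow> carrier (sec T V)"
      if "openin (spc T) U \<and> openin (spc T) V \<and> V \<subseteq> U" for U V
      using that rc by blast
    show "res T U U s = s" if "s \<in> carrier (sec T U)" for U s by (rule id[OF that])
    show "res T V W (res T U V s) = res T U W s"
      if "openin (spc T) U \<and> openin (spc T) V \<and> openin (spc T) W \<and> W \<subseteq> V \<and> V \<subseteq> U" for U V W s
      using that tr by simp
    show "\<exists>!t. t \<in> carrier (sec T (\<Union>\<U>)) \<and> (\<forall>V \<in> \<U>. res T (\<Union>\<U>) V t = s V)"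
      if "(\<forall>V \<in> \<U>. openin (spc T) V \<and> s V \<in> carrier (sec T V)) \<and>
        (\<forall>V \<in> \<U>. \<forall>W \<in> \<U>. res T V (V \<inter> W) (s V) = res T W (V \<inter> W) (s W))" for \<U> s
      using that by (elim conjE) (rule glue)
  qed
  have hom: "res T U V \<in> ring_hom (sec T U) (sec T V)" if VU: "V \<subseteq> U" for U V
  proof (cases "q \<in> V")
    case True
    then have "q \<in> U" using VU by auto
    then show ?thesis using True by (intro ring_hom_memI) (auto simp: T_simps)
  next
    case False
    then show ?thesis by (intro ring_hom_memI) (auto simp: T_simps)
  qed
  show ?thesis unfolding is_ringed_space_def using sh cring_T hom by blast
qed

sublocale T: ringed T
  by unfold_locales (rule is_ringed_T)

lemma q_open: "T.Op {q}" "q \<in> {q}" "q \<in> points T"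
  by (simp_all add: T_simps)

lemma Op_q: "T.Op U \<Longrightarrow> q \<in> U \<Longrightarrow> U = {q}"
  by (auto simp: T_simps)

lemma sec_q: "sec T {q} = K"
  by (simp add: T_simps)

lemma ogerm_iso: "ogerm T q {q} \<in> ring_iso K (stalk T q)"
proof -
  have "bij_betw (ogerm T q {q}) (carrier K) (carrier (stalk T q))"
    unfolding bij_betw_def
  proof (intro conjI)
    show "inj_on (ogerm T q {q}) (carrier K)"
    proof (rule inj_onI)
      fix x y assume x: "x \<in> carrier K" and y: "y \<in> carrier K" and e: "ogerm T q {q} x = ogerm T q {q} y"
      obtain W where "T.Op W" "q \<in> W" "res T {q} W x = res T {q} W y"
        by (rule T.ogerm_eqD[OF q_open(1,2) _ q_open(1,2) _ e]) (use x y sec_q in auto)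
      then show "x = y" by (simp add: T_simps(9))
    qed
    show "ogerm T q {q} ` carrier K = carrier (stalk T q)"
    proof (intro equalityI subsetI)
      fix x assume "x \<in> ogerm T q {q} ` carrier K"
      then show "x \<in> carrier (stalk T q)" using T.ogerm_closed[OF q_open(1,2)] sec_q by auto
    next
      fix x assume "x \<in> carrier (stalk T q)"
      then obtain U s where "x = ogerm T q U s" "T.Op U" "q \<in> U" "s \<in> carrier (sec T U)" by (rule T.stalk_carrierE)
      then show "x \<in> ogerm T q {q} ` carrier K" using Op_q sec_q by auto
    qed
  qed
  then show ?thesis using T.ogerm_hom[OF q_open(1,2)] sec_q by (simp add: ring_iso_def)
qed

lemma stalk_units: "x \<in> carrier (stalk T q) \<Longrightarrow> x \<in> Units (stalk T q) \<longleftrightarrow> x \<noteq> \<zero>\<^bsub>stalk T q\<^esub>"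
proof
  interpret s: cring "stalk T q" by (rule T.cring_stalk[OF q_open(3)])
  have z: "ogerm T q {q} \<zero>\<^bsub>K\<^esub> = \<zero>\<^bsub>stalk T q\<^esub>" using T.ogerm_zero[OF q_open(1,2)] sec_q by simp
  assume x: "x \<in> carrier (stalk T q)"
  { assume u: "x \<in> Units (stalk T q)"
    show "x \<noteq> \<zero>\<^bsub>stalk T q\<^esub>"
    proof
      assume "x = \<zero>\<^bsub>stalk T q\<^esub>"
      then have "\<one>\<^bsub>stalk T q\<^esub> = \<zero>\<^bsub>stalk T q\<^esub>" using u s.Units_r_inv[OF u] s.l_null[OF s.Units_inv_closed[OF u]] by metis
      then have "ogerm T q {q} \<one>\<^bsub>K\<^esub> = ogerm T q {q} \<zero>\<^bsub>K\<^esub>" using T.ogerm_one[OF q_open(1,2)] sec_q z by simp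
      then have "\<one>\<^bsub>K\<^esub> = \<zero>\<^bsub>K\<^esub>"
        by (rule inj_onD[OF bij_betw_imp_inj_on[OF ring_iso_memE(5)[OF ogerm_iso]] _ one_closed zero_closed])
      then show False using one_not_zero by simp
    qed }
  { assume n: "x \<noteq> \<zero>\<^bsub>stalk T q\<^esub>"
    obtain a where a: "a \<in> carrier K" "x = ogerm T q {q} a"
      using x ring_iso_memE(5)[OF ogerm_iso] by (auto simp: bij_betw_def)
    then have "a \<noteq> \<zero>\<^bsub>K\<^esub>" using n z by auto
    then have "a \<in> Units K" using a field_Units by auto
    then show "x \<in> Units (stalk T q)"
      unfolding a(2) using ring_hom_Units[OF _ ring_axioms] ogerm_iso by (auto simp: ring_iso_def) }
qed

lemma local_ring_T: "local_ring (stalk T q)"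
proof -
  interpret s: cring "stalk T q" by (rule T.cring_stalk[OF q_open(3)])
  have "nonunits (stalk T q) = {\<zero>\<^bsub>stalk T q\<^esub>}"
    using stalk_units s.zero_closed unfolding nonunits_def by auto
  then show ?thesis unfolding local_ring_def using s.zeroideal s.is_cring by simp
qed

lemma scheme_T: "scheme T"
proof -
  let ?z = "{\<zero>\<^bsub>K\<^esub>}"
  \<comment> \<open>The single point goes to the zero ideal. The sections of Spec K over it are the
    functions \<open>sp x\<close>, so the sheaf map inverts \<open>sp\<close>; over the empty set it
    goes from a zero ring to a zero ring.\<close>
  define h :: "('q, 'k, 'k set, 'k set \<Rightarrow> ('k \<times> 'k) set) morph" where
    "h = \<lparr> pt = (\<lambda>_. ?z), sh = (\<lambda>U f. if ?z \<in> U then inv_into (carrier K) sp f else \<zero>\<^bsub>K\<^esub>) \<rparr>"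
  let ?X = "open_subspace T {q}"
  have spcX: "spc ?X = discrete_topology {q}" by (simp add: open_subspace_def point_space_def subtopology_discrete_topology)
  have secX: "sec ?X = sec T" "res ?X = res T" by (simp_all add: open_subspace_def)
  have spcK: "spc (Spec K) = discrete_topology {?z}" by (simp add: Spec_def zariski_eq)
  have opK: "openin (spc (Spec K)) U \<longleftrightarrow> U = {} \<or> U = {?z}" for U unfolding spcK by auto
  have pre: "preim ?X h {} = {}" "preim ?X h {?z} = {q}" by (auto simp: preim_def spcX h_def)
  have "homeomorphic_maps (spc ?X) (spc (Spec K)) (pt h) (\<lambda>_. q)"
    unfolding homeomorphic_maps_def spcX spcK h_def by simp
  then have 1: "homeomorphic_map (spc ?X) (spc (Spec K)) (pt h)" by (rule homeomorphic_maps_imp_map)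
  have iso1: "sh h {?z} \<in> ring_iso (sec (Spec K) {?z}) K"
    using ring_iso_set_sym[OF ring_axioms sp_iso] by (simp add: h_def)
  have iso0: "sh h {} \<in> ring_iso (sec (Spec K) {}) (sec T {})"
    by (rule ring_iso_memI) (auto simp: T_simps h_def Spec_def bij_betw_def)
  have 2: "sh h U \<in> ring_iso (sec (Spec K) U) (sec ?X (preim ?X h U))" if "openin (spc (Spec K)) U" for U
    using that iso0 iso1 unfolding opK secX by (auto simp: pre sec_q)
  have 3: "sh h V (res (Spec K) U V s) = res ?X (preim ?X h U) (preim ?X h V) (sh h U s)"
    if U: "openin (spc (Spec K)) U" "openin (spc (Spec K)) V" "V \<subseteq> U" "s \<in> carrier (sec (Spec K) U)" for U V s
  proof (cases "V = {}")
    case True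
    show ?thesis unfolding secX True pre(1) by (simp add: T_simps(10)) (simp add: h_def)
  next
    case False
    then have V: "V = {?z}" "U = {?z}" using U unfolding opK by auto
    have "res (Spec K) U V s = s"
      using U(4) unfolding V Spec_def by (auto intro!: extensional_restrict simp: PiE_def)
    then show ?thesis unfolding secX V pre using T_simps(9)[of "{q}"] by simp
  qed
  have iso: "ringed_space_iso ?X (Spec K) h"
    unfolding ringed_space_iso_def using 1 2 3 by blast
  have "locally_ringed_space T"
    unfolding locally_ringed_space_def using is_ringed_T local_ring_T by (simp add: T_simps)
  then show ?thesis
    unfolding scheme_def using iso q_open is_cring by (auto simp: T_simps intro!: exI[of _ "{q}"])
qed

end

section \<open>Strongly distinct points\<close>

lemma (in cring) minus_zero_imp_eq:
  assumes "x \<in> carrier R" "y \<in> carrier R" "x \<ominus> y = \<zero>"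
  shows "x = y"
proof -
  have "x = (x \<ominus> y) \<oplus> y" using assms(1,2) by algebra
  then show ?thesis using assms by simp
qed

text \<open>If b = u a, the linear form r that takes a to 1 takes b to u, which dictates u. The
  vanishing determinant makes this u work, and the form s gives its inverse in the same way.\<close>

lemma (in cring) proportional_unimodular:
  assumes c: "a\<^sub>0 \<in> carrier R" "a\<^sub>1 \<in> carrier R" "b\<^sub>0 \<in> carrier R" "b\<^sub>1 \<in> carrier R"
    and r: "r\<^sub>0 \<in> carrier R" "r\<^sub>1 \<in> carrier R" "r\<^sub>0 \<otimes> a\<^sub>0 \<oplus> r\<^sub>1 \<otimes> a\<^sub>1 = \<one>"
    and s: "s\<^sub>0 \<in> carrier R" "s\<^sub>1 \<in> carrier R" "s\<^sub>0 \<otimes> b\<^sub>0 \<oplus> s\<^sub>1 \<otimes> b\<^sub>1 = \<one>"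
    and d: "a\<^sub>0 \<otimes> b\<^sub>1 = a\<^sub>1 \<otimes> b\<^sub>0"
  obtains u where "u \<in> Units R" "u \<otimes> a\<^sub>0 = b\<^sub>0" "u \<otimes> a\<^sub>1 = b\<^sub>1"
proof
  let ?u = "r\<^sub>0 \<otimes> b\<^sub>0 \<oplus> r\<^sub>1 \<otimes> b\<^sub>1" and ?w = "s\<^sub>0 \<otimes> a\<^sub>0 \<oplus> s\<^sub>1 \<otimes> a\<^sub>1"
  have "?u \<otimes> a\<^sub>0 = r\<^sub>0 \<otimes> a\<^sub>0 \<otimes> b\<^sub>0 \<oplus> r\<^sub>1 \<otimes> (a\<^sub>0 \<otimes> b\<^sub>1)" using c r s by algebra
  also have "\<dots> = (r\<^sub>0 \<otimes> a\<^sub>0 \<oplus> r\<^sub>1 \<otimes> a\<^sub>1) \<otimes> b\<^sub>0" unfolding d using c r(1,2) s(1,2) by algebra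
  finally show u0: "?u \<otimes> a\<^sub>0 = b\<^sub>0" using r(3) c by simp
  have "?u \<otimes> a\<^sub>1 = r\<^sub>0 \<otimes> (a\<^sub>1 \<otimes> b\<^sub>0) \<oplus> r\<^sub>1 \<otimes> a\<^sub>1 \<otimes> b\<^sub>1" using c r s by algebra
  also have "\<dots> = (r\<^sub>0 \<otimes> a\<^sub>0 \<oplus> r\<^sub>1 \<otimes> a\<^sub>1) \<otimes> b\<^sub>1" unfolding d[symmetric] using c r(1,2) s(1,2) by algebra
  finally show u1: "?u \<otimes> a\<^sub>1 = b\<^sub>1" using r(3) c by simp
  have "?u \<otimes> ?w = s\<^sub>0 \<otimes> (?u \<otimes> a\<^sub>0) \<oplus> s\<^sub>1 \<otimes> (?u \<otimes> a\<^sub>1)" using c r(1,2) s(1,2) by algebra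
  then have "?u \<otimes> ?w = \<one>" unfolding u0 u1 using s(3) by simp
  then show "?u \<in> Units R" using factor_Units[of ?u ?w] c r(1,2) s(1,2) by simp
qed

context ringed
begin

text \<open>Generation of the stalk, applied to the element with coordinate 1, makes the coordinates
  of the two sections a unimodular vector.\<close>

lemma P1_point_coords:
  assumes A: "P1_point S (A, a\<^sub>0, a\<^sub>1)" and c: "charts A c"
  shows "a\<^sub>0 \<in> carrier (msec A (points S))" "a\<^sub>1 \<in> carrier (msec A (points S))"
    and "p \<in> points S \<Longrightarrow> \<exists>r\<^sub>0 \<in> carrier (R p). \<exists>r\<^sub>1 \<in> carrier (R p).
      r\<^sub>0 \<otimes>\<^bsub>R p\<^esub> c p (mgerm S A p (points S) a\<^sub>0) \<oplus>\<^bsub>R p\<^esub> r\<^sub>1 \<otimes>\<^bsub>R p\<^esub> c p (mgerm S A p (points S) a\<^sub>1) = \<one>\<^bsub>R p\<^esub>"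
proof -
  show a: "a\<^sub>0 \<in> carrier (msec A (points S))" "a\<^sub>1 \<in> carrier (msec A (points S))" using A by auto
  assume p: "p \<in> points S"
  interpret r: rank_one "R p" "mstalk S A p" "c p" using c p by (simp add: charts_def)
  interpret M: module_sheaf_on S A by unfold_locales (use A in \<open>simp add: line_bundle_def\<close>)
  obtain e where e: "e \<in> carrier (mstalk S A p)" "c p e = \<one>\<^bsub>R p\<^esub>" by (rule r.generator)
  have "\<forall>x \<in> carrier (mstalk S A p). \<exists>r\<^sub>0 \<in> carrier (R p). \<exists>r\<^sub>1 \<in> carrier (R p).
      x = r\<^sub>0 \<odot>\<^bsub>mstalk S A p\<^esub> mgerm S A p (points S) a\<^sub>0 \<oplus>\<^bsub>mstalk S A p\<^esub> r\<^sub>1 \<odot>\<^bsub>mstalk S A p\<^esub> mgerm S A p (points S) a\<^sub>1"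
    using A p by simp
  from bspec[OF this e(1)] obtain r\<^sub>0 r\<^sub>1 where rr: "r\<^sub>0 \<in> carrier (R p)" "r\<^sub>1 \<in> carrier (R p)"
    "e = r\<^sub>0 \<odot>\<^bsub>mstalk S A p\<^esub> mgerm S A p (points S) a\<^sub>0 \<oplus>\<^bsub>mstalk S A p\<^esub> r\<^sub>1 \<odot>\<^bsub>mstalk S A p\<^esub> mgerm S A p (points S) a\<^sub>1"
    by blast
  have m: "mgerm S A p (points S) a\<^sub>0 \<in> carrier (mstalk S A p)" "mgerm S A p (points S) a\<^sub>1 \<in> carrier (mstalk S A p)"
    using a p by auto
  have "r\<^sub>0 \<otimes>\<^bsub>R p\<^esub> c p (mgerm S A p (points S) a\<^sub>0) \<oplus>\<^bsub>R p\<^esub> r\<^sub>1 \<otimes>\<^bsub>R p\<^esub> c p (mgerm S A p (points S) a\<^sub>1) = \<one>\<^bsub>R p\<^esub>"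
    using e(2) unfolding rr(3) using rr(1,2) m by (simp add: r.c_add r.c_smult r.smult_mem)
  with rr(1,2) show "\<exists>r\<^sub>0 \<in> carrier (R p). \<exists>r\<^sub>1 \<in> carrier (R p).
      r\<^sub>0 \<otimes>\<^bsub>R p\<^esub> c p (mgerm S A p (points S) a\<^sub>0) \<oplus>\<^bsub>R p\<^esub> r\<^sub>1 \<otimes>\<^bsub>R p\<^esub> c p (mgerm S A p (points S) a\<^sub>1) = \<one>\<^bsub>R p\<^esub>"
    by blast
qed

text \<open>If the determinant is not invertible at \<open>p\<close>, then both points have the same restriction to the
  spectrum of the residue field at \<open>p\<close>, which contradicts the emptiness of the equalizer.\<close>

lemma strongly_distinct_unit:
  assumes loc: "local_ring (R p)" and p: "p \<in> points S"
    and A: "P1_point S (A, a\<^sub>0, a\<^sub>1)" and cA: "charts A cA"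
    and B: "P1_point S (B, b\<^sub>0, b\<^sub>1)" and cB: "charts B cB"
    and sd: "strongly_distinct S (A, a\<^sub>0, a\<^sub>1) (B, b\<^sub>0, b\<^sub>1)"
  shows "cA p (mgerm S A p (points S) a\<^sub>0) \<otimes>\<^bsub>R p\<^esub> cB p (mgerm S B p (points S) b\<^sub>1) \<ominus>\<^bsub>R p\<^esub>
    cA p (mgerm S A p (points S) a\<^sub>1) \<otimes>\<^bsub>R p\<^esub> cB p (mgerm S B p (points S) b\<^sub>0) \<in> Units (R p)"
    (is "?d \<in> _")
proof (rule ccontr)
  assume nu: "?d \<notin> Units (R p)"
  obtain K :: "('p, 'r) germ ring" and \<pi> where K: "field K" and pi: "\<pi> \<in> ring_hom (R p) K"
    and piz: "\<And>x. x \<in> carrier (R p) \<Longrightarrow> \<pi> x = \<zero>\<^bsub>K\<^esub> \<longleftrightarrow> x \<in> nonunits (R p)"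
    using residue_field_exists[OF loc] by blast
  interpret K: field K by (rule K)
  interpret P: residue_point p K by unfold_locales
  interpret Rp: cring "R p" by (rule cring_stalk[OF p])
  let ?T = "P.T"
  \<comment> \<open>The inclusion of the residue point: functions near p are evaluated in K. Open
    sets that miss p have empty preimage, whose ring is zero.\<close>
  define h :: "('p, ('p, 'r) germ, 'p, 'r) morph" where
    "h = \<lparr> pt = (\<lambda>_. p), sh = (\<lambda>U s. if p \<in> U then \<pi> (ogerm S p U s) else \<zero>\<^bsub>K\<^esub>) \<rparr>"
  have pth: "pt h t = p" for t by (simp add: h_def)
  have shp: "sh h U s = \<pi> (ogerm S p U s)" if "p \<in> U" for U s using that by (simp add: h_def)
  have shn: "sh h U s = \<zero>\<^bsub>K\<^esub>" if "p \<notin> U" for U s using that by (simp add: h_def)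
  have pre: "preim ?T h U = (if p \<in> U then {p} else {})" for U
    by (auto simp: preim_def pth P.T_simps(2))
  interpret m: ringed_map ?T S h
  proof unfold_locales
    show "continuous_map (spc ?T) (spc S) (pt h)"
      using p by (auto simp: continuous_map_def P.T_simps(1,2) pth)
    fix U assume U: "Op U"
    show "sh h U \<in> ring_hom (sec S U) (sec ?T (preim ?T h U))"
    proof (cases "p \<in> U")
      case True
      have "\<pi> \<circ> ogerm S p U \<in> ring_hom (sec S U) K" by (rule ring_hom_trans[OF ogerm_hom[OF U True] pi])
      moreover have "sh h U = \<pi> \<circ> ogerm S p U" using shp[OF True] by auto
      ultimately show ?thesis using True by (simp add: pre P.sec_q)
    next
      case False
      then show ?thesis by (intro ring_hom_memI) (auto simp: pre shn P.T_simps)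
    qed
    fix V s assume V: "Op V" "V \<subseteq> U" and s: "s \<in> carrier (sec S U)"
    show "sh h V (res S U V s) = res ?T (preim ?T h U) (preim ?T h V) (sh h U s)"
    proof (cases "p \<in> V")
      case True
      then have "p \<in> U" using V by auto
      then show ?thesis using True ogerm_res[OF U V(1) True V(2) s] by (simp add: pre shp P.T_simps(9))
    next
      case False
      then show ?thesis by (simp add: pre shn P.T_simps(10))
    qed
  qed
  interpret Tp: cring "stalk ?T p" by (rule P.T.cring_stalk[OF P.q_open(3)])
  let ?\<phi> = "stalk_map ?T h p"
  have phi: "?\<phi> x = ogerm ?T p {p} (\<pi> x)" if x: "x \<in> carrier (R p)" for x
  proof -
    obtain U s where U: "x = ogerm S p U s" "Op U" "p \<in> U" "s \<in> carrier (sec S U)"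
      by (rule stalk_carrierE[OF x])
    have "p \<in> preim ?T h U" using U(3) by (simp add: pre)
    from m.stalk_map_ogerm[OF U(2) this U(4)] show ?thesis unfolding U(1) pth by (simp add: pre shp U(3))
  qed
  \<comment> \<open>Nonunits of the local ring at p become 0. As units of a field are nonzero, this
    also yields the locality condition in \<open>morph\<close>.\<close>
  have phz: "?\<phi> x = \<zero>\<^bsub>stalk ?T p\<^esub>" if "x \<in> carrier (R p)" "x \<notin> Units (R p)" for x
  proof -
    have "\<pi> x = \<zero>\<^bsub>K\<^esub>" using that piz by (simp add: nonunits_def)
    then show ?thesis using phi[OF that(1)] P.T.ogerm_zero[OF P.q_open(1,2)] P.sec_q by simp
  qed
  have hom: "?\<phi> \<in> ring_hom (R p) (stalk ?T p)" using m.stalk_map_hom[OF P.q_open(3)] by (simp add: pth)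
  have morph: "morphism ?T S h"
    unfolding morphism_def
  proof (intro conjI allI impI ballI)
    fix t x assume "t \<in> points ?T" and x: "x \<in> carrier (stalk S (pt h t))" and u: "stalk_map ?T h t x \<in> Units (stalk ?T t)"
    then have t: "t = p" by (simp add: P.T_simps(2))
    have u': "?\<phi> x \<in> Units (stalk ?T p)" using u t by simp
    then have "?\<phi> x \<noteq> \<zero>\<^bsub>stalk ?T p\<^esub>" using P.stalk_units Tp.Units_closed by blast
    then show "x \<in> Units (stalk S (pt h t))" using phz x unfolding pth by blast
  qed (use m.cont m.sh_hom m.sh_res in auto)
  interpret A: module_sheaf_on S A by unfold_locales (use A in \<open>simp add: line_bundle_def\<close>)
  interpret B: module_sheaf_on S B by unfold_locales (use B in \<open>simp add: line_bundle_def\<close>)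
  interpret O: module_sheaf_on ?T "structure_sheaf ?T" by (rule P.T.module_sheaf_on_structure_sheaf)
  interpret tA: tensor_product ?T S h "structure_sheaf ?T" A "\<lambda>t x. x" cA
    by unfold_locales (rule P.T.charts_structure_sheaf, rule cA)
  interpret tB: tensor_product ?T S h "structure_sheaf ?T" B "\<lambda>t x. x" cB
    by unfold_locales (rule P.T.charts_structure_sheaf, rule cB)
  interpret wA: coordinates ?T tA.G "\<lambda>t V f. tA.tc t (f t)" by (rule tA.coordinates_tensor)
  interpret wB: coordinates ?T tB.G "\<lambda>t V f. tB.tc t (f t)" by (rule tB.coordinates_tensor)
  note cAp = P1_point_coords[OF A cA] and cBp = P1_point_coords[OF B cB]
  let ?vA = "\<lambda>x. cA p (mgerm S A p (points S) x)" and ?vB = "\<lambda>x. cB p (mgerm S B p (points S) x)"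
  interpret rA: rank_one "R p" "mstalk S A p" "cA p" using cA p by (simp add: charts_def)
  interpret rB: rank_one "R p" "mstalk S B p" "cB p" using cB p by (simp add: charts_def)
  have vA: "?vA x \<in> carrier (R p)" if "x \<in> carrier (msec A (points S))" for x using that p by auto
  have vB: "?vB x \<in> carrier (R p)" if "x \<in> carrier (msec B (points S))" for x using that p by auto
  note va = vA[OF cAp(1)] vA[OF cAp(2)] and vb = vB[OF cBp(1)] vB[OF cBp(2)]
  note pc = ring_hom_closed[OF hom]
  \<comment> \<open>The determinant is a nonunit by assumption and becomes 0 in the residue field.
    The two vectors stay unimodular there, hence they are proportional.\<close>
  have "?\<phi> ?d = \<zero>\<^bsub>stalk ?T p\<^esub>" by (rule phz[OF _ nu]) (use va vb in auto)
  moreover have "?\<phi> ?d = ?\<phi> (?vA a\<^sub>0) \<otimes>\<^bsub>stalk ?T p\<^esub> ?\<phi> (?vB b\<^sub>1) \<ominus>\<^bsub>stalk ?T p\<^esub> ?\<phi> (?vA a\<^sub>1) \<otimes>\<^bsub>stalk ?T p\<^esub> ?\<phi> (?vB b\<^sub>0)"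
  proof -
    interpret hr: ring_hom_ring "R p" "stalk ?T p" ?\<phi>
      by (rule ring_hom_ringI2[OF Rp.ring_axioms Tp.ring_axioms hom])
    show ?thesis using va vb by (simp add: a_minus_def)
  qed
  ultimately have "?\<phi> (?vA a\<^sub>0) \<otimes>\<^bsub>stalk ?T p\<^esub> ?\<phi> (?vB b\<^sub>1) \<ominus>\<^bsub>stalk ?T p\<^esub> ?\<phi> (?vA a\<^sub>1) \<otimes>\<^bsub>stalk ?T p\<^esub> ?\<phi> (?vB b\<^sub>0) = \<zero>\<^bsub>stalk ?T p\<^esub>"
    by simp
  then have prp: "?\<phi> (?vA a\<^sub>0) \<otimes>\<^bsub>stalk ?T p\<^esub> ?\<phi> (?vB b\<^sub>1) = ?\<phi> (?vA a\<^sub>1) \<otimes>\<^bsub>stalk ?T p\<^esub> ?\<phi> (?vB b\<^sub>0)"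
    by (rule Tp.minus_zero_imp_eq[rotated 2]) (use pc va vb in auto)
  obtain r\<^sub>0 r\<^sub>1 where r: "r\<^sub>0 \<in> carrier (R p)" "r\<^sub>1 \<in> carrier (R p)"
    "r\<^sub>0 \<otimes>\<^bsub>R p\<^esub> ?vA a\<^sub>0 \<oplus>\<^bsub>R p\<^esub> r\<^sub>1 \<otimes>\<^bsub>R p\<^esub> ?vA a\<^sub>1 = \<one>\<^bsub>R p\<^esub>" using cAp(3)[OF p] by blast
  obtain s\<^sub>0 s\<^sub>1 where s: "s\<^sub>0 \<in> carrier (R p)" "s\<^sub>1 \<in> carrier (R p)"
    "s\<^sub>0 \<otimes>\<^bsub>R p\<^esub> ?vB b\<^sub>0 \<oplus>\<^bsub>R p\<^esub> s\<^sub>1 \<otimes>\<^bsub>R p\<^esub> ?vB b\<^sub>1 = \<one>\<^bsub>R p\<^esub>" using cBp(3)[OF p] by blast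
  have r': "?\<phi> r\<^sub>0 \<otimes>\<^bsub>stalk ?T p\<^esub> ?\<phi> (?vA a\<^sub>0) \<oplus>\<^bsub>stalk ?T p\<^esub> ?\<phi> r\<^sub>1 \<otimes>\<^bsub>stalk ?T p\<^esub> ?\<phi> (?vA a\<^sub>1) = \<one>\<^bsub>stalk ?T p\<^esub>"
    using arg_cong[OF r(3), of ?\<phi>] r(1,2) va by (simp add: ring_hom_add[OF hom] ring_hom_mult[OF hom] ring_hom_one[OF hom])
  have s': "?\<phi> s\<^sub>0 \<otimes>\<^bsub>stalk ?T p\<^esub> ?\<phi> (?vB b\<^sub>0) \<oplus>\<^bsub>stalk ?T p\<^esub> ?\<phi> s\<^sub>1 \<otimes>\<^bsub>stalk ?T p\<^esub> ?\<phi> (?vB b\<^sub>1) = \<one>\<^bsub>stalk ?T p\<^esub>"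
    using arg_cong[OF s(3), of ?\<phi>] s(1,2) vb by (simp add: ring_hom_add[OF hom] ring_hom_mult[OF hom] ring_hom_one[OF hom])
  obtain u where u: "u \<in> Units (stalk ?T p)"
    "u \<otimes>\<^bsub>stalk ?T p\<^esub> ?\<phi> (?vA a\<^sub>0) = ?\<phi> (?vB b\<^sub>0)" "u \<otimes>\<^bsub>stalk ?T p\<^esub> ?\<phi> (?vA a\<^sub>1) = ?\<phi> (?vB b\<^sub>1)"
    by (rule Tp.proportional_unimodular[OF pc[OF va(1)] pc[OF va(2)] pc[OF vb(1)] pc[OF vb(2)]
          pc[OF r(1)] pc[OF r(2)] r' pc[OF s(1)] pc[OF s(2)] s' prp])
  have ptsT: "t \<in> points ?T \<longleftrightarrow> t = p" for t by (simp add: P.T_simps(2))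
  \<comment> \<open>On a one-point space every factor is regular: a frame f of the second pullback
    is rescaled so that its coordinate is \<open>u\<close> times that of a frame e of the
    first.\<close>
  have "\<exists>\<theta>. module_sheaf_iso ?T tA.G tB.G \<theta> \<and> (\<forall>U x. P.T.Op U \<longrightarrow> x \<in> carrier (msec tA.G U) \<longrightarrow>
      (\<forall>t \<in> U. tB.tc t (\<theta> U x t) = u \<otimes>\<^bsub>stalk ?T t\<^esub> tA.tc t (x t)))"
  proof (rule scaling_imp_iso[OF tA.coordinates_tensor tB.coordinates_tensor])
    fix t assume "t \<in> points ?T"
    then have t: "t = p" by (simp add: ptsT)
    show "u \<in> Units (stalk ?T t)" using u t by simp
    obtain U e where U: "P.T.Op U" "p \<in> U" "e \<in> carrier (msec tA.G U)" "tA.tc p (e p) \<in> Units (stalk ?T p)"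
      using wA.frame[OF P.q_open(3)] by blast
    obtain V f where V: "P.T.Op V" "p \<in> V" "f \<in> carrier (msec tB.G V)" "tB.tc p (f p) \<in> Units (stalk ?T p)"
      using wB.frame[OF P.q_open(3)] by blast
    have UV: "U = {p}" "V = {p}" using P.Op_q U V by auto
    let ?y = "u \<otimes>\<^bsub>stalk ?T p\<^esub> tA.tc p (e p) \<otimes>\<^bsub>stalk ?T p\<^esub> inv\<^bsub>stalk ?T p\<^esub> tB.tc p (f p)"
    have "?y \<in> carrier (stalk ?T p)"
      by (rule Tp.m_closed[OF Tp.m_closed[OF Tp.Units_closed[OF u(1)] Tp.Units_closed[OF U(4)]]
            Tp.Units_inv_closed[OF V(4)]])
    then obtain W g where W: "?y = ogerm ?T p W g" "P.T.Op W" "p \<in> W" "g \<in> carrier (sec ?T W)"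
      by (rule P.T.stalk_carrierE)
    have W': "W = {p}" using P.Op_q W by auto
    have "tB.tc p ((g \<odot>\<^bsub>msec tB.G {p}\<^esub> f) p) = ?y \<otimes>\<^bsub>stalk ?T p\<^esub> tB.tc p (f p)"
      unfolding W(1) W' using wB.val_smult[OF V(1,2) _ V(3), of g] W(4) UV W' by simp
    also have "\<dots> = u \<otimes>\<^bsub>stalk ?T p\<^esub> tA.tc p (e p)"
      using u(1) U(4) V(4) by (simp add: Tp.m_assoc Tp.Units_closed)
    finally have "tB.tc p ((g \<odot>\<^bsub>msec tB.G {p}\<^esub> f) p) = u \<otimes>\<^bsub>stalk ?T p\<^esub> tA.tc p (e p)" .
    moreover have "g \<odot>\<^bsub>msec tB.G {p}\<^esub> f \<in> carrier (msec tB.G {p})"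
      using wB.smult_closed[OF P.q_open(1)] W V UV W' by simp
    ultimately show "\<exists>U e e'. P.T.Op U \<and> t \<in> U \<and> e \<in> carrier (msec tA.G U) \<and> e' \<in> carrier (msec tB.G U) \<and>
      (\<forall>q \<in> U. tA.tc q (e q) \<in> Units (stalk ?T q) \<and> tB.tc q (e' q) = u \<otimes>\<^bsub>stalk ?T q\<^esub> tA.tc q (e q))"
      using U UV P.q_open(1) unfolding t
      by (intro exI[of _ "{p}"] exI[of _ e] exI[of _ "g \<odot>\<^bsub>msec tB.G {p}\<^esub> f"]) simp
  qed
  then obtain \<theta> where tt: "module_sheaf_iso ?T tA.G tB.G \<theta> \<and> (\<forall>U x. P.T.Op U \<longrightarrow> x \<in> carrier (msec tA.G U) \<longrightarrow>
      (\<forall>t \<in> U. tB.tc t (\<theta> U x t) = u \<otimes>\<^bsub>stalk ?T t\<^esub> tA.tc t (x t)))" ..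
  note th = tt[THEN conjunct1] and thv = tt[THEN conjunct2, rule_format]
  have g: "P.T.Op (points ?T)" "Op (points S)" "points ?T \<subseteq> preim ?T h (points S)"
    using p P.q_open(1) by (auto simp: pre P.T_simps(2))
  interpret gT: cring "global_sections ?T" by (rule P.T.cringO[OF g(1)])
  have one: "\<one>\<^bsub>global_sections ?T\<^esub> \<in> carrier (msec (structure_sheaf ?T) (points ?T))" by simp
  let ?pA = "\<lambda>a. tensor_sum ?T S h (structure_sheaf ?T) A (points ?T) (points S) {#(\<one>\<^bsub>global_sections ?T\<^esub>, a)#}"
  let ?pB = "\<lambda>a. tensor_sum ?T S h (structure_sheaf ?T) B (points ?T) (points S) {#(\<one>\<^bsub>global_sections ?T\<^esub>, a)#}"
  have o1: "mgerm ?T (structure_sheaf ?T) p (points ?T) \<one>\<^bsub>global_sections ?T\<^esub> = \<one>\<^bsub>stalk ?T p\<^esub>"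
    using P.T.ogerm_one[OF g(1) P.q_open(3)] by simp
  have thg: "\<theta> (points ?T) (?pA a) = ?pB b"
    if a: "a \<in> carrier (msec A (points S))" and b: "b \<in> carrier (msec B (points S))"
      and e: "u \<otimes>\<^bsub>stalk ?T p\<^esub> ?\<phi> (?vA a) = ?\<phi> (?vB b)" for a b
  proof (rule wB.val_inj[OF g(1)])
    note pA = tA.pure_sum[OF g(1,2,3) one a] and pB = tB.pure_sum[OF g(1,2,3) one b]
    show "?pB b \<in> carrier (msec tB.G (points ?T))" by (rule pB(1))
    show "\<theta> (points ?T) (?pA a) \<in> carrier (msec tB.G (points ?T))"
      using th[unfolded module_sheaf_iso_def, THEN conjunct1, rule_format, OF g(1), THEN conjunct1] pA(1)
      by (rule bij_betw_apply)
    fix t assume "t \<in> points ?T"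
    then have t: "t = p" by (simp add: ptsT)
    show "tB.tc t (\<theta> (points ?T) (?pA a) t) = tB.tc t (?pB b t)"
      unfolding t thv[OF g(1) pA(1) P.q_open(3)] pA(2)[OF P.q_open(3)] pB(2)[OF P.q_open(3)] o1
      unfolding pth
      using e pc[OF vA[OF a]] pc[OF vB[OF b]] by simp
  qed
  have "P1_eq ?T (P1_pullback ?T S h (A, a\<^sub>0, a\<^sub>1)) (P1_pullback ?T S h (B, b\<^sub>0, b\<^sub>1))"
    using th thg[OF cAp(1) cBp(1) u(2)] thg[OF cAp(2) cBp(2) u(3)] by auto
  then have "P1_equalizes S (A, a\<^sub>0, a\<^sub>1) (B, b\<^sub>0, b\<^sub>1) ?T h"
    unfolding P1_equalizes_def using P.scheme_T morph by blast
  \<comment> \<open>The universal property yields a map from a nonempty space to the empty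
    one.\<close>
  then obtain k where "morphism ?T (empty_scheme :: ('p, ('p, 'r) germ) ringed_space) k"
    using sd unfolding strongly_distinct_def P1_equalizer_def by blast
  then have "continuous_map (spc ?T) (spc (empty_scheme :: ('p, ('p, 'r) germ) ringed_space)) (pt k)"
    unfolding morphism_def by blast
  then show False using P.q_open(3) by (auto simp: empty_scheme_def continuous_map_def Pi_iff)
qed

end

section \<open>The cross-ratio\<close>

definition det2 :: "('a, 'b) ring_scheme \<Rightarrow> 'a \<Rightarrow> 'a \<Rightarrow> 'a \<Rightarrow> 'a \<Rightarrow> 'a" where
  "det2 R x\<^sub>0 x\<^sub>1 y\<^sub>0 y\<^sub>1 = x\<^sub>0 \<otimes>\<^bsub>R\<^esub> y\<^sub>1 \<ominus>\<^bsub>R\<^esub> x\<^sub>1 \<otimes>\<^bsub>R\<^esub> y\<^sub>0"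

context cring
begin

lemma det2_closed [simp]:
  "x\<^sub>0 \<in> carrier R \<Longrightarrow> x\<^sub>1 \<in> carrier R \<Longrightarrow> y\<^sub>0 \<in> carrier R \<Longrightarrow> y\<^sub>1 \<in> carrier R \<Longrightarrow>
    det2 R x\<^sub>0 x\<^sub>1 y\<^sub>0 y\<^sub>1 \<in> carrier R"
  by (simp add: det2_def)

lemma det2_scale:
  assumes "x\<^sub>0 \<in> carrier R" "x\<^sub>1 \<in> carrier R" "y\<^sub>0 \<in> carrier R" "y\<^sub>1 \<in> carrier R" "l \<in> carrier R" "m \<in> carrier R"
  shows "det2 R (l \<otimes> x\<^sub>0) (l \<otimes> x\<^sub>1) (m \<otimes> y\<^sub>0) (m \<otimes> y\<^sub>1) = (l \<otimes> m) \<otimes> det2 R x\<^sub>0 x\<^sub>1 y\<^sub>0 y\<^sub>1"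
  unfolding det2_def using assms by algebra

text \<open>Multiplicativity of the determinant, for the matrix with rows (m, n) and (k, l) applied
  to the columns x and y.\<close>

lemma det2_matrix:
  assumes "x\<^sub>0 \<in> carrier R" "x\<^sub>1 \<in> carrier R" "y\<^sub>0 \<in> carrier R" "y\<^sub>1 \<in> carrier R"
    "m \<in> carrier R" "n \<in> carrier R" "k \<in> carrier R" "l \<in> carrier R"
  shows "det2 R (m \<otimes> x\<^sub>0 \<oplus> n \<otimes> x\<^sub>1) (k \<otimes> x\<^sub>0 \<oplus> l \<otimes> x\<^sub>1) (m \<otimes> y\<^sub>0 \<oplus> n \<otimes> y\<^sub>1) (k \<otimes> y\<^sub>0 \<oplus> l \<otimes> y\<^sub>1) =
    det2 R m n k l \<otimes> det2 R x\<^sub>0 x\<^sub>1 y\<^sub>0 y\<^sub>1"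
  unfolding det2_def using assms by algebra

lemma det2_swap:
  assumes "x\<^sub>0 \<in> carrier R" "x\<^sub>1 \<in> carrier R" "y\<^sub>0 \<in> carrier R" "y\<^sub>1 \<in> carrier R"
  shows "det2 R y\<^sub>0 y\<^sub>1 x\<^sub>0 x\<^sub>1 = \<ominus> det2 R x\<^sub>0 x\<^sub>1 y\<^sub>0 y\<^sub>1"
  unfolding det2_def using assms by algebra

lemma det2_swap_Units:
  assumes "x\<^sub>0 \<in> carrier R" "x\<^sub>1 \<in> carrier R" "y\<^sub>0 \<in> carrier R" "y\<^sub>1 \<in> carrier R"
    and u: "det2 R x\<^sub>0 x\<^sub>1 y\<^sub>0 y\<^sub>1 \<in> Units R"
  shows "det2 R y\<^sub>0 y\<^sub>1 x\<^sub>0 x\<^sub>1 \<in> Units R"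
proof -
  have "\<ominus> \<one> \<otimes> \<ominus> \<one> = \<one>" by algebra
  then have "\<ominus> \<one> \<in> Units R" using factor_Units[of "\<ominus> \<one>" "\<ominus> \<one>"] by simp
  then have "\<ominus> \<one> \<otimes> det2 R x\<^sub>0 x\<^sub>1 y\<^sub>0 y\<^sub>1 \<in> Units R" using u by simp
  then show ?thesis using det2_swap[OF assms(1-4)] u by (simp add: l_minus Units_closed)
qed

text \<open>The matrix multiplies the determinants of all pairs of vectors by the same unit, so the
  cross-ratio can be computed from the images.\<close>

lemma matrix_cross_ratio:
  assumes a: "a\<^sub>0 \<in> carrier R" "a\<^sub>1 \<in> carrier R" and b: "b\<^sub>0 \<in> carrier R" "b\<^sub>1 \<in> carrier R"
    and c: "c\<^sub>0 \<in> carrier R" "c\<^sub>1 \<in> carrier R" and d: "d\<^sub>0 \<in> carrier R" "d\<^sub>1 \<in> carrier R"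
    and m: "m \<in> carrier R" "n \<in> carrier R" "k \<in> carrier R" "l \<in> carrier R"
    and Ma: "m \<otimes> a\<^sub>0 \<oplus> n \<otimes> a\<^sub>1 = \<mu>\<^sub>a" "k \<otimes> a\<^sub>0 \<oplus> l \<otimes> a\<^sub>1 = \<zero>" and mua: "\<mu>\<^sub>a \<in> Units R"
    and Mb: "m \<otimes> b\<^sub>0 \<oplus> n \<otimes> b\<^sub>1 = \<zero>" "k \<otimes> b\<^sub>0 \<oplus> l \<otimes> b\<^sub>1 = \<mu>\<^sub>b" and mub: "\<mu>\<^sub>b \<in> Units R"
    and Mc: "m \<otimes> c\<^sub>0 \<oplus> n \<otimes> c\<^sub>1 = \<mu>\<^sub>c" "k \<otimes> c\<^sub>0 \<oplus> l \<otimes> c\<^sub>1 = \<mu>\<^sub>c" and muc: "\<mu>\<^sub>c \<in> Units R"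
    and ad: "det2 R a\<^sub>0 a\<^sub>1 d\<^sub>0 d\<^sub>1 \<in> Units R"
  shows "k \<otimes> d\<^sub>0 \<oplus> l \<otimes> d\<^sub>1 \<in> Units R"
    and "z \<in> carrier R \<Longrightarrow> z \<otimes> (det2 R a\<^sub>0 a\<^sub>1 d\<^sub>0 d\<^sub>1 \<otimes> det2 R b\<^sub>0 b\<^sub>1 c\<^sub>0 c\<^sub>1) =
        det2 R a\<^sub>0 a\<^sub>1 c\<^sub>0 c\<^sub>1 \<otimes> det2 R b\<^sub>0 b\<^sub>1 d\<^sub>0 d\<^sub>1 \<Longrightarrow>
      z \<otimes> (k \<otimes> d\<^sub>0 \<oplus> l \<otimes> d\<^sub>1) = m \<otimes> d\<^sub>0 \<oplus> n \<otimes> d\<^sub>1"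
proof -
  define x where "x = m \<otimes> d\<^sub>0 \<oplus> n \<otimes> d\<^sub>1"
  define y where "y = k \<otimes> d\<^sub>0 \<oplus> l \<otimes> d\<^sub>1"
  define \<Delta> where "\<Delta> = det2 R m n k l"
  have xy: "x \<in> carrier R" "y \<in> carrier R" "\<Delta> \<in> carrier R" using d m by (simp_all add: x_def y_def \<Delta>_def)
  have mu: "\<mu>\<^sub>a \<in> carrier R" "\<mu>\<^sub>b \<in> carrier R" "\<mu>\<^sub>c \<in> carrier R" using mua mub muc by auto
  \<comment> \<open>The images of a and b are multiples of (1, 0) and (0, 1) by units, so their
    determinant is a unit and the determinant of the matrix divides it.\<close>
  have "det2 R \<mu>\<^sub>a \<zero> \<zero> \<mu>\<^sub>b = \<Delta> \<otimes> det2 R a\<^sub>0 a\<^sub>1 b\<^sub>0 b\<^sub>1"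
    using det2_matrix[OF a b m] unfolding Ma Mb \<Delta>_def .
  moreover have "det2 R \<mu>\<^sub>a \<zero> \<zero> \<mu>\<^sub>b = \<mu>\<^sub>a \<otimes> \<mu>\<^sub>b" unfolding det2_def using mu by algebra
  ultimately have "\<Delta> \<otimes> det2 R a\<^sub>0 a\<^sub>1 b\<^sub>0 b\<^sub>1 = \<mu>\<^sub>a \<otimes> \<mu>\<^sub>b" by simp
  then have "\<Delta> \<otimes> det2 R a\<^sub>0 a\<^sub>1 b\<^sub>0 b\<^sub>1 \<in> Units R" using mua mub by simp
  then have Du: "\<Delta> \<in> Units R" by (rule factor_Units[OF _ xy(3) det2_closed[OF a b]])
  \<comment> \<open>The determinant with the image of a extracts the second component y of the image
    of d; below, the one with the image of b extracts the first component x.\<close>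
  have "det2 R \<mu>\<^sub>a \<zero> x y = \<Delta> \<otimes> det2 R a\<^sub>0 a\<^sub>1 d\<^sub>0 d\<^sub>1"
    using det2_matrix[OF a d m] unfolding Ma \<Delta>_def x_def y_def .
  moreover have "det2 R \<mu>\<^sub>a \<zero> x y = \<mu>\<^sub>a \<otimes> y" unfolding det2_def using mu xy by algebra
  ultimately have e1: "\<mu>\<^sub>a \<otimes> y = \<Delta> \<otimes> det2 R a\<^sub>0 a\<^sub>1 d\<^sub>0 d\<^sub>1" by simp
  then have "y \<otimes> \<mu>\<^sub>a \<in> Units R" using Du ad mu xy by (simp add: m_comm[of y])
  then have "y \<in> Units R" by (rule factor_Units[OF _ xy(2) mu(1)])
  then show "k \<otimes> d\<^sub>0 \<oplus> l \<otimes> d\<^sub>1 \<in> Units R" unfolding y_def .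
  have "det2 R \<zero> \<mu>\<^sub>b \<mu>\<^sub>c \<mu>\<^sub>c = \<Delta> \<otimes> det2 R b\<^sub>0 b\<^sub>1 c\<^sub>0 c\<^sub>1"
    using det2_matrix[OF b c m] unfolding Mb Mc \<Delta>_def .
  moreover have "det2 R \<zero> \<mu>\<^sub>b \<mu>\<^sub>c \<mu>\<^sub>c = \<ominus> (\<mu>\<^sub>b \<otimes> \<mu>\<^sub>c)" unfolding det2_def using mu by algebra
  ultimately have e2: "\<ominus> (\<mu>\<^sub>b \<otimes> \<mu>\<^sub>c) = \<Delta> \<otimes> det2 R b\<^sub>0 b\<^sub>1 c\<^sub>0 c\<^sub>1" by simp
  have "det2 R \<mu>\<^sub>a \<zero> \<mu>\<^sub>c \<mu>\<^sub>c = \<Delta> \<otimes> det2 R a\<^sub>0 a\<^sub>1 c\<^sub>0 c\<^sub>1"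
    using det2_matrix[OF a c m] unfolding Ma Mc \<Delta>_def .
  moreover have "det2 R \<mu>\<^sub>a \<zero> \<mu>\<^sub>c \<mu>\<^sub>c = \<mu>\<^sub>a \<otimes> \<mu>\<^sub>c" unfolding det2_def using mu by algebra
  ultimately have e3: "\<mu>\<^sub>a \<otimes> \<mu>\<^sub>c = \<Delta> \<otimes> det2 R a\<^sub>0 a\<^sub>1 c\<^sub>0 c\<^sub>1" by simp
  have "det2 R \<zero> \<mu>\<^sub>b x y = \<Delta> \<otimes> det2 R b\<^sub>0 b\<^sub>1 d\<^sub>0 d\<^sub>1"
    using det2_matrix[OF b d m] unfolding Mb \<Delta>_def x_def y_def .
  moreover have "det2 R \<zero> \<mu>\<^sub>b x y = \<ominus> (\<mu>\<^sub>b \<otimes> x)" unfolding det2_def using mu xy by algebra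
  ultimately have e4: "\<ominus> (\<mu>\<^sub>b \<otimes> x) = \<Delta> \<otimes> det2 R b\<^sub>0 b\<^sub>1 d\<^sub>0 d\<^sub>1" by simp
  assume z: "z \<in> carrier R" and e: "z \<otimes> (det2 R a\<^sub>0 a\<^sub>1 d\<^sub>0 d\<^sub>1 \<otimes> det2 R b\<^sub>0 b\<^sub>1 c\<^sub>0 c\<^sub>1) =
        det2 R a\<^sub>0 a\<^sub>1 c\<^sub>0 c\<^sub>1 \<otimes> det2 R b\<^sub>0 b\<^sub>1 d\<^sub>0 d\<^sub>1"
  note dc = det2_closed[OF a d] det2_closed[OF b c] det2_closed[OF a c] det2_closed[OF b d]
  \<comment> \<open>The determinants with b first carry a sign; one of them stands in the numerator
    and one in the denominator, so the signs cancel. The common unit factor is removed at the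
    end.\<close>
  have "(\<mu>\<^sub>a \<otimes> \<mu>\<^sub>b \<otimes> \<mu>\<^sub>c) \<otimes> (z \<otimes> y) = \<ominus> (z \<otimes> ((\<mu>\<^sub>a \<otimes> y) \<otimes> (\<ominus> (\<mu>\<^sub>b \<otimes> \<mu>\<^sub>c))))" using mu xy z by algebra
  also have "\<dots> = \<ominus> ((\<Delta> \<otimes> \<Delta>) \<otimes> (z \<otimes> (det2 R a\<^sub>0 a\<^sub>1 d\<^sub>0 d\<^sub>1 \<otimes> det2 R b\<^sub>0 b\<^sub>1 c\<^sub>0 c\<^sub>1)))"
    unfolding e1 e2 using dc z xy by (simp add: m_ac)
  also have "\<dots> = \<ominus> ((\<Delta> \<otimes> det2 R a\<^sub>0 a\<^sub>1 c\<^sub>0 c\<^sub>1) \<otimes> (\<Delta> \<otimes> det2 R b\<^sub>0 b\<^sub>1 d\<^sub>0 d\<^sub>1))"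
    unfolding e using dc xy by (simp add: m_ac)
  also have "\<dots> = (\<mu>\<^sub>a \<otimes> \<mu>\<^sub>b \<otimes> \<mu>\<^sub>c) \<otimes> x" unfolding e3[symmetric] e4[symmetric] using mu xy by algebra
  finally have "z \<otimes> y = x"
    using Units_l_cancel[of "\<mu>\<^sub>a \<otimes> \<mu>\<^sub>b \<otimes> \<mu>\<^sub>c" "z \<otimes> y" x] mua mub muc xy z by simp
  then show "z \<otimes> (k \<otimes> d\<^sub>0 \<oplus> l \<otimes> d\<^sub>1) = m \<otimes> d\<^sub>0 \<oplus> n \<otimes> d\<^sub>1" unfolding x_def y_def .
qed

text \<open>For quotients of determinants: \<open>g\<close> collects frame coordinates common to
  numerator and denominator, which depend on arbitrary charts. They cancel, so the quotient carries
  a frame with coordinate p to a section with coordinate x.\<close>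

lemma Units_cancel_quotient:
  assumes "g \<in> Units R" "p \<in> carrier R" "x \<in> carrier R" "p \<otimes> g \<in> Units R"
  shows "x \<otimes> g \<otimes> inv (p \<otimes> g) \<otimes> p = x"
proof -
  have g: "g \<in> carrier R" "inv (p \<otimes> g) \<in> carrier R" using assms by auto
  have "g \<otimes> (x \<otimes> g \<otimes> inv (p \<otimes> g) \<otimes> p) = (g \<otimes> x) \<otimes> (inv (p \<otimes> g) \<otimes> (p \<otimes> g))"
    using g assms(2,3) by (simp only: m_ac m_closed)
  also have "\<dots> = g \<otimes> x" using assms(3,4) g by simp
  finally show ?thesis using Units_l_cancel[OF assms(1)] g assms(2,3) by simp
qed

end

lemma (in ringed) ogerm_det2:
  assumes U: "Op U" "p \<in> U"
    and x: "x\<^sub>0 \<in> carrier (sec S U)" "x\<^sub>1 \<in> carrier (sec S U)" "y\<^sub>0 \<in> carrier (sec S U)" "y\<^sub>1 \<in> carrier (sec S U)"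
  shows "ogerm S p U (det2 (sec S U) x\<^sub>0 x\<^sub>1 y\<^sub>0 y\<^sub>1) =
    det2 (R p) (ogerm S p U x\<^sub>0) (ogerm S p U x\<^sub>1) (ogerm S p U y\<^sub>0) (ogerm S p U y\<^sub>1)"
proof -
  interpret u: cring "sec S U" by (rule cringO[OF U(1)])
  show ?thesis unfolding det2_def using ogerm_minus[OF U] ogerm_mult[OF U] x by simp
qed

section \<open>Tensor products over S, and points of the projective line in coordinates\<close>

context ringed
begin

lemma preim_id: "Op U \<Longrightarrow> preim S id_morph U = U"
  using openin_subset by (auto simp: preim_def id_morph_def)

lemma ringed_map_id: "ringed_map S S id_morph"
proof unfold_locales
  show "continuous_map (spc S) (spc S) (pt id_morph)" by (simp add: id_morph_def)
  fix U assume U: "Op U"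
  show "sh id_morph U \<in> ring_hom (sec S U) (sec S (preim S id_morph U))"
    unfolding preim_id[OF U] by (rule ring_hom_memI) (simp_all add: id_morph_def)
  fix V s assume V: "Op V" "V \<subseteq> U"
  show "sh id_morph V (res S U V s) = res S (preim S id_morph U) (preim S id_morph V) (sh id_morph U s)"
    unfolding preim_id[OF U] preim_id[OF V(1)] by (simp add: id_morph_def)
qed

lemma pt_id: "pt id_morph p = p"
  by (simp add: id_morph_def)

lemma stalk_map_id:
  assumes "x \<in> carrier (R p)"
  shows "stalk_map S id_morph p x = x"
proof -
  interpret ringed_map S S id_morph by (rule ringed_map_id)
  obtain U s where U: "x = ogerm S p U s" "Op U" "p \<in> U" "s \<in> carrier (sec S U)" by (rule stalk_carrierE[OF assms])
  have "p \<in> preim S id_morph U" unfolding preim_id[OF U(2)] by (rule U(3))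
  from stalk_map_ogerm[OF U(2) this U(4)] show ?thesis unfolding U(1) pt_id preim_id[OF U(2)] by (simp add: id_morph_def)
qed

text \<open>The case of the identity morphism, whose stalk maps are identities. The coordinates are
  handed out as an abstract \<open>v\<close> that hides their construction.\<close>

lemma tensor_coordinates:
  assumes L: "line_bundle S L" and A: "line_bundle S A" and cL: "charts L cL" and cA: "charts A cA"
  obtains v where "coordinates S (tensor_sheaf S L A) v"
    "\<And>U l a. Op U \<Longrightarrow> l \<in> carrier (msec L U) \<Longrightarrow> a \<in> carrier (msec A U) \<Longrightarrow>
      tensor_sum S S id_morph L A U U {#(l, a)#} \<in> carrier (msec (tensor_sheaf S L A) U)"
    "\<And>U q l a. Op U \<Longrightarrow> q \<in> U \<Longrightarrow> l \<in> carrier (msec L U) \<Longrightarrow> a \<in> carrier (msec A U) \<Longrightarrow>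
      v q U (tensor_sum S S id_morph L A U U {#(l, a)#}) = cL q (mgerm S L q U l) \<otimes>\<^bsub>R q\<^esub> cA q (mgerm S A q U a)"
proof -
  interpret m: ringed_map S S id_morph by (rule ringed_map_id)
  interpret tensor_product S S id_morph L A cL cA
    by unfold_locales (use L A cL cA in \<open>simp_all add: line_bundle_def\<close>)
  show ?thesis
  proof (rule that[OF coordinates_tensor])
    fix U l a assume U: "Op U" and l: "l \<in> carrier (msec L U)" and a: "a \<in> carrier (msec A U)"
    have p: "U \<subseteq> preim S id_morph U" by (simp add: preim_id[OF U])
    note ps = pure_sum[OF U U p l a]
    show "tensor_sum S S id_morph L A U U {#(l, a)#} \<in> carrier (msec (tensor_sheaf S L A) U)" by (rule ps(1))
    fix q assume q: "q \<in> U"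
    have "cA q (mgerm S A q U a) \<in> carrier (R q)" by (rule cA.val_closed[OF U q a])
    then show "tc q (tensor_sum S S id_morph L A U U {#(l, a)#} q) = cL q (mgerm S L q U l) \<otimes>\<^bsub>R q\<^esub> cA q (mgerm S A q U a)"
      using ps(2)[OF q] stalk_map_id unfolding pt_id by simp
  qed
qed

lemma P1_eq_scaling:
  assumes A: "coordinates S A v" and B: "coordinates S B w"
    and a: "a\<^sub>0 \<in> carrier (msec A (points S))" "a\<^sub>1 \<in> carrier (msec A (points S))"
    and e: "P1_eq S (A, a\<^sub>0, a\<^sub>1) (B, b\<^sub>0, b\<^sub>1)" and p: "p \<in> points S"
  shows "\<exists>u \<in> Units (R p). w p (points S) b\<^sub>0 = u \<otimes>\<^bsub>R p\<^esub> v p (points S) a\<^sub>0 \<and>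
    w p (points S) b\<^sub>1 = u \<otimes>\<^bsub>R p\<^esub> v p (points S) a\<^sub>1"
proof -
  obtain \<theta> where th: "module_sheaf_iso S A B \<theta>" "\<theta> (points S) a\<^sub>0 = b\<^sub>0" "\<theta> (points S) a\<^sub>1 = b\<^sub>1" using e by auto
  obtain u where u: "u \<in> Units (R p)" and *: "\<forall>U x. Op U \<longrightarrow> p \<in> U \<longrightarrow> x \<in> carrier (msec A U) \<longrightarrow>
      w p U (\<theta> U x) = u \<otimes>\<^bsub>R p\<^esub> v p U x"
    using iso_imp_scaling[OF A B th(1) p] by blast
  note s = *[rule_format, OF openin_topspace p]
  show ?thesis using u s[OF a(1)] s[OF a(2)] th(2,3) by auto
qed

text \<open>Converse of \<open>P1_point_coords\<close>: multiplying the relation for 1 by the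
  coordinate of x expresses x by the two sections.\<close>

lemma P1_pointI:
  assumes A: "line_bundle S A" and c: "charts A c"
    and a: "a\<^sub>0 \<in> carrier (msec A (points S))" "a\<^sub>1 \<in> carrier (msec A (points S))"
    and gen: "\<And>p. p \<in> points S \<Longrightarrow> \<exists>r\<^sub>0 \<in> carrier (R p). \<exists>r\<^sub>1 \<in> carrier (R p).
      r\<^sub>0 \<otimes>\<^bsub>R p\<^esub> c p (mgerm S A p (points S) a\<^sub>0) \<oplus>\<^bsub>R p\<^esub> r\<^sub>1 \<otimes>\<^bsub>R p\<^esub> c p (mgerm S A p (points S) a\<^sub>1) = \<one>\<^bsub>R p\<^esub>"
  shows "P1_point S (A, a\<^sub>0, a\<^sub>1)"
proof -
  interpret M: module_sheaf_on S A by unfold_locales (use A in \<open>simp add: line_bundle_def\<close>)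
  have "\<exists>r\<^sub>0 \<in> carrier (R p). \<exists>r\<^sub>1 \<in> carrier (R p).
      x = r\<^sub>0 \<odot>\<^bsub>mstalk S A p\<^esub> mgerm S A p (points S) a\<^sub>0 \<oplus>\<^bsub>mstalk S A p\<^esub> r\<^sub>1 \<odot>\<^bsub>mstalk S A p\<^esub> mgerm S A p (points S) a\<^sub>1"
    if p: "p \<in> points S" and x: "x \<in> carrier (mstalk S A p)" for p x
  proof -
    interpret r: rank_one "R p" "mstalk S A p" "c p" using c p by (simp add: charts_def)
    have m: "mgerm S A p (points S) a\<^sub>0 \<in> carrier (mstalk S A p)" "mgerm S A p (points S) a\<^sub>1 \<in> carrier (mstalk S A p)"
      using a p by auto
    obtain r\<^sub>0 r\<^sub>1 where rr: "r\<^sub>0 \<in> carrier (R p)" "r\<^sub>1 \<in> carrier (R p)"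
      "r\<^sub>0 \<otimes>\<^bsub>R p\<^esub> c p (mgerm S A p (points S) a\<^sub>0) \<oplus>\<^bsub>R p\<^esub> r\<^sub>1 \<otimes>\<^bsub>R p\<^esub> c p (mgerm S A p (points S) a\<^sub>1) = \<one>\<^bsub>R p\<^esub>"
      using gen[OF p] by blast
    have sm: "c p x \<otimes>\<^bsub>R p\<^esub> r\<^sub>0 \<in> carrier (R p)" "c p x \<otimes>\<^bsub>R p\<^esub> r\<^sub>1 \<in> carrier (R p)" using rr x by auto
    let ?y = "(c p x \<otimes>\<^bsub>R p\<^esub> r\<^sub>0) \<odot>\<^bsub>mstalk S A p\<^esub> mgerm S A p (points S) a\<^sub>0 \<oplus>\<^bsub>mstalk S A p\<^esub>
      (c p x \<otimes>\<^bsub>R p\<^esub> r\<^sub>1) \<odot>\<^bsub>mstalk S A p\<^esub> mgerm S A p (points S) a\<^sub>1"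
    have y: "?y \<in> carrier (mstalk S A p)" by (rule r.add_mem[OF r.smult_mem[OF sm(1) m(1)] r.smult_mem[OF sm(2) m(2)]])
    have "c p ?y = c p x \<otimes>\<^bsub>R p\<^esub> (r\<^sub>0 \<otimes>\<^bsub>R p\<^esub> c p (mgerm S A p (points S) a\<^sub>0) \<oplus>\<^bsub>R p\<^esub> r\<^sub>1 \<otimes>\<^bsub>R p\<^esub> c p (mgerm S A p (points S) a\<^sub>1))"
      unfolding r.c_add[OF r.smult_mem[OF sm(1) m(1)] r.smult_mem[OF sm(2) m(2)]] r.c_smult[OF sm(1) m(1)] r.c_smult[OF sm(2) m(2)]
      using r.c_closed[OF m(1)] r.c_closed[OF m(2)] r.c_closed[OF x] rr(1,2) by (simp add: r.m_assoc r.r_distr)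
    then have "c p ?y = c p x" unfolding rr(3) using r.c_closed[OF x] by simp
    then have "x = ?y" using r.c_inj[OF x y] by simp
    then show ?thesis using sm by blast
  qed
  then show ?thesis using A a by simp
qed

text \<open>A frame \<open>e\<close> over W in which two global sections have regular components.
  The coordinates of the sections depend on arbitrary charts, but determinants of components are
  functions, and this makes quotients of determinants regular relative to frames.\<close>

definition lframe where
  "lframe F v x\<^sub>0 x\<^sub>1 W e r\<^sub>0 r\<^sub>1 \<longleftrightarrow> Op W \<and> e \<in> carrier (msec F W) \<and> r\<^sub>0 \<in> carrier (sec S W) \<and> r\<^sub>1 \<in> carrier (sec S W) \<and>
    (\<forall>q \<in> W. v q W e \<in> Units (R q) \<and> v q (points S) x\<^sub>0 = ogerm S q W r\<^sub>0 \<otimes>\<^bsub>R q\<^esub> v q W e \<and>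
      v q (points S) x\<^sub>1 = ogerm S q W r\<^sub>1 \<otimes>\<^bsub>R q\<^esub> v q W e)"

lemma lframeD:
  assumes "lframe F v x\<^sub>0 x\<^sub>1 W e r\<^sub>0 r\<^sub>1"
  shows "Op W" "e \<in> carrier (msec F W)" "r\<^sub>0 \<in> carrier (sec S W)" "r\<^sub>1 \<in> carrier (sec S W)"
    "q \<in> W \<Longrightarrow> v q W e \<in> Units (R q)" "q \<in> W \<Longrightarrow> v q (points S) x\<^sub>0 = ogerm S q W r\<^sub>0 \<otimes>\<^bsub>R q\<^esub> v q W e"
    "q \<in> W \<Longrightarrow> v q (points S) x\<^sub>1 = ogerm S q W r\<^sub>1 \<otimes>\<^bsub>R q\<^esub> v q W e"
  using assms unfolding lframe_def by simp_all

lemma lframe_restrict: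
  assumes F: "coordinates S F v" and l: "lframe F v x\<^sub>0 x\<^sub>1 W e r\<^sub>0 r\<^sub>1" and V: "Op V" "V \<subseteq> W"
  shows "lframe F v x\<^sub>0 x\<^sub>1 V (mres F W V e) (res S W V r\<^sub>0) (res S W V r\<^sub>1)"
proof -
  interpret coordinates S F v by (rule F)
  note lD = lframeD[OF l]
  show ?thesis
    unfolding lframe_def
  proof (intro conjI ballI)
    fix q assume q: "q \<in> V"
    then have qW: "q \<in> W" using V by auto
    show "v q V (mres F W V e) \<in> Units (R q)" unfolding val_res[OF lD(1) V q lD(2)] by (rule lD(5)[OF qW])
    show "v q (points S) x\<^sub>0 = ogerm S q V (res S W V r\<^sub>0) \<otimes>\<^bsub>R q\<^esub> v q V (mres F W V e)"
      unfolding val_res[OF lD(1) V q lD(2)] ogerm_res[OF lD(1) V(1) q V(2) lD(3)] by (rule lD(6)[OF qW])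
    show "v q (points S) x\<^sub>1 = ogerm S q V (res S W V r\<^sub>1) \<otimes>\<^bsub>R q\<^esub> v q V (mres F W V e)"
      unfolding val_res[OF lD(1) V q lD(2)] ogerm_res[OF lD(1) V(1) q V(2) lD(4)] by (rule lD(7)[OF qW])
  qed (use V lD mres_closed sheaf_resD[OF sheafO lD(1) V] in auto)
qed

lemma lframe_exists:
  assumes F: "coordinates S F v" and p: "p \<in> points S"
    and x: "x\<^sub>0 \<in> carrier (msec F (points S))" "x\<^sub>1 \<in> carrier (msec F (points S))"
  shows "\<exists>W e r\<^sub>0 r\<^sub>1. p \<in> W \<and> lframe F v x\<^sub>0 x\<^sub>1 W e r\<^sub>0 r\<^sub>1"
proof -
  interpret coordinates S F v by (rule F)
  obtain U e where U: "Op U" "p \<in> U" "e \<in> carrier (msec F U)" and eu: "\<And>q. q \<in> U \<Longrightarrow> v q U e \<in> Units (R q)"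
    using frame[OF p] by blast
  obtain W r where W: "Op W" "p \<in> W" "W \<subseteq> U \<inter> points S" "r \<in> carrier (sec S W)"
    "\<And>q. q \<in> W \<Longrightarrow> v q (points S) x\<^sub>0 = ogerm S q W r \<otimes>\<^bsub>R q\<^esub> v q U e"
    using expand[OF U eu[OF U(2)] openin_topspace p x(1)] by blast
  obtain V s where V: "Op V" "p \<in> V" "V \<subseteq> U \<inter> points S" "s \<in> carrier (sec S V)"
    "\<And>q. q \<in> V \<Longrightarrow> v q (points S) x\<^sub>1 = ogerm S q V s \<otimes>\<^bsub>R q\<^esub> v q U e"
    using expand[OF U eu[OF U(2)] openin_topspace p x(2)] by blast
  let ?Y = "W \<inter> V"
  have Y: "Op ?Y" "p \<in> ?Y" "?Y \<subseteq> U" "?Y \<subseteq> W" "?Y \<subseteq> V" using W V by auto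
  have "lframe F v x\<^sub>0 x\<^sub>1 ?Y (mres F U ?Y e) (res S W ?Y r) (res S V ?Y s)"
    unfolding lframe_def
  proof (intro conjI ballI)
    fix q assume q: "q \<in> ?Y"
    then have q': "q \<in> U" "q \<in> W" "q \<in> V" using Y by auto
    show "v q ?Y (mres F U ?Y e) \<in> Units (R q)" unfolding val_res[OF U(1) Y(1,3) q U(3)] by (rule eu[OF q'(1)])
    show "v q (points S) x\<^sub>0 = ogerm S q ?Y (res S W ?Y r) \<otimes>\<^bsub>R q\<^esub> v q ?Y (mres F U ?Y e)"
      unfolding val_res[OF U(1) Y(1,3) q U(3)] ogerm_res[OF W(1) Y(1) q Y(4) W(4)] by (rule W(5)[OF q'(2)])
    show "v q (points S) x\<^sub>1 = ogerm S q ?Y (res S V ?Y s) \<otimes>\<^bsub>R q\<^esub> v q ?Y (mres F U ?Y e)"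
      unfolding val_res[OF U(1) Y(1,3) q U(3)] ogerm_res[OF V(1) Y(1) q Y(5) V(4)] by (rule V(5)[OF q'(3)])
  next
    show "mres F U ?Y e \<in> carrier (msec F ?Y)" by (rule mres_closed[OF U(1) Y(1,3) U(3)])
    show "res S W ?Y r \<in> carrier (sec S ?Y)" by (rule sheaf_resD[OF sheafO W(1) Y(1,4) W(4)])
    show "res S V ?Y s \<in> carrier (sec S ?Y)" by (rule sheaf_resD[OF sheafO V(1) Y(1,5) V(4)])
  qed (rule Y(1))
  then show ?thesis using Y(2) by blast
qed

lemma lframes_exist:
  assumes F: "coordinates S F v" and G: "coordinates S G w" and H: "coordinates S H y" and p: "p \<in> points S"
    and a: "a\<^sub>0 \<in> carrier (msec F (points S))" "a\<^sub>1 \<in> carrier (msec F (points S))"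
    and b: "b\<^sub>0 \<in> carrier (msec G (points S))" "b\<^sub>1 \<in> carrier (msec G (points S))"
    and c: "c\<^sub>0 \<in> carrier (msec H (points S))" "c\<^sub>1 \<in> carrier (msec H (points S))"
  obtains W e r\<^sub>0 r\<^sub>1 f s\<^sub>0 s\<^sub>1 g t\<^sub>0 t\<^sub>1 where "p \<in> W" "lframe F v a\<^sub>0 a\<^sub>1 W e r\<^sub>0 r\<^sub>1"
    "lframe G w b\<^sub>0 b\<^sub>1 W f s\<^sub>0 s\<^sub>1" "lframe H y c\<^sub>0 c\<^sub>1 W g t\<^sub>0 t\<^sub>1"
proof -
  obtain W1 e r\<^sub>0 r\<^sub>1 where 1: "p \<in> W1" "lframe F v a\<^sub>0 a\<^sub>1 W1 e r\<^sub>0 r\<^sub>1" using lframe_exists[OF F p a] by blast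
  obtain W2 f s\<^sub>0 s\<^sub>1 where 2: "p \<in> W2" "lframe G w b\<^sub>0 b\<^sub>1 W2 f s\<^sub>0 s\<^sub>1" using lframe_exists[OF G p b] by blast
  obtain W3 g t\<^sub>0 t\<^sub>1 where 3: "p \<in> W3" "lframe H y c\<^sub>0 c\<^sub>1 W3 g t\<^sub>0 t\<^sub>1" using lframe_exists[OF H p c] by blast
  let ?W = "W1 \<inter> W2 \<inter> W3"
  have o: "Op ?W" "p \<in> ?W" "?W \<subseteq> W1" "?W \<subseteq> W2" "?W \<subseteq> W3"
    using 1 2 3 lframeD(1)[OF 1(2)] lframeD(1)[OF 2(2)] lframeD(1)[OF 3(2)] by auto
  show ?thesis
    by (rule that[OF o(2) lframe_restrict[OF F 1(2) o(1,3)] lframe_restrict[OF G 2(2) o(1,4)] lframe_restrict[OF H 3(2) o(1,5)]])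
qed

text \<open>Bilinearity separates the regular part of a determinant from the coordinates of the
  frames, which depend on the charts.\<close>

lemma lframe_det2:
  assumes l: "lframe F v a\<^sub>0 a\<^sub>1 W e r\<^sub>0 r\<^sub>1" and m: "lframe G w b\<^sub>0 b\<^sub>1 W f s\<^sub>0 s\<^sub>1" and q: "q \<in> W"
  shows "det2 (R q) (v q (points S) a\<^sub>0) (v q (points S) a\<^sub>1) (w q (points S) b\<^sub>0) (w q (points S) b\<^sub>1) =
    ogerm S q W (det2 (sec S W) r\<^sub>0 r\<^sub>1 s\<^sub>0 s\<^sub>1) \<otimes>\<^bsub>R q\<^esub> (v q W e \<otimes>\<^bsub>R q\<^esub> w q W f)"
proof -
  note lD = lframeD[OF l] and mD = lframeD[OF m]
  interpret b: cring "R q" by (rule cring_stalk[OF Op_sub[OF lD(1) q]])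
  note c = ogerm_closed[OF lD(1) q lD(3)] ogerm_closed[OF lD(1) q lD(4)]
    ogerm_closed[OF lD(1) q mD(3)] ogerm_closed[OF lD(1) q mD(4)]
  have u: "v q W e \<in> carrier (R q)" "w q W f \<in> carrier (R q)" using lD(5)[OF q] mD(5)[OF q] by auto
  show ?thesis
    unfolding lD(6)[OF q] lD(7)[OF q] mD(6)[OF q] mD(7)[OF q] ogerm_det2[OF lD(1) q lD(3,4) mD(3,4)]
    using b.det2_scale[OF c u] c u by (simp add: b.m_comm)
qed

text \<open>Multiplication by \<open>\<Delta>(a, y) / \<Delta>(x, y)\<close> is an isomorphism between the bundles of \<open>x\<close> and \<open>a\<close>.\<close>

lemma point_on_bundle:
  assumes A: "P1_point S (A, a\<^sub>0, a\<^sub>1)" "charts A cA" and X: "P1_point S (X, x\<^sub>0, x\<^sub>1)" "charts X cX"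
    and Y: "P1_point S (Y, y\<^sub>0, y\<^sub>1)" "charts Y cY"
    and ay: "\<And>p. p \<in> points S \<Longrightarrow> det2 (R p) (cA p (mgerm S A p (points S) a\<^sub>0)) (cA p (mgerm S A p (points S) a\<^sub>1))
      (cY p (mgerm S Y p (points S) y\<^sub>0)) (cY p (mgerm S Y p (points S) y\<^sub>1)) \<in> Units (R p)"
    and xy: "\<And>p. p \<in> points S \<Longrightarrow> det2 (R p) (cX p (mgerm S X p (points S) x\<^sub>0)) (cX p (mgerm S X p (points S) x\<^sub>1))
      (cY p (mgerm S Y p (points S) y\<^sub>0)) (cY p (mgerm S Y p (points S) y\<^sub>1)) \<in> Units (R p)"
  shows "\<exists>x'. P1_point S (A, x') \<and> P1_eq S (X, x\<^sub>0, x\<^sub>1) (A, x')"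
proof -
  let ?vA = "\<lambda>p U x. cA p (mgerm S A p U x)" and ?vX = "\<lambda>p U x. cX p (mgerm S X p U x)"
    and ?vY = "\<lambda>p U x. cY p (mgerm S Y p U x)" and ?P = "points S"
  interpret vA: coordinates S A ?vA using A(2) by (simp add: charts_def)
  interpret vX: coordinates S X ?vX using X(2) by (simp add: charts_def)
  interpret vY: coordinates S Y ?vY using Y(2) by (simp add: charts_def)
  note a = P1_point_coords[OF A] and x = P1_point_coords[OF X] and y = P1_point_coords[OF Y]
  let ?N = "\<lambda>q. det2 (R q) (?vA q ?P a\<^sub>0) (?vA q ?P a\<^sub>1) (?vY q ?P y\<^sub>0) (?vY q ?P y\<^sub>1)"
  let ?D = "\<lambda>q. det2 (R q) (?vX q ?P x\<^sub>0) (?vX q ?P x\<^sub>1) (?vY q ?P y\<^sub>0) (?vY q ?P y\<^sub>1)"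
  \<comment> \<open>The two determinants are nowhere vanishing sections of A \<otimes> Y and X
    \<otimes> Y, so A and X are both inverse to Y; \<open>?u\<close> is the resulting isomorphism
    from X to A.\<close>
  let ?u = "\<lambda>q. ?N q \<otimes>\<^bsub>R q\<^esub> inv\<^bsub>R q\<^esub> ?D q"
  have uu: "?u p \<in> Units (R p)" if p: "p \<in> points S" for p
  proof -
    interpret b: cring "R p" by (rule cring_stalk[OF p])
    show ?thesis by (rule b.Units_m_closed[OF ay[OF p] b.Units_inv_Units[OF xy[OF p]]])
  qed
  have "\<exists>\<theta>. module_sheaf_iso S X A \<theta> \<and> (\<forall>U x. Op U \<longrightarrow> x \<in> carrier (msec X U) \<longrightarrow>
      (\<forall>p \<in> U. ?vA p U (\<theta> U x) = ?u p \<otimes>\<^bsub>R p\<^esub> ?vX p U x))"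
  proof (rule scaling_imp_iso[OF vX.coordinates_axioms vA.coordinates_axioms _ uu])
    fix p assume p: "p \<in> points S"
    obtain W e r\<^sub>0 r\<^sub>1 f s\<^sub>0 s\<^sub>1 g t\<^sub>0 t\<^sub>1 where pW: "p \<in> W" and le: "lframe A ?vA a\<^sub>0 a\<^sub>1 W e r\<^sub>0 r\<^sub>1"
      and lf: "lframe X ?vX x\<^sub>0 x\<^sub>1 W f s\<^sub>0 s\<^sub>1" and lg: "lframe Y ?vY y\<^sub>0 y\<^sub>1 W g t\<^sub>0 t\<^sub>1"
      by (rule lframes_exist[OF vA.coordinates_axioms vX.coordinates_axioms vY.coordinates_axioms p a(1,2) x(1,2) y(1,2)])
    note eD = lframeD[OF le] and fD = lframeD[OF lf] and gD = lframeD[OF lg]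
    interpret w: cring "sec S W" by (rule cringO[OF eD(1)])
    \<comment> \<open>Over W the isomorphism takes \<open>?d\<close> f to \<open>?n\<close> e: the
      frame coordinate of Y occurs in both determinants and cancels.\<close>
    let ?n = "det2 (sec S W) r\<^sub>0 r\<^sub>1 t\<^sub>0 t\<^sub>1" and ?d = "det2 (sec S W) s\<^sub>0 s\<^sub>1 t\<^sub>0 t\<^sub>1"
    have nd: "?n \<in> carrier (sec S W)" "?d \<in> carrier (sec S W)" using eD(3,4) fD(3,4) gD(3,4) by auto
    have main: "?vX q W (?d \<odot>\<^bsub>msec X W\<^esub> f) \<in> Units (R q) \<and>
        ?vA q W (?n \<odot>\<^bsub>msec A W\<^esub> e) = ?u q \<otimes>\<^bsub>R q\<^esub> ?vX q W (?d \<odot>\<^bsub>msec X W\<^esub> f)" if q: "q \<in> W" for q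
    proof -
      have qS: "q \<in> points S" by (rule Op_sub[OF eD(1) q])
      interpret b: cring "R q" by (rule cring_stalk[OF qS])
      note c = ogerm_closed[OF eD(1) q nd(1)] ogerm_closed[OF eD(1) q nd(2)]
      note eu = eD(5)[OF q] and fu = fD(5)[OF q] and gu = gD(5)[OF q]
      note ec = b.Units_closed[OF eu] and fc = b.Units_closed[OF fu] and gc = b.Units_closed[OF gu]
      have D: "?D q = (ogerm S q W ?d \<otimes>\<^bsub>R q\<^esub> ?vX q W f) \<otimes>\<^bsub>R q\<^esub> ?vY q W g"
        unfolding lframe_det2[OF lf lg q] using c ec fc gc by (simp add: b.m_assoc)
      have N: "?N q = (ogerm S q W ?n \<otimes>\<^bsub>R q\<^esub> ?vA q W e) \<otimes>\<^bsub>R q\<^esub> ?vY q W g"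
        unfolding lframe_det2[OF le lg q] using c ec fc gc by (simp add: b.m_assoc)
      have Du: "(ogerm S q W ?d \<otimes>\<^bsub>R q\<^esub> ?vX q W f) \<otimes>\<^bsub>R q\<^esub> ?vY q W g \<in> Units (R q)"
        using xy[OF qS] unfolding D .
      have "ogerm S q W ?d \<otimes>\<^bsub>R q\<^esub> ?vX q W f \<in> Units (R q)"
        by (rule b.factor_Units[OF Du b.m_closed[OF c(2) fc] gc])
      moreover have "ogerm S q W ?n \<otimes>\<^bsub>R q\<^esub> ?vA q W e = ?u q \<otimes>\<^bsub>R q\<^esub> (ogerm S q W ?d \<otimes>\<^bsub>R q\<^esub> ?vX q W f)"
        unfolding D N
        by (rule b.Units_cancel_quotient[symmetric, OF gu b.m_closed[OF c(2) fc] b.m_closed[OF c(1) ec] Du])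
      ultimately show ?thesis
        unfolding vX.val_smult[OF eD(1) q nd(2) fD(2)] vA.val_smult[OF eD(1) q nd(1) eD(2)] by blast
    qed
    show "\<exists>U e e'. Op U \<and> p \<in> U \<and> e \<in> carrier (msec X U) \<and> e' \<in> carrier (msec A U) \<and>
      (\<forall>q \<in> U. ?vX q U e \<in> Units (R q) \<and> ?vA q U e' = ?u q \<otimes>\<^bsub>R q\<^esub> ?vX q U e)"
      using eD(1) pW main vX.smult_closed[OF eD(1) nd(2) fD(2)] vA.smult_closed[OF eD(1) nd(1) eD(2)]
      by (intro exI[of _ W] exI[of _ "?d \<odot>\<^bsub>msec X W\<^esub> f"] exI[of _ "?n \<odot>\<^bsub>msec A W\<^esub> e"]) simp
  qed
  then obtain \<theta> where tt: "module_sheaf_iso S X A \<theta> \<and> (\<forall>U x. Op U \<longrightarrow> x \<in> carrier (msec X U) \<longrightarrow>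
      (\<forall>p \<in> U. ?vA p U (\<theta> U x) = ?u p \<otimes>\<^bsub>R p\<^esub> ?vX p U x))" ..
  note th = tt[THEN conjunct1] and thv = tt[THEN conjunct2, rule_format, OF openin_topspace]
  have cl: "\<theta> ?P x \<in> carrier (msec A ?P)" if "x \<in> carrier (msec X ?P)" for x
    using th[unfolded module_sheaf_iso_def, THEN conjunct1, rule_format, OF openin_topspace, THEN conjunct1] that
    by (rule bij_betw_apply)
  have "P1_point S (A, \<theta> ?P x\<^sub>0, \<theta> ?P x\<^sub>1)"
  proof (rule P1_pointI[OF _ A(2) cl[OF x(1)] cl[OF x(2)]])
    show "line_bundle S A" using A(1) by simp
    fix p assume p: "p \<in> points S"
    interpret b: cring "R p" by (rule cring_stalk[OF p])
    obtain r\<^sub>0 r\<^sub>1 where r: "r\<^sub>0 \<in> carrier (R p)" "r\<^sub>1 \<in> carrier (R p)"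
      "r\<^sub>0 \<otimes>\<^bsub>R p\<^esub> ?vX p ?P x\<^sub>0 \<oplus>\<^bsub>R p\<^esub> r\<^sub>1 \<otimes>\<^bsub>R p\<^esub> ?vX p ?P x\<^sub>1 = \<one>\<^bsub>R p\<^esub>" using x(3)[OF p] by blast
    \<comment> \<open>The unimodularity relation for x is transported by dividing its coefficients
      by \<open>?u\<close>, the factor by which the coordinates have grown.\<close>
    let ?i = "inv\<^bsub>R p\<^esub> (?u p)"
    note uc = b.Units_closed[OF uu[OF p]] and ic = b.Units_inv_closed[OF uu[OF p]]
    note vc = vX.val_closed[OF openin_topspace p x(1)] vX.val_closed[OF openin_topspace p x(2)]
    have "r\<^sub>0 \<otimes>\<^bsub>R p\<^esub> ?i \<otimes>\<^bsub>R p\<^esub> ?vA p ?P (\<theta> ?P x\<^sub>0) \<oplus>\<^bsub>R p\<^esub> r\<^sub>1 \<otimes>\<^bsub>R p\<^esub> ?i \<otimes>\<^bsub>R p\<^esub> ?vA p ?P (\<theta> ?P x\<^sub>1) =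
        (?i \<otimes>\<^bsub>R p\<^esub> ?u p) \<otimes>\<^bsub>R p\<^esub> (r\<^sub>0 \<otimes>\<^bsub>R p\<^esub> ?vX p ?P x\<^sub>0 \<oplus>\<^bsub>R p\<^esub> r\<^sub>1 \<otimes>\<^bsub>R p\<^esub> ?vX p ?P x\<^sub>1)"
      unfolding thv[OF x(1) p] thv[OF x(2) p]
      by (subst b.r_distr) (use uc ic vc r(1,2) in \<open>simp_all add: b.m_ac del: b.Units_l_inv b.Units_r_inv\<close>)
    also have "\<dots> = \<one>\<^bsub>R p\<^esub>" unfolding r(3) b.Units_l_inv[OF uu[OF p]] by simp
    finally show "\<exists>r\<^sub>0 \<in> carrier (R p). \<exists>r\<^sub>1 \<in> carrier (R p).
      r\<^sub>0 \<otimes>\<^bsub>R p\<^esub> ?vA p ?P (\<theta> ?P x\<^sub>0) \<oplus>\<^bsub>R p\<^esub> r\<^sub>1 \<otimes>\<^bsub>R p\<^esub> ?vA p ?P (\<theta> ?P x\<^sub>1) = \<one>\<^bsub>R p\<^esub>"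
      using b.m_closed[OF r(1) ic] b.m_closed[OF r(2) ic] by blast
  qed
  moreover have "P1_eq S (X, x\<^sub>0, x\<^sub>1) (A, \<theta> ?P x\<^sub>0, \<theta> ?P x\<^sub>1)" using th by auto
  ultimately show ?thesis by blast
qed

text \<open>The trivialization of the square is multiplication by
  \<open>\<Delta>(b, c) / (\<Delta>(a, b) \<Delta>(a, c))\<close>.\<close>

lemma tensor_square_trivial:
  assumes A: "P1_point S (A, a\<^sub>0, a\<^sub>1)" "charts A cA" and B: "P1_point S (B, b\<^sub>0, b\<^sub>1)" "charts B cB"
    and C: "P1_point S (C, c\<^sub>0, c\<^sub>1)" "charts C cC"
    and ab: "\<And>p. p \<in> points S \<Longrightarrow> det2 (R p) (cA p (mgerm S A p (points S) a\<^sub>0)) (cA p (mgerm S A p (points S) a\<^sub>1))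
      (cB p (mgerm S B p (points S) b\<^sub>0)) (cB p (mgerm S B p (points S) b\<^sub>1)) \<in> Units (R p)"
    and ac: "\<And>p. p \<in> points S \<Longrightarrow> det2 (R p) (cA p (mgerm S A p (points S) a\<^sub>0)) (cA p (mgerm S A p (points S) a\<^sub>1))
      (cC p (mgerm S C p (points S) c\<^sub>0)) (cC p (mgerm S C p (points S) c\<^sub>1)) \<in> Units (R p)"
    and bc: "\<And>p. p \<in> points S \<Longrightarrow> det2 (R p) (cB p (mgerm S B p (points S) b\<^sub>0)) (cB p (mgerm S B p (points S) b\<^sub>1))
      (cC p (mgerm S C p (points S) c\<^sub>0)) (cC p (mgerm S C p (points S) c\<^sub>1)) \<in> Units (R p)"
  shows "\<exists>\<phi>. module_sheaf_iso S (tensor_sheaf S A A) (structure_sheaf S) \<phi>"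
proof -
  let ?vA = "\<lambda>p U x. cA p (mgerm S A p U x)" and ?vB = "\<lambda>p U x. cB p (mgerm S B p U x)"
    and ?vC = "\<lambda>p U x. cC p (mgerm S C p U x)" and ?P = "points S"
  interpret vA: coordinates S A ?vA using A(2) by (simp add: charts_def)
  interpret vB: coordinates S B ?vB using B(2) by (simp add: charts_def)
  interpret vC: coordinates S C ?vC using C(2) by (simp add: charts_def)
  have LA: "line_bundle S A" using A(1) by simp
  obtain v where cv: "coordinates S (tensor_sheaf S A A) v"
    and tm: "\<And>U l a. Op U \<Longrightarrow> l \<in> carrier (msec A U) \<Longrightarrow> a \<in> carrier (msec A U) \<Longrightarrow>
      tensor_sum S S id_morph A A U U {#(l, a)#} \<in> carrier (msec (tensor_sheaf S A A) U)"
    and tv: "\<And>U q l a. Op U \<Longrightarrow> q \<in> U \<Longrightarrow> l \<in> carrier (msec A U) \<Longrightarrow> a \<in> carrier (msec A U) \<Longrightarrow>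
      v q U (tensor_sum S S id_morph A A U U {#(l, a)#}) = ?vA q U l \<otimes>\<^bsub>R q\<^esub> ?vA q U a"
    using tensor_coordinates[OF LA LA A(2) A(2)] by metis
  interpret v: coordinates S "tensor_sheaf S A A" v by (rule cv)
  note a = P1_point_coords[OF A] and b = P1_point_coords[OF B] and c = P1_point_coords[OF C]
  let ?AB = "\<lambda>q. det2 (R q) (?vA q ?P a\<^sub>0) (?vA q ?P a\<^sub>1) (?vB q ?P b\<^sub>0) (?vB q ?P b\<^sub>1)"
  let ?AC = "\<lambda>q. det2 (R q) (?vA q ?P a\<^sub>0) (?vA q ?P a\<^sub>1) (?vC q ?P c\<^sub>0) (?vC q ?P c\<^sub>1)"
  let ?BC = "\<lambda>q. det2 (R q) (?vB q ?P b\<^sub>0) (?vB q ?P b\<^sub>1) (?vC q ?P c\<^sub>0) (?vC q ?P c\<^sub>1)"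
  \<comment> \<open>The three determinants are nowhere vanishing sections of A \<otimes> B, A
    \<otimes> C and B \<otimes> C, so \<open>?u\<close> is one of the inverse of A \<otimes> A, that
    is, an isomorphism from A \<otimes> A to the structure sheaf.\<close>
  let ?u = "\<lambda>q. ?BC q \<otimes>\<^bsub>R q\<^esub> inv\<^bsub>R q\<^esub> (?AB q \<otimes>\<^bsub>R q\<^esub> ?AC q)"
  have "\<exists>\<theta>. module_sheaf_iso S (tensor_sheaf S A A) (structure_sheaf S) \<theta> \<and>
      (\<forall>U x. Op U \<longrightarrow> x \<in> carrier (msec (tensor_sheaf S A A) U) \<longrightarrow>
      (\<forall>p \<in> U. ogerm S p U (\<theta> U x) = ?u p \<otimes>\<^bsub>R p\<^esub> v p U x))"
  proof (rule scaling_imp_iso[OF cv coordinates_structure_sheaf])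
    fix p assume p: "p \<in> points S"
    interpret b: cring "R p" by (rule cring_stalk[OF p])
    show "?u p \<in> Units (R p)"
      by (rule b.Units_m_closed[OF bc[OF p] b.Units_inv_Units[OF b.Units_m_closed[OF ab[OF p] ac[OF p]]]])
    obtain W e r\<^sub>0 r\<^sub>1 f s\<^sub>0 s\<^sub>1 g t\<^sub>0 t\<^sub>1 where pW: "p \<in> W" and le: "lframe A ?vA a\<^sub>0 a\<^sub>1 W e r\<^sub>0 r\<^sub>1"
      and lf: "lframe B ?vB b\<^sub>0 b\<^sub>1 W f s\<^sub>0 s\<^sub>1" and lg: "lframe C ?vC c\<^sub>0 c\<^sub>1 W g t\<^sub>0 t\<^sub>1"
      by (rule lframes_exist[OF vA.coordinates_axioms vB.coordinates_axioms vC.coordinates_axioms p a(1,2) b(1,2) c(1,2)])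
    note eD = lframeD[OF le] and fD = lframeD[OF lf] and gD = lframeD[OF lg]
    interpret w: cring "sec S W" by (rule cringO[OF eD(1)])
    let ?ab = "det2 (sec S W) r\<^sub>0 r\<^sub>1 s\<^sub>0 s\<^sub>1" and ?ac = "det2 (sec S W) r\<^sub>0 r\<^sub>1 t\<^sub>0 t\<^sub>1"
      and ?bc = "det2 (sec S W) s\<^sub>0 s\<^sub>1 t\<^sub>0 t\<^sub>1"
    have dc: "?ab \<in> carrier (sec S W)" "?ac \<in> carrier (sec S W)" "?bc \<in> carrier (sec S W)"
      using eD(3,4) fD(3,4) gD(3,4) by auto
    have pc: "?ab \<otimes>\<^bsub>sec S W\<^esub> ?ac \<in> carrier (sec S W)" using dc by simp
    let ?t = "tensor_sum S S id_morph A A W W {#(e, e)#}"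
    let ?x = "(?ab \<otimes>\<^bsub>sec S W\<^esub> ?ac) \<odot>\<^bsub>msec (tensor_sheaf S A A) W\<^esub> ?t"
    note tc = tm[OF eD(1) eD(2) eD(2)]
    \<comment> \<open>The frame coordinates of B and C occur once above and once below and cancel;
      those of \<open>e\<close> occur twice and make up the coordinate of the tensor
      \<open>?t\<close>.\<close>
    have main: "v q W ?x \<in> Units (R q) \<and> ogerm S q W ?bc = ?u q \<otimes>\<^bsub>R q\<^esub> v q W ?x" if q: "q \<in> W" for q
    proof -
      have qS: "q \<in> points S" by (rule Op_sub[OF eD(1) q])
      interpret b: cring "R q" by (rule cring_stalk[OF qS])
      note oc = ogerm_closed[OF eD(1) q dc(1)] ogerm_closed[OF eD(1) q dc(2)] ogerm_closed[OF eD(1) q dc(3)]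
      note eu = eD(5)[OF q] and fu = fD(5)[OF q] and gu = gD(5)[OF q]
      note ec = b.Units_closed[OF eu] and fc = b.Units_closed[OF fu] and gc = b.Units_closed[OF gu]
      have x: "v q W ?x = (ogerm S q W ?ab \<otimes>\<^bsub>R q\<^esub> ogerm S q W ?ac) \<otimes>\<^bsub>R q\<^esub> (?vA q W e \<otimes>\<^bsub>R q\<^esub> ?vA q W e)"
        unfolding v.val_smult[OF eD(1) q pc tc] ogerm_mult[OF eD(1) q dc(1,2)] tv[OF eD(1) q eD(2) eD(2)] ..
      have xc: "v q W ?x \<in> carrier (R q)" unfolding x using oc ec by simp
      let ?g = "?vB q W f \<otimes>\<^bsub>R q\<^esub> ?vC q W g"
      have gu': "?g \<in> Units (R q)" by (rule b.Units_m_closed[OF fu gu])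
      have P: "?AB q \<otimes>\<^bsub>R q\<^esub> ?AC q = v q W ?x \<otimes>\<^bsub>R q\<^esub> ?g"
        unfolding lframe_det2[OF le lf q] lframe_det2[OF le lg q] x using oc ec fc gc by (simp add: b.m_ac)
      have Pu: "v q W ?x \<otimes>\<^bsub>R q\<^esub> ?g \<in> Units (R q)"
        using b.Units_m_closed[OF ab[OF qS] ac[OF qS]] unfolding P .
      have N: "?BC q = ogerm S q W ?bc \<otimes>\<^bsub>R q\<^esub> ?g" by (rule lframe_det2[OF lf lg q])
      have "v q W ?x \<in> Units (R q)" by (rule b.factor_Units[OF Pu xc b.Units_closed[OF gu']])
      moreover have "ogerm S q W ?bc = ?u q \<otimes>\<^bsub>R q\<^esub> v q W ?x"
        unfolding P N by (rule b.Units_cancel_quotient[symmetric, OF gu' xc oc(3) Pu])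
      ultimately show ?thesis by blast
    qed
    show "\<exists>U e e'. Op U \<and> p \<in> U \<and> e \<in> carrier (msec (tensor_sheaf S A A) U) \<and>
      e' \<in> carrier (msec (structure_sheaf S) U) \<and>
      (\<forall>q \<in> U. v q U e \<in> Units (R q) \<and> ogerm S q U e' = ?u q \<otimes>\<^bsub>R q\<^esub> v q U e)"
      using eD(1) pW main v.smult_closed[OF eD(1) pc tc] dc(3)
      by (intro exI[of _ W] exI[of _ ?x] exI[of _ ?bc]) simp
  qed
  then show ?thesis by blast
qed

text \<open>The unit is chosen before the sections: an isomorphism to the structure sheaf scales all
  determinants at p by the same factor, which then cancels in the cross-ratio.\<close>

lemma Delta_value:
  assumes L: "line_bundle S L" and c: "charts L c"
    and iso: "module_sheaf_iso S (tensor_sheaf S L L) (structure_sheaf S) \<phi>"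
  shows "x\<^sub>0 \<in> carrier (msec L (points S)) \<Longrightarrow> x\<^sub>1 \<in> carrier (msec L (points S)) \<Longrightarrow>
      y\<^sub>0 \<in> carrier (msec L (points S)) \<Longrightarrow> y\<^sub>1 \<in> carrier (msec L (points S)) \<Longrightarrow>
      \<phi> (points S) (Delta S L (x\<^sub>0, x\<^sub>1) (y\<^sub>0, y\<^sub>1)) \<in> carrier (global_sections S)"
    and "p \<in> points S \<Longrightarrow> \<exists>u \<in> Units (R p). \<forall>x\<^sub>0 \<in> carrier (msec L (points S)). \<forall>x\<^sub>1 \<in> carrier (msec L (points S)).
      \<forall>y\<^sub>0 \<in> carrier (msec L (points S)). \<forall>y\<^sub>1 \<in> carrier (msec L (points S)).
      ogerm S p (points S) (\<phi> (points S) (Delta S L (x\<^sub>0, x\<^sub>1) (y\<^sub>0, y\<^sub>1))) = u \<otimes>\<^bsub>R p\<^esub>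
        det2 (R p) (c p (mgerm S L p (points S) x\<^sub>0)) (c p (mgerm S L p (points S) x\<^sub>1))
          (c p (mgerm S L p (points S) y\<^sub>0)) (c p (mgerm S L p (points S) y\<^sub>1))"
proof -
  let ?P = "points S"
  obtain v where cv: "coordinates S (tensor_sheaf S L L) v"
    and tm: "\<And>U l a. Op U \<Longrightarrow> l \<in> carrier (msec L U) \<Longrightarrow> a \<in> carrier (msec L U) \<Longrightarrow>
      tensor_sum S S id_morph L L U U {#(l, a)#} \<in> carrier (msec (tensor_sheaf S L L) U)"
    and tv: "\<And>U q l a. Op U \<Longrightarrow> q \<in> U \<Longrightarrow> l \<in> carrier (msec L U) \<Longrightarrow> a \<in> carrier (msec L U) \<Longrightarrow>
      v q U (tensor_sum S S id_morph L L U U {#(l, a)#}) = c q (mgerm S L q U l) \<otimes>\<^bsub>R q\<^esub> c q (mgerm S L q U a)"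
    using tensor_coordinates[OF L L c c] by metis
  interpret v: coordinates S "tensor_sheaf S L L" v by (rule cv)
  have Dm: "Delta S L (x\<^sub>0, x\<^sub>1) (y\<^sub>0, y\<^sub>1) \<in> carrier (msec (tensor_sheaf S L L) ?P)"
    if "x\<^sub>0 \<in> carrier (msec L ?P)" "x\<^sub>1 \<in> carrier (msec L ?P)" "y\<^sub>0 \<in> carrier (msec L ?P)" "y\<^sub>1 \<in> carrier (msec L ?P)"
    for x\<^sub>0 x\<^sub>1 y\<^sub>0 y\<^sub>1
    unfolding Delta.simps tensor_def
    by (rule v.minus_closed[OF openin_topspace tm[OF openin_topspace that(1,4)] tm[OF openin_topspace that(2,3)]])
  show "\<phi> ?P (Delta S L (x\<^sub>0, x\<^sub>1) (y\<^sub>0, y\<^sub>1)) \<in> carrier (global_sections S)"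
    if "x\<^sub>0 \<in> carrier (msec L ?P)" "x\<^sub>1 \<in> carrier (msec L ?P)" "y\<^sub>0 \<in> carrier (msec L ?P)" "y\<^sub>1 \<in> carrier (msec L ?P)"
    using bij_betw_apply[OF iso[unfolded module_sheaf_iso_def, THEN conjunct1, rule_format, OF openin_topspace, THEN conjunct1] Dm[OF that]]
    by simp
  assume p: "p \<in> ?P"
  obtain u where u: "u \<in> Units (R p)" and *: "\<forall>U x. Op U \<longrightarrow> p \<in> U \<longrightarrow> x \<in> carrier (msec (tensor_sheaf S L L) U) \<longrightarrow>
      ogerm S p U (\<phi> U x) = u \<otimes>\<^bsub>R p\<^esub> v p U x"
    using iso_imp_scaling[OF cv coordinates_structure_sheaf iso p] by blast
  show "\<exists>u \<in> Units (R p). \<forall>x\<^sub>0 \<in> carrier (msec L ?P). \<forall>x\<^sub>1 \<in> carrier (msec L ?P).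
      \<forall>y\<^sub>0 \<in> carrier (msec L ?P). \<forall>y\<^sub>1 \<in> carrier (msec L ?P).
      ogerm S p ?P (\<phi> ?P (Delta S L (x\<^sub>0, x\<^sub>1) (y\<^sub>0, y\<^sub>1))) = u \<otimes>\<^bsub>R p\<^esub>
        det2 (R p) (c p (mgerm S L p ?P x\<^sub>0)) (c p (mgerm S L p ?P x\<^sub>1)) (c p (mgerm S L p ?P y\<^sub>0)) (c p (mgerm S L p ?P y\<^sub>1))"
  proof (rule bexI[OF _ u], intro ballI)
    fix x\<^sub>0 x\<^sub>1 y\<^sub>0 y\<^sub>1
    assume x: "x\<^sub>0 \<in> carrier (msec L ?P)" "x\<^sub>1 \<in> carrier (msec L ?P)" and y: "y\<^sub>0 \<in> carrier (msec L ?P)" "y\<^sub>1 \<in> carrier (msec L ?P)"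
    have "v p ?P (Delta S L (x\<^sub>0, x\<^sub>1) (y\<^sub>0, y\<^sub>1)) =
        det2 (R p) (c p (mgerm S L p ?P x\<^sub>0)) (c p (mgerm S L p ?P x\<^sub>1)) (c p (mgerm S L p ?P y\<^sub>0)) (c p (mgerm S L p ?P y\<^sub>1))"
      unfolding Delta.simps tensor_def det2_def
        v.val_minus[OF openin_topspace tm[OF openin_topspace x(1) y(2)] tm[OF openin_topspace x(2) y(1)] p]
        tv[OF openin_topspace p x(1) y(2)] tv[OF openin_topspace p x(2) y(1)] ..
    then show "ogerm S p ?P (\<phi> ?P (Delta S L (x\<^sub>0, x\<^sub>1) (y\<^sub>0, y\<^sub>1))) = u \<otimes>\<^bsub>R p\<^esub>
        det2 (R p) (c p (mgerm S L p ?P x\<^sub>0)) (c p (mgerm S L p ?P x\<^sub>1)) (c p (mgerm S L p ?P y\<^sub>0)) (c p (mgerm S L p ?P y\<^sub>1))"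
      using *[rule_format, OF openin_topspace p Dm[OF x y]] by simp
  qed
qed

text \<open>Replacing the representatives of the points scales numerator and denominator of the
  cross-ratio by the same unit.\<close>

lemma is_cross_ratio_value:
  assumes A: "P1_point S (A, a\<^sub>0, a\<^sub>1)" "charts A cA" and B: "P1_point S (B, b\<^sub>0, b\<^sub>1)" "charts B cB"
    and C: "P1_point S (C, c\<^sub>0, c\<^sub>1)" "charts C cC" and D: "P1_point S (D, d\<^sub>0, d\<^sub>1)" "charts D cD"
    and ad: "\<And>p. p \<in> points S \<Longrightarrow> det2 (R p) (cA p (mgerm S A p (points S) a\<^sub>0)) (cA p (mgerm S A p (points S) a\<^sub>1))
      (cD p (mgerm S D p (points S) d\<^sub>0)) (cD p (mgerm S D p (points S) d\<^sub>1)) \<in> Units (R p)"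
    and bc: "\<And>p. p \<in> points S \<Longrightarrow> det2 (R p) (cB p (mgerm S B p (points S) b\<^sub>0)) (cB p (mgerm S B p (points S) b\<^sub>1))
      (cC p (mgerm S C p (points S) c\<^sub>0)) (cC p (mgerm S C p (points S) c\<^sub>1)) \<in> Units (R p)"
    and ic: "is_cross_ratio S (A, a\<^sub>0, a\<^sub>1) (B, b\<^sub>0, b\<^sub>1) (C, c\<^sub>0, c\<^sub>1) (D, d\<^sub>0, d\<^sub>1) z"
  shows "z \<in> carrier (global_sections S)"
    and "p \<in> points S \<Longrightarrow> ogerm S p (points S) z \<otimes>\<^bsub>R p\<^esub>
     (det2 (R p) (cA p (mgerm S A p (points S) a\<^sub>0)) (cA p (mgerm S A p (points S) a\<^sub>1))
        (cD p (mgerm S D p (points S) d\<^sub>0)) (cD p (mgerm S D p (points S) d\<^sub>1)) \<otimes>\<^bsub>R p\<^esub>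
      det2 (R p) (cB p (mgerm S B p (points S) b\<^sub>0)) (cB p (mgerm S B p (points S) b\<^sub>1))
        (cC p (mgerm S C p (points S) c\<^sub>0)) (cC p (mgerm S C p (points S) c\<^sub>1))) =
      det2 (R p) (cA p (mgerm S A p (points S) a\<^sub>0)) (cA p (mgerm S A p (points S) a\<^sub>1))
        (cC p (mgerm S C p (points S) c\<^sub>0)) (cC p (mgerm S C p (points S) c\<^sub>1)) \<otimes>\<^bsub>R p\<^esub>
      det2 (R p) (cB p (mgerm S B p (points S) b\<^sub>0)) (cB p (mgerm S B p (points S) b\<^sub>1))
        (cD p (mgerm S D p (points S) d\<^sub>0)) (cD p (mgerm S D p (points S) d\<^sub>1))"
proof -
  let ?P = "points S"
  let ?vA = "\<lambda>p x. cA p (mgerm S A p ?P x)" and ?vB = "\<lambda>p x. cB p (mgerm S B p ?P x)"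
    and ?vC = "\<lambda>p x. cC p (mgerm S C p ?P x)" and ?vD = "\<lambda>p x. cD p (mgerm S D p ?P x)"
  obtain L :: "('p, 'r, 'a) mod_sheaf" and a' b' c' d' \<phi> where
    La: "P1_point S (L, a')" and Lb: "P1_point S (L, b')" and Lc: "P1_point S (L, c')" and Ld: "P1_point S (L, d')"
    and ea: "P1_eq S (A, a\<^sub>0, a\<^sub>1) (L, a')" and eb: "P1_eq S (B, b\<^sub>0, b\<^sub>1) (L, b')"
    and ec: "P1_eq S (C, c\<^sub>0, c\<^sub>1) (L, c')" and ed: "P1_eq S (D, d\<^sub>0, d\<^sub>1) (L, d')"
    and iso: "module_sheaf_iso S (tensor_sheaf S L L) (structure_sheaf S) \<phi>"
    and z: "z = (\<phi> ?P (Delta S L a' c') \<otimes>\<^bsub>global_sections S\<^esub> \<phi> ?P (Delta S L b' d')) \<otimes>\<^bsub>global_sections S\<^esub>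
      inv\<^bsub>global_sections S\<^esub> (\<phi> ?P (Delta S L a' d') \<otimes>\<^bsub>global_sections S\<^esub> \<phi> ?P (Delta S L b' c'))"
    using ic unfolding is_cross_ratio_def Let_def by blast
  obtain a\<^sub>0' a\<^sub>1' b\<^sub>0' b\<^sub>1' c\<^sub>0' c\<^sub>1' d\<^sub>0' d\<^sub>1' where
    pairs: "a' = (a\<^sub>0', a\<^sub>1')" "b' = (b\<^sub>0', b\<^sub>1')" "c' = (c\<^sub>0', c\<^sub>1')" "d' = (d\<^sub>0', d\<^sub>1')"
    by (metis surj_pair)
  have L: "line_bundle S L" using La pairs by simp
  obtain cL where cL: "charts L cL" using line_bundle_charts[OF L] by blast
  let ?vL = "\<lambda>p x. cL p (mgerm S L p ?P x)"
  have mem: "a\<^sub>0' \<in> carrier (msec L ?P)" "a\<^sub>1' \<in> carrier (msec L ?P)" "b\<^sub>0' \<in> carrier (msec L ?P)" "b\<^sub>1' \<in> carrier (msec L ?P)"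
    "c\<^sub>0' \<in> carrier (msec L ?P)" "c\<^sub>1' \<in> carrier (msec L ?P)" "d\<^sub>0' \<in> carrier (msec L ?P)" "d\<^sub>1' \<in> carrier (msec L ?P)"
    using La Lb Lc Ld pairs by auto
  note aP = P1_point_coords[OF A] and bP = P1_point_coords[OF B] and cP = P1_point_coords[OF C] and dP = P1_point_coords[OF D]
  have coL: "coordinates S L (\<lambda>p U x. cL p (mgerm S L p U x))" using cL by (simp add: charts_def)
  have coA: "coordinates S A (\<lambda>p U x. cA p (mgerm S A p U x))" using A(2) by (simp add: charts_def)
  have coB: "coordinates S B (\<lambda>p U x. cB p (mgerm S B p U x))" using B(2) by (simp add: charts_def)
  have coC: "coordinates S C (\<lambda>p U x. cC p (mgerm S C p U x))" using C(2) by (simp add: charts_def)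
  have coD: "coordinates S D (\<lambda>p U x. cD p (mgerm S D p U x))" using D(2) by (simp add: charts_def)
  define \<delta> where "\<delta> x y = \<phi> ?P (Delta S L x y)" for x y
  let ?G = "global_sections S"
  have dm: "\<delta> a' c' \<in> carrier ?G" "\<delta> b' d' \<in> carrier ?G" "\<delta> a' d' \<in> carrier ?G" "\<delta> b' c' \<in> carrier ?G"
    unfolding \<delta>_def pairs using Delta_value(1)[OF L cL iso] mem by simp_all
  interpret G: cring ?G by (rule cringO) simp
  \<comment> \<open>The units k, l, m, n account for the rescaling of a, b, c, d. They are obtained
    together for all four determinants, because numerator and denominator are then both scaled by k
    l m n.\<close>
  have local: "\<exists>k l m n. k \<in> Units (R p) \<and> l \<in> Units (R p) \<and> m \<in> Units (R p) \<and> n \<in> Units (R p) \<and>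
      ogerm S p ?P (\<delta> a' c') = (k \<otimes>\<^bsub>R p\<^esub> m) \<otimes>\<^bsub>R p\<^esub> det2 (R p) (?vA p a\<^sub>0) (?vA p a\<^sub>1) (?vC p c\<^sub>0) (?vC p c\<^sub>1) \<and>
      ogerm S p ?P (\<delta> b' d') = (l \<otimes>\<^bsub>R p\<^esub> n) \<otimes>\<^bsub>R p\<^esub> det2 (R p) (?vB p b\<^sub>0) (?vB p b\<^sub>1) (?vD p d\<^sub>0) (?vD p d\<^sub>1) \<and>
      ogerm S p ?P (\<delta> a' d') = (k \<otimes>\<^bsub>R p\<^esub> n) \<otimes>\<^bsub>R p\<^esub> det2 (R p) (?vA p a\<^sub>0) (?vA p a\<^sub>1) (?vD p d\<^sub>0) (?vD p d\<^sub>1) \<and>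
      ogerm S p ?P (\<delta> b' c') = (l \<otimes>\<^bsub>R p\<^esub> m) \<otimes>\<^bsub>R p\<^esub> det2 (R p) (?vB p b\<^sub>0) (?vB p b\<^sub>1) (?vC p c\<^sub>0) (?vC p c\<^sub>1)"
    if p: "p \<in> ?P" for p
  proof -
    interpret b: cring "R p" by (rule cring_stalk[OF p])
    obtain u where u: "u \<in> Units (R p)" and uv: "\<And>x\<^sub>0 x\<^sub>1 y\<^sub>0 y\<^sub>1. x\<^sub>0 \<in> carrier (msec L ?P) \<Longrightarrow> x\<^sub>1 \<in> carrier (msec L ?P) \<Longrightarrow>
      y\<^sub>0 \<in> carrier (msec L ?P) \<Longrightarrow> y\<^sub>1 \<in> carrier (msec L ?P) \<Longrightarrow>
      ogerm S p ?P (\<delta> (x\<^sub>0, x\<^sub>1) (y\<^sub>0, y\<^sub>1)) = u \<otimes>\<^bsub>R p\<^esub> det2 (R p) (?vL p x\<^sub>0) (?vL p x\<^sub>1) (?vL p y\<^sub>0) (?vL p y\<^sub>1)"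
      using Delta_value(2)[OF L cL iso p] unfolding \<delta>_def by metis
    obtain k where k: "k \<in> Units (R p)" "?vL p a\<^sub>0' = k \<otimes>\<^bsub>R p\<^esub> ?vA p a\<^sub>0" "?vL p a\<^sub>1' = k \<otimes>\<^bsub>R p\<^esub> ?vA p a\<^sub>1"
      using P1_eq_scaling[OF coA coL aP(1,2) ea[unfolded pairs] p] by blast
    obtain l where l: "l \<in> Units (R p)" "?vL p b\<^sub>0' = l \<otimes>\<^bsub>R p\<^esub> ?vB p b\<^sub>0" "?vL p b\<^sub>1' = l \<otimes>\<^bsub>R p\<^esub> ?vB p b\<^sub>1"
      using P1_eq_scaling[OF coB coL bP(1,2) eb[unfolded pairs] p] by blast
    obtain m where m: "m \<in> Units (R p)" "?vL p c\<^sub>0' = m \<otimes>\<^bsub>R p\<^esub> ?vC p c\<^sub>0" "?vL p c\<^sub>1' = m \<otimes>\<^bsub>R p\<^esub> ?vC p c\<^sub>1"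
      using P1_eq_scaling[OF coC coL cP(1,2) ec[unfolded pairs] p] by blast
    obtain n where n: "n \<in> Units (R p)" "?vL p d\<^sub>0' = n \<otimes>\<^bsub>R p\<^esub> ?vD p d\<^sub>0" "?vL p d\<^sub>1' = n \<otimes>\<^bsub>R p\<^esub> ?vD p d\<^sub>1"
      using P1_eq_scaling[OF coD coL dP(1,2) ed[unfolded pairs] p] by blast
    note cl = coordinates.val_closed[OF coA openin_topspace p aP(1)] coordinates.val_closed[OF coA openin_topspace p aP(2)]
      coordinates.val_closed[OF coB openin_topspace p bP(1)] coordinates.val_closed[OF coB openin_topspace p bP(2)]
      coordinates.val_closed[OF coC openin_topspace p cP(1)] coordinates.val_closed[OF coC openin_topspace p cP(2)]
      coordinates.val_closed[OF coD openin_topspace p dP(1)] coordinates.val_closed[OF coD openin_topspace p dP(2)]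
    note uc = b.Units_closed[OF u] b.Units_closed[OF k(1)] b.Units_closed[OF l(1)] b.Units_closed[OF m(1)] b.Units_closed[OF n(1)]
    note d2 = b.det2_closed[OF cl(1,2,5,6)] b.det2_closed[OF cl(3,4,7,8)] b.det2_closed[OF cl(1,2,7,8)] b.det2_closed[OF cl(3,4,5,6)]
    \<comment> \<open>each of the four determinants involves exactly one of \<open>a\<close>, \<open>b\<close>, so the scaling by \<open>\<phi>\<close> can be attributed to these two\<close>
    have uk: "u \<otimes>\<^bsub>R p\<^esub> k \<in> Units (R p)" "u \<otimes>\<^bsub>R p\<^esub> l \<in> Units (R p)" using u k l by simp_all
    have "ogerm S p ?P (\<delta> a' c') = (u \<otimes>\<^bsub>R p\<^esub> k \<otimes>\<^bsub>R p\<^esub> m) \<otimes>\<^bsub>R p\<^esub> det2 (R p) (?vA p a\<^sub>0) (?vA p a\<^sub>1) (?vC p c\<^sub>0) (?vC p c\<^sub>1)"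
      unfolding pairs uv[OF mem(1,2,5,6)] k m b.det2_scale[OF cl(1,2,5,6) uc(2,4)] using uc d2 by (simp add: b.m_assoc)
    moreover have "ogerm S p ?P (\<delta> b' d') = (u \<otimes>\<^bsub>R p\<^esub> l \<otimes>\<^bsub>R p\<^esub> n) \<otimes>\<^bsub>R p\<^esub> det2 (R p) (?vB p b\<^sub>0) (?vB p b\<^sub>1) (?vD p d\<^sub>0) (?vD p d\<^sub>1)"
      unfolding pairs uv[OF mem(3,4,7,8)] l n b.det2_scale[OF cl(3,4,7,8) uc(3,5)] using uc d2 by (simp add: b.m_assoc)
    moreover have "ogerm S p ?P (\<delta> a' d') = (u \<otimes>\<^bsub>R p\<^esub> k \<otimes>\<^bsub>R p\<^esub> n) \<otimes>\<^bsub>R p\<^esub> det2 (R p) (?vA p a\<^sub>0) (?vA p a\<^sub>1) (?vD p d\<^sub>0) (?vD p d\<^sub>1)"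
      unfolding pairs uv[OF mem(1,2,7,8)] k n b.det2_scale[OF cl(1,2,7,8) uc(2,5)] using uc d2 by (simp add: b.m_assoc)
    moreover have "ogerm S p ?P (\<delta> b' c') = (u \<otimes>\<^bsub>R p\<^esub> l \<otimes>\<^bsub>R p\<^esub> m) \<otimes>\<^bsub>R p\<^esub> det2 (R p) (?vB p b\<^sub>0) (?vB p b\<^sub>1) (?vC p c\<^sub>0) (?vC p c\<^sub>1)"
      unfolding pairs uv[OF mem(3,4,5,6)] l m b.det2_scale[OF cl(3,4,5,6) uc(3,4)] using uc d2 by (simp add: b.m_assoc)
    ultimately show ?thesis using uk m(1) n(1) by blast
  qed
  \<comment> \<open>\<open>inv\<close> is meaningful only on units, so the denominator is first
    shown to be invertible as a global section, from its invertibility in all stalks.\<close>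
  have unit: "\<delta> a' d' \<otimes>\<^bsub>?G\<^esub> \<delta> b' c' \<in> Units ?G"
  proof (rule ogerm_Units)
    fix p assume p: "p \<in> ?P"
    interpret b: cring "R p" by (rule cring_stalk[OF p])
    obtain k l m n where u: "k \<in> Units (R p)" "l \<in> Units (R p)" "m \<in> Units (R p)" "n \<in> Units (R p)"
      and e: "ogerm S p ?P (\<delta> a' d') = (k \<otimes>\<^bsub>R p\<^esub> n) \<otimes>\<^bsub>R p\<^esub> det2 (R p) (?vA p a\<^sub>0) (?vA p a\<^sub>1) (?vD p d\<^sub>0) (?vD p d\<^sub>1)"
        "ogerm S p ?P (\<delta> b' c') = (l \<otimes>\<^bsub>R p\<^esub> m) \<otimes>\<^bsub>R p\<^esub> det2 (R p) (?vB p b\<^sub>0) (?vB p b\<^sub>1) (?vC p c\<^sub>0) (?vC p c\<^sub>1)"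
      using local[OF p] by blast
    show "ogerm S p ?P (\<delta> a' d' \<otimes>\<^bsub>?G\<^esub> \<delta> b' c') \<in> Units (R p)"
      unfolding ogerm_mult[OF openin_topspace p dm(3,4)] e
      by (intro b.Units_m_closed u ad[OF p] bc[OF p])
  qed (use dm in simp_all)
  have z': "z = (\<delta> a' c' \<otimes>\<^bsub>?G\<^esub> \<delta> b' d') \<otimes>\<^bsub>?G\<^esub> inv\<^bsub>?G\<^esub> (\<delta> a' d' \<otimes>\<^bsub>?G\<^esub> \<delta> b' c')"
    unfolding z \<delta>_def ..
  note ic' = G.Units_inv_closed[OF unit]
  show zc: "z \<in> carrier ?G" unfolding z' using ic' dm by simp
  have "z \<otimes>\<^bsub>?G\<^esub> (\<delta> a' d' \<otimes>\<^bsub>?G\<^esub> \<delta> b' c') = (\<delta> a' c' \<otimes>\<^bsub>?G\<^esub> \<delta> b' d') \<otimes>\<^bsub>?G\<^esub> (inv\<^bsub>?G\<^esub> (\<delta> a' d' \<otimes>\<^bsub>?G\<^esub> \<delta> b' c') \<otimes>\<^bsub>?G\<^esub> (\<delta> a' d' \<otimes>\<^bsub>?G\<^esub> \<delta> b' c'))"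
    unfolding z' by (rule G.m_assoc) (use ic' dm in simp_all)
  also have "\<dots> = \<delta> a' c' \<otimes>\<^bsub>?G\<^esub> \<delta> b' d'" unfolding G.Units_l_inv[OF unit] using dm by simp
  finally have glob: "z \<otimes>\<^bsub>?G\<^esub> (\<delta> a' d' \<otimes>\<^bsub>?G\<^esub> \<delta> b' c') = \<delta> a' c' \<otimes>\<^bsub>?G\<^esub> \<delta> b' d'" .
  assume p: "p \<in> ?P"
  interpret b: cring "R p" by (rule cring_stalk[OF p])
  let ?ac = "det2 (R p) (?vA p a\<^sub>0) (?vA p a\<^sub>1) (?vC p c\<^sub>0) (?vC p c\<^sub>1)" and ?bd = "det2 (R p) (?vB p b\<^sub>0) (?vB p b\<^sub>1) (?vD p d\<^sub>0) (?vD p d\<^sub>1)"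
    and ?ad = "det2 (R p) (?vA p a\<^sub>0) (?vA p a\<^sub>1) (?vD p d\<^sub>0) (?vD p d\<^sub>1)" and ?bc = "det2 (R p) (?vB p b\<^sub>0) (?vB p b\<^sub>1) (?vC p c\<^sub>0) (?vC p c\<^sub>1)"
  obtain k l m n where u: "k \<in> Units (R p)" "l \<in> Units (R p)" "m \<in> Units (R p)" "n \<in> Units (R p)"
    and e: "ogerm S p ?P (\<delta> a' c') = (k \<otimes>\<^bsub>R p\<^esub> m) \<otimes>\<^bsub>R p\<^esub> ?ac" "ogerm S p ?P (\<delta> b' d') = (l \<otimes>\<^bsub>R p\<^esub> n) \<otimes>\<^bsub>R p\<^esub> ?bd"
      "ogerm S p ?P (\<delta> a' d') = (k \<otimes>\<^bsub>R p\<^esub> n) \<otimes>\<^bsub>R p\<^esub> ?ad" "ogerm S p ?P (\<delta> b' c') = (l \<otimes>\<^bsub>R p\<^esub> m) \<otimes>\<^bsub>R p\<^esub> ?bc"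
    using local[OF p] by blast
  note uc = b.Units_closed[OF u(1)] b.Units_closed[OF u(2)] b.Units_closed[OF u(3)] b.Units_closed[OF u(4)]
  note cl = coordinates.val_closed[OF coA openin_topspace p aP(1)] coordinates.val_closed[OF coA openin_topspace p aP(2)]
    coordinates.val_closed[OF coB openin_topspace p bP(1)] coordinates.val_closed[OF coB openin_topspace p bP(2)]
    coordinates.val_closed[OF coC openin_topspace p cP(1)] coordinates.val_closed[OF coC openin_topspace p cP(2)]
    coordinates.val_closed[OF coD openin_topspace p dP(1)] coordinates.val_closed[OF coD openin_topspace p dP(2)]
  note d2 = b.det2_closed[OF cl(1,2,5,6)] b.det2_closed[OF cl(3,4,7,8)] b.det2_closed[OF cl(1,2,7,8)] b.det2_closed[OF cl(3,4,5,6)]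
  have zp: "ogerm S p ?P z \<in> carrier (R p)" by (rule ogerm_closed[OF openin_topspace p zc])
  have "ogerm S p ?P z \<otimes>\<^bsub>R p\<^esub> (((k \<otimes>\<^bsub>R p\<^esub> n) \<otimes>\<^bsub>R p\<^esub> ?ad) \<otimes>\<^bsub>R p\<^esub> ((l \<otimes>\<^bsub>R p\<^esub> m) \<otimes>\<^bsub>R p\<^esub> ?bc)) =
      ((k \<otimes>\<^bsub>R p\<^esub> m) \<otimes>\<^bsub>R p\<^esub> ?ac) \<otimes>\<^bsub>R p\<^esub> ((l \<otimes>\<^bsub>R p\<^esub> n) \<otimes>\<^bsub>R p\<^esub> ?bd)"
    unfolding e[symmetric]
    using arg_cong[OF glob, of "ogerm S p ?P"] ogerm_mult[OF openin_topspace p zc G.m_closed[OF dm(3,4)]]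
      ogerm_mult[OF openin_topspace p dm(3,4)] ogerm_mult[OF openin_topspace p dm(1,2)] by simp
  then have "(k \<otimes>\<^bsub>R p\<^esub> l \<otimes>\<^bsub>R p\<^esub> m \<otimes>\<^bsub>R p\<^esub> n) \<otimes>\<^bsub>R p\<^esub> (ogerm S p ?P z \<otimes>\<^bsub>R p\<^esub> (?ad \<otimes>\<^bsub>R p\<^esub> ?bc)) =
      (k \<otimes>\<^bsub>R p\<^esub> l \<otimes>\<^bsub>R p\<^esub> m \<otimes>\<^bsub>R p\<^esub> n) \<otimes>\<^bsub>R p\<^esub> (?ac \<otimes>\<^bsub>R p\<^esub> ?bd)"
    using uc d2 zp by (simp add: b.m_ac)
  then show "ogerm S p ?P z \<otimes>\<^bsub>R p\<^esub> (?ad \<otimes>\<^bsub>R p\<^esub> ?bc) = ?ac \<otimes>\<^bsub>R p\<^esub> ?bd"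
    using b.Units_l_cancel[of "k \<otimes>\<^bsub>R p\<^esub> l \<otimes>\<^bsub>R p\<^esub> m \<otimes>\<^bsub>R p\<^esub> n"] u zp d2 by simp
qed

end

section \<open>The image of the fourth point\<close>

theorem theorem6p5:
  fixes S :: "('p, 'r) ringed_space"
    and a b c d :: "('p, 'r, 'm) p1_data"
    and \<sigma> :: "('p, 'r, 'l) pgl2_data"
  assumes "scheme S"
    and "P1_point S a" and "P1_point S b" and "P1_point S c" and "P1_point S d"
    and "strongly_distinct S a b" and "strongly_distinct S a c" and "strongly_distinct S a d"
    and "strongly_distinct S b c" and "strongly_distinct S b d" and "strongly_distinct S c d"
    and "PGL2_element S \<sigma>"
    and "P1_eq S (PGL2_act S \<sigma> a) (P1_infinity S)"
    and "P1_eq S (PGL2_act S \<sigma> b) (P1_zero S)"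
    and "P1_eq S (PGL2_act S \<sigma> c) (P1_one S)"
  shows "P1_eq S (PGL2_act S \<sigma> d)
           (structure_sheaf S, cross_ratio S a b c d, \<one>\<^bsub>global_sections S\<^esub>)"
proof -
  obtain A a\<^sub>0 a\<^sub>1 B b\<^sub>0 b\<^sub>1 C c\<^sub>0 c\<^sub>1 D d\<^sub>0 d\<^sub>1 L M where
    data: "a = (A, a\<^sub>0, a\<^sub>1)" "b = (B, b\<^sub>0, b\<^sub>1)" "c = (C, c\<^sub>0, c\<^sub>1)" "d = (D, d\<^sub>0, d\<^sub>1)" "\<sigma> = (L, M)"
    by (metis surj_pair)
  have lrs: "locally_ringed_space S" using assms(1) by (simp add: scheme_def)
  interpret ringed S by unfold_locales (use lrs in \<open>simp add: locally_ringed_space_def\<close>)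
  have loc: "local_ring (R p)" if "p \<in> points S" for p using lrs that by (simp add: locally_ringed_space_def)
  let ?P = "points S" and ?G = "global_sections S"
  note Pp = assms(2-5)[unfolded data]
  have lb: "line_bundle S A" "line_bundle S B" "line_bundle S C" "line_bundle S D" using Pp by simp_all
  have M: "M i j \<in> carrier (msec L ?P)" if "i \<in> {0, 1}" "j \<in> {0, 1}" for i j
    using assms(12) that unfolding data by auto
  have Mm: "M 0 0 \<in> carrier (msec L ?P)" "M 0 1 \<in> carrier (msec L ?P)" "M 1 0 \<in> carrier (msec L ?P)" "M 1 1 \<in> carrier (msec L ?P)"
    by (auto intro: M)
  have lbL: "line_bundle S L" using assms(12) unfolding data by simp
  obtain cA where cA: "charts A cA" using line_bundle_charts[OF lb(1)] by blast
  obtain cB where cB: "charts B cB" using line_bundle_charts[OF lb(2)] by blast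
  obtain cC where cC: "charts C cC" using line_bundle_charts[OF lb(3)] by blast
  obtain cD where cD: "charts D cD" using line_bundle_charts[OF lb(4)] by blast
  obtain cL where cL: "charts L cL" using line_bundle_charts[OF lbL] by blast
  let ?vA = "\<lambda>p x. cA p (mgerm S A p ?P x)" and ?vB = "\<lambda>p x. cB p (mgerm S B p ?P x)"
    and ?vC = "\<lambda>p x. cC p (mgerm S C p ?P x)" and ?vD = "\<lambda>p x. cD p (mgerm S D p ?P x)"
    and ?vL = "\<lambda>p x. cL p (mgerm S L p ?P x)"
  note aP = P1_point_coords[OF Pp(1) cA] and bP = P1_point_coords[OF Pp(2) cB]
    and cP = P1_point_coords[OF Pp(3) cC] and dP = P1_point_coords[OF Pp(4) cD]
  have clA: "?vA p x \<in> carrier (R p)" if "p \<in> ?P" "x \<in> carrier (msec A ?P)" for p x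
    using cA that unfolding charts_def by (auto intro: coordinates.val_closed)
  have clB: "?vB p x \<in> carrier (R p)" if "p \<in> ?P" "x \<in> carrier (msec B ?P)" for p x
    using cB that unfolding charts_def by (auto intro: coordinates.val_closed)
  have clC: "?vC p x \<in> carrier (R p)" if "p \<in> ?P" "x \<in> carrier (msec C ?P)" for p x
    using cC that unfolding charts_def by (auto intro: coordinates.val_closed)
  have clD: "?vD p x \<in> carrier (R p)" if "p \<in> ?P" "x \<in> carrier (msec D ?P)" for p x
    using cD that unfolding charts_def by (auto intro: coordinates.val_closed)
  have clL: "?vL p x \<in> carrier (R p)" if "p \<in> ?P" "x \<in> carrier (msec L ?P)" for p x
    using cL that unfolding charts_def by (auto intro: coordinates.val_closed)
  let ?AB = "\<lambda>p. det2 (R p) (?vA p a\<^sub>0) (?vA p a\<^sub>1) (?vB p b\<^sub>0) (?vB p b\<^sub>1)"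
    and ?AC = "\<lambda>p. det2 (R p) (?vA p a\<^sub>0) (?vA p a\<^sub>1) (?vC p c\<^sub>0) (?vC p c\<^sub>1)"
    and ?AD = "\<lambda>p. det2 (R p) (?vA p a\<^sub>0) (?vA p a\<^sub>1) (?vD p d\<^sub>0) (?vD p d\<^sub>1)"
    and ?BC = "\<lambda>p. det2 (R p) (?vB p b\<^sub>0) (?vB p b\<^sub>1) (?vC p c\<^sub>0) (?vC p c\<^sub>1)"
    and ?BD = "\<lambda>p. det2 (R p) (?vB p b\<^sub>0) (?vB p b\<^sub>1) (?vD p d\<^sub>0) (?vD p d\<^sub>1)"
  have AB: "?AB p \<in> Units (R p)" if p: "p \<in> ?P" for p
    using strongly_distinct_unit[OF loc[OF p] p Pp(1) cA Pp(2) cB assms(6)[unfolded data]] unfolding det2_def .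
  have AC: "?AC p \<in> Units (R p)" if p: "p \<in> ?P" for p
    using strongly_distinct_unit[OF loc[OF p] p Pp(1) cA Pp(3) cC assms(7)[unfolded data]] unfolding det2_def .
  have AD: "?AD p \<in> Units (R p)" if p: "p \<in> ?P" for p
    using strongly_distinct_unit[OF loc[OF p] p Pp(1) cA Pp(4) cD assms(8)[unfolded data]] unfolding det2_def .
  have BC: "?BC p \<in> Units (R p)" if p: "p \<in> ?P" for p
    using strongly_distinct_unit[OF loc[OF p] p Pp(2) cB Pp(3) cC assms(9)[unfolded data]] unfolding det2_def .
  have BD: "?BD p \<in> Units (R p)" if p: "p \<in> ?P" for p
    using strongly_distinct_unit[OF loc[OF p] p Pp(2) cB Pp(4) cD assms(10)[unfolded data]] unfolding det2_def .
  \<comment> \<open>\<open>point_on_bundle\<close> takes determinants with the auxiliary point in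
    second place; for c and d this point will be b, hence the reversed orders.\<close>
  have CB: "det2 (R p) (?vC p c\<^sub>0) (?vC p c\<^sub>1) (?vB p b\<^sub>0) (?vB p b\<^sub>1) \<in> Units (R p)" if p: "p \<in> ?P" for p
    by (rule cring.det2_swap_Units[OF cring_stalk[OF p] clB[OF p bP(1)] clB[OF p bP(2)] clC[OF p cP(1)] clC[OF p cP(2)] BC[OF p]])
  have DB: "det2 (R p) (?vD p d\<^sub>0) (?vD p d\<^sub>1) (?vB p b\<^sub>0) (?vB p b\<^sub>1) \<in> Units (R p)" if p: "p \<in> ?P" for p
    by (rule cring.det2_swap_Units[OF cring_stalk[OF p] clB[OF p bP(1)] clB[OF p bP(2)] clD[OF p dP(1)] clD[OF p dP(2)] BD[OF p]])
  have cr_mem: "x \<in> carrier ?G" if "is_cross_ratio S a b c d x" for x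
    by (rule is_cross_ratio_value(1)[OF Pp(1) cA Pp(2) cB Pp(3) cC Pp(4) cD AD BC that[unfolded data]])
  have cr_eq: "ogerm S p ?P x \<otimes>\<^bsub>R p\<^esub> (?AD p \<otimes>\<^bsub>R p\<^esub> ?BC p) = ?AC p \<otimes>\<^bsub>R p\<^esub> ?BD p"
    if x: "is_cross_ratio S a b c d x" and p: "p \<in> ?P" for x p
    by (rule is_cross_ratio_value(2)[OF Pp(1) cA Pp(2) cB Pp(3) cC Pp(4) cD AD BC x[unfolded data] p])
  define z where "z = cross_ratio S a b c d"
  \<comment> \<open>A definite description has its defining property only once existence and
    uniqueness are known.\<close>
  have icr: "is_cross_ratio S a b c d z"
  proof -
    \<comment> \<open>All four points are moved to the bundle A. The auxiliary point has to be
      distinct from a and from the point that is moved: it is c for b, and b for the others.\<close>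
    obtain a' where a': "P1_point S (A, a')" "P1_eq S a (A, a')"
      using point_on_bundle[OF Pp(1) cA Pp(1) cA Pp(2) cB AB AB] unfolding data by blast
    obtain b' where b': "P1_point S (A, b')" "P1_eq S b (A, b')"
      using point_on_bundle[OF Pp(1) cA Pp(2) cB Pp(3) cC AC BC] unfolding data by blast
    obtain c' where c': "P1_point S (A, c')" "P1_eq S c (A, c')"
      using point_on_bundle[OF Pp(1) cA Pp(3) cC Pp(2) cB AB CB] unfolding data by blast
    obtain d' where d': "P1_point S (A, d')" "P1_eq S d (A, d')"
      using point_on_bundle[OF Pp(1) cA Pp(4) cD Pp(2) cB AB DB] unfolding data by blast
    obtain \<phi> where "module_sheaf_iso S (tensor_sheaf S A A) (structure_sheaf S) \<phi>"
      using tensor_square_trivial[OF Pp(1) cA Pp(2) cB Pp(3) cC AB AC BC] by blast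
    then have ex: "\<exists>z. is_cross_ratio S a b c d z"
      unfolding is_cross_ratio_def Let_def using a' b' c' d' by blast
    \<comment> \<open>At each point of S every cross-ratio solves the same linear equation with a
      unit coefficient, whichever bundle and trivialization it was computed with.\<close>
    have un: "x = y" if x: "is_cross_ratio S a b c d x" and y: "is_cross_ratio S a b c d y" for x y
    proof -
      note xc = cr_mem[OF x] and yc = cr_mem[OF y]
      show ?thesis
      proof (rule ogerm_inj[OF openin_topspace xc yc])
        fix p assume p: "p \<in> ?P"
        interpret b: cring "R p" by (rule cring_stalk[OF p])
        have u: "?AD p \<otimes>\<^bsub>R p\<^esub> ?BC p \<in> Units (R p)" by (rule b.Units_m_closed[OF AD[OF p] BC[OF p]])
        have "ogerm S p ?P x \<otimes>\<^bsub>R p\<^esub> (?AD p \<otimes>\<^bsub>R p\<^esub> ?BC p) = ogerm S p ?P y \<otimes>\<^bsub>R p\<^esub> (?AD p \<otimes>\<^bsub>R p\<^esub> ?BC p)"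
          unfolding cr_eq[OF x p] cr_eq[OF y p] ..
        then show "ogerm S p ?P x = ogerm S p ?P y"
          using b.Units_l_cancel[OF u] b.m_comm b.Units_closed[OF u] ogerm_closed[OF openin_topspace p xc]
            ogerm_closed[OF openin_topspace p yc] by metis
      qed
    qed
    from ex un have "\<exists>!z. is_cross_ratio S a b c d z" by blast
    then show ?thesis unfolding z_def cross_ratio_def by (rule theI')
  qed
  note zc = cr_mem[OF icr]
  \<comment> \<open>Read in the stalk at p, equality of \<sigma>(x) with (O; s, t) says that the
    matrix applied to the coordinates of x gives (s, t) up to a unit.\<close>
  have image: "\<exists>u \<in> Units (R p).
      u \<otimes>\<^bsub>R p\<^esub> (?vL p (M 0 0) \<otimes>\<^bsub>R p\<^esub> cX p (mgerm S X p ?P x\<^sub>0) \<oplus>\<^bsub>R p\<^esub> ?vL p (M 0 1) \<otimes>\<^bsub>R p\<^esub> cX p (mgerm S X p ?P x\<^sub>1)) = ogerm S p ?P s \<and>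
      u \<otimes>\<^bsub>R p\<^esub> (?vL p (M 1 0) \<otimes>\<^bsub>R p\<^esub> cX p (mgerm S X p ?P x\<^sub>0) \<oplus>\<^bsub>R p\<^esub> ?vL p (M 1 1) \<otimes>\<^bsub>R p\<^esub> cX p (mgerm S X p ?P x\<^sub>1)) = ogerm S p ?P t"
    if X: "P1_point S (X, x\<^sub>0, x\<^sub>1)" "charts X cX" and e: "P1_eq S (PGL2_act S (L, M) (X, x\<^sub>0, x\<^sub>1)) (structure_sheaf S, s, t)"
      and p: "p \<in> ?P" for X :: "('p, 'r, 'm) mod_sheaf" and x\<^sub>0 x\<^sub>1 cX s t p
  proof -
    have lX: "line_bundle S X" using X(1) by simp
    note xP = P1_point_coords[OF X]
    obtain v where cv: "coordinates S (tensor_sheaf S L X) v"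
      and tm: "\<And>U l a. Op U \<Longrightarrow> l \<in> carrier (msec L U) \<Longrightarrow> a \<in> carrier (msec X U) \<Longrightarrow>
        tensor_sum S S id_morph L X U U {#(l, a)#} \<in> carrier (msec (tensor_sheaf S L X) U)"
      and tv: "\<And>U q l a. Op U \<Longrightarrow> q \<in> U \<Longrightarrow> l \<in> carrier (msec L U) \<Longrightarrow> a \<in> carrier (msec X U) \<Longrightarrow>
        v q U (tensor_sum S S id_morph L X U U {#(l, a)#}) = cL q (mgerm S L q U l) \<otimes>\<^bsub>R q\<^esub> cX q (mgerm S X q U a)"
      using tensor_coordinates[OF lbL lX cL X(2)] by metis
    interpret v: coordinates S "tensor_sheaf S L X" v by (rule cv)
    note o = openin_topspace[of "spc S"]
    note t0 = tm[OF o Mm(1) xP(1)] tm[OF o Mm(2) xP(2)] and t1 = tm[OF o Mm(3) xP(1)] tm[OF o Mm(4) xP(2)]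
    obtain u where u: "u \<in> Units (R p)"
      and e0: "ogerm S p ?P s = u \<otimes>\<^bsub>R p\<^esub> v p ?P (tensor S L X (M 0 0) x\<^sub>0 \<oplus>\<^bsub>msec (tensor_sheaf S L X) ?P\<^esub> tensor S L X (M 0 1) x\<^sub>1)"
      and e1: "ogerm S p ?P t = u \<otimes>\<^bsub>R p\<^esub> v p ?P (tensor S L X (M 1 0) x\<^sub>0 \<oplus>\<^bsub>msec (tensor_sheaf S L X) ?P\<^esub> tensor S L X (M 1 1) x\<^sub>1)"
      using P1_eq_scaling[OF cv coordinates_structure_sheaf _ _ e[unfolded PGL2_act.simps] p] v.add_closed[OF o t0] v.add_closed[OF o t1]
      unfolding tensor_def by blast
    show ?thesis
      using u e0 e1 unfolding tensor_def v.val_add[OF o p t0] v.val_add[OF o p t1]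
        tv[OF o p Mm(1) xP(1)] tv[OF o p Mm(2) xP(2)] tv[OF o p Mm(3) xP(1)] tv[OF o p Mm(4) xP(2)] by metis
  qed
  let ?X = "\<lambda>p. ?vL p (M 0 0) \<otimes>\<^bsub>R p\<^esub> ?vD p d\<^sub>0 \<oplus>\<^bsub>R p\<^esub> ?vL p (M 0 1) \<otimes>\<^bsub>R p\<^esub> ?vD p d\<^sub>1"
  let ?Y = "\<lambda>p. ?vL p (M 1 0) \<otimes>\<^bsub>R p\<^esub> ?vD p d\<^sub>0 \<oplus>\<^bsub>R p\<^esub> ?vL p (M 1 1) \<otimes>\<^bsub>R p\<^esub> ?vD p d\<^sub>1"
  \<comment> \<open>The images of a, b, c are unit multiples of (1, 0), (0, 1), (1, 1), so
    \<open>matrix_cross_ratio\<close> applies: the second component of the image of d is a unit, and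
    the first is z times the second.\<close>
  have key: "?Y p \<in> Units (R p) \<and> ogerm S p ?P z \<otimes>\<^bsub>R p\<^esub> ?Y p = ?X p" if p: "p \<in> ?P" for p
  proof -
    interpret b: cring "R p" by (rule cring_stalk[OF p])
    have solve: "y = inv\<^bsub>R p\<^esub> u \<otimes>\<^bsub>R p\<^esub> g" if "u \<in> Units (R p)" "y \<in> carrier (R p)" "u \<otimes>\<^bsub>R p\<^esub> y = g" for u y g
      using that by (metis b.Units_closed b.Units_inv_closed b.Units_l_inv b.l_one b.m_assoc)
    have one: "ogerm S p ?P \<one>\<^bsub>?G\<^esub> = \<one>\<^bsub>R p\<^esub>" "ogerm S p ?P \<zero>\<^bsub>?G\<^esub> = \<zero>\<^bsub>R p\<^esub>"
      using ogerm_one[OF openin_topspace p] ogerm_zero[OF openin_topspace p] by auto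
    note ca = clA[OF p aP(1)] clA[OF p aP(2)] and cb = clB[OF p bP(1)] clB[OF p bP(2)]
      and cc = clC[OF p cP(1)] clC[OF p cP(2)] and cd = clD[OF p dP(1)] clD[OF p dP(2)]
      and cm = clL[OF p Mm(1)] clL[OF p Mm(2)] clL[OF p Mm(3)] clL[OF p Mm(4)]
    obtain u where u: "u \<in> Units (R p)"
      and u0: "u \<otimes>\<^bsub>R p\<^esub> (?vL p (M 0 0) \<otimes>\<^bsub>R p\<^esub> ?vA p a\<^sub>0 \<oplus>\<^bsub>R p\<^esub> ?vL p (M 0 1) \<otimes>\<^bsub>R p\<^esub> ?vA p a\<^sub>1) = \<one>\<^bsub>R p\<^esub>"
      and u1: "u \<otimes>\<^bsub>R p\<^esub> (?vL p (M 1 0) \<otimes>\<^bsub>R p\<^esub> ?vA p a\<^sub>0 \<oplus>\<^bsub>R p\<^esub> ?vL p (M 1 1) \<otimes>\<^bsub>R p\<^esub> ?vA p a\<^sub>1) = \<zero>\<^bsub>R p\<^esub>"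
      using image[OF Pp(1) cA assms(13)[unfolded data P1_infinity_def] p] unfolding one by blast
    obtain v where v: "v \<in> Units (R p)"
      and v0: "v \<otimes>\<^bsub>R p\<^esub> (?vL p (M 0 0) \<otimes>\<^bsub>R p\<^esub> ?vB p b\<^sub>0 \<oplus>\<^bsub>R p\<^esub> ?vL p (M 0 1) \<otimes>\<^bsub>R p\<^esub> ?vB p b\<^sub>1) = \<zero>\<^bsub>R p\<^esub>"
      and v1: "v \<otimes>\<^bsub>R p\<^esub> (?vL p (M 1 0) \<otimes>\<^bsub>R p\<^esub> ?vB p b\<^sub>0 \<oplus>\<^bsub>R p\<^esub> ?vL p (M 1 1) \<otimes>\<^bsub>R p\<^esub> ?vB p b\<^sub>1) = \<one>\<^bsub>R p\<^esub>"
      using image[OF Pp(2) cB assms(14)[unfolded data P1_zero_def] p] unfolding one by blast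
    obtain w where w: "w \<in> Units (R p)"
      and w0: "w \<otimes>\<^bsub>R p\<^esub> (?vL p (M 0 0) \<otimes>\<^bsub>R p\<^esub> ?vC p c\<^sub>0 \<oplus>\<^bsub>R p\<^esub> ?vL p (M 0 1) \<otimes>\<^bsub>R p\<^esub> ?vC p c\<^sub>1) = \<one>\<^bsub>R p\<^esub>"
      and w1: "w \<otimes>\<^bsub>R p\<^esub> (?vL p (M 1 0) \<otimes>\<^bsub>R p\<^esub> ?vC p c\<^sub>0 \<oplus>\<^bsub>R p\<^esub> ?vL p (M 1 1) \<otimes>\<^bsub>R p\<^esub> ?vC p c\<^sub>1) = \<one>\<^bsub>R p\<^esub>"
      using image[OF Pp(3) cC assms(15)[unfolded data P1_one_def] p] unfolding one by blast
    have Ma: "?vL p (M 0 0) \<otimes>\<^bsub>R p\<^esub> ?vA p a\<^sub>0 \<oplus>\<^bsub>R p\<^esub> ?vL p (M 0 1) \<otimes>\<^bsub>R p\<^esub> ?vA p a\<^sub>1 = inv\<^bsub>R p\<^esub> u"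
      "?vL p (M 1 0) \<otimes>\<^bsub>R p\<^esub> ?vA p a\<^sub>0 \<oplus>\<^bsub>R p\<^esub> ?vL p (M 1 1) \<otimes>\<^bsub>R p\<^esub> ?vA p a\<^sub>1 = \<zero>\<^bsub>R p\<^esub>"
      using solve[OF u _ u0] solve[OF u _ u1] u ca cm by simp_all
    have Mb: "?vL p (M 0 0) \<otimes>\<^bsub>R p\<^esub> ?vB p b\<^sub>0 \<oplus>\<^bsub>R p\<^esub> ?vL p (M 0 1) \<otimes>\<^bsub>R p\<^esub> ?vB p b\<^sub>1 = \<zero>\<^bsub>R p\<^esub>"
      "?vL p (M 1 0) \<otimes>\<^bsub>R p\<^esub> ?vB p b\<^sub>0 \<oplus>\<^bsub>R p\<^esub> ?vL p (M 1 1) \<otimes>\<^bsub>R p\<^esub> ?vB p b\<^sub>1 = inv\<^bsub>R p\<^esub> v"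
      using solve[OF v _ v0] solve[OF v _ v1] v cb cm by simp_all
    have Mc: "?vL p (M 0 0) \<otimes>\<^bsub>R p\<^esub> ?vC p c\<^sub>0 \<oplus>\<^bsub>R p\<^esub> ?vL p (M 0 1) \<otimes>\<^bsub>R p\<^esub> ?vC p c\<^sub>1 = inv\<^bsub>R p\<^esub> w"
      "?vL p (M 1 0) \<otimes>\<^bsub>R p\<^esub> ?vC p c\<^sub>0 \<oplus>\<^bsub>R p\<^esub> ?vL p (M 1 1) \<otimes>\<^bsub>R p\<^esub> ?vC p c\<^sub>1 = inv\<^bsub>R p\<^esub> w"
      using solve[OF w _ w0] solve[OF w _ w1] w cc cm by simp_all
    note mcr = b.matrix_cross_ratio[OF ca cb cc cd cm Ma b.Units_inv_Units[OF u] Mb b.Units_inv_Units[OF v]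
        Mc b.Units_inv_Units[OF w] AD[OF p]]
    show ?thesis using mcr(1) mcr(2)[OF ogerm_closed[OF openin_topspace p zc] cr_eq[OF icr p]] by blast
  qed
  obtain v where cv: "coordinates S (tensor_sheaf S L D) v"
    and tm: "\<And>U l a. Op U \<Longrightarrow> l \<in> carrier (msec L U) \<Longrightarrow> a \<in> carrier (msec D U) \<Longrightarrow>
      tensor_sum S S id_morph L D U U {#(l, a)#} \<in> carrier (msec (tensor_sheaf S L D) U)"
    and tv: "\<And>U q l a. Op U \<Longrightarrow> q \<in> U \<Longrightarrow> l \<in> carrier (msec L U) \<Longrightarrow> a \<in> carrier (msec D U) \<Longrightarrow>
      v q U (tensor_sum S S id_morph L D U U {#(l, a)#}) = cL q (mgerm S L q U l) \<otimes>\<^bsub>R q\<^esub> cD q (mgerm S D q U a)"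
    using tensor_coordinates[OF lbL lb(4) cL cD] by metis
  interpret v: coordinates S "tensor_sheaf S L D" v by (rule cv)
  interpret o: coordinates S "structure_sheaf S" "ogerm S" by (rule coordinates_structure_sheaf)
  note o = openin_topspace[of "spc S"]
  note t0 = tm[OF o Mm(1) dP(1)] tm[OF o Mm(2) dP(2)] and t1 = tm[OF o Mm(3) dP(1)] tm[OF o Mm(4) dP(2)]
  let ?x = "tensor S L D (M 0 0) d\<^sub>0 \<oplus>\<^bsub>msec (tensor_sheaf S L D) ?P\<^esub> tensor S L D (M 0 1) d\<^sub>1"
  let ?y = "tensor S L D (M 1 0) d\<^sub>0 \<oplus>\<^bsub>msec (tensor_sheaf S L D) ?P\<^esub> tensor S L D (M 1 1) d\<^sub>1"
  have xm: "?x \<in> carrier (msec (tensor_sheaf S L D) ?P)" and ym: "?y \<in> carrier (msec (tensor_sheaf S L D) ?P)"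
    unfolding tensor_def by (rule v.add_closed[OF o t0], rule v.add_closed[OF o t1])
  have xv: "v p ?P ?x = ?X p" and yv: "v p ?P ?y = ?Y p" if p: "p \<in> ?P" for p
    unfolding tensor_def v.val_add[OF o p t0] v.val_add[OF o p t1]
      tv[OF o p Mm(1) dP(1)] tv[OF o p Mm(2) dP(2)] tv[OF o p Mm(3) dP(1)] tv[OF o p Mm(4) dP(2)] by (rule HOL.refl)+
  interpret G: cring ?G by (rule cringO[OF o])
  \<comment> \<open>The second component of \<sigma>(d) vanishes nowhere, so dividing by it
    trivializes L \<otimes> D and turns the two components into z and 1.\<close>
  have "\<exists>\<theta>. module_sheaf_iso S (tensor_sheaf S L D) (structure_sheaf S) \<theta> \<and>
      (\<forall>U x. Op U \<longrightarrow> x \<in> carrier (msec (tensor_sheaf S L D) U) \<longrightarrow>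
      (\<forall>p \<in> U. ogerm S p U (\<theta> U x) = inv\<^bsub>R p\<^esub> ?Y p \<otimes>\<^bsub>R p\<^esub> v p U x))"
  proof (rule scaling_imp_iso[OF cv coordinates_structure_sheaf])
    fix p assume p: "p \<in> ?P"
    interpret b: cring "R p" by (rule cring_stalk[OF p])
    show "inv\<^bsub>R p\<^esub> ?Y p \<in> Units (R p)" using key[OF p] by simp
    \<comment> \<open>The section \<open>?y\<close> is a global frame, and 1 is its image; this is
      the local comparison at every point.\<close>
    have "v q ?P ?y \<in> Units (R q) \<and> ogerm S q ?P \<one>\<^bsub>?G\<^esub> = inv\<^bsub>R q\<^esub> ?Y q \<otimes>\<^bsub>R q\<^esub> v q ?P ?y" if q: "q \<in> ?P" for q
    proof -
      interpret b: cring "R q" by (rule cring_stalk[OF q])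
      show ?thesis unfolding yv[OF q] ogerm_one[OF o q] using key[OF q] by simp
    qed
    then show "\<exists>U e e'. Op U \<and> p \<in> U \<and> e \<in> carrier (msec (tensor_sheaf S L D) U) \<and> e' \<in> carrier (msec (structure_sheaf S) U) \<and>
      (\<forall>q \<in> U. v q U e \<in> Units (R q) \<and> ogerm S q U e' = inv\<^bsub>R q\<^esub> ?Y q \<otimes>\<^bsub>R q\<^esub> v q U e)"
      using p ym by (intro exI[of _ ?P] exI[of _ ?y] exI[of _ "\<one>\<^bsub>?G\<^esub>"]) simp
  qed
  then obtain \<theta> where tt: "module_sheaf_iso S (tensor_sheaf S L D) (structure_sheaf S) \<theta> \<and>
      (\<forall>U x. Op U \<longrightarrow> x \<in> carrier (msec (tensor_sheaf S L D) U) \<longrightarrow>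
      (\<forall>p \<in> U. ogerm S p U (\<theta> U x) = inv\<^bsub>R p\<^esub> ?Y p \<otimes>\<^bsub>R p\<^esub> v p U x))" ..
  note th = tt[THEN conjunct1] and thv = tt[THEN conjunct2, rule_format, OF o]
  have cl: "\<theta> ?P x \<in> carrier ?G" if "x \<in> carrier (msec (tensor_sheaf S L D) ?P)" for x
    using bij_betw_apply[OF th[unfolded module_sheaf_iso_def, THEN conjunct1, rule_format, OF o, THEN conjunct1] that] by simp
  have "\<theta> ?P ?x = z"
  proof (rule ogerm_inj[OF o cl[OF xm] zc])
    fix p assume p: "p \<in> ?P"
    interpret b: cring "R p" by (rule cring_stalk[OF p])
    note k = key[OF p]
    have zpc: "ogerm S p ?P z \<in> carrier (R p)" by (rule ogerm_closed[OF o p zc])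
    have "inv\<^bsub>R p\<^esub> ?Y p \<otimes>\<^bsub>R p\<^esub> (ogerm S p ?P z \<otimes>\<^bsub>R p\<^esub> ?Y p) = ogerm S p ?P z"
      unfolding b.m_lcomm[OF b.Units_inv_closed[OF conjunct1[OF k]] zpc b.Units_closed[OF conjunct1[OF k]]]
        b.Units_l_inv[OF conjunct1[OF k]] by (rule b.r_one[OF zpc])
    then show "ogerm S p ?P (\<theta> ?P ?x) = ogerm S p ?P z" unfolding thv[OF xm p] xv[OF p] conjunct2[OF k] .
  qed
  moreover have "\<theta> ?P ?y = \<one>\<^bsub>?G\<^esub>"
  proof (rule ogerm_inj[OF o cl[OF ym] G.one_closed])
    fix p assume p: "p \<in> ?P"
    interpret b: cring "R p" by (rule cring_stalk[OF p])
    show "ogerm S p ?P (\<theta> ?P ?y) = ogerm S p ?P \<one>\<^bsub>?G\<^esub>"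
      unfolding thv[OF ym p] yv[OF p] ogerm_one[OF o p] using key[OF p] by simp
  qed
  ultimately show ?thesis using th unfolding data z_def by auto
qed

end
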